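(* Let $f$ be a given model (known distribution) on $\mathbb{R}^d$ with covariance matrix $\Sigma$, and suppose we are given $n$ i.i.d. samples from $f^\lambda$ for unknown $\lambda\in\mathbb{R}^d$. Let $R=r^2I_d$ for $0<r^2<\|\Sigma\|$, and let $\mathcal{I}_R$ be the $R$-smoothed Fisher information matrix of $f$. Let $M\in\mathbb{R}^{d\times d}$ be any (nonzero) symmetric positive semidefinite matrix and let $d_R:=d_{\mathrm{eff}}(M^{1/2}\mathcal{I}_R^{-1}M^{1/2})$. Fix a failure probability $\delta>0$ and let $$ 2\le\gamma\le\left(\frac{n}{d_R+\log\frac1\delta}\right)^{1/8-\alpha}\quad\text{for some }\alpha>0. $$ Let $$ n\ge C\gamma^4\left(\frac{\|\Sigma\|}{r^2}\right)^2\left(\log\frac4\delta+d_R+\frac{d_{\mathrm{eff}}(\Sigma)^2}{d_R}\right) $$ for a large enough constant $C>0$. Then, with probability $1-\delta$, the output $\hat\lambda$ of the high-dimensional global MLE algorithm (defined in the context), run with failure probability $\delta$, smoothing $R$ and approximation parameter $\gamma$, satisfies $$ \|\hat\lambda-\lambda\|_M\le\left(1+O\left(\frac1\gamma\right)\right)\left(\sqrt{\frac{\mathrm{Tr}(M^{1/2}\mathcal{I}_R^{-1}M^{1/2})}{n}}+4\sqrt{\frac{\|M^{1/2}\mathcal{I}_R^{-1}M^{1/2}\|\log\frac4\delta}{n}}\right). $$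
   Context: $f^\lambda(x)=f(x-\lambda)$ is $f$ translated by $\lambda$. $f_R=f*\mathcal{N}(0,R)$ is the $R$-smoothed distribution (identified with its density), with score $s_R(x)=\nabla\log f_R(x)$ and Fisher information matrix $\mathcal{I}_R=\mathbb{E}_{x\sim f_R}[s_R(x)s_R(x)^T]$. $\|x\|_M=\sqrt{x^TMx}$; $\|A\|$ is the operator norm of a matrix $A$; $d_{\mathrm{eff}}(A)=\mathrm{Tr}(A)/\|A\|$ for positive semidefinite $A$. $O(\cdot)$ hides a universal constant. Heavy-tailed mean estimator (known result). There are universal constants $C_0,C_1,C_2$ such that for every $m,d$ and $\delta'>2^{-m/C_2}$ there is an algorithm, running in time $O(md)+(d\log(1/\delta'))^{C_0}$, which, given $m$ i.i.d. copies of any random variable $X$ on $\mathbb{R}^d$ with mean $\mu$ and covariance $\Sigma$, outputs $\hat\mu$ with $\|\hat\mu-\mu\|\le C_1\left(\sqrt{\mathrm{Tr}(\Sigma)/m}+\sqrt{\|\Sigma\|\log(1/\delta')/m}\right)$ with probability at least $1-\delta'$. Local MLE. Input: $f$, $R$, samples $x_1,\dots,x_m$ from $f^\lambda$, an initial estimate $\lambda_1$. Perturb each sample independently, $x_i'=x_i+\mathcal{N}(0,R)$; let $\hat\epsilon=\frac1m\sum_{i=1}^m\mathcal{I}_R^{-1}s_R(x_i'-\lambda_1)$; return $\lambda_1-\hat\epsilon$. High-dimensional global MLE. Input: $\delta$, $f$, $n$ samples from $f^\lambda$, $R$, $\gamma$. (1) Using the first $1/\gamma$ fraction of the samples, compute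 an initial estimate $\lambda_1$ of $\lambda$ with the heavy-tailed mean estimator above (failure probability $\delta/2$), taking $f$ to have mean zero so that the mean of $f^\lambda$ is $\lambda$ (in general, subtract the known mean of $f$ from $\hat\mu$). (2) Run the local MLE on the remaining $1-1/\gamma$ fraction of the samples with smoothing $R$ and initial estimate $\lambda_1$; return its output $\hat\lambda$. The probability is over the samples and the Gaussian perturbations. *)

theory Defs
  imports
    "HOL-Probability.Probability"
    "Jordan_Normal_Form.Determinant"
    "Jordan_Normal_Form.Gauss_Jordan_Elimination"
begin

text \<open>
  The constants hidden in the estimate have to be uniform in the dimension, so the dimension
  must be a term and not a type. Points of \<open>\<real>\<^sup>d\<close> are therefore elements of
  \<open>carrier_vec d\<close> and square matrices are elements of \<open>carrier_mat d d\<close>.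
\<close>

unbundle no vec_syntax
hide_const (open) Finite_Cartesian_Product.vec Finite_Cartesian_Product.mat
  Finite_Cartesian_Product.row Determinants.det
hide_type (open) Finite_Cartesian_Product.vec

definition vnorm :: "real vec \<Rightarrow> real" where
  "vnorm v = sqrt (v \<bullet> v)"

definition mnorm :: "real mat \<Rightarrow> real vec \<Rightarrow> real" where
  "mnorm M x = sqrt (x \<bullet> (M *\<^sub>v x))"

definition tr :: "real mat \<Rightarrow> real" where
  "tr A = (\<Sum>i<dim_row A. A $$ (i, i))"

definition opnorm :: "real mat \<Rightarrow> real" where
  "opnorm A = (SUP v \<in> {v \<in> carrier_vec (dim_col A). vnorm v \<le> 1}. vnorm (A *\<^sub>v v))"

definition d_eff :: "real mat \<Rightarrow> real" where
  "d_eff A = tr A / opnorm A"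

definition sym_psd :: "nat \<Rightarrow> real mat \<Rightarrow> bool" where
  "sym_psd d A \<longleftrightarrow> A \<in> carrier_mat d d \<and> transpose_mat A = A \<and>
     (\<forall>v \<in> carrier_vec d. 0 \<le> v \<bullet> (A *\<^sub>v v))"

definition mat_sqrt :: "real mat \<Rightarrow> real mat" where
  "mat_sqrt A = (THE S. sym_psd (dim_row A) S \<and> S * S = A)"

text \<open>Only meaningful for invertible matrices.\<close>

definition mat_inv :: "real mat \<Rightarrow> real mat" where
  "mat_inv A = the (mat_inverse A)"

definition gradient :: "nat \<Rightarrow> (real vec \<Rightarrow> real) \<Rightarrow> real vec \<Rightarrow> real vec" where
  "gradient d g x = vec d (\<lambda>i. deriv (\<lambda>t. g (x + t \<cdot>\<^sub>v unit_vec d i)) 0)"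

text \<open>The Borel sigma-algebra and Lebesgue measure, transported from the coordinate product.\<close>

definition vborel :: "nat \<Rightarrow> real vec measure" where
  "vborel d = vimage_algebra (carrier_vec d) (\<lambda>v. \<lambda>i\<in>{..<d}. v $ i) (\<Pi>\<^sub>M i\<in>{..<d}. borel)"

definition vlborel :: "nat \<Rightarrow> real vec measure" where
  "vlborel d = distr (\<Pi>\<^sub>M i\<in>{..<d}. lborel) (vborel d) (vec d)"

definition vec_distribution :: "nat \<Rightarrow> real vec measure \<Rightarrow> bool" where
  "vec_distribution d P \<longleftrightarrow> prob_space P \<and> sets P = sets (vborel d)"

definition finite_second_moments :: "nat \<Rightarrow> real vec measure \<Rightarrow> bool" where
  "finite_second_moments d P \<longleftrightarrow> (\<forall>i<d. integrable P (\<lambda>x. (x $ i)\<^sup>2))"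

definition mean_vec :: "nat \<Rightarrow> real vec measure \<Rightarrow> real vec" where
  "mean_vec d P = vec d (\<lambda>i. \<integral>x. x $ i \<partial>P)"

definition cov_mat :: "nat \<Rightarrow> real vec measure \<Rightarrow> real mat" where
  "cov_mat d P = mat d d (\<lambda>(i, j).
     \<integral>x. (x $ i - mean_vec d P $ i) * (x $ j - mean_vec d P $ j) \<partial>P)"

definition translate :: "nat \<Rightarrow> real vec \<Rightarrow> real vec measure \<Rightarrow> real vec measure" where
  "translate d l f = distr f (vborel d) (\<lambda>x. x + l)"

definition gauss_density :: "nat \<Rightarrow> real mat \<Rightarrow> real vec \<Rightarrow> real" where
  "gauss_density d R x =
     exp (- (x \<bullet> (mat_inv R *\<^sub>v x)) / 2) / sqrt ((2 * pi) ^ d * det R)"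

definition gauss :: "nat \<Rightarrow> real mat \<Rightarrow> real vec measure" where
  "gauss d R = density (vlborel d) (\<lambda>x. ennreal (gauss_density d R x))"

text \<open>
  The convolution formula selects the smooth version of the density of \<open>f * N(0, R)\<close>, which is
  what makes the pointwise gradient in the score meaningful.
\<close>

definition smoothed_density :: "nat \<Rightarrow> real mat \<Rightarrow> real vec measure \<Rightarrow> real vec \<Rightarrow> real" where
  "smoothed_density d R f x = (\<integral>y. gauss_density d R (x - y) \<partial>f)"

definition smoothed :: "nat \<Rightarrow> real mat \<Rightarrow> real vec measure \<Rightarrow> real vec measure" where
  "smoothed d R f = density (vlborel d) (\<lambda>x. ennreal (smoothed_density d R f x))"

definition score :: "nat \<Rightarrow> real mat \<Rightarrow> real vec measure \<Rightarrow> real vec \<Rightarrow> real vec" where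
  "score d R f = gradient d (\<lambda>x. ln (smoothed_density d R f x))"

definition fisher :: "nat \<Rightarrow> real mat \<Rightarrow> real vec measure \<Rightarrow> real mat" where
  "fisher d R f = mat d d (\<lambda>(i, j).
     \<integral>x. score d R f x $ i * score d R f x $ j \<partial>(smoothed d R f))"

text \<open>
  An estimator maps the number of samples, the failure probability and the samples (indexed
  from 0) to an estimate of the mean.
\<close>

type_synonym mean_estimator = "nat \<Rightarrow> real \<Rightarrow> (nat \<Rightarrow> real vec) \<Rightarrow> real vec"

definition heavy_tailed_mean_estimator :: "nat \<Rightarrow> real \<Rightarrow> real \<Rightarrow> mean_estimator \<Rightarrow> bool" where
  "heavy_tailed_mean_estimator d C1 C2 est \<longleftrightarrow>
     (\<forall>m \<delta>. 2 powr (- real m / C2) < \<delta> \<longrightarrow>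
        est m \<delta> \<in> (\<Pi>\<^sub>M i\<in>{..<m}. vborel d) \<rightarrow>\<^sub>M vborel d \<and>
        (\<forall>P. vec_distribution d P \<and> finite_second_moments d P \<longrightarrow>
           1 - \<delta> \<le> measure (\<Pi>\<^sub>M i\<in>{..<m}. P)
             {x \<in> space (\<Pi>\<^sub>M i\<in>{..<m}. P).
                vnorm (est m \<delta> x - mean_vec d P) \<le>
                  C1 * (sqrt (tr (cov_mat d P) / m) +
                        sqrt (opnorm (cov_mat d P) * ln (1 / \<delta>) / m))}))"

text \<open>
  The perturbations \<open>w\<close> are an explicit argument; they are drawn from \<open>N(0, R)\<close> when the
  algorithm is analysed.
\<close>

definition local_mle ::
  "nat \<Rightarrow> real vec measure \<Rightarrow> real mat \<Rightarrow> nat \<Rightarrow> (nat \<Rightarrow> real vec) \<Rightarrow> (nat \<Rightarrow> real vec) \<Rightarrow>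
    real vec \<Rightarrow> real vec" where
  "local_mle d f R m x w l1 =
     l1 - (1 / real m) \<cdot>\<^sub>v finsum_vec TYPE(real) d
            (\<lambda>i. mat_inv (fisher d R f) *\<^sub>v score d R f (x i + w i - l1)) {..<m}"

definition first_part :: "nat \<Rightarrow> real \<Rightarrow> nat" where
  "first_part n \<gamma> = nat \<lfloor>real n / \<gamma>\<rfloor>"

text \<open>The mean of \<open>f\<close> is known and need not be zero, hence the correction of the initial estimate.\<close>

definition global_mle ::
  "nat \<Rightarrow> mean_estimator \<Rightarrow> real \<Rightarrow> real vec measure \<Rightarrow> nat \<Rightarrow> (nat \<Rightarrow> real vec) \<Rightarrow> real mat \<Rightarrow> real \<Rightarrow>
    (nat \<Rightarrow> real vec) \<Rightarrow> real vec" where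
  "global_mle d est \<delta> f n x R \<gamma> w =
     (let k = first_part n \<gamma>;
          l1 = est k (\<delta> / 2) (restrict x {..<k}) - mean_vec d f
      in local_mle d f R (n - k) (\<lambda>i. x (k + i)) w l1)"

text \<open>
  Joint law of the \<open>n\<close> samples and of the independent perturbations, one for each sample
  that is passed to the local MLE.
\<close>

definition mle_space ::
  "nat \<Rightarrow> real vec measure \<Rightarrow> real vec \<Rightarrow> nat \<Rightarrow> real mat \<Rightarrow> real \<Rightarrow>
    ((nat \<Rightarrow> real vec) \<times> (nat \<Rightarrow> real vec)) measure" where
  "mle_space d f l n R \<gamma> =
     (\<Pi>\<^sub>M i\<in>{..<n}. translate d l f) \<Otimes>\<^sub>M (\<Pi>\<^sub>M i\<in>{..<n - first_part n \<gamma>}. gauss d R)"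

end

(* Write B for M^(1/2) I_R^(-1) M^(1/2) and let e be the error of the initial estimate.

   With x = y + w, y ~ f and w ~ N(0, R), the score s_R(x) is the conditional expectation of -w/r^2
   given x. By Jensen it is subgaussian with variance proxy 1/r^2, whatever f is, and a Cramer-Rao
   argument bounds the Fisher information from below by 1/(2 ||Sigma||), so the two scales differ by
   a factor of order ||Sigma||/r^2 only.

   Evaluating the score at the wrong location e replaces the law of x by its translate, that is, it
   tilts it by the likelihood ratio of w. Expanding the tilt to second order shows that the mean of the
   score moves by I_R e up to O((|e|/r)^2), and that its variance changes little.

   The norm of the averaged estimation error is a supremum of linear functionals. A PAC-Bayes argument
   with a Gaussian prior on the direction bounds it by sqrt(Tr B / m) + 2 sqrt(||B|| L / m) with leading
   constant 1 + O(1/gamma): a Gaussian mixture of exponential moments is controlled by Fubini and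
   Markov's inequality, and compared below with each of its shifts by the relative entropy.

   The two parts of the sample are independent, so this bound can be applied for fixed values of the
   first part. The lower bound on n makes both the quadratic bias and the loss from n to
   m >= (1 - 1/gamma) n a relative O(1/gamma). *)

theory Submission
  imports Defs
begin

text \<open>Beyond second moments nothing is known about \<open>f\<close>, so outside the given mean
  estimator no tail of a sample is estimated: every exponential moment is that of a Gaussian,
  carried over to the score by conditioning. The price is the variance proxy 1/r^2 in place of the
  Fisher information. Besides invertibility, the Cramer-Rao bound serves to push this loss, kappa =
  ||Sigma||/r^2, into the remainders; leading terms keep the exact Fisher form. The Gaussian prior
  charges arbitrarily long directions. Hence the exponential moment bound must hold for all
  arguments, not only near 0; it carries a quartic correction, which costs a second moment of the
  form B under the prior. With L = log(4/delta), the initial error obeys (|e|/r)^2 <= c gamma kappa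
  (d_eff(Sigma) + L)/n. The bias, of order (|e|/r)^2 sqrt(||B||), must stay below (1/gamma)
  sqrt(||B|| (d_R + L)/n) up to constants. Solving for n produces gamma^4 kappa^2 and
  d_eff(Sigma)^2/d_R in the sample size. Constants such as exp 40 are crude exponential moments,
  absorbed by the sample size.\<close>

unbundle no inner_syntax

section \<open>Vectors, norms and quadratic forms of a fixed dimension\<close>

lemma scalar_prod_self_nonneg: "0 \<le> v \<bullet> (v::real vec)"
  by (auto simp: scalar_prod_def intro!: sum_nonneg)

lemma vnorm_nonneg [simp]: "0 \<le> vnorm v"
  by (simp add: vnorm_def scalar_prod_self_nonneg)

lemma vnorm_square: "(vnorm v)\<^sup>2 = v \<bullet> v"
  by (simp add: vnorm_def scalar_prod_self_nonneg)

lemma scalar_prod_self_eq_0: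
  assumes "v \<in> carrier_vec d" "v \<bullet> v = (0::real)"
  shows "v = 0\<^sub>v d"
proof -
  have "(\<Sum>i\<in>{0..<d}. v $ i * v $ i) = 0"
    using assms by (auto simp: scalar_prod_def)
  hence "\<forall>i\<in>{0..<d}. v $ i * v $ i = 0"
    by (subst (asm) sum_nonneg_eq_0_iff) auto
  thus ?thesis using assms(1) by (intro eq_vecI) auto
qed

text \<open>\<open>scalar_prod\<close> sums over the dimension of its second argument, so it is the
  length of \<open>w\<close> that fixes the range. The form \<open>{..<d}\<close> matches the index
  set of the product measures used later.\<close>

lemma scalar_prod_lt: "w \<in> carrier_vec d \<Longrightarrow> v \<bullet> w = (\<Sum>i<d. v $ i * w $ i)"
  by (auto simp: scalar_prod_def atLeast0LessThan)

lemma mult_mat_vec_nth: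
  "(A::real mat) \<in> carrier_mat n d \<Longrightarrow> v \<in> carrier_vec d \<Longrightarrow> i < n \<Longrightarrow>
    (A *\<^sub>v v) $ i = (\<Sum>j<d. A $$ (i, j) * v $ j)"
  by (auto simp: scalar_prod_def atLeast0LessThan intro!: sum.cong)

lemma quadratic_form_sum:
  assumes "(A::real mat) \<in> carrier_mat n d" "v \<in> carrier_vec d" "u \<in> carrier_vec n"
  shows "u \<bullet> (A *\<^sub>v v) = (\<Sum>i<n. \<Sum>j<d. u $ i * A $$ (i, j) * v $ j)"
  using assms by (subst scalar_prod_lt[of _ n])
    (auto simp: mult_mat_vec_nth[OF assms(1,2)] sum_distrib_left mult.assoc simp del: index_mult_mat_vec intro!: sum.cong)

lemma smult_mat_mult_vec:
  assumes "(A::real mat) \<in> carrier_mat n d" "v \<in> carrier_vec d"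
  shows "(a \<cdot>\<^sub>m A) *\<^sub>v v = a \<cdot>\<^sub>v (A *\<^sub>v v)"
  using assms by (intro eq_vecI)
    (auto simp: mult_mat_vec_nth[of _ n d] sum_distrib_left mult.assoc simp del: index_mult_mat_vec intro!: sum.cong)

text \<open>The discriminant argument, for a form that is only known to be bilinear on pairs \<open>x + t y\<close>.\<close>

lemma discriminant_le:
  fixes a b c :: real
  assumes nonneg: "\<And>t. 0 \<le> a + 2 * t * b + t\<^sup>2 * c"
  shows "b\<^sup>2 \<le> a * c"
proof (cases "c > 0")
  case True
  have "0 \<le> (a + 2 * (- b / c) * b + (- b / c)\<^sup>2 * c) * c"
    using nonneg[of "- b / c"] True by (intro mult_nonneg_nonneg) auto
  also have "\<dots> = a * c - b\<^sup>2"
    using True by (simp add: power2_eq_square algebra_simps)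
  finally show ?thesis by simp
next
  case False
  have a: "a \<ge> 0" using nonneg[of 0] by simp
  have "b = 0"
  proof (rule ccontr)
    assume b: "b \<noteq> 0"
    \<comment> \<open>This witness makes the linear term equal to \<open>- (a + 1)\<close>; as
      \<open>c\<close> is not positive, the quadratic takes a value of at most -1.\<close>
    have "(- (a + 1) / (2 * b))\<^sup>2 * c \<le> 0"
      using False by (intro mult_nonneg_nonpos) auto
    moreover have "2 * (- (a + 1) / (2 * b)) * b = - (a + 1)" using b by simp
    ultimately show False using nonneg[of "- (a + 1) / (2 * b)"] by linarith
  qed
  moreover have "0 \<le> a * c"
  proof (rule ccontr)
    assume "\<not> 0 \<le> a * c"
    hence "c < 0" using False a by (cases "c = 0") auto
    \<comment> \<open>With \<open>b = 0\<close>, the quadratic has the value -1 at this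
      point.\<close>
    define t where "t = sqrt ((a + 1) / - c)"
    have "t\<^sup>2 = (a + 1) / - c" unfolding t_def using a \<open>c < 0\<close> by (intro real_sqrt_pow2 divide_nonneg_pos) auto
    hence "t\<^sup>2 * c = - (a + 1)" using \<open>c < 0\<close> by simp
    thus False using nonneg[of t] \<open>b = 0\<close> by simp
  qed
  ultimately show ?thesis by simp
qed

text \<open>The discriminant of the form along the line x + t y. The matrix may be singular, because
  \<open>discriminant_le\<close> also covers a vanishing leading coefficient.\<close>

lemma psd_Cauchy_Schwarz:
  assumes A: "sym_psd d A" and x: "x \<in> carrier_vec d" and y: "y \<in> carrier_vec d"
  shows "(x \<bullet> (A *\<^sub>v y))\<^sup>2 \<le> (x \<bullet> (A *\<^sub>v x)) * (y \<bullet> (A *\<^sub>v y))"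
proof (rule discriminant_le)
  fix t :: real
  have Ac: "A \<in> carrier_mat d d" and sym: "transpose_mat A = A"
    and psd: "\<And>v. v \<in> carrier_vec d \<Longrightarrow> 0 \<le> v \<bullet> (A *\<^sub>v v)"
    using A by (auto simp: sym_psd_def)
  have c: "A *\<^sub>v x \<in> carrier_vec d" "A *\<^sub>v y \<in> carrier_vec d" "t \<cdot>\<^sub>v y \<in> carrier_vec d"
    "t \<cdot>\<^sub>v (A *\<^sub>v y) \<in> carrier_vec d"
    using Ac x y by auto
  have comm: "y \<bullet> (A *\<^sub>v x) = x \<bullet> (A *\<^sub>v y)"
    using transpose_vec_mult_scalar[OF Ac x y] sym comm_scalar_prod[OF c(2) x] by simp
  have Aty: "A *\<^sub>v (x + t \<cdot>\<^sub>v y) = A *\<^sub>v x + t \<cdot>\<^sub>v (A *\<^sub>v y)"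
    using Ac x y by (simp add: mult_add_distrib_mat_vec mult_mat_vec)
  have "0 \<le> (x + t \<cdot>\<^sub>v y) \<bullet> (A *\<^sub>v (x + t \<cdot>\<^sub>v y))"
    using psd[of "x + t \<cdot>\<^sub>v y"] x y by simp
  also have "\<dots> = x \<bullet> (A *\<^sub>v x) + t * (x \<bullet> (A *\<^sub>v y)) + (t * (y \<bullet> (A *\<^sub>v x)) + t * t * (y \<bullet> (A *\<^sub>v y)))"
    unfolding Aty using x y c
    by (simp add: add_scalar_prod_distrib[of _ d] scalar_prod_add_distrib[of _ d] algebra_simps)
  finally show "0 \<le> x \<bullet> (A *\<^sub>v x) + 2 * t * (x \<bullet> (A *\<^sub>v y)) + t\<^sup>2 * (y \<bullet> (A *\<^sub>v y))"
    by (simp add: comm power2_eq_square algebra_simps)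
qed

lemma sym_psd_one: "sym_psd d (1\<^sub>m d)"
  by (auto simp: sym_psd_def scalar_prod_self_nonneg)

lemma scalar_prod_le_vnorm:
  assumes "v \<in> carrier_vec d" "w \<in> carrier_vec d"
  shows "\<bar>v \<bullet> w\<bar> \<le> vnorm v * vnorm w"
proof (rule power2_le_imp_le)
  show "\<bar>v \<bullet> w\<bar>\<^sup>2 \<le> (vnorm v * vnorm w)\<^sup>2"
    using psd_Cauchy_Schwarz[OF sym_psd_one assms]
    unfolding one_mult_mat_vec[OF assms(1)] one_mult_mat_vec[OF assms(2)] power_mult_distrib vnorm_square
    by simp
qed simp

lemma vnorm_smult: "vnorm (a \<cdot>\<^sub>v v) = \<bar>a\<bar> * vnorm v"
proof -
  have "(a \<cdot>\<^sub>v v) \<bullet> (a \<cdot>\<^sub>v v) = a\<^sup>2 * (v \<bullet> v)"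
    by (simp add: power2_eq_square)
  thus ?thesis by (simp add: vnorm_def real_sqrt_mult)
qed

lemma vnorm_zero [simp]: "vnorm (0\<^sub>v d) = 0"
  by (simp add: vnorm_def)

lemma vnorm_eq_0: "v \<in> carrier_vec d \<Longrightarrow> vnorm v = 0 \<Longrightarrow> v = 0\<^sub>v d"
  using scalar_prod_self_eq_0[of v d] vnorm_square[of v] by simp

text \<open>The Frobenius norm dominates the operator norm, by Cauchy-Schwarz in every row. This
  makes the supremum in \<open>opnorm\<close> a genuine one, and for square roots it later compares
  the operator norm with the trace.\<close>

lemma vnorm_mult_mat_vec_le:
  assumes A: "A \<in> carrier_mat n d" and v: "v \<in> carrier_vec d"
  shows "vnorm (A *\<^sub>v v) \<le> sqrt (\<Sum>i<n. (vnorm (row A i))\<^sup>2) * vnorm v"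
proof (rule power2_le_imp_le)
  have "(vnorm (A *\<^sub>v v))\<^sup>2 = (\<Sum>i<n. (row A i \<bullet> v)\<^sup>2)"
    unfolding vnorm_square using A v by (subst scalar_prod_lt[of _ n]) (auto simp: power2_eq_square)
  also have "\<dots> \<le> (\<Sum>i<n. (vnorm (row A i))\<^sup>2 * (vnorm v)\<^sup>2)"
  proof (rule sum_mono)
    fix i assume "i \<in> {..<n}"
    hence "row A i \<in> carrier_vec d" using A by auto
    from power_mono[OF scalar_prod_le_vnorm[OF this v], of 2]
    show "(row A i \<bullet> v)\<^sup>2 \<le> (vnorm (row A i))\<^sup>2 * (vnorm v)\<^sup>2" by (simp add: power_mult_distrib)
  qed
  also have "\<dots> = (sqrt (\<Sum>i<n. (vnorm (row A i))\<^sup>2) * vnorm v)\<^sup>2"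
    by (simp add: power_mult_distrib sum_nonneg sum_distrib_right)
  finally show "(vnorm (A *\<^sub>v v))\<^sup>2 \<le> (sqrt (\<Sum>i<n. (vnorm (row A i))\<^sup>2) * vnorm v)\<^sup>2" .
qed (simp add: sum_nonneg)

lemma opnorm_bdd:
  assumes A: "A \<in> carrier_mat n d"
  shows "bdd_above ((\<lambda>v. vnorm (A *\<^sub>v v)) ` {v \<in> carrier_vec d. vnorm v \<le> 1})"
proof (rule bdd_aboveI2)
  fix v assume v: "v \<in> {v \<in> carrier_vec d. vnorm v \<le> 1}"
  have "vnorm (A *\<^sub>v v) \<le> sqrt (\<Sum>i<n. (vnorm (row A i))\<^sup>2) * vnorm v"
    using v by (intro vnorm_mult_mat_vec_le[OF A]) auto
  also have "\<dots> \<le> sqrt (\<Sum>i<n. (vnorm (row A i))\<^sup>2) * 1"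
    using v by (intro mult_left_mono) (auto simp: sum_nonneg)
  finally show "vnorm (A *\<^sub>v v) \<le> sqrt (\<Sum>i<n. (vnorm (row A i))\<^sup>2) * 1" .
qed

lemma vnorm_le_opnorm:
  assumes A: "A \<in> carrier_mat n d" and v: "v \<in> carrier_vec d"
  shows "vnorm (A *\<^sub>v v) \<le> opnorm A * vnorm v"
proof (cases "vnorm v = 0")
  case True
  hence "v = 0\<^sub>v d" using vnorm_eq_0 v by blast
  moreover have "A *\<^sub>v 0\<^sub>v d = 0\<^sub>v n" using A by auto
  ultimately show ?thesis by simp
next
  case False
  hence pos: "vnorm v > 0" using vnorm_nonneg[of v] by linarith
  let ?u = "(1 / vnorm v) \<cdot>\<^sub>v v"
  have "vnorm ?u = 1" using pos by (simp add: vnorm_smult)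
  hence "vnorm (A *\<^sub>v ?u) \<le> opnorm A"
    unfolding opnorm_def using A v opnorm_bdd[OF A] by (intro cSUP_upper) auto
  moreover have "A *\<^sub>v ?u = (1 / vnorm v) \<cdot>\<^sub>v (A *\<^sub>v v)"
    using A v by (simp add: mult_mat_vec)
  ultimately show ?thesis using pos by (simp add: vnorm_smult field_simps)
qed

lemma opnorm_nonneg:
  assumes A: "A \<in> carrier_mat n d"
  shows "0 \<le> opnorm A"
proof -
  have "vnorm (A *\<^sub>v 0\<^sub>v d) \<le> opnorm A"
    unfolding opnorm_def using A opnorm_bdd[OF A] by (intro cSUP_upper) auto
  thus ?thesis using vnorm_nonneg order_trans by blast
qed

lemma opnorm_le:
  assumes A: "A \<in> carrier_mat n d" and c: "0 \<le> c"
    and le: "\<And>v. v \<in> carrier_vec d \<Longrightarrow> vnorm (A *\<^sub>v v) \<le> c * vnorm v"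
  shows "opnorm A \<le> c"
  unfolding opnorm_def
proof (rule cSUP_least)
  show "{v \<in> carrier_vec (dim_col A). vnorm v \<le> 1} \<noteq> {}"
    using A by (auto intro!: exI[of _ "0\<^sub>v d"])
  fix v assume v: "v \<in> {v \<in> carrier_vec (dim_col A). vnorm v \<le> 1}"
  hence "vnorm (A *\<^sub>v v) \<le> c * vnorm v" using A le by auto
  also have "\<dots> \<le> c * 1" using v c by (intro mult_left_mono) auto
  finally show "vnorm (A *\<^sub>v v) \<le> c" by simp
qed

lemma quadratic_form_le_opnorm:
  assumes A: "A \<in> carrier_mat d d" and v: "v \<in> carrier_vec d"
  shows "v \<bullet> (A *\<^sub>v v) \<le> opnorm A * (vnorm v)\<^sup>2"
proof -
  have Av: "A *\<^sub>v v \<in> carrier_vec d" using A v by auto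
  have "v \<bullet> (A *\<^sub>v v) \<le> vnorm v * vnorm (A *\<^sub>v v)"
    using scalar_prod_le_vnorm[OF v Av] by linarith
  also have "\<dots> \<le> vnorm v * (opnorm A * vnorm v)"
    by (intro mult_left_mono vnorm_le_opnorm[OF A v]) simp
  finally show ?thesis by (simp add: power2_eq_square algebra_simps)
qed

lemma vnorm_triangle:
  assumes v: "v \<in> carrier_vec d" and w: "w \<in> carrier_vec d"
  shows "vnorm (v + w) \<le> vnorm v + vnorm w"
proof (rule power2_le_imp_le)
  have "(vnorm (v + w))\<^sup>2 = v \<bullet> v + v \<bullet> w + (w \<bullet> v + w \<bullet> w)"
    using v w by (simp add: vnorm_square add_scalar_prod_distrib[of _ d] scalar_prod_add_distrib[of _ d])
  also have "\<dots> = (vnorm v)\<^sup>2 + 2 * (v \<bullet> w) + (vnorm w)\<^sup>2"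
    using comm_scalar_prod[OF v w] by (simp add: vnorm_square)
  also have "\<dots> \<le> (vnorm v)\<^sup>2 + 2 * (vnorm v * vnorm w) + (vnorm w)\<^sup>2"
    using scalar_prod_le_vnorm[OF v w] by simp
  finally show "(vnorm (v + w))\<^sup>2 \<le> (vnorm v + vnorm w)\<^sup>2"
    by (simp add: power2_sum algebra_simps)
qed simp

subsection \<open>Square roots of positive semidefinite matrices\<close>

lemma sym_scalar_prod_mult:
  fixes S :: "real mat"
  assumes "S \<in> carrier_mat d d" "transpose_mat S = S" "x \<in> carrier_vec d" "y \<in> carrier_vec d"
  shows "x \<bullet> (S *\<^sub>v y) = (S *\<^sub>v x) \<bullet> y"
  using transpose_vec_mult_scalar[OF assms(1) assms(4,3)] assms(2) by simp

lemma sym_psd_carrier: "sym_psd d A \<Longrightarrow> A \<in> carrier_mat d d"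
  by (simp add: sym_psd_def)

lemma pow_mat_add:
  assumes C: "(C :: real mat) \<in> carrier_mat d d"
  shows "C ^\<^sub>m (i + j) = C ^\<^sub>m i * C ^\<^sub>m j"
proof (induction j)
  case 0
  show ?case using C by simp
next
  case (Suc j)
  show ?case using Suc pow_carrier_mat[OF C] C
    by (simp add: assoc_mult_mat[of _ d d _ d _ d])
qed

text \<open>Induction in steps of two: the power j + 2 is C C^j C, a congruence of C^j, so its form
  at v is the form of C^j at C v.\<close>

lemma sym_psd_pow:
  assumes C: "sym_psd d C"
  shows "sym_psd d (C ^\<^sub>m k)"
proof (induction k rule: less_induct)
  case (less k)
  have Cc: "C \<in> carrier_mat d d" and sym: "transpose_mat C = C" using C by (auto simp: sym_psd_def)
  consider "k = 0" | "k = 1" | j where "k = Suc (Suc j)"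
    by (metis One_nat_def old.nat.exhaust)
  then show ?case
  proof cases
    case 1
    thus ?thesis using Cc sym_psd_one[of d] by auto
  next
    case 2
    thus ?thesis using Cc C by simp
  next
    case 3
    let ?P = "C ^\<^sub>m j"
    have P: "sym_psd d ?P" using less.IH[of j] 3 by simp
    hence Pc: "?P \<in> carrier_mat d d" and Psym: "transpose_mat ?P = ?P" by (auto simp: sym_psd_def)
    have comm: "C * ?P = ?P * C"
      using pow_mat_add[OF Cc, of 1 j] pow_mat_add[OF Cc, of j 1] Cc by simp
    have e: "C ^\<^sub>m k = C * (?P * C)"
      using 3 comm assoc_mult_mat[OF Cc Pc Cc] by simp
    have PC: "?P * C \<in> carrier_mat d d" by (rule mult_carrier_mat[OF Pc Cc])
    have "transpose_mat (C * (?P * C)) = C * (?P * C)"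
      using Cc Pc PC by (simp only: transpose_mult[OF Cc PC] transpose_mult[OF Pc Cc] sym Psym
          assoc_mult_mat[OF Cc Pc Cc])
    moreover have "0 \<le> v \<bullet> (C * (?P * C) *\<^sub>v v)" if v: "v \<in> carrier_vec d" for v
    proof -
      have Cv: "C *\<^sub>v v \<in> carrier_vec d" using Cc v by simp
      have PCv: "?P *\<^sub>v (C *\<^sub>v v) \<in> carrier_vec d" using Pc Cv by simp
      have "C * (?P * C) *\<^sub>v v = C *\<^sub>v (?P *\<^sub>v (C *\<^sub>v v))"
        by (simp only: assoc_mult_mat_vec[OF Cc PC v] assoc_mult_mat_vec[OF Pc Cc v])
      hence "v \<bullet> (C * (?P * C) *\<^sub>v v) = (C *\<^sub>v v) \<bullet> (?P *\<^sub>v (C *\<^sub>v v))"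
        by (simp only: sym_scalar_prod_mult[OF Cc sym v PCv])
      thus ?thesis using P Cv by (simp add: sym_psd_def)
    qed
    ultimately show ?thesis unfolding e sym_psd_def using Cc PC by auto
  qed
qed

text \<open>The polynomials in \<open>C\<close> with nonnegative coefficients. A product of positive
  semidefinite matrices need not be symmetric; inside this cone everything commutes, so products
  stay positive semidefinite, and with them the iterates below and their increments.\<close>

inductive pow_cone :: "nat \<Rightarrow> real mat \<Rightarrow> real mat \<Rightarrow> bool" for d C where
  zero: "pow_cone d C (0\<^sub>m d d)"
| pow: "pow_cone d C (C ^\<^sub>m k)"
| smult: "pow_cone d C X \<Longrightarrow> 0 \<le> a \<Longrightarrow> pow_cone d C (a \<cdot>\<^sub>m X)"
| add: "pow_cone d C X \<Longrightarrow> pow_cone d C Y \<Longrightarrow> pow_cone d C (X + Y)"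

lemma pow_cone_psd:
  assumes C: "sym_psd d C" and X: "pow_cone d C X"
  shows "sym_psd d X"
  using X
proof induction
  case zero
  have "v \<bullet> (0\<^sub>m d d *\<^sub>v v) = (0::real)" if "v \<in> carrier_vec d" for v
    using that by (auto simp: scalar_prod_def)
  thus ?case by (auto simp: sym_psd_def)
next
  case (pow k)
  show ?case using sym_psd_pow[OF C] .
next
  case (smult X a)
  hence X: "X \<in> carrier_mat d d" "transpose_mat X = X" by (auto simp: sym_psd_def)
  have "transpose_mat (a \<cdot>\<^sub>m X) = a \<cdot>\<^sub>m X"
  proof (rule eq_matI)
    fix i j assume ij: "i < dim_row (a \<cdot>\<^sub>m X)" "j < dim_col (a \<cdot>\<^sub>m X)"
    hence "X $$ (j, i) = transpose_mat X $$ (i, j)" using X(1) by auto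
    thus "transpose_mat (a \<cdot>\<^sub>m X) $$ (i, j) = (a \<cdot>\<^sub>m X) $$ (i, j)"
      using ij X by auto
  qed (use X in auto)
  moreover have "v \<bullet> ((a \<cdot>\<^sub>m X) *\<^sub>v v) = a * (v \<bullet> (X *\<^sub>v v))" if "v \<in> carrier_vec d" for v
    using X that by (auto simp: scalar_prod_def sum_distrib_left algebra_simps intro!: sum.cong)
  ultimately show ?case using smult by (auto simp: sym_psd_def)
next
  case (add X Y)
  hence X: "X \<in> carrier_mat d d" "transpose_mat X = X" and Y: "Y \<in> carrier_mat d d" "transpose_mat Y = Y"
    by (auto simp: sym_psd_def)
  have "transpose_mat (X + Y) = X + Y" using X Y by (simp add: transpose_add)
  moreover have "v \<bullet> ((X + Y) *\<^sub>v v) = v \<bullet> (X *\<^sub>v v) + v \<bullet> (Y *\<^sub>v v)" if "v \<in> carrier_vec d" for v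
    using X Y that by (simp add: add_mult_distrib_mat_vec[of _ d d] scalar_prod_add_distrib[of _ d])
  ultimately show ?case using add by (auto simp: sym_psd_def)
qed

lemma pow_cone_mult:
  assumes C: "sym_psd d C" and X: "pow_cone d C X" and Y: "pow_cone d C Y"
  shows "pow_cone d C (X * Y)"
  using X
proof induction
  case zero
  show ?case using pow_cone_psd[OF C Y] by (auto simp: sym_psd_def intro: pow_cone.zero)
next
  case (pow k)
  show ?case using Y
  proof induction
    case zero
    show ?case using C by (auto simp: sym_psd_def intro: pow_cone.zero)
  next
    case (pow j)
    show ?case using pow_mat_add[of C d k j] C pow_cone.pow[of d C "k + j"] by (simp add: sym_psd_def)
  next
    case (smult X a)
    have "X \<in> carrier_mat d d" "C ^\<^sub>m k \<in> carrier_mat d d"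
      using pow_cone_psd[OF C smult.hyps(1)] C by (auto simp: sym_psd_def)
    hence "C ^\<^sub>m k * (a \<cdot>\<^sub>m X) = a \<cdot>\<^sub>m (C ^\<^sub>m k * X)" by (rule mult_smult_distrib[rotated])
    thus ?case using pow_cone.smult[OF smult.IH smult.hyps(2)] by simp
  next
    case (add X Y)
    have "C ^\<^sub>m k \<in> carrier_mat d d" "X \<in> carrier_mat d d" "Y \<in> carrier_mat d d"
      using pow_cone_psd[OF C add.hyps(1)] pow_cone_psd[OF C add.hyps(2)] C by (auto simp: sym_psd_def)
    hence "C ^\<^sub>m k * (X + Y) = C ^\<^sub>m k * X + C ^\<^sub>m k * Y" by (rule mult_add_distrib_mat)
    thus ?case using pow_cone.add[OF add.IH] by simp
  qed
next
  case (smult X a)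
  have "X \<in> carrier_mat d d" "Y \<in> carrier_mat d d"
    using pow_cone_psd[OF C smult.hyps(1)] pow_cone_psd[OF C Y] by (auto simp: sym_psd_def)
  hence "(a \<cdot>\<^sub>m X) * Y = a \<cdot>\<^sub>m (X * Y)" by (rule mult_smult_assoc_mat)
  thus ?case using pow_cone.smult[OF smult.IH smult.hyps(2)] by simp
next
  case (add X Z)
  have "X \<in> carrier_mat d d" "Z \<in> carrier_mat d d" "Y \<in> carrier_mat d d"
    using pow_cone_psd[OF C add.hyps(1)] pow_cone_psd[OF C add.hyps(2)] pow_cone_psd[OF C Y]
    by (auto simp: sym_psd_def)
  hence "(X + Z) * Y = X * Y + Z * Y" by (rule add_mult_distrib_mat)
  thus ?case using pow_cone.add[OF add.IH] by simp
qed

text \<open>For \<open>C = 1 - A\<close> the iterates converge to \<open>1 - A\<^bsup>1/2\<^esup>\<close>.\<close>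

primrec sqrt_iter :: "nat \<Rightarrow> real mat \<Rightarrow> nat \<Rightarrow> real mat" where
  "sqrt_iter d C 0 = 0\<^sub>m d d"
| "sqrt_iter d C (Suc k) = (1/2) \<cdot>\<^sub>m (C + sqrt_iter d C k * sqrt_iter d C k)"

lemma sqrt_iter_pow_cone:
  assumes C: "sym_psd d C"
  shows "pow_cone d C (sqrt_iter d C k)"
proof (induction k)
  case (Suc k)
  have "pow_cone d C C" using pow_cone.pow[of d C 1] C by (auto simp: sym_psd_def)
  thus ?case unfolding sqrt_iter.simps using Suc
    by (intro pow_cone.smult pow_cone.add pow_cone_mult[OF C]) auto
qed (auto intro: pow_cone.zero)

text \<open>If Z = Y + D are consecutive iterates, the next increment is half of Z Z - Y Y = D Y + Z
  D, which stays in the cone. So the iterates increase in the order of positive semidefinite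
  matrices.\<close>

lemma sqrt_iter_step_pow_cone:
  assumes C: "sym_psd d C"
  shows "\<exists>D. pow_cone d C D \<and> sqrt_iter d C (Suc k) = sqrt_iter d C k + D"
proof (induction k)
  case 0
  have "pow_cone d C C" using pow_cone.pow[of d C 1] C by (auto simp: sym_psd_def)
  moreover have "sqrt_iter d C (Suc 0) = sqrt_iter d C 0 + (1/2) \<cdot>\<^sub>m C"
    using C by (auto simp: sym_psd_def)
  moreover have "pow_cone d C ((1/2) \<cdot>\<^sub>m C)"
    by (rule pow_cone.smult[OF \<open>pow_cone d C C\<close>]) simp
  ultimately show ?case by (intro exI conjI)
next
  case (Suc k)
  let ?Y = "sqrt_iter d C k" and ?Z = "sqrt_iter d C (Suc k)"
  from Suc obtain D where D: "pow_cone d C D" "?Z = ?Y + D" by (elim exE conjE)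
  have cone: "pow_cone d C ?Y" "pow_cone d C ?Z" by (rule sqrt_iter_pow_cone[OF C])+
  have c: "?Y \<in> carrier_mat d d" "?Z \<in> carrier_mat d d" "D \<in> carrier_mat d d" "C \<in> carrier_mat d d"
    by (rule sym_psd_carrier[OF pow_cone_psd[OF C cone(1)]] sym_psd_carrier[OF pow_cone_psd[OF C cone(2)]]
        sym_psd_carrier[OF pow_cone_psd[OF C D(1)]] sym_psd_carrier[OF C])+
  have "?Z * ?Z = ?Z * ?Y + ?Z * D"
    using arg_cong[OF D(2), of "\<lambda>X. ?Z * X"] mult_add_distrib_mat[OF c(2,1,3)] by (simp only:)
  also have "?Z * ?Y = ?Y * ?Y + D * ?Y"
    using arg_cong[OF D(2), of "\<lambda>X. X * ?Y"] add_mult_distrib_mat[OF c(1,3,1)] by (simp only:)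
  finally have zz: "?Z * ?Z = ?Y * ?Y + D * ?Y + ?Z * D" .
  have "sqrt_iter d C (Suc (Suc k)) = (1/2) \<cdot>\<^sub>m (C + ?Z * ?Z)" by simp
  also have "\<dots> = (1/2) \<cdot>\<^sub>m (C + ?Y * ?Y) + (1/2) \<cdot>\<^sub>m (D * ?Y + ?Z * D)"
    unfolding zz using c by (intro eq_matI) (auto simp: algebra_simps simp del: sqrt_iter.simps index_mult_mat(1))
  also have "(1/2) \<cdot>\<^sub>m (C + ?Y * ?Y) = ?Z" by simp
  finally have "sqrt_iter d C (Suc (Suc k)) = ?Z + (1/2) \<cdot>\<^sub>m (D * ?Y + ?Z * D)" .
  moreover have "pow_cone d C ((1/2) \<cdot>\<^sub>m (D * ?Y + ?Z * D))"
    using D(1) cone by (intro pow_cone.smult pow_cone.add pow_cone_mult[OF C]) auto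
  ultimately show ?case by blast
qed

text \<open>An average of two contractions is a contraction. This is the upper bound against which
  the increasing iterates converge.\<close>

lemma sqrt_iter_norm:
  assumes C: "sym_psd d C" and le: "\<And>v. v \<in> carrier_vec d \<Longrightarrow> vnorm (C *\<^sub>v v) \<le> vnorm v"
    and v: "v \<in> carrier_vec d"
  shows "vnorm (sqrt_iter d C k *\<^sub>v v) \<le> vnorm v"
  using v
proof (induction k arbitrary: v)
  case 0
  have "0\<^sub>m d d *\<^sub>v v = 0\<^sub>v d" using 0 by auto
  thus ?case by simp
next
  case (Suc k)
  let ?Y = "sqrt_iter d C k"
  have Y: "?Y \<in> carrier_mat d d" and Cc: "C \<in> carrier_mat d d"
    by (rule sym_psd_carrier[OF pow_cone_psd[OF C sqrt_iter_pow_cone[OF C]]] sym_psd_carrier[OF C])+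
  have Yv: "?Y *\<^sub>v v \<in> carrier_vec d" using Y Suc.prems by simp
  have Y2v: "?Y *\<^sub>v (?Y *\<^sub>v v) \<in> carrier_vec d" using Y Yv by simp
  have Cv: "C *\<^sub>v v \<in> carrier_vec d" using Cc Suc.prems by simp
  have "sqrt_iter d C (Suc k) *\<^sub>v v = (1/2) \<cdot>\<^sub>v (C *\<^sub>v v + ?Y *\<^sub>v (?Y *\<^sub>v v))"
  proof -
    have "(C + ?Y * ?Y) *\<^sub>v v = C *\<^sub>v v + ?Y *\<^sub>v (?Y *\<^sub>v v)"
      using Cc Y Suc.prems by (simp add: add_mult_distrib_mat_vec[of _ d d] mult_carrier_mat[OF Y Y] assoc_mult_mat_vec[OF Y Y])
    moreover have "((1/2) \<cdot>\<^sub>m (C + ?Y * ?Y)) *\<^sub>v v = (1/2) \<cdot>\<^sub>v ((C + ?Y * ?Y) *\<^sub>v v)"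
      using mult_carrier_mat[OF Y Y] Cc Suc.prems by (intro smult_mat_mult_vec[of _ d d]) auto
    ultimately show ?thesis by simp
  qed
  hence "vnorm (sqrt_iter d C (Suc k) *\<^sub>v v) = (1/2) * vnorm (C *\<^sub>v v + ?Y *\<^sub>v (?Y *\<^sub>v v))"
    by (simp add: vnorm_smult)
  also have "\<dots> \<le> (1/2) * (vnorm (C *\<^sub>v v) + vnorm (?Y *\<^sub>v (?Y *\<^sub>v v)))"
    using vnorm_triangle[OF Cv Y2v] by simp
  also have "\<dots> \<le> (1/2) * (vnorm v + vnorm v)"
    using le[OF Suc.prems] order_trans[OF Suc.IH[OF Yv] Suc.IH[OF Suc.prems]] by simp
  finally show ?case by simp
qed

text \<open>Cauchy-Schwarz for the form \<open>C\<close> at the pair C v, v gives |C v|^4 <= |C v|^2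
  |v|^2 once the form bound is applied to both vectors. It converts a bound on the form into one on
  the norm.\<close>

lemma psd_contraction:
  assumes C: "sym_psd d C" and le: "\<And>v. v \<in> carrier_vec d \<Longrightarrow> v \<bullet> (C *\<^sub>v v) \<le> v \<bullet> v"
    and v: "v \<in> carrier_vec d"
  shows "vnorm (C *\<^sub>v v) \<le> vnorm v"
proof -
  have Cv: "C *\<^sub>v v \<in> carrier_vec d" using sym_psd_carrier[OF C] v by simp
  let ?n = "(C *\<^sub>v v) \<bullet> (C *\<^sub>v v)"
  have "?n\<^sup>2 \<le> ((C *\<^sub>v v) \<bullet> (C *\<^sub>v (C *\<^sub>v v))) * (v \<bullet> (C *\<^sub>v v))"
    by (rule psd_Cauchy_Schwarz[OF C Cv v])
  also have "\<dots> \<le> ?n * (v \<bullet> v)"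
    using le[OF Cv] le[OF v] C Cv v by (intro mult_mono) (auto simp: sym_psd_def scalar_prod_self_nonneg)
  finally have "?n * ?n \<le> ?n * (v \<bullet> v)" by (simp add: power2_eq_square)
  hence "?n \<le> v \<bullet> v"
    using scalar_prod_self_nonneg[of "C *\<^sub>v v"] scalar_prod_self_nonneg[of v]
    by (cases "?n = 0") auto
  thus ?thesis by (simp add: vnorm_def)
qed

text \<open>Polarization. It passes from convergence of the quadratic forms, which are monotone, to
  convergence of the matrix entries, which are not.\<close>

lemma unit_quadratic_form:
  assumes Y: "(Y::real mat) \<in> carrier_mat d d" "transpose_mat Y = Y" and ij: "i < d" "j < d"
  shows "Y $$ (i, j) = ((unit_vec d i + unit_vec d j) \<bullet> (Y *\<^sub>v (unit_vec d i + unit_vec d j))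
     - unit_vec d i \<bullet> (Y *\<^sub>v unit_vec d i) - unit_vec d j \<bullet> (Y *\<^sub>v unit_vec d j)) / 2"
proof -
  have u: "unit_vec d i \<bullet> (Y *\<^sub>v unit_vec d j) = Y $$ (i, j)" if "i < d" "j < d" for i j
    using Y that by simp
  have sym: "Y $$ (j, i) = Y $$ (i, j)"
    using arg_cong[OF Y(2), of "\<lambda>X. X $$ (i, j)"] Y(1) ij by simp
  have c: "Y *\<^sub>v unit_vec d i \<in> carrier_vec d" "Y *\<^sub>v unit_vec d j \<in> carrier_vec d"
    using Y by auto
  have "(unit_vec d i + unit_vec d j) \<bullet> (Y *\<^sub>v (unit_vec d i + unit_vec d j)) =
      Y $$ (i, i) + Y $$ (j, i) + (Y $$ (i, j) + Y $$ (j, j))"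
    unfolding mult_add_distrib_mat_vec[OF Y(1) unit_vec_carrier unit_vec_carrier]
    using c ij by (simp add: scalar_prod_add_distrib[of _ d] add_scalar_prod_distrib[of _ d] u
        del: index_mult_mat_vec scalar_prod_left_unit)
  thus ?thesis using u ij sym by simp
qed

text \<open>The quadratic forms of the iterates increase and are bounded, so the iterates have an
  entrywise limit E with 2 E = C + E E. This equation says that (1 - E)^2 = 1 - C, and 1 - E is
  positive semidefinite because the iterates are contractions.\<close>

lemma psd_sqrt_exists_contraction:
  assumes C: "sym_psd d C" and le: "\<And>v. v \<in> carrier_vec d \<Longrightarrow> v \<bullet> (C *\<^sub>v v) \<le> v \<bullet> v"
  shows "\<exists>S. sym_psd d S \<and> S * S = 1\<^sub>m d - C"
proof -
  let ?Y = "sqrt_iter d C"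
  have psd: "sym_psd d (?Y k)" for k by (rule pow_cone_psd[OF C sqrt_iter_pow_cone[OF C]])
  have Yc: "?Y k \<in> carrier_mat d d" for k by (rule sym_psd_carrier[OF psd])
  have Ysym: "transpose_mat (?Y k) = ?Y k" for k using psd by (simp add: sym_psd_def)
  have Cc: "C \<in> carrier_mat d d" by (rule sym_psd_carrier[OF C])
  define q where "q v k = v \<bullet> (?Y k *\<^sub>v v)" for v k
  have q_le: "q v k \<le> v \<bullet> v" if v: "v \<in> carrier_vec d" for v k
  proof -
    have "?Y k *\<^sub>v v \<in> carrier_vec d" by (rule mult_mat_vec_carrier[OF Yc v])
    hence "q v k \<le> vnorm v * vnorm (?Y k *\<^sub>v v)"
      unfolding q_def using scalar_prod_le_vnorm[OF v] by (meson abs_ge_self order_trans)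
    also have "\<dots> \<le> vnorm v * vnorm v"
      using sqrt_iter_norm[OF C psd_contraction[OF C le] v] by (intro mult_left_mono) auto
    finally show ?thesis using vnorm_square[of v] by (simp add: power2_eq_square)
  qed
  have q_mono: "q v k \<le> q v (Suc k)" if v: "v \<in> carrier_vec d" for v k
  proof -
    obtain D where D: "pow_cone d C D" "?Y (Suc k) = ?Y k + D"
      using sqrt_iter_step_pow_cone[OF C] by blast
    have Dp: "sym_psd d D" by (rule pow_cone_psd[OF C D(1)])
    hence "0 \<le> v \<bullet> (D *\<^sub>v v)" using v by (simp add: sym_psd_def)
    moreover have "v \<bullet> ((?Y k + D) *\<^sub>v v) = v \<bullet> (?Y k *\<^sub>v v) + v \<bullet> (D *\<^sub>v v)"
      unfolding add_mult_distrib_mat_vec[OF Yc sym_psd_carrier[OF Dp] v]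
      by (intro scalar_prod_add_distrib[of _ d] v mult_mat_vec_carrier[OF Yc v]
          mult_mat_vec_carrier[OF sym_psd_carrier[OF Dp] v])
    ultimately show ?thesis unfolding q_def D(2) by simp
  qed
  have q_conv: "convergent (q v)" if v: "v \<in> carrier_vec d" for v
  proof -
    have "incseq (q v)" using q_mono[OF v] by (rule incseq_SucI)
    moreover have "\<forall>k. q v k \<le> v \<bullet> v" using q_le[OF v] by blast
    ultimately obtain L where "q v \<longlonglongrightarrow> L" by (rule incseq_convergent)
    thus ?thesis by (rule convergentI)
  qed
  define E where "E = mat d d (\<lambda>(i, j). lim (\<lambda>k. ?Y k $$ (i, j)))"
  have lim: "(\<lambda>k. ?Y k $$ (i, j)) \<longlonglongrightarrow> E $$ (i, j)" if ij: "i < d" "j < d" for i j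
  proof -
    have "(\<lambda>k. ?Y k $$ (i, j)) = (\<lambda>k. (q (unit_vec d i + unit_vec d j) k
        - q (unit_vec d i) k - q (unit_vec d j) k) / 2)"
      unfolding q_def by (rule ext, rule unit_quadratic_form[OF Yc Ysym ij])
    moreover have "convergent \<dots>"
    proof -
      obtain a b c where "q (unit_vec d i + unit_vec d j) \<longlonglongrightarrow> a" "q (unit_vec d i) \<longlonglongrightarrow> b" "q (unit_vec d j) \<longlonglongrightarrow> c"
        using q_conv[of "unit_vec d i + unit_vec d j"] q_conv[of "unit_vec d i"] q_conv[of "unit_vec d j"]
        by (auto simp: convergent_def)
      hence "(\<lambda>k. (q (unit_vec d i + unit_vec d j) k - q (unit_vec d i) k - q (unit_vec d j) k) / 2)
          \<longlonglongrightarrow> (a - b - c) / 2" by (intro tendsto_intros) auto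
      thus ?thesis by (rule convergentI)
    qed
    ultimately show ?thesis using ij by (simp add: E_def convergent_LIMSEQ_iff)
  qed
  have Ec: "E \<in> carrier_mat d d" by (simp add: E_def)
  have EE: "E $$ (i, j) = (C $$ (i, j) + (E * E) $$ (i, j)) / 2" if ij: "i < d" "j < d" for i j
  proof -
    have step: "?Y (Suc k) $$ (i, j) = (C $$ (i, j) + (\<Sum>l\<in>{0..<d}. ?Y k $$ (i, l) * ?Y k $$ (l, j))) / 2" for k
    proof -
      have "(?Y k * ?Y k) $$ (i, j) = (\<Sum>l\<in>{0..<d}. ?Y k $$ (i, l) * ?Y k $$ (l, j))"
        using Yc[of k] ij by (simp add: scalar_prod_def)
      thus ?thesis using Yc[of k] Cc ij by (simp del: index_mult_mat(1))
    qed
    have "(\<lambda>k. (C $$ (i, j) + (\<Sum>l\<in>{0..<d}. ?Y k $$ (i, l) * ?Y k $$ (l, j))) / 2)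
        \<longlonglongrightarrow> (C $$ (i, j) + (\<Sum>l\<in>{0..<d}. E $$ (i, l) * E $$ (l, j))) / 2"
      using ij by (intro tendsto_intros lim) auto
    from LIMSEQ_unique[OF LIMSEQ_Suc[OF lim[OF ij]], unfolded step, OF this]
    have "E $$ (i, j) = (C $$ (i, j) + (\<Sum>l\<in>{0..<d}. E $$ (i, l) * E $$ (l, j))) / 2" .
    thus ?thesis using Ec ij by (simp add: scalar_prod_def)
  qed
  let ?S = "1\<^sub>m d - E"
  have SS: "?S * ?S = 1\<^sub>m d - C"
  proof (rule eq_matI)
    fix i j assume "i < dim_row (1\<^sub>m d - C)" "j < dim_col (1\<^sub>m d - C)"
    hence ij: "i < d" "j < d" using Cc by auto
    have "?S * ?S = 1\<^sub>m d - E - (E - E * E)"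
      using Ec mult_carrier_mat[OF Ec Ec] minus_carrier_mat[OF Ec, of "1\<^sub>m d"]
      by (subst minus_mult_distrib_mat[of _ d d], simp_all)
         (subst mult_minus_distrib_mat[of _ d d], auto)
    hence "(?S * ?S) $$ (i, j) = 1\<^sub>m d $$ (i, j) - E $$ (i, j) - (E $$ (i, j) - (E * E) $$ (i, j))"
      using Ec ij by (simp del: index_mult_mat(1))
    thus "(?S * ?S) $$ (i, j) = (1\<^sub>m d - C) $$ (i, j)" using EE[OF ij] Cc ij
      by (simp add: field_simps del: index_mult_mat(1) index_one_mat(1))
  qed (use Ec Cc in auto)
  moreover have "sym_psd d ?S"
  proof -
    have "transpose_mat ?S = ?S"
    proof (rule eq_matI)
      fix i j assume "i < dim_row ?S" "j < dim_col ?S"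
      hence ij: "i < d" "j < d" using Ec by auto
      have swap: "?Y k $$ (i, j) = ?Y k $$ (j, i)" for k
        using arg_cong[OF Ysym[of k], of "\<lambda>X. X $$ (i, j)"] Yc[of k] ij by simp
      hence "E $$ (i, j) = E $$ (j, i)"
        using LIMSEQ_unique[OF lim[OF ij, unfolded swap] lim[OF ij(2,1)]] by simp
      thus "transpose_mat ?S $$ (i, j) = ?S $$ (i, j)" using Ec ij by auto
    qed (use Ec in auto)
    moreover have "0 \<le> v \<bullet> (?S *\<^sub>v v)" if v: "v \<in> carrier_vec d" for v
    proof -
      have "q v \<longlonglongrightarrow> v \<bullet> (E *\<^sub>v v)"
      proof -
        have "q v = (\<lambda>k. \<Sum>i\<in>{0..<d}. v $ i * (\<Sum>j\<in>{0..<d}. ?Y k $$ (i, j) * v $ j))"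
          unfolding q_def quadratic_form_sum[OF Yc v v]
          by (simp add: sum_distrib_left mult.assoc atLeast0LessThan)
        moreover have "v \<bullet> (E *\<^sub>v v) = (\<Sum>i\<in>{0..<d}. v $ i * (\<Sum>j\<in>{0..<d}. E $$ (i, j) * v $ j))"
          unfolding quadratic_form_sum[OF Ec v v]
          by (simp add: sum_distrib_left mult.assoc atLeast0LessThan)
        ultimately show ?thesis by (auto intro!: tendsto_intros lim)
      qed
      hence "v \<bullet> (E *\<^sub>v v) \<le> v \<bullet> v"
        using q_le[OF v] by (intro LIMSEQ_le_const2) auto
      moreover have "v \<bullet> (?S *\<^sub>v v) = v \<bullet> v - v \<bullet> (E *\<^sub>v v)"
        using Ec v by (simp add: minus_mult_distrib_mat_vec[of _ d d] scalar_prod_minus_distrib[of _ d])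
      ultimately show ?thesis by simp
    qed
    ultimately show ?thesis using Ec by (auto simp: sym_psd_def)
  qed
  ultimately show ?thesis by blast
qed

lemma psd_sqrt_exists:
  assumes A: "sym_psd d A"
  shows "\<exists>S. sym_psd d S \<and> S * S = A"
proof -
  have Ac: "A \<in> carrier_mat d d" and sym: "transpose_mat A = A" using A by (auto simp: sym_psd_def)
  \<comment> \<open>Dividing by \<open>c\<close> puts the form of \<open>A\<close> between 0 and the
    identity; the summand 1 keeps \<open>c\<close> positive when \<open>A\<close> vanishes.\<close>
  define c where "c = opnorm A + 1"
  have c: "c > 0" using opnorm_nonneg[OF Ac] by (simp add: c_def)
  let ?A = "(1 / c) \<cdot>\<^sub>m A" and ?C = "1\<^sub>m d - (1 / c) \<cdot>\<^sub>m A"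
  have A'c: "?A \<in> carrier_mat d d" using Ac by simp
  have Cc: "?C \<in> carrier_mat d d" by (rule minus_carrier_mat[OF A'c])
  have form: "v \<bullet> (?C *\<^sub>v v) = v \<bullet> v - (1 / c) * (v \<bullet> (A *\<^sub>v v))" if v: "v \<in> carrier_vec d" for v
  proof -
    have Av: "A *\<^sub>v v \<in> carrier_vec d" using Ac v by simp
    have "?C *\<^sub>v v = v - (1 / c) \<cdot>\<^sub>v (A *\<^sub>v v)"
      using minus_mult_distrib_mat_vec[OF one_carrier_mat A'c v] v
      by (simp add: smult_mat_mult_vec[OF Ac v])
    thus ?thesis using scalar_prod_minus_distrib[OF v v, of "(1 / c) \<cdot>\<^sub>v (A *\<^sub>v v)"] v Av by simp
  qed
  have "sym_psd d ?C"
  proof -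
    have "transpose_mat ?C = ?C"
    proof (rule eq_matI)
      fix i j assume "i < dim_row ?C" "j < dim_col ?C"
      hence ij: "i < d" "j < d" using Ac by auto
      have "A $$ (j, i) = A $$ (i, j)"
        using arg_cong[OF sym, of "\<lambda>X. X $$ (i, j)"] Ac ij by simp
      thus "transpose_mat ?C $$ (i, j) = ?C $$ (i, j)" using ij Ac by auto
    qed (use Ac in auto)
    moreover have "0 \<le> v \<bullet> (?C *\<^sub>v v)" if v: "v \<in> carrier_vec d" for v
    proof -
      have "v \<bullet> (A *\<^sub>v v) \<le> c * (v \<bullet> v)"
        using quadratic_form_le_opnorm[OF Ac v] scalar_prod_self_nonneg[of v]
        by (simp add: vnorm_square c_def algebra_simps)
      thus ?thesis unfolding form[OF v] using c by (simp add: field_simps)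
    qed
    ultimately show ?thesis using Cc by (auto simp: sym_psd_def)
  qed
  moreover have "v \<bullet> (?C *\<^sub>v v) \<le> v \<bullet> v" if v: "v \<in> carrier_vec d" for v
  proof -
    have "0 \<le> v \<bullet> (A *\<^sub>v v)" using A v by (simp add: sym_psd_def)
    thus ?thesis unfolding form[OF v] using c by simp
  qed
  ultimately obtain S where S: "sym_psd d S" "S * S = 1\<^sub>m d - ?C"
    using psd_sqrt_exists_contraction by blast
  have Sc: "S \<in> carrier_mat d d" by (rule sym_psd_carrier[OF S(1)])
  have SS: "S * S = ?A" unfolding S(2) using Ac by (intro eq_matI) auto
  have "sym_psd d (sqrt c \<cdot>\<^sub>m S)"
    using pow_cone_psd[OF S(1), of "sqrt c \<cdot>\<^sub>m S"] pow_cone.smult[OF pow_cone.pow[of d S 1], of "sqrt c"] Sc c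
    by simp
  moreover have "(sqrt c \<cdot>\<^sub>m S) * (sqrt c \<cdot>\<^sub>m S) = A"
  proof -
    have "(sqrt c \<cdot>\<^sub>m S) * (sqrt c \<cdot>\<^sub>m S) = sqrt c \<cdot>\<^sub>m (sqrt c \<cdot>\<^sub>m (S * S))"
      by (simp add: mult_smult_assoc_mat[OF Sc smult_carrier_mat[OF Sc]] mult_smult_distrib[OF Sc Sc])
    also have "\<dots> = A" unfolding SS using c Ac
      by (intro eq_matI) (auto simp: mult.assoc[symmetric])
    finally show ?thesis .
  qed
  ultimately show ?thesis by blast
qed

lemma tr_mult_comm:
  assumes A: "A \<in> carrier_mat n m" and B: "B \<in> carrier_mat m n"
  shows "tr (A * B) = tr (B * A)"
proof -
  have "tr (A * B) = (\<Sum>i<n. \<Sum>j<m. A $$ (i, j) * B $$ (j, i))"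
    using A B by (auto simp: tr_def scalar_prod_def atLeast0LessThan intro!: sum.cong)
  also have "\<dots> = (\<Sum>j<m. \<Sum>i<n. A $$ (i, j) * B $$ (j, i))" by (rule sum.swap)
  also have "\<dots> = tr (B * A)"
    using A B by (auto simp: tr_def scalar_prod_def atLeast0LessThan intro!: sum.cong)
  finally show ?thesis .
qed

text \<open>Cauchy-Schwarz for the form at the pair A x, x bounds |A x|^4 by a multiple of the form
  at x.\<close>

lemma psd_form_eq_0:
  assumes A: "sym_psd d A" and x: "x \<in> carrier_vec d" and 0: "x \<bullet> (A *\<^sub>v x) = 0"
  shows "A *\<^sub>v x = 0\<^sub>v d"
proof -
  have Ax: "A *\<^sub>v x \<in> carrier_vec d" using sym_psd_carrier[OF A] x by simp
  have "((A *\<^sub>v x) \<bullet> (A *\<^sub>v x))\<^sup>2 \<le> 0"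
    using psd_Cauchy_Schwarz[OF A Ax x] 0 by simp
  hence "(A *\<^sub>v x) \<bullet> (A *\<^sub>v x) = 0" by simp
  thus ?thesis by (rule scalar_prod_self_eq_0[OF Ax])
qed

text \<open>With \<open>D = S - T\<close> and \<open>X = S + T\<close>, \<open>S\<^sup>2 = T\<^sup>2\<close> means \<open>X D = - D X\<close>, so \<open>D X D\<close> has trace 0.\<close>

lemma psd_sqrt_unique:
  assumes S: "sym_psd d S" and T: "sym_psd d T" and eq: "S * S = T * T"
  shows "S = T"
proof -
  have Sc: "S \<in> carrier_mat d d" and Tc: "T \<in> carrier_mat d d"
    and sym: "transpose_mat S = S" "transpose_mat T = T" using S T by (auto simp: sym_psd_def)
  define D where "D = S - T"
  define X where "X = S + T"
  have Dc: "D \<in> carrier_mat d d" and Xc: "X \<in> carrier_mat d d" using Sc Tc by (auto simp: D_def X_def)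
  have prods: "S * S \<in> carrier_mat d d" "S * T \<in> carrier_mat d d" "T * S \<in> carrier_mat d d" "T * T \<in> carrier_mat d d"
    "D * X \<in> carrier_mat d d" "X * D \<in> carrier_mat d d"
    using Sc Tc Dc Xc by (auto intro: mult_carrier_mat)
  have "X * D = S * S - S * T + (T * S - T * T)"
    unfolding X_def D_def add_mult_distrib_mat[OF Sc Tc minus_carrier_mat[OF Tc, of S]]
      mult_minus_distrib_mat[OF Sc Sc Tc] mult_minus_distrib_mat[OF Tc Sc Tc] ..
  moreover have "D * X = S * S + S * T - (T * S + T * T)"
    unfolding X_def D_def minus_mult_distrib_mat[OF Sc Tc add_carrier_mat[OF Tc, of S]]
      mult_add_distrib_mat[OF Sc Sc Tc] mult_add_distrib_mat[OF Tc Sc Tc] ..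
  ultimately have anti: "X * D = - (D * X)"
    unfolding eq using carrier_matD[OF prods(2)] carrier_matD[OF prods(3)] carrier_matD[OF prods(4)]
    by (intro eq_matI) (simp_all del: index_mult_mat)
  have "tr (D * (X * D)) = tr (D * (- (D * X)))" by (simp only: anti)
  also have "D * (- (D * X)) = - (D * (D * X))" using Dc Xc by (intro uminus_mult_right_mat) auto
  also have "tr (- (D * (D * X))) = - tr (D * (D * X))"
    using Dc prods by (auto simp: tr_def sum_negf[symmetric] simp del: index_mult_mat(1))
  also have "tr (D * (D * X)) = tr ((D * X) * D)" by (rule tr_mult_comm[OF Dc prods(5)])
  also have "(D * X) * D = D * (X * D)" by (rule assoc_mult_mat[OF Dc Xc Dc])
  finally have 0: "tr (D * (X * D)) = 0" by simp
  have symD: "transpose_mat D = D" using sym Sc Tc by (simp add: D_def transpose_minus)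
  define u where "u i = col D i" for i
  have u: "u i \<in> carrier_vec d" if "i < d" for i using Dc that by (auto simp: u_def)
  have Su: "S *\<^sub>v u i \<in> carrier_vec d" "T *\<^sub>v u i \<in> carrier_vec d" if "i < d" for i
    using Sc Tc u[OF that] by auto
  have nonneg: "0 \<le> u i \<bullet> (S *\<^sub>v u i)" "0 \<le> u i \<bullet> (T *\<^sub>v u i)" if "i < d" for i
    using S T u[OF that] by (auto simp: sym_psd_def)
  have entry: "(D * (X * D)) $$ (i, i) = u i \<bullet> (S *\<^sub>v u i) + u i \<bullet> (T *\<^sub>v u i)" if i: "i < d" for i
  proof -
    have "(D * (X * D)) $$ (i, i) = row D i \<bullet> col (X * D) i" using Dc prods(6) i by simp
    also have "row D i = u i" unfolding u_def using symD Dc i by (metis row_transpose carrier_matD(2))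
    also have "col (X * D) i = X *\<^sub>v u i" unfolding u_def using Xc Dc i by simp
    also have "X *\<^sub>v u i = S *\<^sub>v u i + T *\<^sub>v u i"
      unfolding X_def by (rule add_mult_distrib_mat_vec[OF Sc Tc u[OF i]])
    finally show ?thesis using scalar_prod_add_distrib[OF u[OF i] Su[OF i]] by simp
  qed
  have "(\<Sum>i<d. u i \<bullet> (S *\<^sub>v u i) + u i \<bullet> (T *\<^sub>v u i)) = 0"
    using 0 entry Dc prods(6) by (simp add: tr_def)
  hence z: "u i \<bullet> (S *\<^sub>v u i) + u i \<bullet> (T *\<^sub>v u i) = 0" if "i < d" for i
    using that nonneg by (subst (asm) sum_nonneg_eq_0_iff) (auto intro: add_nonneg_nonneg)
  \<comment> \<open>\<open>S\<close> and \<open>T\<close> both annihilate the columns of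
    \<open>D\<close>, hence so does \<open>D\<close>. As \<open>D\<close> is symmetric, the diagonal
    of D D consists of the squared lengths of these columns, which therefore vanish.\<close>
  have u0: "u i = 0\<^sub>v d" if i: "i < d" for i
  proof -
    have "S *\<^sub>v u i = 0\<^sub>v d" "T *\<^sub>v u i = 0\<^sub>v d"
      using z[OF i] nonneg[OF i] by (auto intro!: psd_form_eq_0[OF S u[OF i]] psd_form_eq_0[OF T u[OF i]])
    hence Du: "D *\<^sub>v u i = 0\<^sub>v d"
      unfolding D_def minus_mult_distrib_mat_vec[OF Sc Tc u[OF i]] by simp
    have "u i \<bullet> u i = (D *\<^sub>v u i) $ i"
      using Dc i symD by (simp add: u_def) (metis carrier_matD(2) row_transpose)
    also have "\<dots> = 0" using Du i by simp
    finally show ?thesis by (rule scalar_prod_self_eq_0[OF u[OF i]])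
  qed
  show ?thesis
  proof (rule eq_matI)
    fix i j assume "i < dim_row T" "j < dim_col T"
    hence ij: "i < d" "j < d" using Tc by auto
    have "D $$ (i, j) = u j $ i" using Dc ij by (simp add: u_def)
    hence "D $$ (i, j) = 0" using u0[OF ij(2)] ij by simp
    thus "S $$ (i, j) = T $$ (i, j)" using Sc Tc ij by (simp add: D_def)
  qed (use Sc Tc in auto)
qed

lemma mat_sqrt_psd:
  assumes A: "sym_psd d A"
  shows "sym_psd d (mat_sqrt A)" and "mat_sqrt A * mat_sqrt A = A"
proof -
  have d: "dim_row A = d" using sym_psd_carrier[OF A] by simp
  have "\<exists>!S. sym_psd d S \<and> S * S = A"
    using psd_sqrt_exists[OF A] psd_sqrt_unique by metis
  from theI'[OF this] show "sym_psd d (mat_sqrt A)" "mat_sqrt A * mat_sqrt A = A"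
    unfolding mat_sqrt_def d by auto
qed

lemma psd_factor_form:
  assumes G: "sym_psd d G" and v: "v \<in> carrier_vec d"
  shows "v \<bullet> ((G * G) *\<^sub>v v) = (vnorm (G *\<^sub>v v))\<^sup>2"
proof -
  have Gc: "G \<in> carrier_mat d d" and sym: "transpose_mat G = G" using G by (auto simp: sym_psd_def)
  have Gv: "G *\<^sub>v v \<in> carrier_vec d" using Gc v by simp
  show ?thesis
    unfolding assoc_mult_mat_vec[OF Gc Gc v] sym_scalar_prod_mult[OF Gc sym v Gv] vnorm_square ..
qed

lemma tr_psd_factor:
  assumes G: "sym_psd d G"
  shows "tr (G * G) = (\<Sum>i<d. (vnorm (row G i))\<^sup>2)"
proof -
  have Gc: "G \<in> carrier_mat d d" and sym: "transpose_mat G = G" using G by (auto simp: sym_psd_def)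
  have "col G i = row G i" if "i < d" for i
    using that Gc sym by (metis carrier_matD(2) row_transpose)
  thus ?thesis using Gc by (simp add: tr_def vnorm_square)
qed

lemma tr_psd_nonneg: "sym_psd d A \<Longrightarrow> 0 \<le> tr A"
  using tr_psd_factor[OF mat_sqrt_psd(1)] mat_sqrt_psd(2) by (metis sum_nonneg zero_le_power2)

text \<open>Write A = G G with the square root G. Each application of G costs its Frobenius norm,
  which is sqrt (tr A). It follows that effective dimensions are at least 1.\<close>

lemma opnorm_le_tr:
  assumes A: "sym_psd d A"
  shows "opnorm A \<le> tr A"
proof (rule opnorm_le[OF sym_psd_carrier[OF A] tr_psd_nonneg[OF A]])
  fix v :: "real vec" assume v: "v \<in> carrier_vec d"
  let ?G = "mat_sqrt A"
  have Gc: "?G \<in> carrier_mat d d" by (rule sym_psd_carrier[OF mat_sqrt_psd(1)[OF A]])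
  have trG: "(\<Sum>i<d. (vnorm (row ?G i))\<^sup>2) = tr A"
    using tr_psd_factor[OF mat_sqrt_psd(1)[OF A]] mat_sqrt_psd(2)[OF A] by simp
  have Gv: "?G *\<^sub>v v \<in> carrier_vec d" using Gc v by simp
  have "A *\<^sub>v v = ?G *\<^sub>v (?G *\<^sub>v v)"
    using assoc_mult_mat_vec[OF Gc Gc v] mat_sqrt_psd(2)[OF A] by simp
  also have "vnorm \<dots> \<le> sqrt (tr A) * vnorm (?G *\<^sub>v v)"
    using vnorm_mult_mat_vec_le[OF Gc Gv] trG by simp
  also have "\<dots> \<le> sqrt (tr A) * (sqrt (tr A) * vnorm v)"
    using vnorm_mult_mat_vec_le[OF Gc v] trG tr_psd_nonneg[OF A] by (intro mult_left_mono) auto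
  also have "\<dots> = tr A * vnorm v" using tr_psd_nonneg[OF A] by simp
  finally show "vnorm (A *\<^sub>v v) \<le> tr A * vnorm v" .
qed

lemma mnorm_eq_vnorm_sqrt:
  assumes M: "sym_psd d M" and x: "x \<in> carrier_vec d"
  shows "mnorm M x = vnorm (mat_sqrt M *\<^sub>v x)"
  using psd_factor_form[OF mat_sqrt_psd(1)[OF M] x] mat_sqrt_psd(2)[OF M]
  by (simp add: mnorm_def)

text \<open>A kernel vector would have form 0, so the determinant is nonzero and
  \<open>mat_inverse\<close> returns a matrix; for a singular matrix \<open>mat_inv\<close> would be
  an unspecified value.\<close>

lemma mat_inv_pos_def:
  assumes A: "A \<in> carrier_mat d d"
    and pos: "\<And>v. v \<in> carrier_vec d \<Longrightarrow> v \<noteq> 0\<^sub>v d \<Longrightarrow> 0 < v \<bullet> (A *\<^sub>v v)"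
  shows "mat_inv A \<in> carrier_mat d d" "A * mat_inv A = 1\<^sub>m d" "mat_inv A * A = 1\<^sub>m d"
proof -
  have "det A \<noteq> 0"
  proof
    assume "det A = 0"
    then obtain v where v: "v \<in> carrier_vec d" "v \<noteq> 0\<^sub>v d" "A *\<^sub>v v = 0\<^sub>v d"
      using det_0_iff_vec_prod_zero_field[OF A] by blast
    with pos[OF v(1,2)] show False by simp
  qed
  hence "A \<in> Units (ring_mat TYPE(real) d ())" by (rule det_non_zero_imp_unit[OF A])
  with mat_inverse(1)[OF A, where b = "()"] obtain B where B: "mat_inverse A = Some B"
    by (cases "mat_inverse A") auto
  from mat_inverse(2)[OF A B] B show "mat_inv A \<in> carrier_mat d d" "A * mat_inv A = 1\<^sub>m d" "mat_inv A * A = 1\<^sub>m d"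
    by (auto simp: mat_inv_def)
qed

lemma transpose_mat_inv:
  assumes A: "A \<in> carrier_mat d d" "transpose_mat A = A"
    and inv: "mat_inv A \<in> carrier_mat d d" "A * mat_inv A = 1\<^sub>m d" "mat_inv A * A = 1\<^sub>m d"
  shows "transpose_mat (mat_inv A) = mat_inv A"
proof -
  let ?B = "mat_inv A"
  have "transpose_mat ?B * A = 1\<^sub>m d"
    using transpose_mult[OF A(1) inv(1)] inv(2) A(2) by simp
  hence "transpose_mat ?B * (A * ?B) = ?B"
    using assoc_mult_mat[of "transpose_mat ?B" d d A d ?B d] A inv(1) by simp
  thus ?thesis using inv by simp
qed

section \<open>Measurability of vector-valued functions\<close>

lemma space_vborel [simp]: "space (vborel d) = carrier_vec d"
  by (simp add: vborel_def)

lemma measurable_vec_nth [measurable]: "i < d \<Longrightarrow> (\<lambda>v. v $ i) \<in> borel_measurable (vborel d)"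
proof -
  assume i: "i < d"
  have "(\<lambda>v. \<lambda>i\<in>{..<d}. v $ i) \<in> vborel d \<rightarrow>\<^sub>M (\<Pi>\<^sub>M i\<in>{..<d}. borel)"
    unfolding vborel_def by (rule measurable_vimage_algebra1) (auto simp: space_PiM)
  from measurable_compose[OF this measurable_component_singleton[of i]] i
  show ?thesis by simp
qed

text \<open>\<open>vborel d\<close> is generated by the coordinate map, so measurability is checked
  coordinatewise. The carrier condition is separate because the type contains vectors of every
  length.\<close>

lemma measurable_into_vborel:
  assumes "\<And>x. x \<in> space N \<Longrightarrow> f x \<in> carrier_vec d"
    and "\<And>i. i < d \<Longrightarrow> (\<lambda>x. f x $ i) \<in> borel_measurable N"
  shows "f \<in> N \<rightarrow>\<^sub>M vborel d"
  unfolding vborel_def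
  by (rule measurable_vimage_algebra2) (use assms in \<open>auto intro!: measurable_restrict\<close>)

lemma measurable_vborel_nth:
  "f \<in> N \<rightarrow>\<^sub>M vborel d \<Longrightarrow> i < d \<Longrightarrow> (\<lambda>x. f x $ i) \<in> borel_measurable N"
  by (rule measurable_compose[OF _ measurable_vec_nth])

lemma measurable_vborel_carrier: "f \<in> N \<rightarrow>\<^sub>M vborel d \<Longrightarrow> x \<in> space N \<Longrightarrow> f x \<in> carrier_vec d"
  using measurable_space[of f N "vborel d" x] by simp

lemma measurable_vec_add:
  assumes f: "f \<in> N \<rightarrow>\<^sub>M vborel d" and g: "g \<in> N \<rightarrow>\<^sub>M vborel d"
  shows "(\<lambda>x. f x + g x) \<in> N \<rightarrow>\<^sub>M vborel d"
proof (rule measurable_into_vborel)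
  fix i assume i: "i < d"
  have eq: "(f x + g x) $ i = f x $ i + g x $ i" if "x \<in> space N" for x
    using measurable_vborel_carrier[OF g that] i by auto
  have "(\<lambda>x. f x $ i + g x $ i) \<in> borel_measurable N"
    using measurable_vborel_nth[OF f i] measurable_vborel_nth[OF g i] by measurable
  thus "(\<lambda>x. (f x + g x) $ i) \<in> borel_measurable N" by (subst measurable_cong[OF eq])
qed (use measurable_vborel_carrier[OF f] measurable_vborel_carrier[OF g] in auto)

lemma measurable_vec_smult:
  assumes a: "a \<in> borel_measurable N" and g: "g \<in> N \<rightarrow>\<^sub>M vborel d"
  shows "(\<lambda>x. a x \<cdot>\<^sub>v g x) \<in> N \<rightarrow>\<^sub>M vborel d"
proof (rule measurable_into_vborel)
  fix i assume i: "i < d"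
  have eq: "(a x \<cdot>\<^sub>v g x) $ i = a x * g x $ i" if "x \<in> space N" for x
    using measurable_vborel_carrier[OF g that] i by auto
  have "(\<lambda>x. a x * g x $ i) \<in> borel_measurable N"
    using measurable_vborel_nth[OF g i] a by measurable
  thus "(\<lambda>x. (a x \<cdot>\<^sub>v g x) $ i) \<in> borel_measurable N" by (subst measurable_cong[OF eq])
qed (use measurable_vborel_carrier[OF g] in auto)

lemma measurable_vec_diff:
  assumes f: "f \<in> N \<rightarrow>\<^sub>M vborel d" and g: "g \<in> N \<rightarrow>\<^sub>M vborel d"
  shows "(\<lambda>x. f x - g x) \<in> N \<rightarrow>\<^sub>M vborel d"
proof (rule measurable_into_vborel)
  fix i assume i: "i < d"
  have eq: "(f x - g x) $ i = f x $ i - g x $ i" if "x \<in> space N" for x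
    using measurable_vborel_carrier[OF g that] i by auto
  have "(\<lambda>x. f x $ i - g x $ i) \<in> borel_measurable N"
    using measurable_vborel_nth[OF f i] measurable_vborel_nth[OF g i] by measurable
  thus "(\<lambda>x. (f x - g x) $ i) \<in> borel_measurable N" by (subst measurable_cong[OF eq])
qed (use measurable_vborel_carrier[OF f] measurable_vborel_carrier[OF g] in auto)

lemma measurable_scalar_prod:
  assumes f: "f \<in> N \<rightarrow>\<^sub>M vborel d" and g: "g \<in> N \<rightarrow>\<^sub>M vborel d"
  shows "(\<lambda>x. f x \<bullet> g x) \<in> borel_measurable N"
proof -
  have eq: "f x \<bullet> g x = (\<Sum>i<d. f x $ i * g x $ i)" if "x \<in> space N" for x
    by (rule scalar_prod_lt[OF measurable_vborel_carrier[OF g that]])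
  have "(\<lambda>x. \<Sum>i<d. f x $ i * g x $ i) \<in> borel_measurable N"
    by (intro borel_measurable_sum borel_measurable_times measurable_vborel_nth[OF f] measurable_vborel_nth[OF g]) auto
  thus ?thesis by (subst measurable_cong[OF eq])
qed

lemma measurable_mult_mat_vec:
  assumes A: "A \<in> carrier_mat n d" and g: "g \<in> N \<rightarrow>\<^sub>M vborel d"
  shows "(\<lambda>x. A *\<^sub>v g x) \<in> N \<rightarrow>\<^sub>M vborel n"
proof (rule measurable_into_vborel)
  fix i assume i: "i < n"
  have eq: "(A *\<^sub>v g x) $ i = (\<Sum>j<d. A $$ (i, j) * g x $ j)" if "x \<in> space N" for x
    by (rule mult_mat_vec_nth[OF A measurable_vborel_carrier[OF g that] i])
  have "(\<lambda>x. \<Sum>j<d. A $$ (i, j) * g x $ j) \<in> borel_measurable N"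
    by (intro borel_measurable_sum borel_measurable_times measurable_vborel_nth[OF g]) auto
  thus "(\<lambda>x. (A *\<^sub>v g x) $ i) \<in> borel_measurable N" by (subst measurable_cong[OF eq])
qed (use measurable_vborel_carrier[OF g] A in auto)

lemma measurable_vec_const: "c \<in> carrier_vec d \<Longrightarrow> (\<lambda>x. c) \<in> N \<rightarrow>\<^sub>M vborel d"
  by simp

lemma measurable_vnorm:
  assumes f: "f \<in> N \<rightarrow>\<^sub>M vborel d"
  shows "(\<lambda>x. vnorm (f x)) \<in> borel_measurable N"
  unfolding vnorm_def using measurable_scalar_prod[OF f f] by measurable

lemmas vec_measurable = measurable_vec_add measurable_vec_smult measurable_vec_diff
  measurable_scalar_prod measurable_mult_mat_vec measurable_vec_const measurable_vnorm

subsection \<open>Lebesgue measure and Gaussian measures on vectors\<close>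

lemma sets_vlborel [measurable_cong, simp]: "sets (vlborel d) = sets (vborel d)"
  by (simp add: vlborel_def)

lemma space_vlborel [simp]: "space (vlborel d) = carrier_vec d"
  by (simp add: vlborel_def)

interpretation lborel_prod: product_sigma_finite "\<lambda>i::nat. lborel :: real measure"
  by standard

lemma measurable_vec_lborel [measurable]: "vec d \<in> (\<Pi>\<^sub>M i\<in>{..<d}. lborel) \<rightarrow>\<^sub>M vborel d"
  by (rule measurable_into_vborel) auto

lemma nn_integral_vlborel:
  "g \<in> borel_measurable (vborel d) \<Longrightarrow>
    (\<integral>\<^sup>+x. g x \<partial>vlborel d) = (\<integral>\<^sup>+\<omega>. g (vec d \<omega>) \<partial>(\<Pi>\<^sub>M i\<in>{..<d}. lborel))"
  unfolding vlborel_def by (intro nn_integral_distr) auto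

lemma PiM_lborel_translation:
  fixes a :: "nat \<Rightarrow> real"
  shows "distr (\<Pi>\<^sub>M i\<in>{..<d}. lborel) (\<Pi>\<^sub>M i\<in>{..<d}. lborel) (\<lambda>\<omega>. \<lambda>i\<in>{..<d}. a i + \<omega> i) = (\<Pi>\<^sub>M i\<in>{..<d}. lborel)"
proof (rule lborel_prod.PiM_eqI)
  fix A :: "nat \<Rightarrow> real set" assume A: "\<And>i. i \<in> {..<d} \<Longrightarrow> A i \<in> sets lborel"
  have A': "(\<lambda>x. a i + x) -` A i \<in> sets borel" if "i < d" for i
    using A[of i] that by (intro measurable_sets_borel) auto
  have "(\<lambda>\<omega>. \<lambda>i\<in>{..<d}. a i + \<omega> i) -` Pi\<^sub>E {..<d} A \<inter> space (\<Pi>\<^sub>M i\<in>{..<d}. lborel)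
      = Pi\<^sub>E {..<d} (\<lambda>i. (\<lambda>x. a i + x) -` A i)"
    by (auto simp: space_PiM PiE_iff)
  moreover have "emeasure lborel ((\<lambda>x. a i + x) -` A i) = emeasure lborel (A i)" if "i < d" for i
    using arg_cong[OF lborel_distr_plus[of "a i"], of "\<lambda>M. emeasure M (A i)"] A[of i] that
    by (simp add: emeasure_distr)
  moreover have "emeasure (\<Pi>\<^sub>M i\<in>{..<d}. lborel) (Pi\<^sub>E {..<d} (\<lambda>i. (\<lambda>x. a i + x) -` A i))
      = (\<Prod>i\<in>{..<d}. emeasure lborel ((\<lambda>x. a i + x) -` A i))"
    using A' by (intro lborel_prod.emeasure_PiM) auto
  ultimately show "emeasure (distr (\<Pi>\<^sub>M i\<in>{..<d}. lborel) (\<Pi>\<^sub>M i\<in>{..<d}. lborel) (\<lambda>\<omega>. \<lambda>i\<in>{..<d}. a i + \<omega> i)) (Pi\<^sub>E {..<d} A)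
      = (\<Prod>i\<in>{..<d}. emeasure lborel (A i))"
    using A by (subst emeasure_distr) (auto intro!: sets_PiM_I_finite measurable_restrict borel_measurable_add)
qed auto

lemma vlborel_translation:
  assumes g: "g \<in> borel_measurable (vborel d)" and a: "a \<in> carrier_vec d"
  shows "(\<integral>\<^sup>+x. g (x + a) \<partial>vlborel d) = (\<integral>\<^sup>+x. g x \<partial>vlborel d)"
proof -
  let ?T = "\<lambda>\<omega>. \<lambda>i\<in>{..<d}. a $ i + \<omega> i"
  have ga: "(\<lambda>x. g (x + a)) \<in> borel_measurable (vborel d)"
    by (rule measurable_compose[OF measurable_vec_add[OF measurable_ident_sets[OF refl] measurable_vec_const[OF a]] g])
  have "(\<integral>\<^sup>+x. g x \<partial>vlborel d) = (\<integral>\<^sup>+\<omega>. g (vec d \<omega>) \<partial>distr (\<Pi>\<^sub>M i\<in>{..<d}. lborel) (\<Pi>\<^sub>M i\<in>{..<d}. lborel) ?T)"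
    unfolding PiM_lborel_translation by (rule nn_integral_vlborel[OF g])
  also have "\<dots> = (\<integral>\<^sup>+\<omega>. g (vec d (?T \<omega>)) \<partial>(\<Pi>\<^sub>M i\<in>{..<d}. lborel))"
    using g by (intro nn_integral_distr) auto
  also have "\<dots> = (\<integral>\<^sup>+\<omega>. g (vec d \<omega> + a) \<partial>(\<Pi>\<^sub>M i\<in>{..<d}. lborel))"
  proof (rule nn_integral_cong)
    fix \<omega> :: "nat \<Rightarrow> real"
    have "vec d (?T \<omega>) = vec d \<omega> + a" using a by (intro eq_vecI) auto
    thus "g (vec d (?T \<omega>)) = g (vec d \<omega> + a)" by simp
  qed
  also have "\<dots> = (\<integral>\<^sup>+x. g (x + a) \<partial>vlborel d)"
    using nn_integral_vlborel[OF ga] by simp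
  finally show ?thesis by simp
qed

text \<open>Balls of the l1 norm with integer radius exhaust the carrier, and each lies in a box of
  finite volume. Sigma-finiteness is what allows the Lebesgue integral to be exchanged with the
  integral over \<open>f\<close>.\<close>

lemma sigma_finite_vlborel: "sigma_finite_measure (vlborel d)"
proof -
  let ?f = "\<lambda>x::real vec. \<Sum>i<d. \<bar>x $ i\<bar>"
  let ?B = "\<lambda>n::nat. {x \<in> space (vborel d). ?f x \<le> real n}"
  have "?f \<in> borel_measurable (vborel d)"
    by (intro borel_measurable_sum borel_measurable_abs measurable_vec_nth) auto
  hence B: "?B n \<in> sets (vborel d)" for n
    by (intro borel_measurable_le) auto
  have fin: "emeasure (vlborel d) (?B n) < \<infinity>" for n
  proof -
    let ?box = "Pi\<^sub>E {..<d} (\<lambda>i. {- real n .. real n})"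
    have box: "?box \<in> sets (\<Pi>\<^sub>M i\<in>{..<d}. lborel)" by (intro sets_PiM_I_finite) auto
    have sub: "vec d -` ?B n \<inter> space (\<Pi>\<^sub>M i\<in>{..<d}. lborel) \<subseteq> ?box"
    proof
      fix \<omega> assume "\<omega> \<in> vec d -` ?B n \<inter> space (\<Pi>\<^sub>M i\<in>{..<d}. lborel)"
      hence le: "(\<Sum>i<d. \<bar>\<omega> i\<bar>) \<le> real n" and ext: "\<omega> \<in> extensional {..<d}"
        by (auto simp: space_PiM PiE_iff)
      have "\<bar>\<omega> i\<bar> \<le> real n" if "i < d" for i
        using member_le_sum[of i "{..<d}" "\<lambda>i. \<bar>\<omega> i\<bar>"] that le by simp
      thus "\<omega> \<in> ?box" using ext by (auto simp: PiE_iff abs_le_iff minus_le_iff)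
    qed
    have "emeasure (vlborel d) (?B n) = emeasure (\<Pi>\<^sub>M i\<in>{..<d}. lborel) (vec d -` ?B n \<inter> space (\<Pi>\<^sub>M i\<in>{..<d}. lborel))"
      unfolding vlborel_def by (rule emeasure_distr[OF measurable_vec_lborel B])
    also have "\<dots> \<le> emeasure (\<Pi>\<^sub>M i\<in>{..<d}. lborel) ?box" by (rule emeasure_mono[OF sub box])
    also have "\<dots> = (\<Prod>i<d. ennreal (2 * real n))"
      by (subst lborel_prod.emeasure_PiM) auto
    also have "\<dots> = ennreal (\<Prod>i<d. 2 * real n)" by (rule prod_ennreal) simp
    also have "\<dots> < \<infinity>" by simp
    finally show ?thesis .
  qed
  have cover: "(\<Union>n. ?B n) = carrier_vec d"
    using real_arch_simple[of "?f _"] by auto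
  show ?thesis
  proof
    show "\<exists>A. countable A \<and> A \<subseteq> sets (vlborel d) \<and> \<Union> A = space (vlborel d) \<and> (\<forall>a\<in>A. emeasure (vlborel d) a \<noteq> \<infinity>)"
    proof (intro exI[of _ "range ?B"] conjI ballI)
      show "range ?B \<subseteq> sets (vlborel d)" using B by (simp add: image_subset_iff)
      show "\<Union> (range ?B) = space (vlborel d)" using cover by simp
      fix a assume "a \<in> range ?B"
      then obtain n where "a = ?B n" by (rule rangeE)
      thus "emeasure (vlborel d) a \<noteq> \<infinity>" using fin[of n] by (simp only: less_top) 
    qed simp
  qed
qed

abbreviation iso_cov :: "nat \<Rightarrow> real \<Rightarrow> real mat" where
  "iso_cov d s \<equiv> s\<^sup>2 \<cdot>\<^sub>m 1\<^sub>m d"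

lemma mat_inv_iso_cov:
  assumes "s \<noteq> 0"
  shows "mat_inv (iso_cov d s) = (1 / s\<^sup>2) \<cdot>\<^sub>m 1\<^sub>m d"
proof -
  let ?A = "iso_cov d s"
  have form: "?A *\<^sub>v v = s\<^sup>2 \<cdot>\<^sub>v v" if "v \<in> carrier_vec d" for v
    using that by (simp add: smult_mat_mult_vec[OF one_carrier_mat])
  have pos: "0 < v \<bullet> (?A *\<^sub>v v)" if v: "v \<in> carrier_vec d" "v \<noteq> 0\<^sub>v d" for v
  proof -
    have "v \<bullet> v \<noteq> 0" using v scalar_prod_self_eq_0 by blast
    thus ?thesis using assms v scalar_prod_self_nonneg[of v] by (simp add: form)
  qed
  have Ac: "?A \<in> carrier_mat d d" by simp
  note inv = mat_inv_pos_def[OF Ac pos]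
  have "?A * mat_inv ?A = s\<^sup>2 \<cdot>\<^sub>m mat_inv ?A"
    using inv(1) by (simp add: mult_smult_assoc_mat[OF one_carrier_mat])
  with inv have "s\<^sup>2 \<cdot>\<^sub>m mat_inv ?A = 1\<^sub>m d" by simp
  hence "(1 / s\<^sup>2) \<cdot>\<^sub>m (s\<^sup>2 \<cdot>\<^sub>m mat_inv ?A) = (1 / s\<^sup>2) \<cdot>\<^sub>m 1\<^sub>m d" by simp
  moreover have "(1 / s\<^sup>2) \<cdot>\<^sub>m (s\<^sup>2 \<cdot>\<^sub>m mat_inv ?A) = mat_inv ?A"
    using assms by (intro eq_matI) auto
  ultimately show ?thesis by simp
qed

lemma gauss_density_iso:
  assumes s: "s > 0" and x: "x \<in> carrier_vec d"
  shows "gauss_density d (iso_cov d s) x = exp (- (x \<bullet> x) / (2 * s\<^sup>2)) / sqrt ((2 * pi * s\<^sup>2) ^ d)"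
  using s x by (simp add: gauss_density_def mat_inv_iso_cov smult_mat_mult_vec[OF one_carrier_mat]
      det_smult power_mult_distrib field_simps)

text \<open>The factorization reduces the total mass and the moments of the Gaussian measure to
  those of the one-dimensional normal density.\<close>

lemma gauss_density_iso_prod:
  assumes s: "s > 0" and x: "x \<in> carrier_vec d"
  shows "gauss_density d (iso_cov d s) x = (\<Prod>i<d. normal_density 0 s (x $ i))"
proof -
  have "(\<Prod>i<d. normal_density 0 s (x $ i)) = (\<Prod>i<d. 1 / sqrt (2 * pi * s\<^sup>2)) * (\<Prod>i<d. exp (- (x $ i)\<^sup>2 / (2 * s\<^sup>2)))"
    by (simp only: normal_density_def prod.distrib diff_0_right)
  also have "(\<Prod>i<d. exp (- (x $ i)\<^sup>2 / (2 * s\<^sup>2))) = exp (- (x \<bullet> x) / (2 * s\<^sup>2))"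
    using x by (simp add: exp_sum[symmetric] scalar_prod_lt sum_negf sum_divide_distrib[symmetric] power2_eq_square)
  also have "(\<Prod>i<d. 1 / sqrt (2 * pi * s\<^sup>2)) = 1 / sqrt ((2 * pi * s\<^sup>2) ^ d)"
    by (simp add: real_sqrt_power power_one_over)
  finally show ?thesis by (simp add: gauss_density_iso[OF assms])
qed

lemma gauss_density_iso_pos:
  "s > 0 \<Longrightarrow> x \<in> carrier_vec d \<Longrightarrow> 0 < gauss_density d (iso_cov d s) x"
  by (simp add: gauss_density_iso)

lemma gauss_density_iso_shift:
  assumes s: "s > 0" and x: "x \<in> carrier_vec d" and a: "a \<in> carrier_vec d"
  shows "gauss_density d (iso_cov d s) (x + a) =
     gauss_density d (iso_cov d s) x * exp (- (a \<bullet> x) / s\<^sup>2 - (a \<bullet> a) / (2 * s\<^sup>2))"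
proof -
  have "(x + a) \<bullet> (x + a) = x \<bullet> x + 2 * (a \<bullet> x) + a \<bullet> a"
    using x a comm_scalar_prod[OF x a]
    by (simp add: add_scalar_prod_distrib[of _ d] scalar_prod_add_distrib[of _ d])
  hence "exp (- ((x + a) \<bullet> (x + a)) / (2 * s\<^sup>2))
      = exp (- (x \<bullet> x) / (2 * s\<^sup>2)) * exp (- (a \<bullet> x) / s\<^sup>2 - (a \<bullet> a) / (2 * s\<^sup>2))"
    unfolding exp_add[symmetric] using s by (simp add: field_simps)
  thus ?thesis using assms by (simp add: gauss_density_iso)
qed

lemma gauss_density_iso_measurable:
  assumes s: "s > 0" and f: "f \<in> N \<rightarrow>\<^sub>M vborel d"
  shows "(\<lambda>x. gauss_density d (iso_cov d s) (f x)) \<in> borel_measurable N"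
proof -
  have eq: "gauss_density d (iso_cov d s) (f x) = exp (- (f x \<bullet> f x) / (2 * s\<^sup>2)) / sqrt ((2 * pi * s\<^sup>2) ^ d)"
    if "x \<in> space N" for x
    by (rule gauss_density_iso[OF s measurable_vborel_carrier[OF f that]])
  have "(\<lambda>x. exp (- (f x \<bullet> f x) / (2 * s\<^sup>2)) / sqrt ((2 * pi * s\<^sup>2) ^ d)) \<in> borel_measurable N"
    using measurable_scalar_prod[OF f f] by measurable
  thus ?thesis by (subst measurable_cong[OF eq])
qed

lemma sets_gauss [measurable_cong, simp]: "sets (gauss d R) = sets (vborel d)"
  by (simp add: gauss_def)

lemma space_gauss [simp]: "space (gauss d R) = carrier_vec d"
  by (simp add: gauss_def)

lemma nn_integral_gauss:
  assumes s: "s > 0" and g: "g \<in> borel_measurable (vborel d)"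
  shows "(\<integral>\<^sup>+x. g x \<partial>gauss d (iso_cov d s)) = (\<integral>\<^sup>+x. ennreal (gauss_density d (iso_cov d s) x) * g x \<partial>vlborel d)"
proof -
  have "(\<lambda>x. gauss_density d (iso_cov d s) x) \<in> borel_measurable (vborel d)"
    by (rule gauss_density_iso_measurable[OF s]) simp
  thus ?thesis unfolding gauss_def using g by (intro nn_integral_density) auto
qed

lemma prob_space_gauss:
  assumes s: "s > 0"
  shows "prob_space (gauss d (iso_cov d s))"
proof
  have "emeasure (gauss d (iso_cov d s)) (space (gauss d (iso_cov d s)))
      = (\<integral>\<^sup>+x. 1 \<partial>gauss d (iso_cov d s))" by simp
  also have "\<dots> = (\<integral>\<^sup>+x. ennreal (gauss_density d (iso_cov d s) x) \<partial>vlborel d)"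
    by (subst nn_integral_gauss[OF s]) auto
  also have "\<dots> = (\<integral>\<^sup>+\<omega>. ennreal (gauss_density d (iso_cov d s) (vec d \<omega>)) \<partial>(\<Pi>\<^sub>M i\<in>{..<d}. lborel))"
    by (intro nn_integral_vlborel measurable_compose[OF _ measurable_ennreal] gauss_density_iso_measurable[OF s]) simp
  also have "\<dots> = (\<integral>\<^sup>+\<omega>. (\<Prod>i<d. ennreal (normal_density 0 s (\<omega> i))) \<partial>(\<Pi>\<^sub>M i\<in>{..<d}. lborel))"
    using s by (intro nn_integral_cong) (auto simp: gauss_density_iso_prod prod_ennreal)
  also have "\<dots> = (\<Prod>i<d. \<integral>\<^sup>+x. ennreal (normal_density 0 s x) \<partial>lborel)"
    by (intro lborel_prod.product_nn_integral_prod) auto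
  also have "\<dots> = 1"
    using s by (simp add: nn_integral_eq_integral)
  finally show "emeasure (gauss d (iso_cov d s)) (space (gauss d (iso_cov d s))) = 1" .
qed

text \<open>The Cameron-Martin formula: a shift of the argument is traded for a likelihood ratio. It
  yields the moment generating function, turns a wrong location into a tilt of the noise, and
  relates prior and posterior in the PAC-Bayes inequality.\<close>

lemma gauss_translation:
  assumes s: "s > 0" and g: "g \<in> borel_measurable (vborel d)" and a: "a \<in> carrier_vec d"
  shows "(\<integral>\<^sup>+w. g (w + a) \<partial>gauss d (iso_cov d s)) =
    (\<integral>\<^sup>+w. ennreal (exp (a \<bullet> w / s\<^sup>2 - (a \<bullet> a) / (2 * s\<^sup>2))) * g w \<partial>gauss d (iso_cov d s))"
proof -
  let ?\<phi> = "gauss_density d (iso_cov d s)"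
  let ?E = "\<lambda>w. exp (a \<bullet> w / s\<^sup>2 - (a \<bullet> a) / (2 * s\<^sup>2))"
  have id: "(\<lambda>x. x) \<in> vborel d \<rightarrow>\<^sub>M vborel d" by simp
  have add: "(\<lambda>x. x + a) \<in> vborel d \<rightarrow>\<^sub>M vborel d" by (intro vec_measurable id a)
  have mE: "?E \<in> borel_measurable (vborel d)"
    using measurable_scalar_prod[OF measurable_vec_const[OF a] id] by measurable
  have m\<phi>: "?\<phi> \<in> borel_measurable (vborel d)" by (rule gauss_density_iso_measurable[OF s id])
  have "(\<integral>\<^sup>+w. g (w + a) \<partial>gauss d (iso_cov d s)) = (\<integral>\<^sup>+w. ennreal (?\<phi> w) * g (w + a) \<partial>vlborel d)"
    by (rule nn_integral_gauss[OF s measurable_compose[OF add g]])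
  also have "\<dots> = (\<integral>\<^sup>+w. ennreal (?\<phi> (w + a) * ?E (w + a)) * g (w + a) \<partial>vlborel d)"
  proof (rule nn_integral_cong)
    fix w assume "w \<in> space (vlborel d)"
    hence w: "w \<in> carrier_vec d" by simp
    have cancel: "- p / t - q / (2 * t) + ((p + q) / t - q / (2 * t)) = 0" if "t > 0" for p q t :: real
      using that by (simp add: field_simps)
    have "?\<phi> (w + a) * ?E (w + a) = ?\<phi> w"
      unfolding gauss_density_iso_shift[OF s w a] scalar_prod_add_distrib[OF a w a] mult.assoc
        exp_add[symmetric] using cancel[of "s\<^sup>2" "a \<bullet> w" "a \<bullet> a"] s by simp
    thus "ennreal (?\<phi> w) * g (w + a) = ennreal (?\<phi> (w + a) * ?E (w + a)) * g (w + a)" by simp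
  qed
  also have "\<dots> = (\<integral>\<^sup>+w. ennreal (?\<phi> w * ?E w) * g w \<partial>vlborel d)"
    by (rule vlborel_translation[OF _ a, of "\<lambda>w. ennreal (?\<phi> w * ?E w) * g w"])
       (use g mE m\<phi> in measurable)
  also have "\<dots> = (\<integral>\<^sup>+w. ennreal (?\<phi> w) * (ennreal (?E w) * g w) \<partial>vlborel d)"
  proof (rule nn_integral_cong)
    fix w assume "w \<in> space (vlborel d)"
    hence "0 \<le> ?\<phi> w" using gauss_density_iso_pos[OF s, of w d] by simp
    thus "ennreal (?\<phi> w * ?E w) * g w = ennreal (?\<phi> w) * (ennreal (?E w) * g w)"
      by (subst ennreal_mult) (simp_all only: exp_ge_zero mult.assoc)
  qed
  also have "\<dots> = (\<integral>\<^sup>+w. ennreal (?E w) * g w \<partial>gauss d (iso_cov d s))"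
    by (rule nn_integral_gauss[OF s, symmetric])
       (use g mE in measurable)
  finally show ?thesis .
qed

text \<open>Translating the constant 1 by s^2 v: the likelihood ratio is exp (v . w) up to a
  constant factor, and it has total mass 1.\<close>

lemma gauss_mgf:
  assumes s: "s > 0" and v: "v \<in> carrier_vec d"
  shows "(\<integral>\<^sup>+w. ennreal (exp (v \<bullet> w)) \<partial>gauss d (iso_cov d s)) = ennreal (exp (s\<^sup>2 * (v \<bullet> v) / 2))"
proof -
  interpret prob_space "gauss d (iso_cov d s)" by (rule prob_space_gauss[OF s])
  have sv: "s\<^sup>2 \<cdot>\<^sub>v v \<in> carrier_vec d" using v by simp
  have m: "(\<lambda>w. exp (v \<bullet> w)) \<in> borel_measurable (vborel d)"
    using measurable_scalar_prod[OF measurable_vec_const[OF v] measurable_ident_sets[OF refl]] by measurable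
  have "1 = (\<integral>\<^sup>+w. 1 \<partial>gauss d (iso_cov d s))" using emeasure_space_1 by simp
  also have "\<dots> = (\<integral>\<^sup>+w. ennreal (exp ((s\<^sup>2 \<cdot>\<^sub>v v) \<bullet> w / s\<^sup>2 - ((s\<^sup>2 \<cdot>\<^sub>v v) \<bullet> (s\<^sup>2 \<cdot>\<^sub>v v)) / (2 * s\<^sup>2))) \<partial>gauss d (iso_cov d s))"
    using gauss_translation[OF s _ sv, of "\<lambda>_. 1"] by simp
  also have "\<dots> = (\<integral>\<^sup>+w. ennreal (exp (- (s\<^sup>2 * (v \<bullet> v) / 2))) * ennreal (exp (v \<bullet> w)) \<partial>gauss d (iso_cov d s))"
    using s v by (intro nn_integral_cong)
      (simp add: ennreal_mult'[symmetric] exp_add[symmetric] power2_eq_square algebra_simps)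
  also have "\<dots> = ennreal (exp (- (s\<^sup>2 * (v \<bullet> v) / 2))) * (\<integral>\<^sup>+w. ennreal (exp (v \<bullet> w)) \<partial>gauss d (iso_cov d s))"
    by (intro nn_integral_cmult measurable_compose[OF _ measurable_ennreal]) (use m in \<open>simp cong: measurable_cong_sets\<close>)
  finally have "ennreal (exp (s\<^sup>2 * (v \<bullet> v) / 2)) * 1 = ennreal (exp (s\<^sup>2 * (v \<bullet> v) / 2)) *
      (ennreal (exp (- (s\<^sup>2 * (v \<bullet> v) / 2))) * (\<integral>\<^sup>+w. ennreal (exp (v \<bullet> w)) \<partial>gauss d (iso_cov d s)))"
    by simp
  thus ?thesis by (simp add: mult.assoc[symmetric] ennreal_mult'[symmetric] exp_add[symmetric])
qed

lemma gauss_coordinate_integral: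
  fixes h :: "nat \<Rightarrow> real \<Rightarrow> real"
  assumes s: "s > 0" and h: "\<And>k. k < d \<Longrightarrow> integrable lborel (\<lambda>x. normal_density 0 s x * h k x)"
    and m: "\<And>k. k < d \<Longrightarrow> h k \<in> borel_measurable borel"
  shows "integrable (gauss d (iso_cov d s)) (\<lambda>w. \<Prod>k<d. h k (w $ k))"
    and "(\<integral>w. (\<Prod>k<d. h k (w $ k)) \<partial>gauss d (iso_cov d s)) = (\<Prod>k<d. \<integral>x. normal_density 0 s x * h k x \<partial>lborel)"
proof -
  let ?\<phi> = "gauss_density d (iso_cov d s)"
  let ?H = "\<lambda>w::real vec. \<Prod>k<d. h k (w $ k)"
  have mH: "?H \<in> borel_measurable (vborel d)"
    by (intro borel_measurable_prod measurable_compose[OF measurable_vec_nth m]) auto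
  have m\<phi>: "?\<phi> \<in> borel_measurable (vborel d)" by (rule gauss_density_iso_measurable[OF s]) simp
  have pos: "AE w in vlborel d. 0 \<le> ?\<phi> w"
    using gauss_density_iso_pos[OF s] by (auto intro!: AE_I2 less_imp_le)
  have eq: "?\<phi> (vec d \<omega>) * ?H (vec d \<omega>) = (\<Prod>k<d. normal_density 0 s (\<omega> k) * h k (\<omega> k))" for \<omega>
    using s by (simp add: gauss_density_iso_prod prod.distrib)
  have int: "integrable (\<Pi>\<^sub>M i\<in>{..<d}. lborel) (\<lambda>\<omega>. \<Prod>k<d. normal_density 0 s (\<omega> k) * h k (\<omega> k))"
    using h by (intro lborel_prod.product_integrable_prod) auto
  have m2: "(\<lambda>w. ?\<phi> w * ?H w) \<in> borel_measurable (vborel d)"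
    by (intro borel_measurable_times m\<phi> mH)
  have m\<phi>': "?\<phi> \<in> borel_measurable (vlborel d)" and mH': "?H \<in> borel_measurable (vlborel d)"
    using m\<phi> mH by (simp_all cong: measurable_cong_sets)
  have "integrable (vlborel d) (\<lambda>w. ?\<phi> w * ?H w)"
    unfolding vlborel_def integrable_distr_eq[OF measurable_vec_lborel m2] eq by (rule int)
  thus "integrable (gauss d (iso_cov d s)) ?H"
    unfolding gauss_def integrable_real_density[OF m\<phi>' pos mH'] .
  have "(\<integral>w. ?H w \<partial>gauss d (iso_cov d s)) = (\<integral>w. ?\<phi> w * ?H w \<partial>vlborel d)"
    unfolding gauss_def by (rule integral_real_density[OF m\<phi>' pos mH'])
  also have "\<dots> = (\<integral>\<omega>. (\<Prod>k<d. normal_density 0 s (\<omega> k) * h k (\<omega> k)) \<partial>(\<Pi>\<^sub>M i\<in>{..<d}. lborel))"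
    unfolding vlborel_def integral_distr[OF measurable_vec_lborel m2] eq ..
  also have "\<dots> = (\<Prod>k<d. \<integral>x. normal_density 0 s x * h k x \<partial>lborel)"
    using h by (intro lborel_prod.product_integral_prod) auto
  finally show "(\<integral>w. ?H w \<partial>gauss d (iso_cov d s)) = (\<Prod>k<d. \<integral>x. normal_density 0 s x * h k x \<partial>lborel)" .
qed

lemma gauss_moments:
  assumes s: "s > 0" and i: "i < d" and j: "j < d"
  shows "integrable (gauss d (iso_cov d s)) (\<lambda>w. w $ i)"
    and "(\<integral>w. w $ i \<partial>gauss d (iso_cov d s)) = 0"
    and "integrable (gauss d (iso_cov d s)) (\<lambda>w. w $ i * w $ j)"
    and "(\<integral>w. w $ i * w $ j \<partial>gauss d (iso_cov d s)) = (if i = j then s\<^sup>2 else 0)"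
proof -
  have m0: "integrable lborel (\<lambda>x. normal_density 0 s x * 1)" "(\<integral>x. normal_density 0 s x * 1 \<partial>lborel) = 1"
    using s by auto
  have m1: "integrable lborel (\<lambda>x. normal_density 0 s x * x)" "(\<integral>x. normal_density 0 s x * x \<partial>lborel) = 0"
    using integrable_normal_moment_nz_1[OF s, of 0] integral_normal_moment_nz_1[OF s, of 0] by auto
  have m2: "integrable lborel (\<lambda>x. normal_density 0 s x * (x * x))" "(\<integral>x. normal_density 0 s x * (x * x) \<partial>lborel) = s\<^sup>2"
    using integrable_normal_moment[OF s, of 0 2] integral_normal_moment_even[OF s, of 0 1]
    by (auto simp: power2_eq_square fact_numeral)
  have pick: "(\<Prod>k<d. if k = i then g k else 1) = g i" for g :: "nat \<Rightarrow> real"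
    using i by (subst prod.delta) auto
  let ?h1 = "\<lambda>k x. if k = i then x else 1 :: real"
  have h1: "(\<Prod>k<d. ?h1 k (w $ k)) = w $ i" for w :: "real vec" by (rule pick)
  note c1 = gauss_coordinate_integral[OF s, of d ?h1, unfolded h1]
  have i1: "integrable lborel (\<lambda>x. normal_density 0 s x * ?h1 k x)" for k using m0 m1 by (cases "k = i") auto
  have v1: "(\<integral>x. normal_density 0 s x * ?h1 k x \<partial>lborel) = (if k = i then 0 else 1)" for k
    using m0 m1 by (cases "k = i") auto
  show "integrable (gauss d (iso_cov d s)) (\<lambda>w. w $ i)" by (rule c1(1)[OF i1]) auto
  show "(\<integral>w. w $ i \<partial>gauss d (iso_cov d s)) = 0"
    using c1(2)[OF i1] i by (simp add: v1 pick)
  let ?h2 = "\<lambda>k x. (if k = i then x else 1) * (if k = j then x else 1) :: real"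
  have h2: "(\<Prod>k<d. ?h2 k (w $ k)) = w $ i * w $ j" for w :: "real vec"
    using i j by (simp add: prod.distrib)
  note c2 = gauss_coordinate_integral[OF s, of d ?h2, unfolded h2]
  have i2: "integrable lborel (\<lambda>x. normal_density 0 s x * ?h2 k x)" for k
    using m0 m1 m2 by (cases "k = i"; cases "k = j") auto
  have v2: "(\<integral>x. normal_density 0 s x * ?h2 k x \<partial>lborel)
      = (if k = i then if k = j then s\<^sup>2 else 0 else if k = j then 0 else 1)" for k
    using m0 m1 m2 by (cases "k = i"; cases "k = j") auto
  show "integrable (gauss d (iso_cov d s)) (\<lambda>w. w $ i * w $ j)" by (rule c2(1)[OF i2]) auto
  have "(\<integral>w. w $ i * w $ j \<partial>gauss d (iso_cov d s))
      = (\<Prod>k<d. if k = i then if k = j then s\<^sup>2 else 0 else if k = j then 0 else 1)"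
    by (subst c2(2)[OF i2]) (auto simp: v2)
  also have "\<dots> = (if i = j then s\<^sup>2 else 0)"
  proof (cases "i = j")
    case True
    thus ?thesis using pick[of "\<lambda>_. s\<^sup>2"] by (auto intro!: prod.cong simp: if_distrib cong: if_cong)
  next
    case False
    thus ?thesis using i by (auto intro!: bexI[of _ i])
  qed
  finally show "(\<integral>w. w $ i * w $ j \<partial>gauss d (iso_cov d s)) = (if i = j then s\<^sup>2 else 0)" .
qed

section \<open>Jensen's inequality for the exponential function\<close>

lemma exp_tangent: "exp b * (1 + a - b) \<le> exp (a::real)"
proof -
  have "exp b * (1 + (a - b)) \<le> exp b * exp (a - b)"
    by (intro mult_left_mono) auto
  thus ?thesis by (simp add: exp_add[symmetric] algebra_simps)
qed

lemma ennreal_integral_le_nn_integral: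
  fixes g :: "'a \<Rightarrow> real"
  assumes g: "integrable M g"
  shows "ennreal (\<integral>x. g x \<partial>M) \<le> (\<integral>\<^sup>+x. ennreal (g x) \<partial>M)"
proof -
  have i: "integrable M (\<lambda>x. max 0 (g x))" using g by (intro integrable_max) auto
  have "(\<integral>\<^sup>+x. ennreal (g x) \<partial>M) = (\<integral>\<^sup>+x. ennreal (max 0 (g x)) \<partial>M)"
    by (intro nn_integral_cong) (auto simp: max_def ennreal_neg)
  also have "\<dots> = ennreal (\<integral>x. max 0 (g x) \<partial>M)"
    by (rule nn_integral_eq_integral[OF i]) auto
  also have "ennreal (\<integral>x. g x \<partial>M) \<le> \<dots>"
    using g i by (intro ennreal_leI integral_mono) auto
  finally show ?thesis .
qed

text \<open>The tangent line at the mean lies below the exponential. The right-hand side is a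
  nonnegative integral, which may be infinite, so integrability is asked of \<open>h\<close> and not
  of its exponential.\<close>

lemma exp_integral_le:
  fixes h :: "'a \<Rightarrow> real"
  assumes M: "prob_space M" and h: "integrable M h"
  shows "ennreal (exp (\<integral>x. h x \<partial>M)) \<le> (\<integral>\<^sup>+x. ennreal (exp (h x)) \<partial>M)"
proof -
  interpret prob_space M by fact
  let ?m = "\<integral>x. h x \<partial>M"
  have i: "integrable M (\<lambda>x. exp ?m * (1 + h x - ?m))" using h by (intro integrable_mult_right Bochner_Integration.integrable_diff Bochner_Integration.integrable_add) auto
  have "(\<integral>x. exp ?m * (1 + h x - ?m) \<partial>M) = exp ?m * (\<integral>x. 1 + h x - ?m \<partial>M)" by simp
  also have "(\<integral>x. 1 + h x - ?m \<partial>M) = 1" using h by (simp add: prob_space)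
  finally have "exp ?m = (\<integral>x. exp ?m * (1 + h x - ?m) \<partial>M)" by simp
  hence "ennreal (exp ?m) = ennreal (\<integral>x. exp ?m * (1 + h x - ?m) \<partial>M)" by (rule arg_cong)
  also have "\<dots> \<le> (\<integral>\<^sup>+x. ennreal (exp ?m * (1 + h x - ?m)) \<partial>M)"
    by (rule ennreal_integral_le_nn_integral[OF i])
  also have "\<dots> \<le> (\<integral>\<^sup>+x. ennreal (exp (h x)) \<partial>M)"
    by (intro nn_integral_mono ennreal_leI exp_tangent)
  finally show ?thesis .
qed

section \<open>The smoothed density, its score, and the joint law of sample and noise\<close>

locale smoothing =
  fixes d :: nat and f :: "real vec measure" and r :: real
  assumes f: "vec_distribution d f" and r: "r > 0"

abbreviation (in smoothing) phi :: "real vec \<Rightarrow> real" where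
  "phi \<equiv> gauss_density d (iso_cov d r)"
abbreviation (in smoothing) noise :: "real vec measure" where
  "noise \<equiv> gauss d (iso_cov d r)"
abbreviation (in smoothing) joint :: "(real vec \<times> real vec) measure" where
  "joint \<equiv> f \<Otimes>\<^sub>M noise"
abbreviation (in smoothing) dens :: "real vec \<Rightarrow> real" where
  "dens \<equiv> smoothed_density d (iso_cov d r) f"
abbreviation (in smoothing) sc :: "real vec \<Rightarrow> real vec" where
  "sc \<equiv> score d (iso_cov d r) f"
abbreviation (in smoothing) fi :: "real mat" where
  "fi \<equiv> fisher d (iso_cov d r) f"

lemma (in smoothing) sets_f [simp, measurable_cong]: "sets f = sets (vborel d)"
  using f by (simp add: vec_distribution_def)

lemma (in smoothing) space_f [simp]: "space f = carrier_vec d"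
  using sets_eq_imp_space_eq[OF sets_f] by simp

lemma (in smoothing) prob_f: "prob_space f"
  using f by (simp add: vec_distribution_def)

lemma (in smoothing) prob_noise: "prob_space noise"
  by (rule prob_space_gauss[OF r])

lemma (in smoothing) prob_joint: "prob_space joint"
proof -
  interpret pair_prob_space f noise
    by (intro pair_prob_space.intro pair_sigma_finite.intro prob_space_imp_sigma_finite prob_f prob_noise)
  show ?thesis by (rule prob_space_axioms)
qed

lemma (in smoothing) sets_joint: "sets joint = sets (vborel d \<Otimes>\<^sub>M vborel d)"
  by (intro sets_pair_measure_cong) auto

lemma (in smoothing) space_joint: "space joint = carrier_vec d \<times> carrier_vec d"
  by (simp add: space_pair_measure)

lemma (in smoothing) measurable_joint:
  "fst \<in> joint \<rightarrow>\<^sub>M vborel d" "snd \<in> joint \<rightarrow>\<^sub>M vborel d"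
  using measurable_fst[of f noise] measurable_snd[of f noise]
  by (simp_all cong: measurable_cong_sets)

lemma (in smoothing) phi_measurable: "g \<in> N \<rightarrow>\<^sub>M vborel d \<Longrightarrow> (\<lambda>x. phi (g x)) \<in> borel_measurable N"
  by (rule gauss_density_iso_measurable[OF r])

lemma (in smoothing) phi_pos: "x \<in> carrier_vec d \<Longrightarrow> 0 < phi x"
  by (rule gauss_density_iso_pos[OF r])

lemma (in smoothing) phi_nonneg: "x \<in> carrier_vec d \<Longrightarrow> 0 \<le> phi x"
  using phi_pos by (simp add: less_imp_le)

lemma (in smoothing) ident_diff_measurable: "x \<in> carrier_vec d \<Longrightarrow> (\<lambda>y. x - y) \<in> f \<rightarrow>\<^sub>M vborel d"
  by (intro measurable_vec_diff measurable_vec_const measurable_ident_sets sets_f)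

lemma coordinate_square_le:
  assumes "u \<in> carrier_vec d" "i < d"
  shows "(u $ i)\<^sup>2 \<le> u \<bullet> (u :: real vec)"
proof -
  have "(u $ i)\<^sup>2 \<le> (\<Sum>k<d. (u $ k)\<^sup>2)"
    using assms by (intro member_le_sum) auto
  thus ?thesis using assms by (simp add: scalar_prod_lt power2_eq_square)
qed

text \<open>A second order expansion with a remainder that is uniform in the base point, so that it
  survives integration.\<close>

lemma exp_square_taylor:
  fixes a t c :: real
  assumes c: "c > 0"
  shows "\<bar>exp (- (a + t)\<^sup>2 / (2 * c)) - exp (- a\<^sup>2 / (2 * c)) + t * a / c * exp (- a\<^sup>2 / (2 * c))\<bar> \<le> 2 / c * t\<^sup>2"
proof -
  let ?g = "\<lambda>s::real. exp (- (a + s)\<^sup>2 / (2 * c))"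
  let ?g1 = "\<lambda>s::real. - ((a + s) / c) * ?g s"
  let ?g2 = "\<lambda>s::real. ((a + s) / c)\<^sup>2 * ?g s - ?g s / c"
  define D where "D m = (if m = 0 then ?g else if m = 1 then ?g1 else ?g2)" for m :: nat
  have inner: "((\<lambda>s. - (a + s)\<^sup>2 / (2 * c)) has_real_derivative - ((a + s) / c)) (at s)" for s
    using c by (auto intro!: derivative_eq_intros simp: field_simps)
  have d0: "(?g has_real_derivative ?g1 s) (at s)" for s
    using DERIV_chain2[OF DERIV_exp inner] by (simp add: mult.commute)
  have lin: "((\<lambda>s. - ((a + s) / c)) has_real_derivative - (1 / c)) (at s)" for s
    using c by (auto intro!: derivative_eq_intros)
  have d1: "(?g1 has_real_derivative ?g2 s) (at s)" for s
    by (rule DERIV_cong[OF DERIV_mult[OF lin d0]]) (simp add: power2_eq_square)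
  have "\<exists>s. \<bar>s\<bar> \<le> \<bar>t\<bar> \<and> ?g t = (\<Sum>m<2. D m 0 / fact m * t ^ m) + D 2 s / fact 2 * t ^ 2"
  proof (rule Maclaurin_bi_le)
    show "D 0 = ?g" by (simp add: D_def)
    show "\<forall>m s. m < 2 \<and> \<bar>s\<bar> \<le> \<bar>t\<bar> \<longrightarrow> (D m has_real_derivative D (Suc m) s) (at s)"
    proof (intro allI impI)
      fix m :: nat and s assume "m < 2 \<and> \<bar>s\<bar> \<le> \<bar>t\<bar>"
      then consider "m = 0" | "m = 1" by linarith
      thus "(D m has_real_derivative D (Suc m) s) (at s)"
        by cases (use d0 d1 in \<open>simp_all add: D_def\<close>)
    qed
  qed
  then obtain s where s: "?g t = (\<Sum>m<2. D m 0 / fact m * t ^ m) + D 2 s / fact 2 * t ^ 2" by blast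
  have "?g t = ?g 0 + ?g1 0 * t + ?g2 s / 2 * t\<^sup>2"
    using s by (simp add: D_def numeral_2_eq_2)
  hence eq: "?g t - ?g 0 + t * a / c * ?g 0 = ?g2 s / 2 * t\<^sup>2" by (simp add: algebra_simps)
  have g2: "\<bar>?g2 s\<bar> \<le> 4 / c"
  proof -
    \<comment> \<open>In terms of y the second derivative is (2 y - 1) exp (- y) / c, and y exp (-
      y) is at most 1.\<close>
    define y where "y = (a + s)\<^sup>2 / (2 * c)"
    have E: "?g s = exp (- y)" by (simp add: y_def)
    have "0 \<le> y" using c by (simp add: y_def)
    hence le: "0 \<le> y * exp (- y)" "y * exp (- y) \<le> 1" "exp (- y) \<le> 1"
      using order_trans[OF _ exp_ge_add_one_self[of y], of y] by (auto simp: exp_minus field_simps)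
    have "((a + s) / c)\<^sup>2 = 2 / c * y" using c by (simp add: y_def power2_eq_square)
    hence "?g2 s = (2 * (y * exp (- y)) - exp (- y)) / c"
      unfolding E by (simp add: diff_divide_distrib)
    moreover have "\<bar>2 * (y * exp (- y)) - exp (- y)\<bar> \<le> 4" using le exp_ge_zero[of "- y"] by linarith
    ultimately show ?thesis using c by (simp add: divide_right_mono)
  qed
  have "\<bar>?g2 s / 2 * t\<^sup>2\<bar> = \<bar>?g2 s\<bar> * (t\<^sup>2 / 2)" by (simp only: abs_mult abs_divide) simp
  also have "\<dots> \<le> 4 / c * (t\<^sup>2 / 2)" by (rule mult_right_mono[OF g2]) simp
  finally show ?thesis unfolding eq[symmetric] by simp
qed

text \<open>Only coordinate \<open>i\<close> moves, so the one-dimensional expansion applies while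
  the other factors are frozen in \<open>?K\<close>. Bounding \<open>?K\<close> by the peak of the
  density makes the remainder uniform in \<open>u\<close>.\<close>

lemma (in smoothing) phi_taylor:
  assumes u: "u \<in> carrier_vec d" and i: "i < d"
  shows "\<bar>phi (u + t \<cdot>\<^sub>v unit_vec d i) - phi u + t * (u $ i / r\<^sup>2) * phi u\<bar>
    \<le> 2 / r\<^sup>2 / sqrt ((2 * pi * r\<^sup>2) ^ d) * t\<^sup>2"
proof -
  let ?K = "exp (- (u \<bullet> u - (u $ i)\<^sup>2) / (2 * r\<^sup>2)) / sqrt ((2 * pi * r\<^sup>2) ^ d)"
  let ?e = "\<lambda>s. exp (- (u $ i + s)\<^sup>2 / (2 * r\<^sup>2))"
  have te: "t \<cdot>\<^sub>v unit_vec d i \<in> carrier_vec d" by simp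
  have sq: "(u + t \<cdot>\<^sub>v unit_vec d i) \<bullet> (u + t \<cdot>\<^sub>v unit_vec d i) = (u \<bullet> u - (u $ i)\<^sup>2) + (u $ i + t)\<^sup>2"
  proof -
    have "(u + t \<cdot>\<^sub>v unit_vec d i) \<bullet> (u + t \<cdot>\<^sub>v unit_vec d i)
        = u \<bullet> u + u \<bullet> (t \<cdot>\<^sub>v unit_vec d i) + ((t \<cdot>\<^sub>v unit_vec d i) \<bullet> u
          + (t \<cdot>\<^sub>v unit_vec d i) \<bullet> (t \<cdot>\<^sub>v unit_vec d i))"
      unfolding add_scalar_prod_distrib[OF u te add_carrier_vec[OF u te]]
        scalar_prod_add_distrib[OF u u te] scalar_prod_add_distrib[OF te u te] ..
    also have "u \<bullet> (t \<cdot>\<^sub>v unit_vec d i) = t * u $ i" using u i by simp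
    also have "(t \<cdot>\<^sub>v unit_vec d i) \<bullet> u = t * u $ i" using u i by simp
    also have "(t \<cdot>\<^sub>v unit_vec d i) \<bullet> (t \<cdot>\<^sub>v unit_vec d i) = t * t" using i by simp
    finally show ?thesis by (simp add: power2_eq_square algebra_simps)
  qed
  have split: "exp (- (A + B) / (2 * r\<^sup>2)) = exp (- A / (2 * r\<^sup>2)) * exp (- B / (2 * r\<^sup>2))" for A B
    unfolding exp_add[symmetric] by (simp add: diff_divide_distrib)
  let ?b = "exp (- (u $ i)\<^sup>2 / (2 * r\<^sup>2))"
  have p: "phi (u + t \<cdot>\<^sub>v unit_vec d i) = ?K * ?e t"
    unfolding gauss_density_iso[OF r add_carrier_vec[OF u te]] sq split by simp
  have p0: "phi u = ?K * ?b"
    using split[of "u \<bullet> u - (u $ i)\<^sup>2" "(u $ i)\<^sup>2"]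
    unfolding gauss_density_iso[OF r u] diff_add_cancel by simp
  have neg: "- (u \<bullet> u - (u $ i)\<^sup>2) / (2 * r\<^sup>2) \<le> 0"
    using coordinate_square_le[OF u i] by (intro divide_nonpos_nonneg) auto
  have K: "0 \<le> ?K" by simp
  have K1: "?K \<le> 1 / sqrt ((2 * pi * r\<^sup>2) ^ d)"
    using neg by (intro divide_right_mono) auto
  have alg: "K * A - K * B + t * (x / c) * (K * B) = K * (A - B + t * x / c * B)" for K A B x c :: real
    by (simp add: algebra_simps)
  have "\<bar>phi (u + t \<cdot>\<^sub>v unit_vec d i) - phi u + t * (u $ i / r\<^sup>2) * phi u\<bar>
      = ?K * \<bar>?e t - ?b + t * (u $ i) / r\<^sup>2 * ?b\<bar>"
    unfolding p p0 alg abs_mult[of ?K] using K by simp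
  also have "\<dots> \<le> 1 / sqrt ((2 * pi * r\<^sup>2) ^ d) * (2 / r\<^sup>2 * t\<^sup>2)"
    by (rule mult_mono[OF K1 exp_square_taylor]) (use r in auto)
  also have "\<dots> = 2 / r\<^sup>2 / sqrt ((2 * pi * r\<^sup>2) ^ d) * t\<^sup>2"
    by (simp only: times_divide_eq_left times_divide_eq_right mult_1_left divide_divide_eq_left mult.commute)
  finally show ?thesis .
qed

lemma (in smoothing) phi_le:
  "u \<in> carrier_vec d \<Longrightarrow> phi u \<le> 1 / sqrt ((2 * pi * r\<^sup>2) ^ d)"
  using r scalar_prod_self_nonneg[of u] by (auto simp: gauss_density_iso intro!: divide_right_mono)

text \<open>The Gaussian factor beats the linear one. Boundedness gives integrability against an
  arbitrary \<open>f\<close>, whatever its moments.\<close>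

lemma (in smoothing) coordinate_phi_le:
  assumes u: "u \<in> carrier_vec d" and i: "i < d"
  shows "\<bar>u $ i * phi u\<bar> \<le> 2 * max 1 (r\<^sup>2) / sqrt ((2 * pi * r\<^sup>2) ^ d)"
proof -
  have "\<bar>u $ i\<bar> * exp (- (u \<bullet> u) / (2 * r\<^sup>2)) \<le> 2 * max 1 (r\<^sup>2)"
  proof -
    let ?y = "(u $ i)\<^sup>2 / (2 * r\<^sup>2)"
    have "1 + ?y \<le> exp ?y" by (rule exp_ge_add_one_self)
    hence le: "(1 + ?y) * exp (- ?y) \<le> 1" using exp_gt_zero[of ?y] by (simp add: exp_minus field_simps)
    have "\<bar>u $ i\<bar> \<le> 1 + (u $ i)\<^sup>2"
      using zero_le_power2[of "\<bar>u $ i\<bar> - 1"] by (simp add: power2_eq_square algebra_simps)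
    also have "\<dots> = 1 + 2 * r\<^sup>2 * ?y" using r by simp
    also have "\<dots> \<le> 2 * max 1 (r\<^sup>2) * (1 + ?y)"
    proof -
      have "2 * r\<^sup>2 * ?y \<le> 2 * max 1 (r\<^sup>2) * ?y" by (intro mult_right_mono) auto
      moreover have "1 \<le> 2 * max 1 (r\<^sup>2)" by simp
      ultimately show ?thesis unfolding distrib_left by linarith
    qed
    finally have "\<bar>u $ i\<bar> * exp (- (u \<bullet> u) / (2 * r\<^sup>2)) \<le> 2 * max 1 (r\<^sup>2) * (1 + ?y) * exp (- ?y)"
      using coordinate_square_le[OF u i] r by (intro mult_mono) (auto intro!: divide_right_mono)
    also have "\<dots> \<le> 2 * max 1 (r\<^sup>2) * 1"
      unfolding mult.assoc[of "2 * max 1 (r\<^sup>2)"] using le by (intro mult_left_mono) auto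
    finally show ?thesis by simp
  qed
  thus ?thesis using r by (simp add: gauss_density_iso[OF r u] abs_mult divide_right_mono)
qed

lemma (in smoothing) phi_integrable:
  assumes x: "x \<in> carrier_vec d"
  shows "integrable f (\<lambda>y. phi (x - y))"
proof -
  interpret prob_space f by (rule prob_f)
  show ?thesis
  proof (rule integrable_const_bound)
    show "(\<lambda>y. phi (x - y)) \<in> borel_measurable f"
      by (rule phi_measurable[OF ident_diff_measurable[OF x]])
    show "AE y in f. norm (phi (x - y)) \<le> 1 / sqrt ((2 * pi * r\<^sup>2) ^ d)"
    proof (rule AE_I2)
      fix y assume "y \<in> space f"
      hence "x - y \<in> carrier_vec d" using x by simp
      thus "norm (phi (x - y)) \<le> 1 / sqrt ((2 * pi * r\<^sup>2) ^ d)" using phi_le phi_pos by (simp add: less_imp_le)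
    qed
  qed
qed

lemma (in smoothing) coordinate_phi_integrable:
  assumes x: "x \<in> carrier_vec d" and i: "i < d"
  shows "integrable f (\<lambda>y. (x - y) $ i * phi (x - y))"
proof -
  interpret prob_space f by (rule prob_f)
  show ?thesis
  proof (rule integrable_const_bound)
    show "(\<lambda>y. (x - y) $ i * phi (x - y)) \<in> borel_measurable f"
      by (intro borel_measurable_times phi_measurable measurable_vborel_nth[OF _ i] ident_diff_measurable[OF x])
    show "AE y in f. norm ((x - y) $ i * phi (x - y)) \<le> 2 * max 1 (r\<^sup>2) / sqrt ((2 * pi * r\<^sup>2) ^ d)"
    proof (rule AE_I2)
      fix y assume "y \<in> space f"
      hence "x - y \<in> carrier_vec d" using x by simp
      from coordinate_phi_le[OF this i]
      show "norm ((x - y) $ i * phi (x - y)) \<le> 2 * max 1 (r\<^sup>2) / sqrt ((2 * pi * r\<^sup>2) ^ d)" by simp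
    qed
  qed
qed

lemma (in smoothing) dens_pos:
  assumes x: "x \<in> carrier_vec d"
  shows "0 < dens x"
proof -
  interpret prob_space f by (rule prob_f)
  have pos: "AE y in f. 0 < phi (x - y)" using phi_pos x by (auto intro!: AE_I2)
  have "0 \<le> dens x" unfolding smoothed_density_def
    using phi_nonneg x by (intro integral_nonneg_AE AE_I2) simp
  moreover have "dens x \<noteq> 0"
  proof
    assume "dens x = 0"
    hence "AE y in f. phi (x - y) = 0"
      using phi_nonneg x unfolding smoothed_density_def
      by (subst (asm) integral_nonneg_eq_0_iff_AE[OF phi_integrable[OF x]]) (auto intro!: AE_I2)
    with pos have "AE y in f. False" by eventually_elim simp
    thus False by simp
  qed
  ultimately show ?thesis by simp
qed

lemma DERIV_quadratic_remainder:
  fixes F :: "real \<Rightarrow> real"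
  assumes "\<And>t. \<bar>F t - F 0 - t * D\<bar> \<le> C * t\<^sup>2"
  shows "(F has_real_derivative D) (at 0)"
proof -
  have "((\<lambda>t. (F t - F 0) / t - D) \<longlongrightarrow> 0) (at 0)"
  proof (rule Lim_null_comparison)
    have "\<forall>\<^sub>F t in at 0. t \<noteq> (0::real)" by (simp add: eventually_at_filter)
    thus "\<forall>\<^sub>F t in at 0. norm ((F t - F 0) / t - D) \<le> C * \<bar>t\<bar>"
    proof (rule eventually_mono)
      fix t :: real assume t: "t \<noteq> 0"
      have "\<bar>(F t - F 0) / t - D\<bar> = \<bar>F t - F 0 - t * D\<bar> / \<bar>t\<bar>"
        using t by (simp add: abs_divide[symmetric] diff_divide_distrib)
      also have "\<dots> \<le> C * t\<^sup>2 / \<bar>t\<bar>" using assms[of t] by (intro divide_right_mono) auto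
      also have "\<dots> = C * \<bar>t\<bar>" using t by (simp add: power2_eq_square abs_if)
      finally show "norm ((F t - F 0) / t - D) \<le> C * \<bar>t\<bar>" by simp
    qed
    show "((\<lambda>t. C * \<bar>t\<bar>) \<longlongrightarrow> 0) (at 0)" by (auto intro!: tendsto_eq_intros)
  qed
  hence "((\<lambda>t. (F t - F 0) / t) \<longlongrightarrow> D) (at 0)" by (rule LIM_zero_cancel)
  thus ?thesis by (simp add: has_field_derivative_iff)
qed

text \<open>Differentiation under the integral sign, justified by the uniform quadratic remainder of
  \<open>phi_taylor\<close>. The quotient is the mean of - w / r^2 under the density
  \<open>phi (x - y) / dens x\<close> in y, which is the conditional law of the sample given the
  smoothed point.\<close>

lemma (in smoothing) score_nth:
  assumes x: "x \<in> carrier_vec d" and i: "i < d"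
  shows "sc x $ i = (\<integral>y. - ((x - y) $ i / r\<^sup>2) * phi (x - y) \<partial>f) / dens x"
proof -
  interpret prob_space f by (rule prob_f)
  let ?F = "\<lambda>t. dens (x + t \<cdot>\<^sub>v unit_vec d i)"
  let ?D = "\<integral>y. - ((x - y) $ i / r\<^sup>2) * phi (x - y) \<partial>f"
  let ?C = "2 / r\<^sup>2 / sqrt ((2 * pi * r\<^sup>2) ^ d)"
  have x0: "x + 0 \<cdot>\<^sub>v unit_vec d i = x" using x by auto
  have iD: "integrable f (\<lambda>y. - ((x - y) $ i / r\<^sup>2) * phi (x - y))"
    using integrable_mult_right[OF coordinate_phi_integrable[OF x i], of "- 1 / r\<^sup>2"] by simp
  have xt: "x + t \<cdot>\<^sub>v unit_vec d i \<in> carrier_vec d" for t using x by simp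
  have bound: "\<bar>?F t - ?F 0 - t * ?D\<bar> \<le> ?C * t\<^sup>2" for t
  proof -
    let ?g = "\<lambda>y. phi (x + t \<cdot>\<^sub>v unit_vec d i - y) - phi (x - y) - t * (- ((x - y) $ i / r\<^sup>2) * phi (x - y))"
    have ig: "integrable f ?g"
      by (intro Bochner_Integration.integrable_diff integrable_mult_right phi_integrable[OF xt] phi_integrable[OF x] iD)
    have "?F t - ?F 0 - t * ?D = (\<integral>y. ?g y \<partial>f)"
      unfolding x0 smoothed_density_def
        Bochner_Integration.integral_diff[OF Bochner_Integration.integrable_diff[OF phi_integrable[OF xt]
          phi_integrable[OF x]] integrable_mult_right[OF iD]]
        Bochner_Integration.integral_diff[OF phi_integrable[OF xt] phi_integrable[OF x]]
        integral_mult_right_zero ..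
    hence "\<bar>?F t - ?F 0 - t * ?D\<bar> \<le> (\<integral>y. \<bar>?g y\<bar> \<partial>f)" using integral_abs_bound[of f ?g] by simp
    also have "\<dots> \<le> (\<integral>y. ?C * t\<^sup>2 \<partial>f)"
    proof (rule integral_mono)
      show "integrable f (\<lambda>y. \<bar>?g y\<bar>)" using ig by (rule integrable_abs)
      fix y assume "y \<in> space f"
      hence y: "y \<in> carrier_vec d" by simp
      have "x + t \<cdot>\<^sub>v unit_vec d i - y = (x - y) + t \<cdot>\<^sub>v unit_vec d i" using x y by (intro eq_vecI) auto
      thus "\<bar>?g y\<bar> \<le> ?C * t\<^sup>2" using phi_taylor[of "x - y" i t] x y i by simp
    qed simp
    also have "\<dots> = ?C * t\<^sup>2" using prob_space by simp
    finally show ?thesis .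
  qed
  have "(?F has_real_derivative ?D) (at 0)" by (rule DERIV_quadratic_remainder[OF bound])
  hence "((\<lambda>t. ln (?F t)) has_real_derivative ?D * inverse (?F 0)) (at 0)"
    using dens_pos[OF x] x0 by (auto intro!: derivative_eq_intros simp: field_simps)
  hence "deriv (\<lambda>t. ln (?F t)) 0 = ?D / dens x"
    unfolding x0 by (simp add: DERIV_imp_deriv divide_inverse)
  thus ?thesis using i by (simp add: score_def gradient_def)
qed

lemma (in smoothing) score_carrier: "sc x \<in> carrier_vec d"
  by (simp add: score_def gradient_def)

lemma (in smoothing) pair_sf: "pair_sigma_finite (vlborel d) f"
  by (intro pair_sigma_finite.intro sigma_finite_vlborel prob_space_imp_sigma_finite prob_f)

lemma (in smoothing) pair_sf_joint: "pair_sigma_finite f noise"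
  by (intro pair_sigma_finite.intro prob_space_imp_sigma_finite prob_f prob_noise)

text \<open>The change of variables \<open>(x, y) \<mapsto> (y, x - y)\<close>, where \<open>x\<close> is the smoothed point.\<close>

lemma (in smoothing) shear_measurable:
  "(\<lambda>(x, y). (y, x - y)) \<in> vlborel d \<Otimes>\<^sub>M f \<rightarrow>\<^sub>M joint"
proof -
  have m: "fst \<in> vlborel d \<Otimes>\<^sub>M f \<rightarrow>\<^sub>M vborel d" "snd \<in> vlborel d \<Otimes>\<^sub>M f \<rightarrow>\<^sub>M vborel d"
    using measurable_fst[of "vlborel d" f] measurable_snd[of "vlborel d" f]
    by (simp_all cong: measurable_cong_sets)
  have "(\<lambda>z. (snd z, fst z - snd z)) \<in> vlborel d \<Otimes>\<^sub>M f \<rightarrow>\<^sub>M vborel d \<Otimes>\<^sub>M vborel d"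
    by (intro measurable_Pair measurable_vec_diff m)
  thus ?thesis by (simp add: case_prod_beta' measurable_cong_sets[OF refl sets_joint])
qed

lemma (in smoothing) phi_shear_measurable:
  "(\<lambda>z. phi (fst z - snd z)) \<in> borel_measurable (vlborel d \<Otimes>\<^sub>M f)"
proof -
  have m: "fst \<in> vlborel d \<Otimes>\<^sub>M f \<rightarrow>\<^sub>M vborel d" "snd \<in> vlborel d \<Otimes>\<^sub>M f \<rightarrow>\<^sub>M vborel d"
    using measurable_fst[of "vlborel d" f] measurable_snd[of "vlborel d" f]
    by (simp_all cong: measurable_cong_sets)
  show ?thesis by (intro phi_measurable measurable_vec_diff m)
qed

text \<open>For fixed y the substitution w = x - y is a translation of Lebesgue measure. Exchanging
  the integrals then displays \<open>phi (x - y)\<close> as the joint density of the smoothed point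
  and the sample.\<close>

lemma (in smoothing) nn_integral_joint_shear:
  assumes H: "H \<in> borel_measurable joint"
  shows "(\<integral>\<^sup>+z. H z \<partial>joint) = (\<integral>\<^sup>+z. ennreal (phi (fst z - snd z)) * H (snd z, fst z - snd z) \<partial>(vlborel d \<Otimes>\<^sub>M f))"
proof -
  interpret F: prob_space f by (rule prob_f)
  interpret N: prob_space noise by (rule prob_noise)
  interpret P: pair_sigma_finite "vlborel d" f by (rule pair_sf)
  have mH: "(\<lambda>w. H (y, w)) \<in> borel_measurable (vborel d)" if "y \<in> carrier_vec d" for y
    using measurable_Pair2[OF H, of y] that by (simp cong: measurable_cong_sets)
  have id: "(\<lambda>x. x) \<in> vborel d \<rightarrow>\<^sub>M vborel d" by simp
  have sh: "(\<lambda>z. ennreal (phi (fst z - snd z)) * H (snd z, fst z - snd z)) \<in> borel_measurable (vlborel d \<Otimes>\<^sub>M f)"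
    using measurable_compose[OF shear_measurable H] phi_shear_measurable
    by (intro borel_measurable_times_ennreal measurable_compose[OF _ measurable_ennreal]) (simp_all add: case_prod_beta')
  have "(\<integral>\<^sup>+z. H z \<partial>joint) = (\<integral>\<^sup>+y. \<integral>\<^sup>+w. H (y, w) \<partial>noise \<partial>f)"
    by (rule N.nn_integral_fst[OF H, symmetric])
  also have "\<dots> = (\<integral>\<^sup>+y. \<integral>\<^sup>+x. ennreal (phi (x - y)) * H (y, x - y) \<partial>vlborel d \<partial>f)"
  proof (rule nn_integral_cong)
    fix y assume "y \<in> space f"
    hence y: "y \<in> carrier_vec d" by simp
    have my: "- y \<in> carrier_vec d" using y by simp
    have m: "(\<lambda>w. ennreal (phi w) * H (y, w)) \<in> borel_measurable (vborel d)"
      by (intro borel_measurable_times_ennreal mH[OF y] measurable_compose[OF phi_measurable[OF id] measurable_ennreal])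
    have "(\<integral>\<^sup>+w. H (y, w) \<partial>noise) = (\<integral>\<^sup>+w. ennreal (phi w) * H (y, w) \<partial>vlborel d)"
      by (rule nn_integral_gauss[OF r mH[OF y]])
    also have "\<dots> = (\<integral>\<^sup>+x. ennreal (phi (x + - y)) * H (y, x + - y) \<partial>vlborel d)"
      by (rule vlborel_translation[OF m my, symmetric])
    also have "\<dots> = (\<integral>\<^sup>+x. ennreal (phi (x - y)) * H (y, x - y) \<partial>vlborel d)"
      using y by (intro nn_integral_cong) (auto simp: minus_add_uminus_vec)
    finally show "(\<integral>\<^sup>+w. H (y, w) \<partial>noise) = (\<integral>\<^sup>+x. ennreal (phi (x - y)) * H (y, x - y) \<partial>vlborel d)" .
  qed
  also have "\<dots> = (\<integral>\<^sup>+z. ennreal (phi (fst z - snd z)) * H (snd z, fst z - snd z) \<partial>(vlborel d \<Otimes>\<^sub>M f))"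
    using P.nn_integral_snd[of "\<lambda>z. ennreal (phi (fst z - snd z)) * H (snd z, fst z - snd z)"] sh by simp
  finally show ?thesis .
qed

text \<open>Indicators in \<open>nn_integral_joint_shear\<close> give an equality of measures, and
  in this form the change of variables also applies to integrals of signed functions.\<close>

lemma (in smoothing) joint_eq_distr:
  "joint = distr (density (vlborel d \<Otimes>\<^sub>M f) (\<lambda>z. ennreal (phi (fst z - snd z)))) joint (\<lambda>(x, y). (y, x - y))"
proof (rule measure_eqI)
  fix A assume A: "A \<in> sets joint"
  let ?\<mu> = "density (vlborel d \<Otimes>\<^sub>M f) (\<lambda>z. ennreal (phi (fst z - snd z)))"
  have sh: "(\<lambda>(x, y). (y, x - y)) \<in> ?\<mu> \<rightarrow>\<^sub>M joint" using shear_measurable by simp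
  have mi: "(\<lambda>z. indicator A (snd z, fst z - snd z) :: ennreal) \<in> borel_measurable (vlborel d \<Otimes>\<^sub>M f)"
    using measurable_compose[OF shear_measurable borel_measurable_indicator[OF A]] by (simp add: case_prod_beta')
  have "emeasure joint A = (\<integral>\<^sup>+z. indicator A z \<partial>joint)" using A by simp
  also have "\<dots> = (\<integral>\<^sup>+z. ennreal (phi (fst z - snd z)) * indicator A (snd z, fst z - snd z) \<partial>(vlborel d \<Otimes>\<^sub>M f))"
    using A by (intro nn_integral_joint_shear borel_measurable_indicator)
  also have "\<dots> = (\<integral>\<^sup>+z. indicator A (snd z, fst z - snd z) \<partial>?\<mu>)"
    using phi_shear_measurable mi by (intro nn_integral_density[symmetric]) auto
  also have "\<dots> = (\<integral>\<^sup>+z. indicator A z \<partial>distr ?\<mu> joint (\<lambda>(x, y). (y, x - y)))"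
    using A by (subst nn_integral_distr[OF sh]) (auto simp: case_prod_beta')
  also have "\<dots> = emeasure (distr ?\<mu> joint (\<lambda>(x, y). (y, x - y))) A" using A by simp
  finally show "emeasure joint A = emeasure (distr ?\<mu> joint (\<lambda>(x, y). (y, x - y))) A" .
qed simp

lemma (in smoothing) integral_joint_shear:
  fixes H :: "real vec \<times> real vec \<Rightarrow> real"
  assumes H: "integrable joint H"
  shows "integrable (vlborel d \<Otimes>\<^sub>M f) (\<lambda>z. phi (fst z - snd z) * H (snd z, fst z - snd z))"
    and "(\<integral>z. H z \<partial>joint) = (\<integral>z. phi (fst z - snd z) * H (snd z, fst z - snd z) \<partial>(vlborel d \<Otimes>\<^sub>M f))"
proof -
  let ?\<mu> = "density (vlborel d \<Otimes>\<^sub>M f) (\<lambda>z. ennreal (phi (fst z - snd z)))"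
  have mH: "H \<in> borel_measurable joint" using H by auto
  have sh: "(\<lambda>(x, y). (y, x - y)) \<in> ?\<mu> \<rightarrow>\<^sub>M joint" using shear_measurable by simp
  have mHs: "(\<lambda>z. H (snd z, fst z - snd z)) \<in> borel_measurable (vlborel d \<Otimes>\<^sub>M f)"
    using measurable_compose[OF shear_measurable mH] by (simp add: case_prod_beta')
  have pos: "AE z in vlborel d \<Otimes>\<^sub>M f. 0 \<le> phi (fst z - snd z)"
    using phi_pos by (intro AE_I2 less_imp_le) (auto simp: space_pair_measure)
  have "integrable (distr ?\<mu> joint (\<lambda>(x, y). (y, x - y))) H" using H joint_eq_distr by simp
  hence "integrable ?\<mu> (\<lambda>z. H (snd z, fst z - snd z))"
    by (subst (asm) integrable_distr_eq[OF sh mH]) (simp add: case_prod_beta')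
  thus "integrable (vlborel d \<Otimes>\<^sub>M f) (\<lambda>z. phi (fst z - snd z) * H (snd z, fst z - snd z))"
    by (subst (asm) integrable_real_density[OF phi_shear_measurable pos mHs])
  have "(\<integral>z. H z \<partial>joint) = (\<integral>z. H z \<partial>distr ?\<mu> joint (\<lambda>(x, y). (y, x - y)))"
    using joint_eq_distr by simp
  also have "\<dots> = (\<integral>z. H (snd z, fst z - snd z) \<partial>?\<mu>)"
    by (subst integral_distr[OF sh mH]) (simp add: case_prod_beta')
  also have "\<dots> = (\<integral>z. phi (fst z - snd z) * H (snd z, fst z - snd z) \<partial>(vlborel d \<Otimes>\<^sub>M f))"
    by (rule integral_real_density[OF phi_shear_measurable pos mHs])
  finally show "(\<integral>z. H z \<partial>joint) = (\<integral>z. phi (fst z - snd z) * H (snd z, fst z - snd z) \<partial>(vlborel d \<Otimes>\<^sub>M f))" .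
qed

lemma (in smoothing) dens_measurable: "dens \<in> borel_measurable (vborel d)"
proof -
  interpret F: prob_space f by (rule prob_f)
  have "(\<lambda>x. \<integral>y. phi (x - y) \<partial>f) \<in> borel_measurable (vlborel d)"
    using phi_shear_measurable by (intro F.borel_measurable_lebesgue_integral) (simp add: case_prod_beta')
  moreover have "dens = (\<lambda>x. \<integral>y. phi (x - y) \<partial>f)" by (simp add: smoothed_density_def fun_eq_iff)
  ultimately show ?thesis by (simp cong: measurable_cong_sets)
qed

text \<open>The definition by pointwise derivatives does not exhibit measurability; the quotient of
  parameter integrals in \<open>score_nth\<close> does.\<close>

lemma (in smoothing) score_measurable: "sc \<in> vborel d \<rightarrow>\<^sub>M vborel d"
proof (rule measurable_into_vborel)
  fix i assume i: "i < d"
  interpret F: prob_space f by (rule prob_f)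
  have m: "fst \<in> vlborel d \<Otimes>\<^sub>M f \<rightarrow>\<^sub>M vborel d" "snd \<in> vlborel d \<Otimes>\<^sub>M f \<rightarrow>\<^sub>M vborel d"
    using measurable_fst[of "vlborel d" f] measurable_snd[of "vlborel d" f]
    by (simp_all cong: measurable_cong_sets)
  have "(\<lambda>z. (fst z - snd z) $ i) \<in> borel_measurable (vlborel d \<Otimes>\<^sub>M f)"
    by (intro measurable_vborel_nth[OF _ i] measurable_vec_diff m)
  hence "(\<lambda>z. - ((fst z - snd z) $ i / r\<^sup>2) * phi (fst z - snd z)) \<in> borel_measurable (vlborel d \<Otimes>\<^sub>M f)"
    using phi_shear_measurable by (intro borel_measurable_times borel_measurable_uminus borel_measurable_divide) auto
  hence "(\<lambda>x. \<integral>y. - ((x - y) $ i / r\<^sup>2) * phi (x - y) \<partial>f) \<in> borel_measurable (vlborel d)"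
    by (intro F.borel_measurable_lebesgue_integral) (simp add: case_prod_beta')
  hence "(\<lambda>x. (\<integral>y. - ((x - y) $ i / r\<^sup>2) * phi (x - y) \<partial>f) / dens x) \<in> borel_measurable (vborel d)"
    using dens_measurable by (intro borel_measurable_divide) (simp_all cong: measurable_cong_sets)
  moreover have "sc x $ i = (\<integral>y. - ((x - y) $ i / r\<^sup>2) * phi (x - y) \<partial>f) / dens x" if "x \<in> space (vborel d)" for x
    using score_nth[OF _ i, of x] that by simp
  ultimately show "(\<lambda>x. sc x $ i) \<in> borel_measurable (vborel d)" by (subst measurable_cong)
qed (simp add: score_carrier)

lemma (in smoothing) sum_measurable: "(\<lambda>z. fst z + snd z) \<in> joint \<rightarrow>\<^sub>M vborel d"
  by (intro measurable_vec_add measurable_joint)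

lemma (in smoothing) dens_nn_integral:
  assumes x: "x \<in> carrier_vec d"
  shows "ennreal (dens x) = (\<integral>\<^sup>+y. ennreal (phi (x - y)) \<partial>f)"
  unfolding smoothed_density_def using phi_pos x
  by (intro nn_integral_eq_integral[symmetric] phi_integrable AE_I2) (auto intro: less_imp_le)

lemma (in smoothing) nn_integral_smoothed:
  assumes h: "h \<in> borel_measurable (vborel d)"
  shows "(\<integral>\<^sup>+z. h (fst z + snd z) \<partial>joint) = (\<integral>\<^sup>+x. ennreal (dens x) * h x \<partial>vlborel d)"
proof -
  interpret F: prob_space f by (rule prob_f)
  interpret P: pair_sigma_finite "vlborel d" f by (rule pair_sf)
  have m: "fst \<in> vlborel d \<Otimes>\<^sub>M f \<rightarrow>\<^sub>M vborel d"
    using measurable_fst[of "vlborel d" f] by (simp cong: measurable_cong_sets)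
  have cancel: "y + (x - y) = x" if "x \<in> carrier_vec d" "y \<in> carrier_vec d" for x y :: "real vec"
    using that by (intro eq_vecI) auto
  have "(\<integral>\<^sup>+z. h (fst z + snd z) \<partial>joint)
      = (\<integral>\<^sup>+z. ennreal (phi (fst z - snd z)) * h (snd z + (fst z - snd z)) \<partial>(vlborel d \<Otimes>\<^sub>M f))"
    using nn_integral_joint_shear[OF measurable_compose[OF sum_measurable h]] by simp
  also have "\<dots> = (\<integral>\<^sup>+z. ennreal (phi (fst z - snd z)) * h (fst z) \<partial>(vlborel d \<Otimes>\<^sub>M f))"
    by (intro nn_integral_cong) (auto simp: space_pair_measure cancel)
  also have "\<dots> = (\<integral>\<^sup>+x. \<integral>\<^sup>+y. ennreal (phi (x - y)) * h x \<partial>f \<partial>vlborel d)"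
    using phi_shear_measurable measurable_compose[OF m h]
    by (subst F.nn_integral_fst[symmetric]) (auto intro!: borel_measurable_times_ennreal)
  also have "\<dots> = (\<integral>\<^sup>+x. ennreal (dens x) * h x \<partial>vlborel d)"
  proof (rule nn_integral_cong)
    fix x assume "x \<in> space (vlborel d)"
    hence x: "x \<in> carrier_vec d" by simp
    show "(\<integral>\<^sup>+y. ennreal (phi (x - y)) * h x \<partial>f) = ennreal (dens x) * h x"
      using phi_measurable[OF ident_diff_measurable[OF x]]
      by (subst nn_integral_multc) (auto simp: dens_nn_integral[OF x])
  qed
  finally show ?thesis .
qed

text \<open>\<open>smoothed\<close> is defined by a density. Identifying it with the law of sample
  plus noise lets every later expectation, in particular the Fisher information, be taken over
  \<open>joint\<close>.\<close>

lemma (in smoothing) smoothed_eq_distr: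
  "smoothed d (iso_cov d r) f = distr joint (vborel d) (\<lambda>z. fst z + snd z)"
proof (rule measure_eqI)
  fix A assume "A \<in> sets (smoothed d (iso_cov d r) f)"
  hence A: "A \<in> sets (vborel d)" by (simp add: smoothed_def)
  have "emeasure (smoothed d (iso_cov d r) f) A = (\<integral>\<^sup>+x. ennreal (dens x) * indicator A x \<partial>vlborel d)"
    unfolding smoothed_def using A dens_measurable
    by (intro emeasure_density) (auto cong: measurable_cong_sets)
  also have "\<dots> = (\<integral>\<^sup>+z. indicator A (fst z + snd z) \<partial>joint)"
    using A by (intro nn_integral_smoothed[symmetric]) auto
  also have "\<dots> = (\<integral>\<^sup>+x. indicator A x \<partial>distr joint (vborel d) (\<lambda>z. fst z + snd z))"
    using A by (intro nn_integral_distr[symmetric] sum_measurable) auto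
  also have "\<dots> = emeasure (distr joint (vborel d) (\<lambda>z. fst z + snd z)) A" using A by simp
  finally show "emeasure (smoothed d (iso_cov d r) f) A = emeasure (distr joint (vborel d) (\<lambda>z. fst z + snd z)) A" .
qed (simp add: smoothed_def)

text \<open>The score is the conditional expectation of \<open>- w / r\<^sup>2\<close> given \<open>y + w\<close>.\<close>

lemma (in smoothing) score_conditional_expectation:
  assumes h: "h \<in> borel_measurable (vborel d)" and i: "i < d"
    and int: "integrable joint (\<lambda>z. h (fst z + snd z) * snd z $ i)"
  shows "integrable joint (\<lambda>z. h (fst z + snd z) * sc (fst z + snd z) $ i)"
    and "(\<integral>z. h (fst z + snd z) * sc (fst z + snd z) $ i \<partial>joint) = - (\<integral>z. h (fst z + snd z) * snd z $ i \<partial>joint) / r\<^sup>2"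
proof -
  interpret F: prob_space f by (rule prob_f)
  interpret P: pair_sigma_finite "vlborel d" f by (rule pair_sf)
  let ?H = "\<lambda>z. - (h (fst z + snd z) * snd z $ i) / r\<^sup>2"
  have iH: "integrable joint ?H" using int by (intro integrable_divide integrable_minus)
  have cancel: "y + (x - y) = x" if "x \<in> carrier_vec d" "y \<in> carrier_vec d" for x y :: "real vec"
    using that by (intro eq_vecI) auto
  let ?K = "\<lambda>z. phi (fst z - snd z) * ?H (snd z, fst z - snd z)"
  have K: "integrable (vlborel d \<Otimes>\<^sub>M f) ?K" "(\<integral>z. ?H z \<partial>joint) = (\<integral>z. ?K z \<partial>(vlborel d \<Otimes>\<^sub>M f))"
    by (rule integral_joint_shear[OF iH])+
  have inner: "(\<integral>y. ?K (x, y) \<partial>f) = dens x * (h x * sc x $ i)" if x: "x \<in> carrier_vec d" for x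
  proof -
    have "(\<integral>y. ?K (x, y) \<partial>f) = (\<integral>y. h x * (- ((x - y) $ i / r\<^sup>2) * phi (x - y)) \<partial>f)"
      using x by (intro Bochner_Integration.integral_cong) (auto simp: cancel)
    also have "\<dots> = h x * (\<integral>y. - ((x - y) $ i / r\<^sup>2) * phi (x - y) \<partial>f)" by simp
    also have "\<dots> = dens x * (h x * sc x $ i)"
      using dens_pos[OF x] by (simp add: score_nth[OF x i])
    finally show ?thesis .
  qed
  have mhs: "(\<lambda>x. h x * sc x $ i) \<in> borel_measurable (vborel d)"
    by (intro borel_measurable_times h measurable_vborel_nth[OF score_measurable i])
  have mhs': "(\<lambda>x. h x * sc x $ i) \<in> borel_measurable (vlborel d)" and md: "dens \<in> borel_measurable (vlborel d)"
    using mhs dens_measurable by (simp_all cong: measurable_cong_sets)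
  have pos: "AE x in vlborel d. 0 \<le> dens x" using dens_pos by (auto intro!: AE_I2 less_imp_le)
  have "integrable (vlborel d) (\<lambda>x. \<integral>y. ?K (x, y) \<partial>f)" by (rule P.integrable_fst'[OF K(1)])
  moreover have "integrable (vlborel d) (\<lambda>x. \<integral>y. ?K (x, y) \<partial>f) \<longleftrightarrow> integrable (vlborel d) (\<lambda>x. dens x * (h x * sc x $ i))"
    by (rule Bochner_Integration.integrable_cong[OF refl inner]) simp
  ultimately have "integrable (vlborel d) (\<lambda>x. dens x * (h x * sc x $ i))" by blast
  hence "integrable (smoothed d (iso_cov d r) f) (\<lambda>x. h x * sc x $ i)"
    unfolding smoothed_def by (subst integrable_real_density[OF md pos mhs'])
  thus "integrable joint (\<lambda>z. h (fst z + snd z) * sc (fst z + snd z) $ i)"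
    unfolding smoothed_eq_distr integrable_distr_eq[OF sum_measurable mhs] .
  have "(\<integral>z. h (fst z + snd z) * sc (fst z + snd z) $ i \<partial>joint) = (\<integral>x. h x * sc x $ i \<partial>smoothed d (iso_cov d r) f)"
    unfolding smoothed_eq_distr integral_distr[OF sum_measurable mhs] ..
  also have "\<dots> = (\<integral>x. dens x * (h x * sc x $ i) \<partial>vlborel d)"
    unfolding smoothed_def by (rule integral_real_density[OF md pos mhs'])
  also have "\<dots> = (\<integral>x. \<integral>y. ?K (x, y) \<partial>f \<partial>vlborel d)"
    by (rule Bochner_Integration.integral_cong[OF refl inner[symmetric]]) simp
  also have "\<dots> = (\<integral>z. ?K z \<partial>(vlborel d \<Otimes>\<^sub>M f))" by (rule P.integral_fst'[OF K(1)])
  also have "\<dots> = - (\<integral>z. h (fst z + snd z) * snd z $ i \<partial>joint) / r\<^sup>2"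
    unfolding K(2)[symmetric] by simp
  finally show "(\<integral>z. h (fst z + snd z) * sc (fst z + snd z) $ i \<partial>joint) = - (\<integral>z. h (fst z + snd z) * snd z $ i \<partial>joint) / r\<^sup>2" .
qed

lemma (in smoothing) scalar_score:
  assumes v: "v \<in> carrier_vec d" and x: "x \<in> carrier_vec d"
  shows "(\<integral>y. - (v \<bullet> (x - y)) / r\<^sup>2 * phi (x - y) \<partial>f) = dens x * (v \<bullet> sc x)"
    and "integrable f (\<lambda>y. - (v \<bullet> (x - y)) / r\<^sup>2 * phi (x - y))"
proof -
  have i: "integrable f (\<lambda>y. - ((x - y) $ i / r\<^sup>2) * phi (x - y))" if "i < d" for i
    using integrable_mult_right[OF coordinate_phi_integrable[OF x that], of "- 1 / r\<^sup>2"] by simp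
  have eq: "- (v \<bullet> (x - y)) / r\<^sup>2 * phi (x - y) = (\<Sum>i<d. v $ i * (- ((x - y) $ i / r\<^sup>2) * phi (x - y)))"
    if "y \<in> space f" for y
  proof -
    have "x - y \<in> carrier_vec d" using that x by simp
    thus ?thesis unfolding scalar_prod_lt[OF \<open>x - y \<in> carrier_vec d\<close>]
      by (simp only: sum_negf[symmetric] sum_divide_distrib sum_distrib_right) (simp add: mult.assoc)
  qed
  have isum: "integrable f (\<lambda>y. \<Sum>i<d. v $ i * (- ((x - y) $ i / r\<^sup>2) * phi (x - y)))"
    by (intro Bochner_Integration.integrable_sum integrable_mult_right i) simp
  show "integrable f (\<lambda>y. - (v \<bullet> (x - y)) / r\<^sup>2 * phi (x - y))"
    using isum by (subst Bochner_Integration.integrable_cong[OF refl eq])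
  have "(\<integral>y. - (v \<bullet> (x - y)) / r\<^sup>2 * phi (x - y) \<partial>f)
      = (\<integral>y. (\<Sum>i<d. v $ i * (- ((x - y) $ i / r\<^sup>2) * phi (x - y))) \<partial>f)"
    by (rule Bochner_Integration.integral_cong[OF refl eq])
  also have "\<dots> = (\<Sum>i<d. \<integral>y. v $ i * (- ((x - y) $ i / r\<^sup>2) * phi (x - y)) \<partial>f)"
    by (intro Bochner_Integration.integral_sum integrable_mult_right i) simp
  also have "\<dots> = (\<Sum>i<d. v $ i * (dens x * sc x $ i))"
  proof (rule sum.cong[OF refl])
    fix k assume "k \<in> {..<d}"
    hence "sc x $ k = (\<integral>y. - ((x - y) $ k / r\<^sup>2) * phi (x - y) \<partial>f) / dens x" using score_nth[OF x] by simp
    hence "(\<integral>y. - ((x - y) $ k / r\<^sup>2) * phi (x - y) \<partial>f) = dens x * sc x $ k"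
      using dens_pos[OF x] by simp
    thus "(\<integral>y. v $ k * (- ((x - y) $ k / r\<^sup>2) * phi (x - y)) \<partial>f) = v $ k * (dens x * sc x $ k)"
      by (simp only: integral_mult_right_zero)
  qed
  also have "\<dots> = dens x * (v \<bullet> sc x)"
    by (simp add: scalar_prod_lt[OF score_carrier] sum_distrib_left algebra_simps)
  finally show "(\<integral>y. - (v \<bullet> (x - y)) / r\<^sup>2 * phi (x - y) \<partial>f) = dens x * (v \<bullet> sc x)" .
qed

text \<open>Conditional Jensen inequality, which makes the score subgaussian with the variance proxy
  of \<open>- w / r\<^sup>2\<close>.\<close>

lemma (in smoothing) score_jensen:
  assumes v: "v \<in> carrier_vec d" and x: "x \<in> carrier_vec d"
  shows "ennreal (dens x * exp (v \<bullet> sc x)) \<le> (\<integral>\<^sup>+y. ennreal (phi (x - y) * exp (- (v \<bullet> (x - y)) / r\<^sup>2)) \<partial>f)"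
proof -
  interpret F: prob_space f by (rule prob_f)
  let ?k = "\<lambda>y. phi (x - y) / dens x"
  \<comment> \<open>The conditional law of the sample y given the smoothed point x.\<close>
  let ?\<mu> = "density f (\<lambda>y. ennreal (?k y))"
  let ?h = "\<lambda>y. - (v \<bullet> (x - y)) / r\<^sup>2"
  have D: "dens x > 0" by (rule dens_pos[OF x])
  have mk: "?k \<in> borel_measurable f" using phi_measurable[OF ident_diff_measurable[OF x]] by simp
  have mh: "?h \<in> borel_measurable f"
    using measurable_scalar_prod[OF measurable_vec_const[OF v] ident_diff_measurable[OF x]] by simp
  have k0: "AE y in f. 0 \<le> ?k y" using D phi_nonneg x by (intro AE_I2) simp
  have P: "prob_space ?\<mu>"
  proof
    have "emeasure ?\<mu> (space ?\<mu>) = (\<integral>\<^sup>+y. 1 \<partial>?\<mu>)" by simp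
    also have "\<dots> = (\<integral>\<^sup>+y. ennreal (?k y) * 1 \<partial>f)"
      using mk by (intro nn_integral_density) auto
    also have "\<dots> = (\<integral>\<^sup>+y. ennreal (?k y) \<partial>f)" by simp
    also have "\<dots> = ennreal (\<integral>y. ?k y \<partial>f)"
      using phi_integrable[OF x] by (intro nn_integral_eq_integral k0) simp
    also have "(\<integral>y. ?k y \<partial>f) = 1" using D by (simp add: smoothed_density_def)
    finally show "emeasure ?\<mu> (space ?\<mu>) = 1" by simp
  qed
  have eq: "?k y * ?h y = - (v \<bullet> (x - y)) / r\<^sup>2 * phi (x - y) / dens x" for y by (simp add: mult.commute)
  have ih: "integrable ?\<mu> ?h"
    unfolding integrable_real_density[OF mk k0 mh] eq using scalar_score(2)[OF v x] by (rule integrable_divide)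
  have m: "(\<integral>y. ?h y \<partial>?\<mu>) = v \<bullet> sc x"
    unfolding integral_real_density[OF mk k0 mh] eq
    unfolding integral_divide_zero[of f _ "dens x"] scalar_score(1)[OF v x] using D by simp
  have "ennreal (exp (v \<bullet> sc x)) \<le> (\<integral>\<^sup>+y. ennreal (exp (?h y)) \<partial>?\<mu>)"
    using exp_integral_le[OF P ih] unfolding m .
  also have "\<dots> = (\<integral>\<^sup>+y. ennreal (?k y) * ennreal (exp (?h y)) \<partial>f)"
    using mk mh by (intro nn_integral_density) auto
  finally have le: "ennreal (exp (v \<bullet> sc x)) \<le> (\<integral>\<^sup>+y. ennreal (?k y) * ennreal (exp (?h y)) \<partial>f)" .
  have "ennreal (dens x * exp (v \<bullet> sc x)) = ennreal (dens x) * ennreal (exp (v \<bullet> sc x))"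
    using D by (simp add: ennreal_mult)
  also have "\<dots> \<le> ennreal (dens x) * (\<integral>\<^sup>+y. ennreal (?k y) * ennreal (exp (?h y)) \<partial>f)"
    by (rule mult_left_mono[OF le]) simp
  also have "\<dots> = (\<integral>\<^sup>+y. ennreal (dens x) * (ennreal (?k y) * ennreal (exp (?h y))) \<partial>f)"
    using mk mh by (intro nn_integral_cmult[symmetric]) auto
  also have "\<dots> = (\<integral>\<^sup>+y. ennreal (phi (x - y) * exp (?h y)) \<partial>f)"
  proof (rule nn_integral_cong)
    fix y assume "y \<in> space f"
    hence "0 \<le> phi (x - y)" using x phi_nonneg by simp
    thus "ennreal (dens x) * (ennreal (?k y) * ennreal (exp (?h y))) = ennreal (phi (x - y) * exp (?h y))"
      using D by (simp add: ennreal_mult'[symmetric] ennreal_mult[symmetric] del: ennreal_mult)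
  qed
  finally show ?thesis .
qed

text \<open>Integrating \<open>score_jensen\<close> over x and undoing the shear leaves the
  exponential moment of - w / r^2, a Gaussian vector with covariance 1/r^2 times the identity. No
  property of \<open>f\<close> enters the bound.\<close>

lemma (in smoothing) score_mgf:
  assumes v: "v \<in> carrier_vec d"
  shows "(\<integral>\<^sup>+z. ennreal (exp (v \<bullet> sc (fst z + snd z))) \<partial>joint) \<le> ennreal (exp (v \<bullet> v / (2 * r\<^sup>2)))"
proof -
  interpret F: prob_space f by (rule prob_f)
  interpret N: prob_space noise by (rule prob_noise)
  interpret P: pair_sigma_finite "vlborel d" f by (rule pair_sf)
  let ?u = "(- 1 / r\<^sup>2) \<cdot>\<^sub>v v"
  have u: "?u \<in> carrier_vec d" using v by simp
  have m1: "(\<lambda>x. exp (v \<bullet> sc x)) \<in> borel_measurable (vborel d)"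
    using measurable_scalar_prod[OF measurable_vec_const[OF v] score_measurable] by simp
  have m2: "(\<lambda>z. exp (?u \<bullet> snd z)) \<in> borel_measurable joint"
    using measurable_scalar_prod[OF measurable_vec_const[OF u] measurable_joint(2)] by simp
  have m3: "(\<lambda>w. exp (?u \<bullet> w)) \<in> borel_measurable noise"
    using measurable_scalar_prod[OF measurable_vec_const[OF u] measurable_ident_sets[OF sets_gauss]] by simp
  have m4: "(\<lambda>z. ennreal (phi (fst z - snd z)) * ennreal (exp (?u \<bullet> (fst z - snd z)))) \<in> borel_measurable (vlborel d \<Otimes>\<^sub>M f)"
    using phi_shear_measurable measurable_compose[OF shear_measurable m2] by (simp add: case_prod_beta')
  have "(\<integral>\<^sup>+z. ennreal (exp (v \<bullet> sc (fst z + snd z))) \<partial>joint) = (\<integral>\<^sup>+x. ennreal (dens x) * ennreal (exp (v \<bullet> sc x)) \<partial>vlborel d)"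
    using m1 by (intro nn_integral_smoothed) simp
  also have "\<dots> \<le> (\<integral>\<^sup>+x. \<integral>\<^sup>+y. ennreal (phi (x - y)) * ennreal (exp (?u \<bullet> (x - y))) \<partial>f \<partial>vlborel d)"
  proof (rule nn_integral_mono)
    fix x assume "x \<in> space (vlborel d)"
    hence x: "x \<in> carrier_vec d" by simp
    have "ennreal (dens x) * ennreal (exp (v \<bullet> sc x)) = ennreal (dens x * exp (v \<bullet> sc x))"
      using dens_pos[OF x] by (simp add: ennreal_mult)
    also have "\<dots> \<le> (\<integral>\<^sup>+y. ennreal (phi (x - y) * exp (- (v \<bullet> (x - y)) / r\<^sup>2)) \<partial>f)" by (rule score_jensen[OF v x])
    also have "\<dots> = (\<integral>\<^sup>+y. ennreal (phi (x - y)) * ennreal (exp (?u \<bullet> (x - y))) \<partial>f)"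
      using x v phi_nonneg by (intro nn_integral_cong) (simp add: ennreal_mult)
    finally show "ennreal (dens x) * ennreal (exp (v \<bullet> sc x)) \<le> (\<integral>\<^sup>+y. ennreal (phi (x - y)) * ennreal (exp (?u \<bullet> (x - y))) \<partial>f)" .
  qed
  also have "\<dots> = (\<integral>\<^sup>+z. ennreal (phi (fst z - snd z)) * ennreal (exp (?u \<bullet> (fst z - snd z))) \<partial>(vlborel d \<Otimes>\<^sub>M f))"
    using F.nn_integral_fst[OF m4] by simp
  also have "\<dots> = (\<integral>\<^sup>+z. ennreal (exp (?u \<bullet> snd z)) \<partial>joint)"
    using nn_integral_joint_shear[of "\<lambda>z. ennreal (exp (?u \<bullet> snd z))"] m2 by simp
  also have "\<dots> = (\<integral>\<^sup>+y. \<integral>\<^sup>+w. ennreal (exp (?u \<bullet> w)) \<partial>noise \<partial>f)"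
    using N.nn_integral_fst[OF measurable_compose[OF m2 measurable_ennreal]] by (simp only: snd_conv)
  also have "\<dots> = ennreal (exp (r\<^sup>2 * (?u \<bullet> ?u) / 2))"
    using F.emeasure_space_1 by (simp only: gauss_mgf[OF r u] nn_integral_const) simp
  also have "r\<^sup>2 * (?u \<bullet> ?u) / 2 = v \<bullet> v / (2 * r\<^sup>2)"
    using v r by (simp add: power2_eq_square field_simps)
  finally show ?thesis .
qed

lemma (in smoothing) noise_mgf:
  assumes v: "v \<in> carrier_vec d"
  shows "(\<integral>\<^sup>+z. ennreal (exp (v \<bullet> snd z)) \<partial>joint) = ennreal (exp (r\<^sup>2 * (v \<bullet> v) / 2))"
proof -
  interpret F: prob_space f by (rule prob_f)
  interpret N: prob_space noise by (rule prob_noise)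
  have m2: "(\<lambda>z. exp (v \<bullet> snd z)) \<in> borel_measurable joint"
    using measurable_scalar_prod[OF measurable_vec_const[OF v] measurable_joint(2)] by simp
  have "(\<integral>\<^sup>+z. ennreal (exp (v \<bullet> snd z)) \<partial>joint) = (\<integral>\<^sup>+y. \<integral>\<^sup>+w. ennreal (exp (v \<bullet> w)) \<partial>noise \<partial>f)"
    using N.nn_integral_fst[OF measurable_compose[OF m2 measurable_ennreal]] by (simp only: snd_conv)
  also have "\<dots> = ennreal (exp (r\<^sup>2 * (v \<bullet> v) / 2))"
    using F.emeasure_space_1 by (simp only: gauss_mgf[OF r v] nn_integral_const) simp
  finally show ?thesis .
qed

text \<open>Translating the smoothed point by \<open>- \<epsilon>\<close> amounts to the likelihood ratio of the noise.\<close>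

lemma (in smoothing) joint_translation:
  assumes g: "g \<in> borel_measurable (vborel d)" and e: "e \<in> carrier_vec d"
  shows "(\<integral>\<^sup>+z. g (fst z + snd z - e) \<partial>joint) =
    (\<integral>\<^sup>+z. ennreal (exp (- (e \<bullet> snd z) / r\<^sup>2 - (e \<bullet> e) / (2 * r\<^sup>2))) * g (fst z + snd z) \<partial>joint)"
proof -
  interpret N: prob_space noise by (rule prob_noise)
  have me: "- e \<in> carrier_vec d" using e by simp
  have sub: "(\<lambda>x. x - e) \<in> vborel d \<rightarrow>\<^sub>M vborel d"
    by (intro measurable_vec_diff measurable_vec_const e) simp
  have m1: "(\<lambda>z. g (fst z + snd z - e)) \<in> borel_measurable joint"
    using measurable_compose[OF measurable_compose[OF sum_measurable sub] g] .
  let ?\<rho> = "\<lambda>w. exp (- (e \<bullet> w) / r\<^sup>2 - (e \<bullet> e) / (2 * r\<^sup>2))"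
  have m\<rho>: "(\<lambda>z. ?\<rho> (snd z)) \<in> borel_measurable joint"
    using measurable_scalar_prod[OF measurable_vec_const[OF e] measurable_joint(2)] by simp
  have m2: "(\<lambda>z. ennreal (?\<rho> (snd z)) * g (fst z + snd z)) \<in> borel_measurable joint"
    using m\<rho> measurable_compose[OF sum_measurable g] by simp
  have "(\<integral>\<^sup>+z. g (fst z + snd z - e) \<partial>joint) = (\<integral>\<^sup>+y. \<integral>\<^sup>+w. g (y + w - e) \<partial>noise \<partial>f)"
    using N.nn_integral_fst[OF m1] by simp
  also have "\<dots> = (\<integral>\<^sup>+y. \<integral>\<^sup>+w. ennreal (?\<rho> w) * g (y + w) \<partial>noise \<partial>f)"
  proof (rule nn_integral_cong)
    fix y assume "y \<in> space f"
    hence y: "y \<in> carrier_vec d" by simp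
    have add: "(\<lambda>w. y + w) \<in> vborel d \<rightarrow>\<^sub>M vborel d"
      by (intro measurable_vec_add measurable_vec_const y) simp
    have "(\<integral>\<^sup>+w. g (y + w - e) \<partial>noise) = (\<integral>\<^sup>+w. g (y + (w + - e)) \<partial>noise)"
    proof (rule nn_integral_cong)
      fix w :: "real vec" assume "w \<in> space noise"
      hence "y + w - e = y + (w + - e)" using y e by (intro eq_vecI) auto
      thus "g (y + w - e) = g (y + (w + - e))" by simp
    qed
    also have "\<dots> = (\<integral>\<^sup>+w. ennreal (exp ((- e) \<bullet> w / r\<^sup>2 - ((- e) \<bullet> (- e)) / (2 * r\<^sup>2))) * g (y + w) \<partial>noise)"
      by (rule gauss_translation[OF r measurable_compose[OF add g] me])
    also have "\<dots> = (\<integral>\<^sup>+w. ennreal (?\<rho> w) * g (y + w) \<partial>noise)"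
      using e by (intro nn_integral_cong) simp
    finally show "(\<integral>\<^sup>+w. g (y + w - e) \<partial>noise) = (\<integral>\<^sup>+w. ennreal (?\<rho> w) * g (y + w) \<partial>noise)" .
  qed
  also have "\<dots> = (\<integral>\<^sup>+z. ennreal (?\<rho> (snd z)) * g (fst z + snd z) \<partial>joint)"
    using N.nn_integral_fst[OF m2] by simp
  finally show ?thesis .
qed

section \<open>Exponential estimates and subgaussian variables\<close>

lemma power_le_fact_exp:
  fixes x :: real
  assumes "0 \<le> x"
  shows "x ^ k \<le> fact k * exp x"
proof -
  have "(\<Sum>n\<in>{k}. inverse (fact n) * x ^ n) \<le> (\<Sum>n. inverse (fact n) * x ^ n)"
    using assms summable_exp[of x] by (intro sum_le_suminf) auto
  also have "\<dots> = exp x" by (simp add: exp_def scaleR_conv_of_real divide_inverse)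
  finally show ?thesis by (simp add: field_simps)
qed

lemma abs_exp_minus_one_le: "\<bar>exp y - 1\<bar> \<le> \<bar>y\<bar> * exp \<bar>y :: real\<bar>"
proof (cases "0 \<le> y")
  case True
  have "exp y - 1 = exp y * (1 - exp (- y))" by (simp add: algebra_simps exp_minus)
  also have "\<dots> \<le> exp y * y" using exp_ge_add_one_self[of "- y"] by (intro mult_left_mono) auto
  finally show ?thesis using True by (simp add: mult.commute)
next
  case False
  have "1 - exp y \<le> - y" using exp_ge_add_one_self[of y] by linarith
  also have "\<dots> \<le> - y * exp (- y)" using False mult_left_mono[of 1 "exp (- y)" "- y"] by simp
  finally show ?thesis using False by simp
qed

lemma abs_exp_taylor1_le: "\<bar>exp y - 1 - y\<bar> \<le> y\<^sup>2 * exp \<bar>y :: real\<bar>"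
proof -
  have nn: "0 \<le> exp y - 1 - y" using exp_ge_add_one_self[of y] by linarith
  have "exp y - 1 - y \<le> y * (exp y - 1)"
  proof -
    have "exp y * (1 - y) \<le> exp y * exp (- y)" using exp_ge_add_one_self[of "- y"] by (intro mult_left_mono) auto
    hence "exp y * (1 - y) \<le> 1" by (simp add: exp_minus)
    thus ?thesis by (simp add: algebra_simps)
  qed
  also have "\<dots> \<le> \<bar>y\<bar> * \<bar>exp y - 1\<bar>" by (metis abs_ge_self abs_mult)
  also have "\<dots> \<le> \<bar>y\<bar> * (\<bar>y\<bar> * exp \<bar>y\<bar>)" by (intro mult_left_mono abs_exp_minus_one_le) auto
  finally show ?thesis using nn by (simp add: power2_eq_square abs_mult_self_eq mult.assoc[symmetric])
qed

text \<open>The coefficient 1/2 must be exact, since it determines the leading constant of the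
  deviation bound; the cubic remainder may be crude.\<close>

lemma exp_taylor2_le: "exp y \<le> 1 + y + y\<^sup>2 / 2 + \<bar>y\<bar> ^ 3 * exp \<bar>y :: real\<bar>"
proof -
  obtain t where t: "\<bar>t\<bar> \<le> \<bar>y\<bar>" "exp y = (\<Sum>m<3. y ^ m / fact m) + exp t / fact 3 * y ^ 3"
    using Maclaurin_exp_le[of y 3] by blast
  have "exp t / fact 3 * y ^ 3 \<le> \<bar>exp t / fact 3 * y ^ 3\<bar>" by (rule abs_ge_self)
  also have "\<dots> = exp t / 6 * \<bar>y\<bar> ^ 3" by (simp add: abs_mult power_abs fact_numeral)
  also have "\<dots> \<le> exp \<bar>y\<bar> * \<bar>y\<bar> ^ 3"
  proof (rule mult_right_mono)
    have "exp t \<le> exp \<bar>y\<bar>" using t(1) by simp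
    thus "exp t / 6 \<le> exp \<bar>y\<bar>" using exp_ge_zero[of t] by linarith
  qed simp
  finally show ?thesis using t(2) by (simp add: numeral_3_eq_3 power2_eq_square mult.commute)
qed

text \<open>A small fraction h of a main quadratic term is spent to raise the order of an error
  term. In the end h is 1/gamma, so the amount spent is a relative error of the size
  allowed.\<close>

lemma Young_le:
  fixes x y h :: real
  assumes h: "h > 0"
  shows "x * y \<le> h * x\<^sup>2 + y\<^sup>2 / (4 * h)"
proof -
  have "0 \<le> (2 * h * x - y)\<^sup>2 / (4 * h)" using h by simp
  also have "(2 * h * x - y)\<^sup>2 / (4 * h) = h * x\<^sup>2 - x * y + y\<^sup>2 / (4 * h)"
    using h by (simp add: power2_eq_square field_simps)
  finally show ?thesis by simp
qed

lemma integral_Cauchy_Schwarz: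
  fixes X Y :: "'a \<Rightarrow> real"
  assumes X: "X \<in> borel_measurable M" "integrable M (\<lambda>x. (X x)\<^sup>2)"
    and Y: "Y \<in> borel_measurable M" "integrable M (\<lambda>x. (Y x)\<^sup>2)"
  shows "integrable M (\<lambda>x. X x * Y x)"
    and "(\<integral>x. X x * Y x \<partial>M)\<^sup>2 \<le> (\<integral>x. (X x)\<^sup>2 \<partial>M) * (\<integral>x. (Y x)\<^sup>2 \<partial>M)"
proof -
  show i: "integrable M (\<lambda>x. X x * Y x)"
  proof (rule Bochner_Integration.integrable_bound)
    show "integrable M (\<lambda>x. (X x)\<^sup>2 + (Y x)\<^sup>2)" using X Y by simp
    show "(\<lambda>x. X x * Y x) \<in> borel_measurable M" using X Y by simp
    have "\<bar>X x * Y x\<bar> \<le> (X x)\<^sup>2 + (Y x)\<^sup>2" for x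
      using Young_le[of 1 "\<bar>X x\<bar>" "\<bar>Y x\<bar>"] zero_le_power2[of "Y x"]
      unfolding power2_abs abs_mult by linarith
    thus "AE x in M. norm (X x * Y x) \<le> norm ((X x)\<^sup>2 + (Y x)\<^sup>2)" by simp
  qed
  show "(\<integral>x. X x * Y x \<partial>M)\<^sup>2 \<le> (\<integral>x. (X x)\<^sup>2 \<partial>M) * (\<integral>x. (Y x)\<^sup>2 \<partial>M)"
  proof (rule discriminant_le)
    fix t :: real
    have "0 \<le> (\<integral>x. (X x + t * Y x)\<^sup>2 \<partial>M)" by simp
    also have "\<dots> = (\<integral>x. (X x)\<^sup>2 + (2 * t * (X x * Y x) + t\<^sup>2 * (Y x)\<^sup>2) \<partial>M)"
      by (intro Bochner_Integration.integral_cong refl) (simp add: power2_eq_square algebra_simps)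
    also have "\<dots> = (\<integral>x. (X x)\<^sup>2 \<partial>M) + (2 * t * (\<integral>x. X x * Y x \<partial>M) + t\<^sup>2 * (\<integral>x. (Y x)\<^sup>2 \<partial>M))"
      using X(2) Y(2) i by (subst Bochner_Integration.integral_add) (auto simp: Bochner_Integration.integral_add)
    finally show "0 \<le> (\<integral>x. (X x)\<^sup>2 \<partial>M) + 2 * t * (\<integral>x. X x * Y x \<partial>M) + t\<^sup>2 * (\<integral>x. (Y x)\<^sup>2 \<partial>M)" by simp
  qed
qed

text \<open>The variance proxy is normalized to 1. Both signs of \<open>c\<close> are included, so
  one bound controls both tails.\<close>

definition subgauss :: "'a measure \<Rightarrow> ('a \<Rightarrow> real) \<Rightarrow> bool" where
  "subgauss M T \<longleftrightarrow> T \<in> borel_measurable M \<and>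
    (\<forall>c. (\<integral>\<^sup>+x. ennreal (exp (c * T x)) \<partial>M) \<le> ennreal (exp (c\<^sup>2 / 2)))"

lemma subgauss_measurable: "subgauss M T \<Longrightarrow> T \<in> borel_measurable M"
  by (simp add: subgauss_def)

lemma subgauss_exp_abs:
  assumes T: "subgauss M T"
  shows "integrable M (\<lambda>x. exp (c * \<bar>T x\<bar>))" and "(\<integral>x. exp (c * \<bar>T x\<bar>) \<partial>M) \<le> 2 * exp (c\<^sup>2 / 2)"
proof -
  have m: "T \<in> borel_measurable M" by (rule subgauss_measurable[OF T])
  have b: "(\<integral>\<^sup>+x. ennreal (exp (k * T x)) \<partial>M) \<le> ennreal (exp (k\<^sup>2 / 2))" for k
    using T by (simp add: subgauss_def)
  have "(\<integral>\<^sup>+x. ennreal (exp (c * \<bar>T x\<bar>)) \<partial>M) \<le> (\<integral>\<^sup>+x. ennreal (exp (c * T x)) + ennreal (exp (- c * T x)) \<partial>M)"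
    by (intro nn_integral_mono) (auto simp: abs_if ennreal_plus[symmetric] simp del: ennreal_plus)
  also have "\<dots> = (\<integral>\<^sup>+x. ennreal (exp (c * T x)) \<partial>M) + (\<integral>\<^sup>+x. ennreal (exp (- c * T x)) \<partial>M)"
    using m by (intro nn_integral_add) auto
  also have "\<dots> \<le> ennreal (exp (c\<^sup>2 / 2)) + ennreal (exp (c\<^sup>2 / 2))"
    using b[of c] b[of "- c"] by (intro add_mono) auto
  also have "\<dots> = ennreal (2 * exp (c\<^sup>2 / 2))" by (simp add: ennreal_plus[symmetric] del: ennreal_plus)
  finally have le: "(\<integral>\<^sup>+x. ennreal (exp (c * \<bar>T x\<bar>)) \<partial>M) \<le> ennreal (2 * exp (c\<^sup>2 / 2))" .
  show i: "integrable M (\<lambda>x. exp (c * \<bar>T x\<bar>))"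
    using m le by (intro integrableI_bounded) (auto intro: le_less_trans)
  have "ennreal (\<integral>x. exp (c * \<bar>T x\<bar>) \<partial>M) = (\<integral>\<^sup>+x. ennreal (exp (c * \<bar>T x\<bar>)) \<partial>M)"
    by (rule nn_integral_eq_integral[OF i, symmetric]) simp
  with le have "ennreal (\<integral>x. exp (c * \<bar>T x\<bar>) \<partial>M) \<le> ennreal (2 * exp (c\<^sup>2 / 2))" by simp
  thus "(\<integral>x. exp (c * \<bar>T x\<bar>) \<partial>M) \<le> 2 * exp (c\<^sup>2 / 2)" by (subst (asm) ennreal_le_iff) auto
qed

text \<open>A power is at most a multiple of the exponential, by one term of its series, and
  subgaussianity controls exponentials of every order.\<close>

lemma subgauss_power_integrable:
  assumes T: "subgauss M T"
  shows "integrable M (\<lambda>x. \<bar>T x\<bar> ^ k)"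
proof (rule Bochner_Integration.integrable_bound)
  show "integrable M (\<lambda>x. fact k * exp (1 * \<bar>T x\<bar>))"
    by (intro integrable_mult_right subgauss_exp_abs(1)[OF T])
  show "(\<lambda>x. \<bar>T x\<bar> ^ k) \<in> borel_measurable M" using subgauss_measurable[OF T] by simp
  show "AE x in M. norm (\<bar>T x\<bar> ^ k) \<le> norm (fact k * exp (1 * \<bar>T x\<bar>))"
    using power_le_fact_exp[OF abs_ge_zero] by simp
qed

lemma subgauss_power_integral_le:
  assumes T: "subgauss M T"
  shows "(\<integral>x. \<bar>T x\<bar> ^ k \<partial>M) \<le> fact k * (2 * exp (1 / 2))"
proof -
  have "(\<integral>x. \<bar>T x\<bar> ^ k \<partial>M) \<le> (\<integral>x. fact k * exp (1 * \<bar>T x\<bar>) \<partial>M)"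
    using power_le_fact_exp[OF abs_ge_zero]
    by (intro integral_mono subgauss_power_integrable[OF T] integrable_mult_right subgauss_exp_abs(1)[OF T]) simp
  also have "\<dots> \<le> fact k * (2 * exp (1 / 2))"
    using subgauss_exp_abs(2)[OF T, of 1] by simp
  finally show ?thesis .
qed

lemma subgauss_square_integrable: "subgauss M T \<Longrightarrow> integrable M (\<lambda>x. (T x)\<^sup>2)"
  using subgauss_power_integrable[of M T 2] by simp

subsection \<open>Exponential tilting of subgaussian variables\<close>

text \<open>In the application \<open>T\<close> is r times the score in a unit direction,
  \<open>N\<close> is the noise over r in the direction of the location error, and \<open>e\<close>
  is the length of that error over r. \<open>norm1\<close> makes the tilt \<open>rho\<close> a
  probability density. \<open>T\<close> and \<open>N\<close> are dependent in an unspecified way, so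
  only their separate exponential moments are used, apart from the mixed moment of T N.\<close>

locale tilted = prob_space M for M :: "'a measure" +
  fixes T N :: "'a \<Rightarrow> real" and e :: real
  assumes T: "subgauss M T" and N: "subgauss M N" and e0: "0 \<le> e" and e1: "e \<le> 1"
    and norm1: "(\<integral>x. exp (- (e * N x) - e\<^sup>2 / 2) \<partial>M) = 1"

abbreviation (in tilted) rho :: "'a \<Rightarrow> real" where
  "rho x \<equiv> exp (- (e * N x) - e\<^sup>2 / 2)"

lemma (in tilted) exponent_le: "\<bar>- (e * N x) - e\<^sup>2 / 2\<bar> \<le> e * (\<bar>N x\<bar> + 1)"
proof -
  have "e\<^sup>2 / 2 \<le> e" using e0 e1 mult_left_mono[of e 1 e] by (simp add: power2_eq_square)
  moreover have "\<bar>e * N x\<bar> = e * \<bar>N x\<bar>" using e0 by (simp add: abs_mult)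
  ultimately show ?thesis unfolding distrib_left using zero_le_power2[of e] by linarith
qed

lemma (in tilted) exponent_le': "\<bar>- (e * N x) - e\<^sup>2 / 2\<bar> \<le> \<bar>N x\<bar> + 1"
  using exponent_le[of x] mult_right_mono[OF e1, of "\<bar>N x\<bar> + 1"] by auto

lemma (in tilted) rho_le: "rho x \<le> exp (\<bar>N x\<bar> + 1)"
  using exponent_le'[of x] by simp

lemma (in tilted) measurable_TN [measurable]: "T \<in> borel_measurable M" "N \<in> borel_measurable M"
  using subgauss_measurable T N by auto

text \<open>The inequality 2 a b <= a^2 + b^2 decouples the dependent variables \<open>N\<close> and
  \<open>T\<close>, at the cost of doubling both exponents.\<close>

lemma (in tilted) rho_exp_le: "rho x * exp (k * \<bar>T x\<bar>) \<le> (exp 2 * exp (2 * \<bar>N x\<bar>) + exp (2 * k * \<bar>T x\<bar>)) / 2"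
proof -
  have "0 \<le> (rho x - exp (k * \<bar>T x\<bar>))\<^sup>2" by simp
  hence "rho x * exp (k * \<bar>T x\<bar>) \<le> ((rho x)\<^sup>2 + (exp (k * \<bar>T x\<bar>))\<^sup>2) / 2"
    by (simp add: power2_diff)
  moreover have "(rho x)\<^sup>2 \<le> (exp (\<bar>N x\<bar> + 1))\<^sup>2" by (intro power_mono rho_le) simp
  moreover have "(exp (\<bar>N x\<bar> + 1))\<^sup>2 = exp 2 * exp (2 * \<bar>N x\<bar>)"
    by (simp add: power2_eq_square exp_add[symmetric])
  moreover have "(exp (k * \<bar>T x\<bar>))\<^sup>2 = exp (2 * k * \<bar>T x\<bar>)"
    by (simp add: power2_eq_square exp_add[symmetric])
  ultimately show ?thesis by auto
qed

lemma (in tilted) tilted_exp_abs: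
  shows "integrable M (\<lambda>x. rho x * exp (k * \<bar>T x\<bar>))"
    and "(\<integral>x. rho x * exp (k * \<bar>T x\<bar>) \<partial>M) \<le> exp 4 + exp (2 * k\<^sup>2)"
proof -
  have iB: "integrable M (\<lambda>x. (exp 2 * exp (2 * \<bar>N x\<bar>) + exp (2 * k * \<bar>T x\<bar>)) / 2)"
    by (intro integrable_divide Bochner_Integration.integrable_add integrable_mult_right subgauss_exp_abs(1)[OF N] subgauss_exp_abs(1)[OF T])
  show i: "integrable M (\<lambda>x. rho x * exp (k * \<bar>T x\<bar>))"
  proof (rule Bochner_Integration.integrable_bound[OF iB])
    show "AE x in M. norm (rho x * exp (k * \<bar>T x\<bar>)) \<le> norm ((exp 2 * exp (2 * \<bar>N x\<bar>) + exp (2 * k * \<bar>T x\<bar>)) / 2)"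
    proof (rule AE_I2)
      fix x
      have "norm (rho x * exp (k * \<bar>T x\<bar>)) = rho x * exp (k * \<bar>T x\<bar>)" by simp
      also note rho_exp_le
      also have "(exp 2 * exp (2 * \<bar>N x\<bar>) + exp (2 * k * \<bar>T x\<bar>)) / 2 \<le> norm ((exp 2 * exp (2 * \<bar>N x\<bar>) + exp (2 * k * \<bar>T x\<bar>)) / 2)"
        by simp
      finally show "norm (rho x * exp (k * \<bar>T x\<bar>)) \<le> norm ((exp 2 * exp (2 * \<bar>N x\<bar>) + exp (2 * k * \<bar>T x\<bar>)) / 2)" .
    qed
  qed measurable
  have "(\<integral>x. rho x * exp (k * \<bar>T x\<bar>) \<partial>M) \<le> (\<integral>x. (exp 2 * exp (2 * \<bar>N x\<bar>) + exp (2 * k * \<bar>T x\<bar>)) / 2 \<partial>M)"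
    by (intro integral_mono i iB rho_exp_le)
  also have "\<dots> = (exp 2 * (\<integral>x. exp (2 * \<bar>N x\<bar>) \<partial>M) + (\<integral>x. exp (2 * k * \<bar>T x\<bar>) \<partial>M)) / 2"
    using subgauss_exp_abs(1)[OF N, of 2] subgauss_exp_abs(1)[OF T, of "2 * k"] by simp
  also have "\<dots> \<le> (exp 2 * (2 * exp (2\<^sup>2 / 2)) + 2 * exp ((2 * k)\<^sup>2 / 2)) / 2"
    using subgauss_exp_abs(2)[OF N, of 2] subgauss_exp_abs(2)[OF T, of "2 * k"]
    by (intro divide_right_mono add_mono mult_left_mono) auto
  also have "\<dots> = exp 4 + exp (2 * k\<^sup>2)" by (simp add: exp_add[symmetric] power2_eq_square)
  finally show "(\<integral>x. rho x * exp (k * \<bar>T x\<bar>) \<partial>M) \<le> exp 4 + exp (2 * k\<^sup>2)" .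
qed

lemma (in tilted) tilted_dominated:
  assumes g: "g \<in> borel_measurable M" and le: "\<And>x. \<bar>g x\<bar> \<le> c * exp (k * \<bar>T x\<bar>)"
  shows "integrable M (\<lambda>x. rho x * g x)"
proof (rule Bochner_Integration.integrable_bound[OF integrable_mult_right[OF tilted_exp_abs(1), of c k]])
  show "(\<lambda>x. rho x * g x) \<in> borel_measurable M" using g by measurable
  show "AE x in M. norm (rho x * g x) \<le> norm (c * (rho x * exp (k * \<bar>T x\<bar>)))"
  proof (rule AE_I2)
    fix x
    have "norm (rho x * g x) = rho x * \<bar>g x\<bar>" by (simp add: abs_mult)
    also have "\<dots> \<le> rho x * (c * exp (k * \<bar>T x\<bar>))" by (intro mult_left_mono le) simp
    also have "\<dots> \<le> norm (c * (rho x * exp (k * \<bar>T x\<bar>)))"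
      using abs_ge_self[of "c * (rho x * exp (k * \<bar>T x\<bar>))"] by (simp add: algebra_simps)
    finally show "norm (rho x * g x) \<le> norm (c * (rho x * exp (k * \<bar>T x\<bar>)))" .
  qed
qed

lemma (in tilted) tilted_power_integrable: "integrable M (\<lambda>x. rho x * T x ^ k)"
  using power_le_fact_exp[OF abs_ge_zero, of "T _" k]
  by (intro tilted_dominated[of _ "fact k" 1]) (auto simp: power_abs)

lemma (in tilted) tilted_integrable: "integrable M (\<lambda>x. rho x * T x)" "integrable M (\<lambda>x. rho x * (T x)\<^sup>2)" "integrable M rho"
  using tilted_power_integrable[of 1] tilted_power_integrable[of 2] tilted_power_integrable[of 0] by simp_all

lemma (in tilted) tilted_exp_integrable: "integrable M (\<lambda>x. rho x * exp (- a * T x))"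
proof (rule tilted_dominated[of _ 1 "\<bar>a\<bar>"])
  fix x
  have "- a * T x \<le> \<bar>a\<bar> * \<bar>T x\<bar>" using abs_ge_self[of "- a * T x"] by (simp add: abs_mult)
  thus "\<bar>exp (- a * T x)\<bar> \<le> 1 * exp (\<bar>a\<bar> * \<bar>T x\<bar>)" by simp
qed measurable

text \<open>The tilt is 1 - e N up to an error of order e^2 in mean square. Cauchy-Schwarz against
  \<open>T\<close> keeps the standard deviation of \<open>T\<close> as a factor; after rescaling
  this is the square root of the Fisher form, so the bias is measured in the right units and not in
  those of the variance proxy.\<close>

lemma (in tilted) tilted_first_moment:
  "\<bar>(\<integral>x. rho x * T x \<partial>M) - (\<integral>x. T x \<partial>M) + e * (\<integral>x. T x * N x \<partial>M)\<bar>
     \<le> 18 * exp 12 * e\<^sup>2 * sqrt (\<integral>x. (T x)\<^sup>2 \<partial>M)"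
proof -
  let ?R = "\<lambda>x. rho x - 1 + e * N x"
  have R: "(?R x)\<^sup>2 \<le> 9 * exp 4 * e ^ 4 * exp (4 * \<bar>N x\<bar>)" for x
  proof -
    let ?y = "- (e * N x) - e\<^sup>2 / 2" and ?n = "\<bar>N x\<bar> + 1"
    have "?R x = (exp ?y - 1 - ?y) + - (e\<^sup>2 / 2)" by simp
    hence "\<bar>?R x\<bar> \<le> \<bar>exp ?y - 1 - ?y\<bar> + \<bar>- (e\<^sup>2 / 2)\<bar>" by (metis abs_triangle_ineq)
    hence "\<bar>?R x\<bar> \<le> \<bar>exp ?y - 1 - ?y\<bar> + e\<^sup>2 / 2" by simp
    also have "\<bar>exp ?y - 1 - ?y\<bar> \<le> \<bar>?y\<bar>\<^sup>2 * exp \<bar>?y\<bar>" using abs_exp_taylor1_le[of ?y] by simp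
    also have "\<dots> \<le> (e * ?n)\<^sup>2 * exp ?n"
      by (intro mult_mono power_mono exponent_le) (use exponent_le'[of x] in auto)
    also have "(e * ?n)\<^sup>2 * exp ?n \<le> e\<^sup>2 * (2 * exp ?n) * exp ?n"
      using power_le_fact_exp[of ?n 2] unfolding power_mult_distrib
      by (intro mult_right_mono mult_left_mono) (auto simp: fact_numeral)
    also have "e\<^sup>2 * (2 * exp ?n) * exp ?n + e\<^sup>2 / 2 \<le> 3 * e\<^sup>2 * exp (2 * ?n)"
    proof -
      have "e\<^sup>2 * 1 \<le> e\<^sup>2 * exp (2 * ?n)" by (intro mult_left_mono) auto
      moreover have "exp ?n * exp ?n = exp (2 * ?n)" by (simp add: exp_add[symmetric])
      hence "e\<^sup>2 * (2 * exp ?n) * exp ?n = 2 * (e\<^sup>2 * exp (2 * ?n))" by (simp only: mult.assoc mult.left_commute)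
      ultimately show ?thesis using zero_le_power2[of e] by linarith
    qed
    finally have "\<bar>?R x\<bar> \<le> 3 * e\<^sup>2 * exp (2 * ?n)" by simp
    hence "\<bar>?R x\<bar>\<^sup>2 \<le> (3 * e\<^sup>2 * exp (2 * ?n))\<^sup>2" by (intro power_mono) auto
    also have "\<dots> = 9 * e ^ 4 * (exp (2 * ?n))\<^sup>2" by (simp add: power_mult_distrib)
    also have "(exp (2 * ?n))\<^sup>2 = exp 4 * exp (4 * \<bar>N x\<bar>)"
      by (simp add: power2_eq_square exp_add[symmetric])
    finally show ?thesis by (simp add: mult_ac)
  qed
  have iB: "integrable M (\<lambda>x. 9 * exp 4 * e ^ 4 * exp (4 * \<bar>N x\<bar>))"
    by (intro integrable_mult_right subgauss_exp_abs(1)[OF N])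
  have iR: "integrable M (\<lambda>x. (?R x)\<^sup>2)"
    using R by (intro Bochner_Integration.integrable_bound[OF iB]) auto
  have iT: "integrable M T" using subgauss_power_integrable[OF T, of 1] by (simp add: integrable_abs_iff)
  have TN: "integrable M (\<lambda>x. T x * N x)"
    by (intro integral_Cauchy_Schwarz(1) subgauss_square_integrable T N) auto
  have "(\<integral>x. (?R x)\<^sup>2 \<partial>M) \<le> (\<integral>x. 9 * exp 4 * e ^ 4 * exp (4 * \<bar>N x\<bar>) \<partial>M)"
    by (intro integral_mono iR iB R)
  also have "\<dots> \<le> 9 * exp 4 * e ^ 4 * (2 * exp (4\<^sup>2 / 2))"
    unfolding integral_mult_right_zero
    using subgauss_exp_abs(2)[OF N, of 4] by (intro mult_left_mono) auto
  \<comment> \<open>The exponent is 12 = 4 + 4^2/2, from the factor exp 4 in the bound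
    \<open>R\<close> and the exponential moment of order 4. Below, a constant above 1 is replaced by
    its square to obtain a perfect square.\<close>
  also have "\<dots> = 18 * exp 12 * e ^ 4" by (simp add: mult_exp_exp mult_ac)
  also have "\<dots> \<le> (18 * exp 12 * e\<^sup>2)\<^sup>2"
  proof -
    have "1 \<le> 18 * exp (12::real)" using one_le_exp_iff[of "12::real"] by linarith
    hence "18 * exp (12::real) \<le> (18 * exp 12)\<^sup>2" 
      using mult_left_mono[of 1 "18 * exp (12::real)" "18 * exp 12"] by (simp add: power2_eq_square)
    hence "18 * exp (12::real) * e ^ 4 \<le> (18 * exp 12)\<^sup>2 * e ^ 4" by (intro mult_right_mono) auto
    thus ?thesis by (simp add: power_mult_distrib)
  qed
  finally have R2: "(\<integral>x. (?R x)\<^sup>2 \<partial>M) \<le> (18 * exp 12 * e\<^sup>2)\<^sup>2" .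
  have cs: "integrable M (\<lambda>x. T x * ?R x)" "(\<integral>x. T x * ?R x \<partial>M)\<^sup>2 \<le> (\<integral>x. (T x)\<^sup>2 \<partial>M) * (\<integral>x. (?R x)\<^sup>2 \<partial>M)"
    by (intro integral_Cauchy_Schwarz subgauss_square_integrable T iR; measurable)+
  have "(\<integral>x. rho x * T x \<partial>M) - (\<integral>x. T x \<partial>M) + e * (\<integral>x. T x * N x \<partial>M) = (\<integral>x. rho x * T x - T x + e * (T x * N x) \<partial>M)"
    using tilted_integrable(1) iT TN by simp
  also have "\<dots> = (\<integral>x. T x * ?R x \<partial>M)"
    by (intro Bochner_Integration.integral_cong refl) (simp add: algebra_simps)
  finally have eq: "(\<integral>x. rho x * T x \<partial>M) - (\<integral>x. T x \<partial>M) + e * (\<integral>x. T x * N x \<partial>M) = (\<integral>x. T x * ?R x \<partial>M)" .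
  have "(\<integral>x. T x * ?R x \<partial>M)\<^sup>2 \<le> (\<integral>x. (T x)\<^sup>2 \<partial>M) * (18 * exp 12 * e\<^sup>2)\<^sup>2"
    by (rule order_trans[OF cs(2)]) (intro mult_left_mono R2, simp)
  also have "\<dots> = (18 * exp 12 * e\<^sup>2 * sqrt (\<integral>x. (T x)\<^sup>2 \<partial>M))\<^sup>2"
    by (simp add: power_mult_distrib)
  finally have "\<bar>\<integral>x. T x * ?R x \<partial>M\<bar>\<^sup>2 \<le> (18 * exp 12 * e\<^sup>2 * sqrt (\<integral>x. (T x)\<^sup>2 \<partial>M))\<^sup>2" by simp
  thus ?thesis unfolding eq by (rule power2_le_imp_le) simp
qed

text \<open>The difference from the untilted square is T times T (rho - 1). Young's inequality
  spends h T^2 on it and leaves an error of order e^2 / h, which a small initial error makes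
  negligible.\<close>

lemma (in tilted) tilted_second_moment:
  assumes h: "h > 0"
  shows "(\<integral>x. rho x * (T x)\<^sup>2 \<partial>M) \<le> (1 + h) * (\<integral>x. (T x)\<^sup>2 \<partial>M) + 100 * exp 40 / h * e\<^sup>2"
proof -
  let ?B = "\<lambda>x. (1 + h) * (T x)\<^sup>2 + e\<^sup>2 / (8 * h) * (24 * exp (1 * \<bar>T x\<bar>) + exp 8 * exp (8 * \<bar>N x\<bar>))"
  have le: "rho x * (T x)\<^sup>2 \<le> ?B x" for x
  proof -
    let ?n = "\<bar>N x\<bar> + 1"
    have "\<bar>rho x - 1\<bar> \<le> \<bar>- (e * N x) - e\<^sup>2 / 2\<bar> * exp \<bar>- (e * N x) - e\<^sup>2 / 2\<bar>" by (rule abs_exp_minus_one_le)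
    also have "\<dots> \<le> e * ?n * exp ?n"
      by (intro mult_mono exponent_le) (use exponent_le'[of x] e0 in auto)
    also have "\<dots> \<le> e * exp ?n * exp ?n"
      using power_le_fact_exp[of ?n 1] e0 by (intro mult_right_mono mult_left_mono) auto
    also have "\<dots> = e * exp (2 * ?n)" by (simp add: mult_exp_exp mult.assoc)
    finally have "\<bar>rho x - 1\<bar>\<^sup>2 \<le> (e * exp (2 * ?n))\<^sup>2" by (intro power_mono) auto
    also have "\<dots> = e\<^sup>2 * exp (4 * ?n)" by (simp add: power_mult_distrib power2_eq_square mult_exp_exp)
    finally have r2: "(rho x - 1)\<^sup>2 \<le> e\<^sup>2 * exp (4 * ?n)" by simp
    have "T x * (T x * (rho x - 1)) \<le> h * (T x)\<^sup>2 + (T x * (rho x - 1))\<^sup>2 / (4 * h)" by (rule Young_le[OF h])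
    also have "(T x * (rho x - 1))\<^sup>2 / (4 * h) \<le> ((T x)\<^sup>2 * (e\<^sup>2 * exp (4 * ?n))) / (4 * h)"
      using r2 h by (intro divide_right_mono) (auto simp: power_mult_distrib intro!: mult_left_mono)
    also have "(T x)\<^sup>2 * (e\<^sup>2 * exp (4 * ?n)) / (4 * h) = e\<^sup>2 / (8 * h) * (2 * ((T x)\<^sup>2 * exp (4 * ?n)))"
      using h by (simp add: field_simps)
    also have "\<dots> \<le> e\<^sup>2 / (8 * h) * (24 * exp (1 * \<bar>T x\<bar>) + exp 8 * exp (8 * \<bar>N x\<bar>))"
    proof (rule mult_left_mono)
      have "0 \<le> ((T x)\<^sup>2 - exp (4 * ?n))\<^sup>2" by simp
      hence "2 * ((T x)\<^sup>2 * exp (4 * ?n)) \<le> ((T x)\<^sup>2)\<^sup>2 + (exp (4 * ?n))\<^sup>2"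
        by (simp add: power2_diff)
      moreover have "((T x)\<^sup>2)\<^sup>2 \<le> 24 * exp (1 * \<bar>T x\<bar>)"
        using power_le_fact_exp[OF abs_ge_zero, of "T x" 4] by (simp add: fact_numeral)
      moreover have "(exp (4 * ?n))\<^sup>2 = exp 8 * exp (8 * \<bar>N x\<bar>)"
        by (simp add: power2_eq_square exp_add[symmetric])
      ultimately show "2 * ((T x)\<^sup>2 * exp (4 * ?n)) \<le> 24 * exp (1 * \<bar>T x\<bar>) + exp 8 * exp (8 * \<bar>N x\<bar>)" by linarith
    qed (use h in simp)
    finally have "T x * (T x * (rho x - 1)) \<le> h * (T x)\<^sup>2 + e\<^sup>2 / (8 * h) * (24 * exp (1 * \<bar>T x\<bar>) + exp 8 * exp (8 * \<bar>N x\<bar>))" by simp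
    moreover have "rho x * (T x)\<^sup>2 = (T x)\<^sup>2 + T x * (T x * (rho x - 1))" by (simp add: power2_eq_square algebra_simps)
    ultimately show ?thesis by (simp add: algebra_simps)
  qed
  have iE: "integrable M (\<lambda>x. 24 * exp (1 * \<bar>T x\<bar>) + exp 8 * exp (8 * \<bar>N x\<bar>))"
    by (intro Bochner_Integration.integrable_add integrable_mult_right subgauss_exp_abs(1)[OF N] subgauss_exp_abs(1)[OF T])
  have iT: "integrable M (\<lambda>x. (T x)\<^sup>2)" by (rule subgauss_square_integrable[OF T])
  have iB: "integrable M ?B" by (intro Bochner_Integration.integrable_add integrable_mult_right iE iT)
  have E: "(\<integral>x. 24 * exp (1 * \<bar>T x\<bar>) + exp 8 * exp (8 * \<bar>N x\<bar>) \<partial>M) \<le> 800 * exp 40"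
  proof -
    have "(\<integral>x. 24 * exp (1 * \<bar>T x\<bar>) + exp 8 * exp (8 * \<bar>N x\<bar>) \<partial>M)
        = 24 * (\<integral>x. exp (1 * \<bar>T x\<bar>) \<partial>M) + exp 8 * (\<integral>x. exp (8 * \<bar>N x\<bar>) \<partial>M)"
      using subgauss_exp_abs(1)[OF N, of 8] subgauss_exp_abs(1)[OF T, of 1] by simp
    also have "\<dots> \<le> 24 * (2 * exp (1\<^sup>2 / 2)) + exp 8 * (2 * exp (8\<^sup>2 / 2))"
      using subgauss_exp_abs(2)[OF N, of 8] subgauss_exp_abs(2)[OF T, of 1]
      by (intro add_mono mult_left_mono) auto
    \<comment> \<open>The origin of exp 40: the exponent is 8 + 8^2/2.\<close>
    also have "exp 8 * (2 * exp (8\<^sup>2 / 2)) = 2 * exp (40::real)" by (simp add: mult_exp_exp)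
    also have "24 * (2 * exp (1\<^sup>2 / 2)) \<le> 48 * exp (40::real)" by simp
    finally show ?thesis using exp_ge_zero[of "40::real"] by linarith
  qed
  have "(\<integral>x. rho x * (T x)\<^sup>2 \<partial>M) \<le> (\<integral>x. ?B x \<partial>M)"
    by (intro integral_mono tilted_integrable iB le)
  also have "\<dots> = (1 + h) * (\<integral>x. (T x)\<^sup>2 \<partial>M) + e\<^sup>2 / (8 * h) * (\<integral>x. 24 * exp (1 * \<bar>T x\<bar>) + exp 8 * exp (8 * \<bar>N x\<bar>) \<partial>M)"
    by (subst Bochner_Integration.integral_add[OF integrable_mult_right[OF iT] integrable_mult_right[OF iE]])
       (simp only: integral_mult_right_zero)
  also have "\<dots> \<le> (1 + h) * (\<integral>x. (T x)\<^sup>2 \<partial>M) + e\<^sup>2 / (8 * h) * (800 * exp 40)"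
    using h by (intro add_left_mono mult_left_mono E) simp
  also have "e\<^sup>2 / (8 * h) * (800 * exp 40) = 100 * exp 40 / h * e\<^sup>2" by simp
  finally show ?thesis .
qed

text \<open>All a >= 0 have to be covered because the directions in the later mixture are unbounded.
  For a <= 1 the cubic Taylor term is split by Young's inequality into h / 2 times the quadratic
  term, whence (1 + h) / 2, and a quartic term over h. For larger a the crude bound exp (5 a^2) is
  already below what the quartic term contributes.\<close>

lemma (in tilted) tilted_mgf:
  assumes h: "0 < h" "h \<le> 1" and a: "0 \<le> a"
  shows "(\<integral>x. rho x * exp (- a * T x) \<partial>M) \<le>
    exp (- a * (\<integral>x. rho x * T x \<partial>M) + (1 + h) / 2 * a\<^sup>2 * (\<integral>x. rho x * (T x)\<^sup>2 \<partial>M) + 20 * exp 18 / h * a ^ 4)"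
proof (cases "a \<le> 1")
  case True
  let ?B = "\<lambda>x. rho x - a * (rho x * T x) + (1 + h) / 2 * a\<^sup>2 * (rho x * (T x)\<^sup>2) + 12 / h * a ^ 4 * (rho x * exp (3 * \<bar>T x\<bar>))"
  have le: "rho x * exp (- a * T x) \<le> ?B x" for x
  proof -
    let ?u = "a * \<bar>T x\<bar>"
    have u: "\<bar>- a * T x\<bar> = ?u" using a by (simp add: abs_mult)
    have "exp (- a * T x) \<le> 1 + (- a * T x) + (- a * T x)\<^sup>2 / 2 + \<bar>- a * T x\<bar> ^ 3 * exp \<bar>- a * T x\<bar>" by (rule exp_taylor2_le)
    also have "\<bar>- a * T x\<bar> ^ 3 * exp \<bar>- a * T x\<bar> = ?u * (?u\<^sup>2 * exp ?u)"
      unfolding u by (simp add: power2_eq_square power3_eq_cube)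
    also have "\<dots> \<le> h / 2 * ?u\<^sup>2 + (?u\<^sup>2 * exp ?u)\<^sup>2 / (4 * (h / 2))" by (rule Young_le) (use h in simp)
    also have "(?u\<^sup>2 * exp ?u)\<^sup>2 = a ^ 4 * (\<bar>T x\<bar> ^ 4 * exp (2 * ?u))"
      by (simp add: power_mult_distrib power2_eq_square mult_exp_exp power4_eq_xxxx mult_ac)
    also have "a ^ 4 * (\<bar>T x\<bar> ^ 4 * exp (2 * ?u)) / (4 * (h / 2)) \<le> a ^ 4 * (24 * exp \<bar>T x\<bar> * exp (2 * \<bar>T x\<bar>)) / (4 * (h / 2))"
    proof -
      have "?u \<le> \<bar>T x\<bar>" using True a mult_right_mono[of a 1 "\<bar>T x\<bar>"] by simp
      thus ?thesis using power_le_fact_exp[OF abs_ge_zero, of "T x" 4] h a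
        by (intro divide_right_mono mult_left_mono mult_mono) (auto simp: fact_numeral)
    qed
    also have "a ^ 4 * (24 * exp \<bar>T x\<bar> * exp (2 * \<bar>T x\<bar>)) / (4 * (h / 2)) = 12 / h * a ^ 4 * exp (3 * \<bar>T x\<bar>)"
      using h by (simp add: mult_exp_exp mult.assoc field_simps)
    also have "?u\<^sup>2 = a\<^sup>2 * (T x)\<^sup>2" by (simp add: power_mult_distrib)
    finally have "exp (- a * T x) \<le> 1 - a * T x + (1 + h) / 2 * a\<^sup>2 * (T x)\<^sup>2 + 12 / h * a ^ 4 * exp (3 * \<bar>T x\<bar>)"
      by (simp add: power_mult_distrib algebra_simps add_divide_distrib)
    hence "rho x * exp (- a * T x) \<le> rho x * (1 - a * T x + (1 + h) / 2 * a\<^sup>2 * (T x)\<^sup>2 + 12 / h * a ^ 4 * exp (3 * \<bar>T x\<bar>))"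
      by (intro mult_left_mono) auto
    thus ?thesis by (simp only: distrib_left right_diff_distrib mult_1_right mult.left_commute)
  qed
  have i1: "integrable M (\<lambda>x. rho x - a * (rho x * T x))"
    by (intro Bochner_Integration.integrable_diff integrable_mult_right tilted_integrable)
  have i2: "integrable M (\<lambda>x. (1 + h) / 2 * a\<^sup>2 * (rho x * (T x)\<^sup>2))"
    by (intro integrable_mult_right tilted_integrable)
  have i3: "integrable M (\<lambda>x. 12 / h * a ^ 4 * (rho x * exp (3 * \<bar>T x\<bar>)))"
    by (intro integrable_mult_right tilted_exp_abs(1))
  have iB: "integrable M ?B" by (intro Bochner_Integration.integrable_add i1 i2 i3)
  have "(\<integral>x. rho x * exp (- a * T x) \<partial>M) \<le> (\<integral>x. ?B x \<partial>M)"
    by (intro integral_mono tilted_exp_integrable iB le)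
  also have "\<dots> = (1 - a * (\<integral>x. rho x * T x \<partial>M)) + (1 + h) / 2 * a\<^sup>2 * (\<integral>x. rho x * (T x)\<^sup>2 \<partial>M)
      + 12 / h * a ^ 4 * (\<integral>x. rho x * exp (3 * \<bar>T x\<bar>) \<partial>M)"
    unfolding Bochner_Integration.integral_add[OF Bochner_Integration.integrable_add[OF i1 i2] i3]
      Bochner_Integration.integral_add[OF i1 i2]
      Bochner_Integration.integral_diff[OF tilted_integrable(3) integrable_mult_right[OF tilted_integrable(1)]]
      integral_mult_right_zero norm1 ..
  \<comment> \<open>Here exp 18 arises: the moment has order 3, one unit from dominating the fourth
    power of \<open>T\<close> and two from the squared Taylor remainder.\<close>
  also have "12 / h * a ^ 4 * (\<integral>x. rho x * exp (3 * \<bar>T x\<bar>) \<partial>M) \<le> 12 / h * a ^ 4 * (exp 4 + exp (2 * 3\<^sup>2))"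
    using h a by (intro mult_left_mono tilted_exp_abs) auto
  also have "12 / h * a ^ 4 * (exp 4 + exp (2 * 3\<^sup>2)) \<le> 20 * exp 18 / h * a ^ 4"
  proof -
    have "exp (4::real) * 4 \<le> exp 4 * exp 14" using exp_ge_add_one_self[of "14::real"] by simp
    hence e: "exp 4 * 4 \<le> exp (18::real)" by (simp add: mult_exp_exp)
    have "12 * (x + y) \<le> 20 * y" if "x * 4 \<le> y" "0 \<le> y" for x y :: real
      using that by (simp add: algebra_simps)
    from this[OF e exp_ge_zero] have "12 * (exp 4 + exp 18) \<le> 20 * exp (18::real)" .
    hence "12 * (exp 4 + exp 18) * (a ^ 4 / h) \<le> 20 * exp 18 * (a ^ 4 / h)"
      using h a by (intro mult_right_mono) auto
    thus ?thesis by (simp add: algebra_simps add_divide_distrib)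
  qed
  finally have "(\<integral>x. rho x * exp (- a * T x) \<partial>M) \<le> 1 + (- a * (\<integral>x. rho x * T x \<partial>M) + (1 + h) / 2 * a\<^sup>2 * (\<integral>x. rho x * (T x)\<^sup>2 \<partial>M) + 20 * exp 18 / h * a ^ 4)"
    by simp
  thus ?thesis using exp_ge_add_one_self order_trans by blast
next
  case False
  hence a1: "1 \<le> a" by simp
  have pw: "1 \<le> a\<^sup>2" "a\<^sup>2 \<le> a ^ 4" "a \<le> a ^ 4" using a1 power_increasing[of 2 4 a] power_increasing[of 1 4 a] by auto
  have "(\<integral>x. rho x * exp (- a * T x) \<partial>M) \<le> (\<integral>x. rho x * exp (a * \<bar>T x\<bar>) \<partial>M)"
  proof (intro integral_mono tilted_exp_integrable tilted_exp_abs)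
    fix x
    have "- a * T x \<le> a * \<bar>T x\<bar>" using abs_ge_self[of "- a * T x"] a by (simp add: abs_mult)
    thus "rho x * exp (- a * T x) \<le> rho x * exp (a * \<bar>T x\<bar>)" by simp
  qed
  also have "\<dots> \<le> exp 4 + exp (2 * a\<^sup>2)" by (rule tilted_exp_abs(2))
  also have "\<dots> \<le> exp (5 * a\<^sup>2)"
  proof -
    have "exp 4 \<le> exp (4 * a\<^sup>2)" "exp (2 * a\<^sup>2) \<le> exp (4 * a\<^sup>2)" using pw by auto
    moreover have "2 \<le> exp (a\<^sup>2)" using exp_ge_add_one_self[of "a\<^sup>2"] pw by linarith
    hence "exp (4 * a\<^sup>2) * 2 \<le> exp (4 * a\<^sup>2) * exp (a\<^sup>2)" by (intro mult_left_mono) auto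
    moreover have "exp (4 * a\<^sup>2) * exp (a\<^sup>2) = exp (5 * a\<^sup>2)" by (simp add: mult_exp_exp)
    ultimately show ?thesis by linarith
  qed
  also have "\<dots> \<le> exp (- a * (\<integral>x. rho x * T x \<partial>M) + (1 + h) / 2 * a\<^sup>2 * (\<integral>x. rho x * (T x)\<^sup>2 \<partial>M) + 20 * exp 18 / h * a ^ 4)"
  proof -
    have "(\<integral>x. rho x * T x \<partial>M) \<le> (\<integral>x. rho x * exp (1 * \<bar>T x\<bar>) \<partial>M)"
    proof (intro integral_mono tilted_integrable tilted_exp_abs mult_left_mono)
      fix x show "T x \<le> exp (1 * \<bar>T x\<bar>)"
        using power_le_fact_exp[OF abs_ge_zero, of "T x" 1] abs_ge_self[of "T x"] by simp
    qed simp
    also have "\<dots> \<le> exp 4 + exp (2 * 1\<^sup>2)" by (rule tilted_exp_abs(2))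
    finally have "a * (\<integral>x. rho x * T x \<partial>M) \<le> a * (exp 4 + exp 2)" using a by (intro mult_left_mono) auto
    also have "\<dots> \<le> a ^ 4 * (exp 4 + exp 2)" using pw by (intro mult_right_mono) auto
    finally have t1: "a * (\<integral>x. rho x * T x \<partial>M) \<le> a ^ 4 * (exp 4 + exp 2)" .
    have t2: "0 \<le> (1 + h) / 2 * a\<^sup>2 * (\<integral>x. rho x * (T x)\<^sup>2 \<partial>M)"
      using h by (intro mult_nonneg_nonneg integral_nonneg) auto
    have t3: "5 * a\<^sup>2 \<le> 5 * a ^ 4" using pw by simp
    have "5 + exp 4 + exp 2 \<le> 20 * exp (18::real)"
    proof -
      have "exp 4 \<le> exp (18::real)" "exp 2 \<le> exp (18::real)" "1 \<le> exp (18::real)" by auto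
      thus ?thesis by linarith
    qed
    also have "\<dots> \<le> 20 * exp 18 / h" using h by (simp add: le_divide_eq)
    finally have "a ^ 4 * (5 + exp 4 + exp 2) \<le> a ^ 4 * (20 * exp 18 / h)" by (intro mult_left_mono) auto
    hence "5 * a ^ 4 + a ^ 4 * (exp 4 + exp 2) \<le> 20 * exp 18 / h * a ^ 4" by (simp add: algebra_simps)
    with t1 t2 t3 show ?thesis by simp
  qed
  finally show ?thesis .
qed

section \<open>Moments of the score and the Fisher information\<close>

lemma (in smoothing) scalar_score_measurable:
  assumes u: "u \<in> carrier_vec d"
  shows "(\<lambda>x. u \<bullet> sc x) \<in> borel_measurable (vborel d)"
    and "(\<lambda>z. u \<bullet> sc (fst z + snd z)) \<in> borel_measurable joint"
proof -
  show m: "(\<lambda>x. u \<bullet> sc x) \<in> borel_measurable (vborel d)"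
    by (rule measurable_scalar_prod[OF measurable_vec_const[OF u] score_measurable])
  show "(\<lambda>z. u \<bullet> sc (fst z + snd z)) \<in> borel_measurable joint"
    by (rule measurable_compose[OF sum_measurable m])
qed

lemma (in smoothing) scalar_noise_measurable:
  "u \<in> carrier_vec d \<Longrightarrow> (\<lambda>z. u \<bullet> snd z) \<in> borel_measurable joint"
  by (rule measurable_scalar_prod[OF measurable_vec_const measurable_joint(2)])

lemma (in smoothing) score_subgauss:
  assumes u: "u \<in> carrier_vec d" and le: "u \<bullet> u \<le> 1"
  shows "subgauss joint (\<lambda>z. r * (u \<bullet> sc (fst z + snd z)))"
  unfolding subgauss_def
proof (intro conjI allI)
  show "(\<lambda>z. r * (u \<bullet> sc (fst z + snd z))) \<in> borel_measurable joint"
    using scalar_score_measurable[OF u] by simp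
  fix c
  have cu: "(c * r) \<cdot>\<^sub>v u \<in> carrier_vec d" using u by simp
  have "(\<integral>\<^sup>+z. ennreal (exp (c * (r * (u \<bullet> sc (fst z + snd z))))) \<partial>joint)
      = (\<integral>\<^sup>+z. ennreal (exp (((c * r) \<cdot>\<^sub>v u) \<bullet> sc (fst z + snd z))) \<partial>joint)"
    using u score_carrier by (intro nn_integral_cong) (simp add: smult_scalar_prod_distrib[OF u score_carrier] mult.assoc)
  also have "\<dots> \<le> ennreal (exp (((c * r) \<cdot>\<^sub>v u) \<bullet> ((c * r) \<cdot>\<^sub>v u) / (2 * r\<^sup>2)))" by (rule score_mgf[OF cu])
  also have "\<dots> \<le> ennreal (exp (c\<^sup>2 / 2))"
  proof -
    have "((c * r) \<cdot>\<^sub>v u) \<bullet> ((c * r) \<cdot>\<^sub>v u) / (2 * r\<^sup>2) = c\<^sup>2 / 2 * (u \<bullet> u)"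
      using r u by (simp add: power2_eq_square)
    also have "\<dots> \<le> c\<^sup>2 / 2 * 1" by (intro mult_left_mono le) simp
    finally show ?thesis by (intro ennreal_leI) simp
  qed
  finally show "(\<integral>\<^sup>+z. ennreal (exp (c * (r * (u \<bullet> sc (fst z + snd z))))) \<partial>joint) \<le> ennreal (exp (c\<^sup>2 / 2))" .
qed

lemma (in smoothing) noise_subgauss:
  assumes u: "u \<in> carrier_vec d" and le: "u \<bullet> u \<le> 1"
  shows "subgauss joint (\<lambda>z. (u \<bullet> snd z) / r)"
  unfolding subgauss_def
proof (intro conjI allI)
  show "(\<lambda>z. (u \<bullet> snd z) / r) \<in> borel_measurable joint"
    using scalar_noise_measurable[OF u] by simp
  fix c
  have cu: "(c / r) \<cdot>\<^sub>v u \<in> carrier_vec d" using u by simp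
  have "(\<integral>\<^sup>+z. ennreal (exp (c * ((u \<bullet> snd z) / r))) \<partial>joint)
      = (\<integral>\<^sup>+z. ennreal (exp (((c / r) \<cdot>\<^sub>v u) \<bullet> snd z)) \<partial>joint)"
    using u by (intro nn_integral_cong) (auto simp: space_joint)
  also have "\<dots> = ennreal (exp (r\<^sup>2 * (((c / r) \<cdot>\<^sub>v u) \<bullet> ((c / r) \<cdot>\<^sub>v u)) / 2))" by (rule noise_mgf[OF cu])
  also have "\<dots> \<le> ennreal (exp (c\<^sup>2 / 2))"
  proof -
    have "r\<^sup>2 * (((c / r) \<cdot>\<^sub>v u) \<bullet> ((c / r) \<cdot>\<^sub>v u)) / 2 = c\<^sup>2 / 2 * (u \<bullet> u)"
      using r u by (simp add: power2_eq_square)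
    also have "\<dots> \<le> c\<^sup>2 / 2 * 1" by (intro mult_left_mono le) simp
    finally show ?thesis by (intro ennreal_leI) simp
  qed
  finally show "(\<integral>\<^sup>+z. ennreal (exp (c * ((u \<bullet> snd z) / r))) \<partial>joint) \<le> ennreal (exp (c\<^sup>2 / 2))" .
qed

text \<open>The vector 0 is sent to 0, by \<open>1 / 0 = 0\<close>.\<close>

definition normalize_vec :: "real vec \<Rightarrow> real vec" where
  "normalize_vec v = (1 / vnorm v) \<cdot>\<^sub>v v"

lemma normalize_vec:
  assumes v: "v \<in> carrier_vec d"
  shows "normalize_vec v \<in> carrier_vec d" "normalize_vec v \<bullet> normalize_vec v \<le> 1"
    "x \<in> carrier_vec d \<Longrightarrow> vnorm v * (normalize_vec v \<bullet> x) = v \<bullet> x"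
proof -
  show c: "normalize_vec v \<in> carrier_vec d" using v by (simp add: normalize_vec_def)
  have "normalize_vec v \<bullet> normalize_vec v = (1 / vnorm v)\<^sup>2 * (vnorm v)\<^sup>2"
    using v vnorm_square[of v, symmetric] by (simp only: normalize_vec_def power2_eq_square) simp
  also have "\<dots> \<le> 1" by (cases "vnorm v = 0") (auto simp: power_divide)
  finally show "normalize_vec v \<bullet> normalize_vec v \<le> 1" .
  assume x: "x \<in> carrier_vec d"
  show "vnorm v * (normalize_vec v \<bullet> x) = v \<bullet> x"
  proof (cases "vnorm v = 0")
    case True
    thus ?thesis using vnorm_eq_0[OF v True] x by simp
  next
    case False
    thus ?thesis using v x by (simp add: normalize_vec_def)
  qed
qed

lemma (in smoothing) scalar_score_square_integrable:
  assumes v: "v \<in> carrier_vec d"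
  shows "integrable joint (\<lambda>z. (v \<bullet> sc (fst z + snd z))\<^sup>2)"
proof -
  have "integrable joint (\<lambda>z. (vnorm v / r)\<^sup>2 * (r * (normalize_vec v \<bullet> sc (fst z + snd z)))\<^sup>2)"
    by (intro integrable_mult_right subgauss_square_integrable score_subgauss normalize_vec[OF v])
  moreover have "(vnorm v / r)\<^sup>2 * (r * (normalize_vec v \<bullet> sc x))\<^sup>2 = (v \<bullet> sc x)\<^sup>2" for x
    using normalize_vec(3)[OF v score_carrier, of x] r
    by (simp add: power_mult_distrib[symmetric] mult.assoc)
  ultimately show ?thesis by simp
qed

lemma (in smoothing) scalar_noise_square_integrable:
  assumes v: "v \<in> carrier_vec d"
  shows "integrable joint (\<lambda>z. (v \<bullet> snd z)\<^sup>2)"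
proof -
  have "integrable joint (\<lambda>z. (vnorm v * r)\<^sup>2 * ((normalize_vec v \<bullet> snd z) / r)\<^sup>2)"
    by (intro integrable_mult_right subgauss_square_integrable noise_subgauss normalize_vec[OF v])
  moreover have "(vnorm v * r)\<^sup>2 * ((normalize_vec v \<bullet> snd z) / r)\<^sup>2 = (v \<bullet> snd z)\<^sup>2" if "z \<in> space joint" for z
  proof -
    have "snd z \<in> carrier_vec d" using that by (auto simp: space_joint)
    thus ?thesis using normalize_vec(3)[OF v, of "snd z"] r by (simp add: power_mult_distrib[symmetric])
  qed
  ultimately show ?thesis by (simp cong: Bochner_Integration.integrable_cong)
qed

lemma (in smoothing) scalar_score_prod_integrable:
  assumes "u \<in> carrier_vec d" "v \<in> carrier_vec d"
  shows "integrable joint (\<lambda>z. (u \<bullet> sc (fst z + snd z)) * (v \<bullet> sc (fst z + snd z)))"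
  by (intro integral_Cauchy_Schwarz(1) scalar_score_measurable scalar_score_square_integrable assms)

lemma (in smoothing) fisher_carrier [simp]: "fi \<in> carrier_mat d d"
  by (simp add: fisher_def)

lemma unit_vec_scalar: "i < d \<Longrightarrow> v \<in> carrier_vec d \<Longrightarrow> unit_vec d i \<bullet> v = (v $ i :: real)"
  by simp

lemma (in smoothing) fisher_nth:
  assumes i: "i < d" and j: "j < d"
  shows "fi $$ (i, j) = (\<integral>z. sc (fst z + snd z) $ i * sc (fst z + snd z) $ j \<partial>joint)"
    and "integrable joint (\<lambda>z. sc (fst z + snd z) $ i * sc (fst z + snd z) $ j)"
proof -
  have m: "(\<lambda>x. sc x $ i * sc x $ j) \<in> borel_measurable (vborel d)"
    by (intro borel_measurable_times measurable_vborel_nth[OF score_measurable] i j)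
  show "fi $$ (i, j) = (\<integral>z. sc (fst z + snd z) $ i * sc (fst z + snd z) $ j \<partial>joint)"
    using i j unfolding fisher_def smoothed_eq_distr by (simp add: integral_distr[OF sum_measurable m])
  show "integrable joint (\<lambda>z. sc (fst z + snd z) $ i * sc (fst z + snd z) $ j)"
    using scalar_score_prod_integrable[of "unit_vec d i" "unit_vec d j"]
    by (simp add: unit_vec_scalar[OF i score_carrier] unit_vec_scalar[OF j score_carrier])
qed

lemma (in smoothing) fisher_form:
  assumes u: "u \<in> carrier_vec d" and v: "v \<in> carrier_vec d"
  shows "u \<bullet> (fi *\<^sub>v v) = (\<integral>z. (u \<bullet> sc (fst z + snd z)) * (v \<bullet> sc (fst z + snd z)) \<partial>joint)"
proof -
  have "(\<integral>z. (u \<bullet> sc (fst z + snd z)) * (v \<bullet> sc (fst z + snd z)) \<partial>joint)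
      = (\<integral>z. (\<Sum>i<d. \<Sum>j<d. u $ i * v $ j * (sc (fst z + snd z) $ i * sc (fst z + snd z) $ j)) \<partial>joint)"
    unfolding scalar_prod_lt[OF score_carrier] sum_product
    by (intro Bochner_Integration.integral_cong refl sum.cong) simp
  also have "\<dots> = (\<Sum>i<d. \<integral>z. (\<Sum>j<d. u $ i * v $ j * (sc (fst z + snd z) $ i * sc (fst z + snd z) $ j)) \<partial>joint)"
    by (intro Bochner_Integration.integral_sum Bochner_Integration.integrable_sum integrable_mult_right fisher_nth(2)) auto
  also have "\<dots> = (\<Sum>i<d. \<Sum>j<d. \<integral>z. u $ i * v $ j * (sc (fst z + snd z) $ i * sc (fst z + snd z) $ j) \<partial>joint)"
    by (intro sum.cong refl Bochner_Integration.integral_sum integrable_mult_right fisher_nth(2)) auto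
  also have "\<dots> = (\<Sum>i<d. \<Sum>j<d. u $ i * fi $$ (i, j) * v $ j)"
    by (intro sum.cong refl) (simp add: fisher_nth(1))
  also have "\<dots> = u \<bullet> (fi *\<^sub>v v)" by (rule quadratic_form_sum[OF fisher_carrier v u, symmetric])
  finally show ?thesis by simp
qed

lemma (in smoothing) fisher_form_square:
  assumes v: "v \<in> carrier_vec d"
  shows "v \<bullet> (fi *\<^sub>v v) = (\<integral>z. (v \<bullet> sc (fst z + snd z))\<^sup>2 \<partial>joint)"
  using fisher_form[OF v v] by (simp add: power2_eq_square)

lemma (in smoothing) fisher_symmetric: "transpose_mat fi = fi"
  by (rule eq_matI) (auto simp: fisher_def mult.commute)

lemma gauss_scalar_moments:
  assumes s: "s > 0" and v: "v \<in> carrier_vec d"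
  shows "integrable (gauss d (iso_cov d s)) (\<lambda>w. v \<bullet> w)" "(\<integral>w. v \<bullet> w \<partial>gauss d (iso_cov d s)) = 0"
    "integrable (gauss d (iso_cov d s)) (\<lambda>w. (v \<bullet> w)\<^sup>2)" "(\<integral>w. (v \<bullet> w)\<^sup>2 \<partial>gauss d (iso_cov d s)) = s\<^sup>2 * (v \<bullet> v)"
proof -
  let ?G = "gauss d (iso_cov d s)"
  have e1: "v \<bullet> w = (\<Sum>i<d. v $ i * w $ i)" if "w \<in> space ?G" for w
    using that by (simp add: scalar_prod_lt)
  have e2: "(v \<bullet> w)\<^sup>2 = (\<Sum>i<d. \<Sum>j<d. v $ i * v $ j * (w $ i * w $ j))" if "w \<in> space ?G" for w
    unfolding e1[OF that] power2_eq_square sum_product by (intro sum.cong refl) simp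
  have i1: "integrable ?G (\<lambda>w. \<Sum>i<d. v $ i * w $ i)"
    by (intro Bochner_Integration.integrable_sum integrable_mult_right gauss_moments(1)[OF s]) auto
  have i2: "integrable ?G (\<lambda>w. \<Sum>i<d. \<Sum>j<d. v $ i * v $ j * (w $ i * w $ j))"
    by (intro Bochner_Integration.integrable_sum integrable_mult_right gauss_moments(3)[OF s]) auto
  show "integrable ?G (\<lambda>w. v \<bullet> w)" using i1 by (subst Bochner_Integration.integrable_cong[OF refl e1])
  show "integrable ?G (\<lambda>w. (v \<bullet> w)\<^sup>2)" using i2 by (subst Bochner_Integration.integrable_cong[OF refl e2])
  have "(\<integral>w. v \<bullet> w \<partial>?G) = (\<integral>w. (\<Sum>i<d. v $ i * w $ i) \<partial>?G)"
    by (rule Bochner_Integration.integral_cong[OF refl e1])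
  also have "\<dots> = (\<Sum>i<d. \<integral>w. v $ i * w $ i \<partial>?G)"
    by (intro Bochner_Integration.integral_sum integrable_mult_right gauss_moments(1)[OF s]) auto
  also have "\<dots> = 0" by (intro sum.neutral) (simp add: gauss_moments(2)[OF s])
  finally show "(\<integral>w. v \<bullet> w \<partial>?G) = 0" .
  have "(\<integral>w. (v \<bullet> w)\<^sup>2 \<partial>?G) = (\<integral>w. (\<Sum>i<d. \<Sum>j<d. v $ i * v $ j * (w $ i * w $ j)) \<partial>?G)"
    by (rule Bochner_Integration.integral_cong[OF refl e2])
  also have "\<dots> = (\<Sum>i<d. \<integral>w. (\<Sum>j<d. v $ i * v $ j * (w $ i * w $ j)) \<partial>?G)"
    by (intro Bochner_Integration.integral_sum Bochner_Integration.integrable_sum integrable_mult_right gauss_moments(3)[OF s]) auto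
  also have "\<dots> = (\<Sum>i<d. \<Sum>j<d. \<integral>w. v $ i * v $ j * (w $ i * w $ j) \<partial>?G)"
    by (intro sum.cong refl Bochner_Integration.integral_sum integrable_mult_right gauss_moments(3)[OF s]) auto
  also have "\<dots> = (\<Sum>i<d. \<Sum>j<d. if i = j then v $ i * v $ i * s\<^sup>2 else 0)"
    by (intro sum.cong refl) (simp add: gauss_moments(4)[OF s])
  also have "\<dots> = s\<^sup>2 * (v \<bullet> v)"
    using v by (simp add: scalar_prod_lt sum_distrib_left mult.commute)
  finally show "(\<integral>w. (v \<bullet> w)\<^sup>2 \<partial>?G) = s\<^sup>2 * (v \<bullet> v)" .
qed

lemma (in smoothing) joint_integral_prod:
  fixes g k :: "real vec \<Rightarrow> real"
  assumes g: "integrable f g" and k: "integrable noise k"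
  shows "integrable joint (\<lambda>z. g (fst z) * k (snd z))"
    and "(\<integral>z. g (fst z) * k (snd z) \<partial>joint) = (\<integral>y. g y \<partial>f) * (\<integral>w. k w \<partial>noise)"
proof -
  interpret P: pair_sigma_finite f noise by (rule pair_sf_joint)
  interpret N: sigma_finite_measure noise by (rule prob_space_imp_sigma_finite[OF prob_noise])
  have m: "(\<lambda>z. g (fst z) * k (snd z)) \<in> borel_measurable joint"
    using g k by (intro borel_measurable_times measurable_compose[OF measurable_fst] measurable_compose[OF measurable_snd]) auto
  show i: "integrable joint (\<lambda>z. g (fst z) * k (snd z))"
  proof (rule P.Fubini_integrable[OF m])
    have "integrable f (\<lambda>y. \<bar>g y\<bar> * (\<integral>w. \<bar>k w\<bar> \<partial>noise))" using g by simp
    thus "integrable f (\<lambda>x. \<integral>y. norm (g (fst (x, y)) * k (snd (x, y))) \<partial>noise)"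
      by (simp add: abs_mult)
    show "AE x in f. integrable noise (\<lambda>y. g (fst (x, y)) * k (snd (x, y)))" using k by simp
  qed
  have "(\<integral>z. g (fst z) * k (snd z) \<partial>joint) = (\<integral>y. \<integral>w. g y * k w \<partial>noise \<partial>f)"
    using P.integral_fst'[OF i] by simp
  also have "\<dots> = (\<integral>y. g y \<partial>f) * (\<integral>w. k w \<partial>noise)" by simp
  finally show "(\<integral>z. g (fst z) * k (snd z) \<partial>joint) = (\<integral>y. g y \<partial>f) * (\<integral>w. k w \<partial>noise)" .
qed

text \<open>Square integrability of \<open>h\<close> supplies the integrability required by
  \<open>score_conditional_expectation\<close>. The identity is used with \<open>h\<close> constant
  (the score has mean zero), with \<open>h\<close> the score itself (its covariance with the noise),
  and with \<open>h\<close> an affine functional (Cramer-Rao).\<close>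

lemma (in smoothing) score_scalar_expectation:
  assumes h: "h \<in> borel_measurable (vborel d)" "integrable joint (\<lambda>z. (h (fst z + snd z))\<^sup>2)"
    and v: "v \<in> carrier_vec d"
  shows "integrable joint (\<lambda>z. h (fst z + snd z) * (v \<bullet> sc (fst z + snd z)))"
    and "integrable joint (\<lambda>z. h (fst z + snd z) * (v \<bullet> snd z))"
    and "(\<integral>z. h (fst z + snd z) * (v \<bullet> sc (fst z + snd z)) \<partial>joint)
      = - (\<integral>z. h (fst z + snd z) * (v \<bullet> snd z) \<partial>joint) / r\<^sup>2"
proof -
  have mh: "(\<lambda>z. h (fst z + snd z)) \<in> borel_measurable joint"
    by (rule measurable_compose[OF sum_measurable h(1)])
  have iW: "integrable joint (\<lambda>z. h (fst z + snd z) * snd z $ i)" if i: "i < d" for i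
  proof -
    have "integrable joint (\<lambda>z. h (fst z + snd z) * (unit_vec d i \<bullet> snd z))"
      by (intro integral_Cauchy_Schwarz(1) mh h scalar_noise_measurable scalar_noise_square_integrable) auto
    moreover have "h (fst z + snd z) * (unit_vec d i \<bullet> snd z) = h (fst z + snd z) * snd z $ i" if "z \<in> space joint" for z
      using that i by (auto simp: space_joint)
    ultimately show ?thesis by (simp cong: Bochner_Integration.integrable_cong)
  qed
  note K = score_conditional_expectation[OF h(1) _ iW]
  have e1: "h (fst z + snd z) * (v \<bullet> sc (fst z + snd z)) = (\<Sum>i<d. v $ i * (h (fst z + snd z) * sc (fst z + snd z) $ i))" for z
    by (simp add: scalar_prod_lt[OF score_carrier] sum_distrib_left mult_ac)
  have e2: "h (fst z + snd z) * (v \<bullet> snd z) = (\<Sum>i<d. v $ i * (h (fst z + snd z) * snd z $ i))" if "z \<in> space joint" for z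
  proof -
    have "snd z \<in> carrier_vec d" using that by (auto simp: space_joint)
    thus ?thesis by (simp add: scalar_prod_lt sum_distrib_left mult_ac)
  qed
  show "integrable joint (\<lambda>z. h (fst z + snd z) * (v \<bullet> sc (fst z + snd z)))"
    unfolding e1 by (intro Bochner_Integration.integrable_sum integrable_mult_right K(1)) auto
  have "integrable joint (\<lambda>z. \<Sum>i<d. v $ i * (h (fst z + snd z) * snd z $ i))"
    by (intro Bochner_Integration.integrable_sum integrable_mult_right iW) auto
  thus "integrable joint (\<lambda>z. h (fst z + snd z) * (v \<bullet> snd z))"
    by (subst Bochner_Integration.integrable_cong[OF refl e2])
  have "(\<integral>z. h (fst z + snd z) * (v \<bullet> sc (fst z + snd z)) \<partial>joint)
      = (\<Sum>i<d. v $ i * (\<integral>z. h (fst z + snd z) * sc (fst z + snd z) $ i \<partial>joint))"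
    unfolding e1 by (subst Bochner_Integration.integral_sum) (auto intro!: integrable_mult_right K(1))
  also have "\<dots> = (\<Sum>i<d. v $ i * (- (\<integral>z. h (fst z + snd z) * snd z $ i \<partial>joint) / r\<^sup>2))"
    by (intro sum.cong refl arg_cong2[where f = "(*)"] K(2)) auto
  also have "\<dots> = - (\<Sum>i<d. v $ i * (\<integral>z. h (fst z + snd z) * snd z $ i \<partial>joint)) / r\<^sup>2"
    by (simp add: sum_negf sum_divide_distrib)
  also have "(\<Sum>i<d. v $ i * (\<integral>z. h (fst z + snd z) * snd z $ i \<partial>joint))
      = (\<integral>z. (\<Sum>i<d. v $ i * (h (fst z + snd z) * snd z $ i)) \<partial>joint)"
    by (subst Bochner_Integration.integral_sum) (auto intro!: integrable_mult_right iW)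
  also have "\<dots> = (\<integral>z. h (fst z + snd z) * (v \<bullet> snd z) \<partial>joint)"
    by (rule Bochner_Integration.integral_cong[OF refl e2[symmetric]])
  finally show "(\<integral>z. h (fst z + snd z) * (v \<bullet> sc (fst z + snd z)) \<partial>joint)
      = - (\<integral>z. h (fst z + snd z) * (v \<bullet> snd z) \<partial>joint) / r\<^sup>2" .
qed

lemma (in smoothing) score_mean_zero:
  assumes v: "v \<in> carrier_vec d"
  shows "(\<integral>z. v \<bullet> sc (fst z + snd z) \<partial>joint) = 0"
proof -
  interpret F: prob_space f by (rule prob_f)
  interpret J: prob_space joint by (rule prob_joint)
  have "(\<integral>z. v \<bullet> sc (fst z + snd z) \<partial>joint) = - (\<integral>z. v \<bullet> snd z \<partial>joint) / r\<^sup>2"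
    using score_scalar_expectation(3)[of "\<lambda>_. 1", OF _ _ v] by simp
  also have "(\<integral>z. v \<bullet> snd z \<partial>joint) = 0"
    using joint_integral_prod(2)[of "\<lambda>_. 1" "\<lambda>w. v \<bullet> w"] gauss_scalar_moments(1,2)[OF r v] by simp
  finally show ?thesis by simp
qed

text \<open>This covariance is the first-order effect of the tilt on the mean of the score; it is
  how the Fisher matrix enters the expansion at a wrong location.\<close>

lemma (in smoothing) score_noise_covariance:
  assumes v: "v \<in> carrier_vec d" and e: "e \<in> carrier_vec d"
  shows "(\<integral>z. (v \<bullet> sc (fst z + snd z)) * (e \<bullet> snd z) \<partial>joint) = - (r\<^sup>2 * (v \<bullet> (fi *\<^sub>v e)))"
  using score_scalar_expectation(3)[OF scalar_score_measurable(1)[OF v] scalar_score_square_integrable[OF v] e] r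
  by (simp add: fisher_form[OF v e] field_simps)

subsection \<open>The Cramer-Rao bound\<close>

lemma square_integrable_scalar_prod:
  assumes P: "vec_distribution d P" and fs: "finite_second_moments d P"
  shows "i < d \<Longrightarrow> integrable P (\<lambda>x. x $ i)" "i < d \<Longrightarrow> j < d \<Longrightarrow> integrable P (\<lambda>x. x $ i * x $ j)"
    and "i < d \<Longrightarrow> j < d \<Longrightarrow> integrable P (\<lambda>x. (x $ i - c) * (x $ j - c'))"
proof -
  interpret prob_space P using P by (simp add: vec_distribution_def)
  have sP: "sets P = sets (vborel d)" using P by (simp add: vec_distribution_def)
  have m: "(\<lambda>x. x $ i) \<in> borel_measurable P" if "i < d" for i
    using measurable_vec_nth[OF that] by (simp add: measurable_cong_sets[OF sP refl])
  have sq: "integrable P (\<lambda>x. (x $ i)\<^sup>2)" if "i < d" for i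
    using fs that by (simp add: finite_second_moments_def)
  have i1: "integrable P (\<lambda>x. x $ i)" if "i < d" for i
    using integral_Cauchy_Schwarz(1)[OF m[OF that] sq[OF that], of "\<lambda>_. 1"] by simp
  have i2: "integrable P (\<lambda>x. x $ i * x $ j)" if "i < d" "j < d" for i j
    using integral_Cauchy_Schwarz(1)[OF m[OF that(1)] sq[OF that(1)] m[OF that(2)] sq[OF that(2)]] .
  show "i < d \<Longrightarrow> integrable P (\<lambda>x. x $ i)" "i < d \<Longrightarrow> j < d \<Longrightarrow> integrable P (\<lambda>x. x $ i * x $ j)"
    by (rule i1 i2; assumption)+
  assume ij: "i < d" "j < d"
  have "integrable P (\<lambda>x. x $ i * x $ j - c' * x $ i - c * x $ j + c * c')"
    using i1[OF ij(1)] i1[OF ij(2)] i2[OF ij] by simp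
  thus "integrable P (\<lambda>x. (x $ i - c) * (x $ j - c'))" by (simp add: algebra_simps)
qed

lemma cov_mat_form:
  assumes P: "vec_distribution d P" and fs: "finite_second_moments d P" and v: "v \<in> carrier_vec d"
  shows "integrable P (\<lambda>y. (v \<bullet> (y - mean_vec d P))\<^sup>2)"
    and "v \<bullet> (cov_mat d P *\<^sub>v v) = (\<integral>y. (v \<bullet> (y - mean_vec d P))\<^sup>2 \<partial>P)"
    and "integrable P (\<lambda>y. v \<bullet> (y - mean_vec d P))"
proof -
  interpret prob_space P using P by (simp add: vec_distribution_def)
  have sP: "sets P = sets (vborel d)" using P by (simp add: vec_distribution_def)
  have spP: "space P = carrier_vec d" using sets_eq_imp_space_eq[OF sP] by simp
  let ?m = "mean_vec d P"
  have mc: "?m \<in> carrier_vec d" by (simp add: mean_vec_def)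
  have e1: "v \<bullet> (y - ?m) = (\<Sum>i<d. v $ i * (y $ i - ?m $ i))" if "y \<in> space P" for y
  proof -
    have y: "y - ?m \<in> carrier_vec d" using that spP mc by simp
    show ?thesis unfolding scalar_prod_lt[OF y] using that spP mc by (intro sum.cong) auto
  qed
  have e2: "(v \<bullet> (y - ?m))\<^sup>2 = (\<Sum>i<d. \<Sum>j<d. v $ i * v $ j * ((y $ i - ?m $ i) * (y $ j - ?m $ j)))" if "y \<in> space P" for y
    unfolding e1[OF that] power2_eq_square sum_product by (intro sum.cong refl) simp
  note ii = square_integrable_scalar_prod[OF P fs]
  have i2: "integrable P (\<lambda>y. \<Sum>i<d. \<Sum>j<d. v $ i * v $ j * ((y $ i - ?m $ i) * (y $ j - ?m $ j)))"
    by (intro Bochner_Integration.integrable_sum integrable_mult_right ii(3)) auto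
  show "integrable P (\<lambda>y. (v \<bullet> (y - ?m))\<^sup>2)" using i2 by (subst Bochner_Integration.integrable_cong[OF refl e2])
  have i1: "integrable P (\<lambda>y. \<Sum>i<d. v $ i * (y $ i - ?m $ i))"
    by (intro Bochner_Integration.integrable_sum integrable_mult_right Bochner_Integration.integrable_diff ii(1)) auto
  show "integrable P (\<lambda>y. v \<bullet> (y - ?m))" using i1 by (subst Bochner_Integration.integrable_cong[OF refl e1])
  have cc: "cov_mat d P \<in> carrier_mat d d" by (simp add: cov_mat_def)
  have "(\<integral>y. (v \<bullet> (y - ?m))\<^sup>2 \<partial>P) = (\<integral>y. (\<Sum>i<d. \<Sum>j<d. v $ i * v $ j * ((y $ i - ?m $ i) * (y $ j - ?m $ j))) \<partial>P)"
    by (rule Bochner_Integration.integral_cong[OF refl e2])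
  also have "\<dots> = (\<Sum>i<d. \<integral>y. (\<Sum>j<d. v $ i * v $ j * ((y $ i - ?m $ i) * (y $ j - ?m $ j))) \<partial>P)"
    by (intro Bochner_Integration.integral_sum Bochner_Integration.integrable_sum integrable_mult_right ii(3)) auto
  also have "\<dots> = (\<Sum>i<d. \<Sum>j<d. \<integral>y. v $ i * v $ j * ((y $ i - ?m $ i) * (y $ j - ?m $ j)) \<partial>P)"
    by (intro sum.cong refl Bochner_Integration.integral_sum integrable_mult_right ii(3)) auto
  also have "\<dots> = (\<Sum>i<d. \<Sum>j<d. v $ i * cov_mat d P $$ (i, j) * v $ j)"
    by (intro sum.cong refl) (simp add: cov_mat_def)
  also have "\<dots> = v \<bullet> (cov_mat d P *\<^sub>v v)" by (rule quadratic_form_sum[OF cc v v, symmetric])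
  finally show "v \<bullet> (cov_mat d P *\<^sub>v v) = (\<integral>y. (v \<bullet> (y - ?m))\<^sup>2 \<partial>P)" by simp
qed

text \<open>Cauchy-Schwarz between the score in direction v and the centred functional <v, x - mean>
  of the smoothed point. Their product has mean - |v|^2, and the functional has variance v' Sigma v
  + r^2 |v|^2 because sample and noise are independent.\<close>

lemma (in smoothing) Cramer_Rao:
  assumes fs: "finite_second_moments d f" and v: "v \<in> carrier_vec d"
  shows "(v \<bullet> v)\<^sup>2 \<le> (v \<bullet> (fi *\<^sub>v v)) * (v \<bullet> (cov_mat d f *\<^sub>v v) + r\<^sup>2 * (v \<bullet> v))"
proof -
  interpret F: prob_space f by (rule prob_f)
  interpret N: prob_space noise by (rule prob_noise)
  let ?m = "mean_vec d f"
  have mc: "?m \<in> carrier_vec d" by (simp add: mean_vec_def)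
  let ?h = "\<lambda>x. v \<bullet> (x - ?m)"
  let ?g = "\<lambda>y. v \<bullet> (y - ?m)"
  note G = gauss_scalar_moments[OF r v] and C = cov_mat_form[OF f fs v]
  have mh: "?h \<in> borel_measurable (vborel d)"
    by (rule measurable_scalar_prod[OF measurable_vec_const[OF v]
        measurable_vec_diff[OF measurable_ident_sets[OF refl] measurable_vec_const[OF mc]]])
  have hz: "?h (fst z + snd z) = ?g (fst z) + v \<bullet> snd z" if "z \<in> space joint" for z
  proof -
    have z: "fst z \<in> carrier_vec d" "snd z \<in> carrier_vec d" using that by (auto simp: space_joint)
    have "fst z + snd z - ?m = (fst z - ?m) + snd z" using z mc by (intro eq_vecI) auto
    thus ?thesis using scalar_prod_add_distrib[OF v, of "fst z - ?m" "snd z"] z mc by simp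
  qed
  have J1: "integrable joint (\<lambda>z. (?g (fst z))\<^sup>2)" "(\<integral>z. (?g (fst z))\<^sup>2 \<partial>joint) = v \<bullet> (cov_mat d f *\<^sub>v v)"
    using joint_integral_prod[OF C(1), of "\<lambda>_. 1"] C(2) N.prob_space by auto
  have J2: "integrable joint (\<lambda>z. ?g (fst z) * (v \<bullet> snd z))" "(\<integral>z. ?g (fst z) * (v \<bullet> snd z) \<partial>joint) = 0"
    using joint_integral_prod[OF C(3) G(1)] G(2) by auto
  have J3: "integrable joint (\<lambda>z. (v \<bullet> snd z)\<^sup>2)" "(\<integral>z. (v \<bullet> snd z)\<^sup>2 \<partial>joint) = r\<^sup>2 * (v \<bullet> v)"
    using joint_integral_prod[of "\<lambda>_. 1", OF _ G(3)] G(4) F.prob_space by auto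
  have sq: "(?h (fst z + snd z))\<^sup>2 = (?g (fst z))\<^sup>2 + 2 * (?g (fst z) * (v \<bullet> snd z)) + (v \<bullet> snd z)\<^sup>2" if "z \<in> space joint" for z
    unfolding hz[OF that] power2_sum by simp
  have isq: "integrable joint (\<lambda>z. (?g (fst z))\<^sup>2 + 2 * (?g (fst z) * (v \<bullet> snd z)) + (v \<bullet> snd z)\<^sup>2)"
    using J1(1) J2(1) J3(1) by simp
  have ih: "integrable joint (\<lambda>z. (?h (fst z + snd z))\<^sup>2)"
    using isq by (subst Bochner_Integration.integrable_cong[OF refl sq])
  have "(\<integral>z. (?h (fst z + snd z))\<^sup>2 \<partial>joint) = (\<integral>z. (?g (fst z))\<^sup>2 + 2 * (?g (fst z) * (v \<bullet> snd z)) + (v \<bullet> snd z)\<^sup>2 \<partial>joint)"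
    by (rule Bochner_Integration.integral_cong[OF refl sq])
  also have "\<dots> = v \<bullet> (cov_mat d f *\<^sub>v v) + r\<^sup>2 * (v \<bullet> v)"
    using J1 J2 J3 by simp
  finally have h2: "(\<integral>z. (?h (fst z + snd z))\<^sup>2 \<partial>joint) = v \<bullet> (cov_mat d f *\<^sub>v v) + r\<^sup>2 * (v \<bullet> v)" .
  have "(\<integral>z. ?h (fst z + snd z) * (v \<bullet> sc (fst z + snd z)) \<partial>joint) = - (\<integral>z. ?h (fst z + snd z) * (v \<bullet> snd z) \<partial>joint) / r\<^sup>2"
    by (rule score_scalar_expectation(3)[OF mh ih v])
  also have "(\<integral>z. ?h (fst z + snd z) * (v \<bullet> snd z) \<partial>joint) = (\<integral>z. ?g (fst z) * (v \<bullet> snd z) + (v \<bullet> snd z)\<^sup>2 \<partial>joint)"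
    by (rule Bochner_Integration.integral_cong[OF refl]) (simp add: hz distrib_right power2_eq_square)
  also have "\<dots> = r\<^sup>2 * (v \<bullet> v)" using J2 J3 by simp
  finally have "(\<integral>z. ?h (fst z + snd z) * (v \<bullet> sc (fst z + snd z)) \<partial>joint) = - (v \<bullet> v)" using r by simp
  hence "(v \<bullet> v)\<^sup>2 = (\<integral>z. ?h (fst z + snd z) * (v \<bullet> sc (fst z + snd z)) \<partial>joint)\<^sup>2" by simp
  also have "\<dots> \<le> (\<integral>z. (?h (fst z + snd z))\<^sup>2 \<partial>joint) * (\<integral>z. (v \<bullet> sc (fst z + snd z))\<^sup>2 \<partial>joint)"
    by (intro integral_Cauchy_Schwarz(2) ih scalar_score_measurable scalar_score_square_integrable v
        measurable_compose[OF sum_measurable mh])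
  finally show ?thesis unfolding h2 fisher_form_square[OF v, symmetric] by (simp add: mult.commute)
qed

text \<open>As r^2 is at most ||Sigma||, the variance in \<open>Cramer_Rao\<close> is at most 2
  ||Sigma|| |v|^2, and one factor |v|^2 cancels. The bound compares the variance proxy with the
  Fisher form and makes the Fisher matrix invertible.\<close>

lemma (in smoothing) fisher_lower_bound:
  assumes fs: "finite_second_moments d f" and le: "r\<^sup>2 \<le> opnorm (cov_mat d f)" and v: "v \<in> carrier_vec d"
  shows "v \<bullet> v \<le> 2 * opnorm (cov_mat d f) * (v \<bullet> (fi *\<^sub>v v))"
proof -
  let ?S = "opnorm (cov_mat d f)"
  have J: "0 \<le> v \<bullet> (fi *\<^sub>v v)" unfolding fisher_form_square[OF v] by simp
  have cc: "cov_mat d f \<in> carrier_mat d d" by (simp add: cov_mat_def)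
  have "v \<bullet> (cov_mat d f *\<^sub>v v) + r\<^sup>2 * (v \<bullet> v) \<le> ?S * (v \<bullet> v) + ?S * (v \<bullet> v)"
    using quadratic_form_le_opnorm[OF cc v] le scalar_prod_self_nonneg[of v]
    by (intro add_mono mult_right_mono) (auto simp: vnorm_square)
  also have "\<dots> = 2 * ?S * (v \<bullet> v)" by simp
  finally have "(v \<bullet> v)\<^sup>2 \<le> (v \<bullet> (fi *\<^sub>v v)) * (2 * ?S * (v \<bullet> v))"
    using order_trans[OF Cramer_Rao[OF fs v] mult_left_mono[OF _ J]] by blast
  hence *: "(v \<bullet> v) * (v \<bullet> v) \<le> (v \<bullet> v) * (2 * ?S * (v \<bullet> (fi *\<^sub>v v)))"
    by (simp add: power2_eq_square mult_ac)
  show ?thesis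
  proof (cases "v \<bullet> v = 0")
    case True
    thus ?thesis using J opnorm_nonneg[OF cc] by simp
  next
    case False
    with scalar_prod_self_nonneg[of v] have "0 < v \<bullet> v" by simp
    with * show ?thesis by (simp only: mult_le_cancel_left_pos)
  qed
qed

subsection \<open>The score at a misspecified location\<close>

abbreviation (in smoothing) ratio :: "real vec \<Rightarrow> real vec \<Rightarrow> real" where
  "ratio e w \<equiv> exp (- (e \<bullet> w) / r\<^sup>2 - (e \<bullet> e) / (2 * r\<^sup>2))"

text \<open>By the translation formula this is the mean of the score at y + w - e, that is, of the
  score evaluated with location error e.\<close>

definition (in smoothing) shifted_mean :: "real vec \<Rightarrow> real vec" where
  "shifted_mean e = vec d (\<lambda>i. \<integral>z. ratio e (snd z) * sc (fst z + snd z) $ i \<partial>joint)"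

text \<open>For the unit vector u along e, (|e|/r) (<u, w>/r) = <e, w>/r^2, so the tilt of the
  locale is the likelihood ratio. The identity is restricted to the space of \<open>joint\<close>,
  where w has the right length.\<close>

lemma (in smoothing) tilted_score:
  assumes v: "v \<in> carrier_vec d" and e: "e \<in> carrier_vec d" and er: "vnorm e \<le> r"
  shows "tilted joint (\<lambda>z. r * (normalize_vec v \<bullet> sc (fst z + snd z))) (\<lambda>z. normalize_vec e \<bullet> snd z / r) (vnorm e / r)"
    and "z \<in> space joint \<Longrightarrow> exp (- (vnorm e / r * (normalize_vec e \<bullet> snd z / r)) - (vnorm e / r)\<^sup>2 / 2) = ratio e (snd z)"
proof -
  interpret J: prob_space joint by (rule prob_joint)
  have eq: "exp (- (vnorm e / r * (normalize_vec e \<bullet> snd z / r)) - (vnorm e / r)\<^sup>2 / 2) = ratio e (snd z)"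
    if "z \<in> space joint" for z
  proof -
    have "snd z \<in> carrier_vec d" using that by (auto simp: space_joint)
    from normalize_vec(3)[OF e this] have "vnorm e / r * (normalize_vec e \<bullet> snd z / r) = e \<bullet> snd z / r\<^sup>2"
      by (simp add: power2_eq_square)
    moreover have "(vnorm e / r)\<^sup>2 / 2 = (e \<bullet> e) / (2 * r\<^sup>2)" by (simp add: power_divide vnorm_square)
    ultimately show ?thesis by simp
  qed
  thus "z \<in> space joint \<Longrightarrow> exp (- (vnorm e / r * (normalize_vec e \<bullet> snd z / r)) - (vnorm e / r)\<^sup>2 / 2) = ratio e (snd z)" .
  have m: "(\<lambda>z. ratio e (snd z)) \<in> borel_measurable joint"
    using scalar_noise_measurable[OF e] by simp
  \<comment> \<open>Translating the constant function 1 shows that the likelihood ratio has mean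
    1.\<close>
  have "(\<integral>\<^sup>+z. ennreal (ratio e (snd z)) \<partial>joint) = 1"
    using joint_translation[of "\<lambda>_. 1", OF _ e] J.emeasure_space_1 by simp
  hence "(\<integral>z. ratio e (snd z) \<partial>joint) = 1"
    using m by (subst integral_eq_nn_integral) auto
  hence "(\<integral>z. exp (- (vnorm e / r * (normalize_vec e \<bullet> snd z / r)) - (vnorm e / r)\<^sup>2 / 2) \<partial>joint) = 1"
    by (subst Bochner_Integration.integral_cong[OF refl eq])
  thus "tilted joint (\<lambda>z. r * (normalize_vec v \<bullet> sc (fst z + snd z))) (\<lambda>z. normalize_vec e \<bullet> snd z / r) (vnorm e / r)"
    using r er by unfold_locales (auto intro!: score_subgauss noise_subgauss normalize_vec v e)
qed

lemma (in smoothing) scale_score: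
  assumes v: "v \<in> carrier_vec d"
  shows "vnorm v / r * (r * (normalize_vec v \<bullet> sc x)) = v \<bullet> sc x"
  using normalize_vec(3)[OF v score_carrier] r by simp

lemma (in smoothing) shifted_mean_scalar:
  assumes v: "v \<in> carrier_vec d" and e: "e \<in> carrier_vec d" and er: "vnorm e \<le> r"
  shows "v \<bullet> shifted_mean e = (\<integral>z. ratio e (snd z) * (v \<bullet> sc (fst z + snd z)) \<partial>joint)"
    and "integrable joint (\<lambda>z. ratio e (snd z) * (v \<bullet> sc (fst z + snd z)))"
proof -
  have i: "integrable joint (\<lambda>z. ratio e (snd z) * (v \<bullet> sc (fst z + snd z)))" if v: "v \<in> carrier_vec d" for v
  proof -
    note t = tilted_score[OF v e er]
    interpret t: tilted joint "\<lambda>z. r * (normalize_vec v \<bullet> sc (fst z + snd z))" "\<lambda>z. normalize_vec e \<bullet> snd z / r" "vnorm e / r"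
      by (rule t(1))
    have "integrable joint (\<lambda>z. vnorm v / r * (t.rho z * (r * (normalize_vec v \<bullet> sc (fst z + snd z)))))"
      by (intro integrable_mult_right t.tilted_integrable)
    moreover have "vnorm v / r * (t.rho z * (r * (normalize_vec v \<bullet> sc (fst z + snd z)))) = ratio e (snd z) * (v \<bullet> sc (fst z + snd z))"
      if "z \<in> space joint" for z
      unfolding t(2)[OF that] mult.left_commute[of "vnorm v / r" "ratio e (snd z)"] scale_score[OF v] ..
    ultimately show ?thesis by (simp only: cong: Bochner_Integration.integrable_cong)
  qed
  show "integrable joint (\<lambda>z. ratio e (snd z) * (v \<bullet> sc (fst z + snd z)))" by (rule i[OF v])
  have ii: "integrable joint (\<lambda>z. ratio e (snd z) * sc (fst z + snd z) $ k)" if "k < d" for k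
    using i[of "unit_vec d k"] by (simp add: unit_vec_scalar[OF that score_carrier])
  have sm: "shifted_mean e \<in> carrier_vec d" by (simp add: shifted_mean_def)
  have "(\<integral>z. ratio e (snd z) * (v \<bullet> sc (fst z + snd z)) \<partial>joint)
      = (\<integral>z. (\<Sum>k<d. v $ k * (ratio e (snd z) * sc (fst z + snd z) $ k)) \<partial>joint)"
    unfolding scalar_prod_lt[OF score_carrier]
    by (intro Bochner_Integration.integral_cong refl) (simp only: sum_distrib_left mult.left_commute)
  also have "\<dots> = (\<Sum>k<d. \<integral>z. v $ k * (ratio e (snd z) * sc (fst z + snd z) $ k) \<partial>joint)"
    by (intro Bochner_Integration.integral_sum integrable_mult_right ii) simp
  also have "\<dots> = v \<bullet> shifted_mean e"
    unfolding scalar_prod_lt[OF sm] by (intro sum.cong refl) (simp add: shifted_mean_def)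
  finally show "v \<bullet> shifted_mean e = (\<integral>z. ratio e (snd z) * (v \<bullet> sc (fst z + snd z)) \<partial>joint)" by simp
qed

text \<open>This is \<open>tilted_first_moment\<close> times |v| / r: the untilted mean is 0, the
  mixed moment contributes minus the Fisher form of v and e, and the standard deviation becomes the
  square root of the Fisher form at v.\<close>

lemma (in smoothing) shifted_bias:
  assumes v: "v \<in> carrier_vec d" and e: "e \<in> carrier_vec d" and er: "vnorm e \<le> r"
  shows "\<bar>v \<bullet> shifted_mean e - v \<bullet> (fi *\<^sub>v e)\<bar> \<le> 18 * exp 12 * (vnorm e / r)\<^sup>2 * sqrt (v \<bullet> (fi *\<^sub>v v))"
proof -
  let ?T = "\<lambda>z. r * (normalize_vec v \<bullet> sc (fst z + snd z))" and ?N = "\<lambda>z. normalize_vec e \<bullet> snd z / r"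
  let ?a = "vnorm v / r" and ?e = "vnorm e / r"
  note t = tilted_score[OF v e er]
  interpret t: tilted joint ?T ?N ?e by (rule t(1))
  have a0: "0 \<le> ?a" using r by simp
  have 1: "?a * (\<integral>z. t.rho z * ?T z \<partial>joint) = v \<bullet> shifted_mean e"
    unfolding shifted_mean_scalar(1)[OF v e er] integral_mult_right_zero[symmetric]
    unfolding mult.left_commute[of ?a "t.rho _"] scale_score[OF v]
    by (rule Bochner_Integration.integral_cong[OF refl]) (simp only: t(2))
  have 2: "?a * (\<integral>z. ?T z \<partial>joint) = 0"
    unfolding integral_mult_right_zero[symmetric] scale_score[OF v] by (rule score_mean_zero[OF v])
  have 3: "?a * (?e * (\<integral>z. ?T z * ?N z \<partial>joint)) = - (v \<bullet> (fi *\<^sub>v e))"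
  proof -
    have "?a * (?e * (\<integral>z. ?T z * ?N z \<partial>joint)) = (\<integral>z. ?a * (?e * (?T z * ?N z)) \<partial>joint)" by simp
    also have "\<dots> = (\<integral>z. (v \<bullet> sc (fst z + snd z)) * (e \<bullet> snd z) / r\<^sup>2 \<partial>joint)"
    proof (rule Bochner_Integration.integral_cong[OF refl])
      fix z assume "z \<in> space joint"
      hence "snd z \<in> carrier_vec d" by (auto simp: space_joint)
      from normalize_vec(3)[OF e this] have "?e * ?N z = e \<bullet> snd z / r\<^sup>2" by (simp add: power2_eq_square)
      moreover have "?a * (?e * (?T z * ?N z)) = (?a * ?T z) * (?e * ?N z)" by (simp only: mult_ac)
      ultimately show "?a * (?e * (?T z * ?N z)) = (v \<bullet> sc (fst z + snd z)) * (e \<bullet> snd z) / r\<^sup>2"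
        unfolding scale_score[OF v] by simp
    qed
    also have "\<dots> = (\<integral>z. (v \<bullet> sc (fst z + snd z)) * (e \<bullet> snd z) \<partial>joint) / r\<^sup>2" by simp
    also have "\<dots> = - (v \<bullet> (fi *\<^sub>v e))" unfolding score_noise_covariance[OF v e] using r by simp
    finally show ?thesis .
  qed
  have 4: "?a * sqrt (\<integral>z. (?T z)\<^sup>2 \<partial>joint) = sqrt (v \<bullet> (fi *\<^sub>v v))"
  proof -
    have "?a * sqrt (\<integral>z. (?T z)\<^sup>2 \<partial>joint) = sqrt (?a\<^sup>2 * (\<integral>z. (?T z)\<^sup>2 \<partial>joint))"
      using a0 by (simp only: real_sqrt_mult real_sqrt_abs abs_of_nonneg)
    also have "?a\<^sup>2 * (\<integral>z. (?T z)\<^sup>2 \<partial>joint) = v \<bullet> (fi *\<^sub>v v)"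
      unfolding fisher_form_square[OF v] integral_mult_right_zero[symmetric] power_mult_distrib[symmetric] scale_score[OF v] ..
    finally show ?thesis .
  qed
  have "\<bar>v \<bullet> shifted_mean e - v \<bullet> (fi *\<^sub>v e)\<bar>
      = \<bar>?a * ((\<integral>z. t.rho z * ?T z \<partial>joint) - (\<integral>z. ?T z \<partial>joint) + ?e * (\<integral>z. ?T z * ?N z \<partial>joint))\<bar>"
    unfolding distrib_left right_diff_distrib 1 2 3 by simp
  also have "\<dots> = ?a * \<bar>(\<integral>z. t.rho z * ?T z \<partial>joint) - (\<integral>z. ?T z \<partial>joint) + ?e * (\<integral>z. ?T z * ?N z \<partial>joint)\<bar>"
    using a0 by (simp only: abs_mult abs_of_nonneg)
  also have "\<dots> \<le> ?a * (18 * exp 12 * ?e\<^sup>2 * sqrt (\<integral>z. (?T z)\<^sup>2 \<partial>joint))"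
    by (rule mult_left_mono[OF t.tilted_first_moment a0])
  also have "\<dots> = 18 * exp 12 * ?e\<^sup>2 * sqrt (v \<bullet> (fi *\<^sub>v v))"
    unfolding 4[symmetric] by (simp only: mult_ac)
  finally show ?thesis .
qed

text \<open>This is \<open>tilted_mgf\<close> at a = |v| / r. The hypothesis \<open>lower\<close>,
  an instance of the Cramer-Rao bound, turns a^2 into a multiple of the Fisher form J, so that all
  errors become relative to J; \<open>ek\<close> then keeps the change of variance caused by the
  tilt below h J.\<close>

lemma (in smoothing) shifted_mgf:
  assumes v: "v \<in> carrier_vec d" and e: "e \<in> carrier_vec d" and er: "vnorm e \<le> r"
    and h: "0 < h" "h \<le> 1" and k: "0 < k"
    and lower: "v \<bullet> v / r\<^sup>2 \<le> 2 * k * (v \<bullet> (fi *\<^sub>v v))"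
    and ek: "(vnorm e / r)\<^sup>2 * (200 * exp 40 * k) \<le> h\<^sup>2"
  shows "(\<integral>\<^sup>+z. ennreal (exp (- (v \<bullet> sc (fst z + snd z - e)))) \<partial>joint)
    \<le> ennreal (exp (- (v \<bullet> shifted_mean e) + (1 + 5 * h) / 2 * (v \<bullet> (fi *\<^sub>v v)) + 80 * exp 18 * k\<^sup>2 / h * (v \<bullet> (fi *\<^sub>v v))\<^sup>2))"
proof -
  let ?T = "\<lambda>z. r * (normalize_vec v \<bullet> sc (fst z + snd z))" and ?N = "\<lambda>z. normalize_vec e \<bullet> snd z / r"
  let ?a = "vnorm v / r" and ?e = "vnorm e / r" and ?J = "v \<bullet> (fi *\<^sub>v v)"
  note t = tilted_score[OF v e er]
  interpret t: tilted joint ?T ?N ?e by (rule t(1))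
  have a0: "0 \<le> ?a" using r by simp
  have J0: "0 \<le> ?J" unfolding fisher_form_square[OF v] by simp
  have a2: "?a\<^sup>2 \<le> 2 * k * ?J" using lower by (simp add: power_divide vnorm_square)
  have aT: "- ?a * ?T z = - (v \<bullet> sc (fst z + snd z))" for z
    using scale_score[OF v, of "fst z + snd z"] by simp
  have 1: "?a * (\<integral>z. t.rho z * ?T z \<partial>joint) = v \<bullet> shifted_mean e"
    unfolding shifted_mean_scalar(1)[OF v e er] integral_mult_right_zero[symmetric]
    unfolding mult.left_commute[of ?a "t.rho _"] scale_score[OF v]
    by (rule Bochner_Integration.integral_cong[OF refl]) (simp only: t(2))
  have J: "?a\<^sup>2 * (\<integral>z. (?T z)\<^sup>2 \<partial>joint) = ?J"
    unfolding fisher_form_square[OF v] integral_mult_right_zero[symmetric] power_mult_distrib[symmetric] scale_score[OF v] ..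
  have m: "(\<lambda>x. exp (- (v \<bullet> sc x))) \<in> borel_measurable (vborel d)"
    using scalar_score_measurable(1)[OF v] by simp
  have "(\<integral>\<^sup>+z. ennreal (exp (- (v \<bullet> sc (fst z + snd z - e)))) \<partial>joint)
      = (\<integral>\<^sup>+z. ennreal (ratio e (snd z)) * ennreal (exp (- (v \<bullet> sc (fst z + snd z)))) \<partial>joint)"
    using m by (intro joint_translation e) simp
  also have "\<dots> = (\<integral>\<^sup>+z. ennreal (t.rho z * exp (- ?a * ?T z)) \<partial>joint)"
  proof (rule nn_integral_cong)
    fix z assume z: "z \<in> space joint"
    show "ennreal (ratio e (snd z)) * ennreal (exp (- (v \<bullet> sc (fst z + snd z)))) = ennreal (t.rho z * exp (- ?a * ?T z))"
      unfolding aT t(2)[OF z] by (simp add: ennreal_mult)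
  qed
  also have "\<dots> = ennreal (\<integral>z. t.rho z * exp (- ?a * ?T z) \<partial>joint)"
    by (intro nn_integral_eq_integral t.tilted_exp_integrable) simp
  also have "\<dots> \<le> ennreal (exp (- ?a * (\<integral>z. t.rho z * ?T z \<partial>joint) + (1 + h) / 2 * ?a\<^sup>2 * (\<integral>z. t.rho z * (?T z)\<^sup>2 \<partial>joint) + 20 * exp 18 / h * ?a ^ 4))"
    by (intro ennreal_leI t.tilted_mgf h a0)
  also have "\<dots> \<le> ennreal (exp (- (v \<bullet> shifted_mean e) + (1 + 5 * h) / 2 * ?J + 80 * exp 18 * k\<^sup>2 / h * ?J\<^sup>2))"
  proof -
    have "?a\<^sup>2 * (\<integral>z. t.rho z * (?T z)\<^sup>2 \<partial>joint) \<le> ?a\<^sup>2 * ((1 + h) * (\<integral>z. (?T z)\<^sup>2 \<partial>joint) + 100 * exp 40 / h * ?e\<^sup>2)"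
      by (intro mult_left_mono t.tilted_second_moment h) simp
    also have "\<dots> = (1 + h) * ?J + ?a\<^sup>2 * (100 * exp 40 / h * ?e\<^sup>2)" unfolding J[symmetric] by (simp add: algebra_simps)
    also have "?a\<^sup>2 * (100 * exp 40 / h * ?e\<^sup>2) \<le> (2 * k * ?J) * (100 * exp 40 / h * ?e\<^sup>2)"
      using a2 h by (intro mult_right_mono) auto
    also have "(2 * k * ?J) * (100 * exp 40 / h * ?e\<^sup>2) = ?J / h * (?e\<^sup>2 * (200 * exp 40 * k))" by simp
    also have "\<dots> \<le> ?J / h * h\<^sup>2" using J0 h by (intro mult_left_mono ek) auto
    also have "?J / h * h\<^sup>2 = h * ?J" using h by (simp add: power2_eq_square)
    finally have b: "?a\<^sup>2 * (\<integral>z. t.rho z * (?T z)\<^sup>2 \<partial>joint) \<le> (1 + 2 * h) * ?J" by (simp add: algebra_simps)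
    have "(1 + h) / 2 * (?a\<^sup>2 * (\<integral>z. t.rho z * (?T z)\<^sup>2 \<partial>joint)) \<le> (1 + h) / 2 * ((1 + 2 * h) * ?J)"
      using h by (intro mult_left_mono b) auto
    also have "\<dots> = ((1 + h) * (1 + 2 * h)) / 2 * ?J" by simp
    also have "\<dots> \<le> (1 + 5 * h) / 2 * ?J"
    proof (intro mult_right_mono divide_right_mono J0)
      \<comment> \<open>The factor 1 + h is that of the Taylor bound, and 1 + 2 h collects h from
        the second moment and h from \<open>ek\<close>.\<close>
      have "h * h \<le> h" using h mult_left_mono[of h 1 h] by simp
      thus "(1 + h) * (1 + 2 * h) \<le> 1 + 5 * h" by (simp add: algebra_simps)
    qed simp
    finally have c: "(1 + h) / 2 * ?a\<^sup>2 * (\<integral>z. t.rho z * (?T z)\<^sup>2 \<partial>joint) \<le> (1 + 5 * h) / 2 * ?J" by (simp add: mult.assoc)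
    \<comment> \<open>By \<open>a2\<close> the quartic term becomes one in J^2; the constant 80 is
      20 * 2^2.\<close>
    have "?a ^ 4 = (?a\<^sup>2)\<^sup>2" by simp
    also have "\<dots> \<le> (2 * k * ?J)\<^sup>2" by (intro power_mono a2) simp
    finally have "20 * exp 18 / h * ?a ^ 4 \<le> 20 * exp 18 / h * (2 * k * ?J)\<^sup>2" using h by (intro mult_left_mono) auto
    also have "\<dots> = 80 * exp 18 * k\<^sup>2 / h * ?J\<^sup>2" by (simp add: power_mult_distrib)
    finally have q: "20 * exp 18 / h * ?a ^ 4 \<le> 80 * exp 18 * k\<^sup>2 / h * ?J\<^sup>2" .
    have neg: "- ?a * (\<integral>z. t.rho z * ?T z \<partial>joint) = - (v \<bullet> shifted_mean e)" using 1 by simp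
    show ?thesis unfolding neg by (intro ennreal_leI) (use c q in simp)
  qed
  finally show ?thesis .
qed

section \<open>Quadratic forms of Gaussian vectors and the PAC-Bayes inequality\<close>

lemma gauss_subgauss:
  assumes s: "s > 0" and u: "u \<in> carrier_vec d" and le: "u \<bullet> u \<le> 1"
  shows "subgauss (gauss d (iso_cov d s)) (\<lambda>w. (u \<bullet> w) / s)"
  unfolding subgauss_def
proof (intro conjI allI)
  show "(\<lambda>w. (u \<bullet> w) / s) \<in> borel_measurable (gauss d (iso_cov d s))"
    using measurable_scalar_prod[OF measurable_vec_const[OF u] measurable_ident_sets[OF sets_gauss]] by simp
  fix c
  have cu: "(c / s) \<cdot>\<^sub>v u \<in> carrier_vec d" using u by simp
  have "(\<integral>\<^sup>+w. ennreal (exp (c * ((u \<bullet> w) / s))) \<partial>gauss d (iso_cov d s))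
      = (\<integral>\<^sup>+w. ennreal (exp (((c / s) \<cdot>\<^sub>v u) \<bullet> w)) \<partial>gauss d (iso_cov d s))"
    using u by (intro nn_integral_cong) auto
  also have "\<dots> = ennreal (exp (s\<^sup>2 * (((c / s) \<cdot>\<^sub>v u) \<bullet> ((c / s) \<cdot>\<^sub>v u)) / 2))" by (rule gauss_mgf[OF s cu])
  also have "\<dots> \<le> ennreal (exp (c\<^sup>2 / 2))"
  proof -
    have "s\<^sup>2 * (((c / s) \<cdot>\<^sub>v u) \<bullet> ((c / s) \<cdot>\<^sub>v u)) / 2 = c\<^sup>2 / 2 * (u \<bullet> u)"
      using s u by (simp add: power2_eq_square)
    also have "\<dots> \<le> c\<^sup>2 / 2 * 1" by (intro mult_left_mono le) simp
    finally show ?thesis by (intro ennreal_leI) simp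
  qed
  finally show "(\<integral>\<^sup>+w. ennreal (exp (c * ((u \<bullet> w) / s))) \<partial>gauss d (iso_cov d s)) \<le> ennreal (exp (c\<^sup>2 / 2))" .
qed

text \<open>The rows of the square root take the place of an eigenbasis: the form becomes a sum of
  squares of linear functionals, whose Gaussian moments are known and whose squared lengths add up
  to the trace.\<close>

lemma psd_form_sum:
  assumes B: "sym_psd d B" and x: "x \<in> carrier_vec d"
  shows "x \<bullet> (B *\<^sub>v x) = (\<Sum>j<d. (row (mat_sqrt B) j \<bullet> x)\<^sup>2)"
proof -
  have Gc: "mat_sqrt B \<in> carrier_mat d d" by (rule sym_psd_carrier[OF mat_sqrt_psd(1)[OF B]])
  have Gx: "mat_sqrt B *\<^sub>v x \<in> carrier_vec d" using Gc x by simp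
  have "x \<bullet> (B *\<^sub>v x) = (mat_sqrt B *\<^sub>v x) \<bullet> (mat_sqrt B *\<^sub>v x)"
    using psd_factor_form[OF mat_sqrt_psd(1)[OF B] x] mat_sqrt_psd(2)[OF B] by (simp add: vnorm_square)
  also have "\<dots> = (\<Sum>j<d. (row (mat_sqrt B) j \<bullet> x)\<^sup>2)"
    using Gc by (simp add: scalar_prod_lt[OF Gx] power2_eq_square)
  finally show ?thesis .
qed

lemma psd_tr_sum:
  assumes B: "sym_psd d B"
  shows "tr B = (\<Sum>j<d. (vnorm (row (mat_sqrt B) j))\<^sup>2)"
  using tr_psd_factor[OF mat_sqrt_psd(1)[OF B]] mat_sqrt_psd(2)[OF B] by simp

lemma psd_form_measurable:
  "B \<in> carrier_mat d d \<Longrightarrow> g \<in> N \<rightarrow>\<^sub>M vborel d \<Longrightarrow> (\<lambda>x. g x \<bullet> (B *\<^sub>v g x)) \<in> borel_measurable N"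
  by (intro measurable_scalar_prod measurable_mult_mat_vec)

lemma sum_cross_terms:
  fixes a b :: "nat \<Rightarrow> real"
  shows "(\<Sum>j<n. (a j + b j)\<^sup>2) = (\<Sum>j<n. (a j)\<^sup>2) + (\<Sum>j<n. 2 * a j * b j) + (\<Sum>j<n. (b j)\<^sup>2)"
  by (simp add: power2_sum sum.distrib algebra_simps)

text \<open>The first moment is exact because it carries the leading constant. The second moment
  enters only the quartic correction and is bounded crudely: 8 comes from (2 x + 2 y)^2 <= 8 x^2 + 8
  y^2, and 768 = 8 * 96 with 96 a bound for a fourth moment.\<close>

lemma gauss_form_moments:
  assumes s: "s > 0" and B: "sym_psd d B" and a: "a \<in> carrier_vec d"
  shows "integrable (gauss d (iso_cov d s)) (\<lambda>w. (w + a) \<bullet> (B *\<^sub>v (w + a)))"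
    and "(\<integral>w. (w + a) \<bullet> (B *\<^sub>v (w + a)) \<partial>gauss d (iso_cov d s)) = a \<bullet> (B *\<^sub>v a) + s\<^sup>2 * tr B"
    and "integrable (gauss d (iso_cov d s)) (\<lambda>w. ((w + a) \<bullet> (B *\<^sub>v (w + a)))\<^sup>2)"
    and "(\<integral>w. ((w + a) \<bullet> (B *\<^sub>v (w + a)))\<^sup>2 \<partial>gauss d (iso_cov d s)) \<le> 8 * (a \<bullet> (B *\<^sub>v a))\<^sup>2 + 768 * (s\<^sup>2 * tr B)\<^sup>2"
proof -
  let ?\<pi> = "gauss d (iso_cov d s)"
  interpret P: prob_space ?\<pi> by (rule prob_space_gauss[OF s])
  let ?g = "row (mat_sqrt B)"
  have Gc: "mat_sqrt B \<in> carrier_mat d d" by (rule sym_psd_carrier[OF mat_sqrt_psd(1)[OF B]])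
  have Bc: "B \<in> carrier_mat d d" by (rule sym_psd_carrier[OF B])
  have g: "?g j \<in> carrier_vec d" if "j < d" for j using Gc that by auto
  note M = gauss_scalar_moments[OF s]
  have e1: "(w + a) \<bullet> (B *\<^sub>v (w + a)) = (\<Sum>j<d. (?g j \<bullet> a)\<^sup>2) + (\<Sum>j<d. 2 * (?g j \<bullet> a) * (?g j \<bullet> w)) + (\<Sum>j<d. (?g j \<bullet> w)\<^sup>2)"
    if "w \<in> space ?\<pi>" for w
  proof -
    have w: "w \<in> carrier_vec d" using that by simp
    have "(w + a) \<bullet> (B *\<^sub>v (w + a)) = (\<Sum>j<d. (?g j \<bullet> a + ?g j \<bullet> w)\<^sup>2)"
      unfolding psd_form_sum[OF B add_carrier_vec[OF w a]]
      by (intro sum.cong refl) (simp add: scalar_prod_add_distrib[OF g w a] add.commute)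
    thus ?thesis unfolding sum_cross_terms .
  qed
  have i1: "integrable ?\<pi> (\<lambda>w. (\<Sum>j<d. (?g j \<bullet> a)\<^sup>2) + (\<Sum>j<d. 2 * (?g j \<bullet> a) * (?g j \<bullet> w)) + (\<Sum>j<d. (?g j \<bullet> w)\<^sup>2))"
    by (intro Bochner_Integration.integrable_add Bochner_Integration.integrable_sum integrable_mult_right M g) auto
  show "integrable ?\<pi> (\<lambda>w. (w + a) \<bullet> (B *\<^sub>v (w + a)))" using i1 by (subst Bochner_Integration.integrable_cong[OF refl e1])
  have s1: "(\<integral>w. (\<Sum>j<d. 2 * (?g j \<bullet> a) * (?g j \<bullet> w)) \<partial>?\<pi>) = 0"
  proof -
    have "(\<integral>w. (\<Sum>j<d. 2 * (?g j \<bullet> a) * (?g j \<bullet> w)) \<partial>?\<pi>) = (\<Sum>j<d. \<integral>w. 2 * (?g j \<bullet> a) * (?g j \<bullet> w) \<partial>?\<pi>)"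
      by (intro Bochner_Integration.integral_sum integrable_mult_right M g) auto
    also have "\<dots> = 0" by (intro sum.neutral) (simp add: M(2)[OF g])
    finally show ?thesis .
  qed
  have s2: "(\<integral>w. (\<Sum>j<d. (?g j \<bullet> w)\<^sup>2) \<partial>?\<pi>) = s\<^sup>2 * tr B"
  proof -
    have "(\<integral>w. (\<Sum>j<d. (?g j \<bullet> w)\<^sup>2) \<partial>?\<pi>) = (\<Sum>j<d. \<integral>w. (?g j \<bullet> w)\<^sup>2 \<partial>?\<pi>)"
      by (intro Bochner_Integration.integral_sum M g) auto
    also have "\<dots> = (\<Sum>j<d. s\<^sup>2 * (vnorm (?g j))\<^sup>2)"
      by (intro sum.cong refl) (simp add: M(4)[OF g] vnorm_square)
    also have "\<dots> = s\<^sup>2 * tr B" unfolding psd_tr_sum[OF B] by (simp add: sum_distrib_left)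
    finally show ?thesis .
  qed
  have "(\<integral>w. (w + a) \<bullet> (B *\<^sub>v (w + a)) \<partial>?\<pi>)
      = (\<integral>w. (\<Sum>j<d. (?g j \<bullet> a)\<^sup>2) + (\<Sum>j<d. 2 * (?g j \<bullet> a) * (?g j \<bullet> w)) + (\<Sum>j<d. (?g j \<bullet> w)\<^sup>2) \<partial>?\<pi>)"
    by (rule Bochner_Integration.integral_cong[OF refl e1])
  also have "\<dots> = (\<integral>w. (\<Sum>j<d. (?g j \<bullet> a)\<^sup>2) + (\<Sum>j<d. 2 * (?g j \<bullet> a) * (?g j \<bullet> w)) \<partial>?\<pi>) + (\<integral>w. (\<Sum>j<d. (?g j \<bullet> w)\<^sup>2) \<partial>?\<pi>)"
    by (intro Bochner_Integration.integral_add Bochner_Integration.integrable_add Bochner_Integration.integrable_sum integrable_mult_right M g) auto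
  also have "(\<integral>w. (\<Sum>j<d. (?g j \<bullet> a)\<^sup>2) + (\<Sum>j<d. 2 * (?g j \<bullet> a) * (?g j \<bullet> w)) \<partial>?\<pi>)
      = (\<integral>w. (\<Sum>j<d. (?g j \<bullet> a)\<^sup>2) \<partial>?\<pi>) + (\<integral>w. (\<Sum>j<d. 2 * (?g j \<bullet> a) * (?g j \<bullet> w)) \<partial>?\<pi>)"
    by (intro Bochner_Integration.integral_add Bochner_Integration.integrable_sum integrable_mult_right M g) auto
  also have "(\<integral>w. (\<Sum>j<d. (?g j \<bullet> a)\<^sup>2) \<partial>?\<pi>) = a \<bullet> (B *\<^sub>v a)"
    using P.prob_space by (simp add: psd_form_sum[OF B a])
  finally show "(\<integral>w. (w + a) \<bullet> (B *\<^sub>v (w + a)) \<partial>?\<pi>) = a \<bullet> (B *\<^sub>v a) + s\<^sup>2 * tr B"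
    unfolding s1 s2 by simp
  let ?p = "\<lambda>j. (vnorm (?g j))\<^sup>2"
  let ?T = "\<lambda>j w. (normalize_vec (?g j) \<bullet> w) / s"
  have sub: "subgauss ?\<pi> (?T j)" if "j < d" for j
    by (rule gauss_subgauss[OF s normalize_vec(1)[OF g[OF that]] normalize_vec(2)[OF g[OF that]]])
  have abs4: "\<bar>x\<bar> ^ 4 = x ^ 4" for x :: real by (rule power_even_abs) simp
  let ?Q = "\<lambda>w. 8 * (a \<bullet> (B *\<^sub>v a))\<^sup>2 + 8 * (s ^ 4 * tr B * (\<Sum>j<d. ?p j * \<bar>?T j w\<bar> ^ 4))"
  have Q: "((w + a) \<bullet> (B *\<^sub>v (w + a)))\<^sup>2 \<le> ?Q w" if "w \<in> space ?\<pi>" for w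
  proof -
    have w: "w \<in> carrier_vec d" using that by simp
    let ?x = "a \<bullet> (B *\<^sub>v a)" and ?y = "w \<bullet> (B *\<^sub>v w)"
    have x0: "0 \<le> ?x" and y0: "0 \<le> ?y" using B a w by (auto simp: sym_psd_def)
    have z0: "0 \<le> (w + a) \<bullet> (B *\<^sub>v (w + a))" using B a w by (auto simp: sym_psd_def)
    have "(w + a) \<bullet> (B *\<^sub>v (w + a)) \<le> 2 * ?x + 2 * ?y"
    proof -
      have "(\<Sum>j<d. 2 * (?g j \<bullet> a) * (?g j \<bullet> w)) \<le> (\<Sum>j<d. (?g j \<bullet> a)\<^sup>2 + (?g j \<bullet> w)\<^sup>2)"
        by (intro sum_mono sum_squares_bound)
      thus ?thesis unfolding e1[OF that] psd_form_sum[OF B a] psd_form_sum[OF B w] by (simp add: sum.distrib)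
    qed
    hence "((w + a) \<bullet> (B *\<^sub>v (w + a)))\<^sup>2 \<le> (2 * ?x + 2 * ?y)\<^sup>2" using z0 by (rule power_mono)
    also have "\<dots> \<le> 8 * ?x\<^sup>2 + 8 * ?y\<^sup>2"
      using sum_squares_bound[of ?x ?y] by (simp add: power2_eq_square algebra_simps)
    \<comment> \<open>Cauchy-Schwarz with the weights |g_j|^2, whose sum is the trace, avoids mixed
      fourth moments of different functionals.\<close>
    also have "?y\<^sup>2 \<le> s ^ 4 * tr B * (\<Sum>j<d. ?p j * \<bar>?T j w\<bar> ^ 4)"
    proof -
      have gj: "(?g j \<bullet> w)\<^sup>2 = s\<^sup>2 * (vnorm (?g j) * (vnorm (?g j) * (?T j w)\<^sup>2))" if "j < d" for j
      proof -
        have "?g j \<bullet> w = s * (vnorm (?g j) * ?T j w)"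
          using normalize_vec(3)[OF g[OF that] w] s by simp
        thus ?thesis by (simp add: power2_eq_square mult_ac)
      qed
      have "?y = s\<^sup>2 * (\<Sum>j<d. vnorm (?g j) * (vnorm (?g j) * (?T j w)\<^sup>2))"
        unfolding psd_form_sum[OF B w] sum_distrib_left by (intro sum.cong refl gj) simp
      hence "?y\<^sup>2 = s ^ 4 * (\<Sum>j<d. vnorm (?g j) * (vnorm (?g j) * (?T j w)\<^sup>2))\<^sup>2"
        by (simp add: power_mult_distrib)
      also have "\<dots> \<le> s ^ 4 * ((\<Sum>j<d. ?p j) * (\<Sum>j<d. (vnorm (?g j) * (?T j w)\<^sup>2)\<^sup>2))"
        using s by (intro mult_left_mono Cauchy_Schwarz_ineq_sum) auto
      also have "(\<Sum>j<d. (vnorm (?g j) * (?T j w)\<^sup>2)\<^sup>2) = (\<Sum>j<d. ?p j * \<bar>?T j w\<bar> ^ 4)"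
        by (intro sum.cong refl) (simp only: power_mult_distrib abs4 power_mult[symmetric], simp)
      finally show ?thesis unfolding psd_tr_sum[OF B] by (simp only: mult.assoc)
    qed
    finally show ?thesis by simp
  qed
  have iS: "integrable ?\<pi> (\<lambda>w. \<Sum>j<d. ?p j * \<bar>?T j w\<bar> ^ 4)"
    by (intro Bochner_Integration.integrable_sum integrable_mult_right subgauss_power_integrable sub) simp
  have iQ: "integrable ?\<pi> ?Q"
    by (intro Bochner_Integration.integrable_add integrable_mult_right iS) simp
  have m: "(\<lambda>w. (w + a) \<bullet> (B *\<^sub>v (w + a))) \<in> borel_measurable ?\<pi>"
    by (intro psd_form_measurable[OF Bc] measurable_vec_add measurable_vec_const a measurable_ident_sets sets_gauss)
  show iq: "integrable ?\<pi> (\<lambda>w. ((w + a) \<bullet> (B *\<^sub>v (w + a)))\<^sup>2)"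
  proof (rule Bochner_Integration.integrable_bound[OF iQ])
    show "AE w in ?\<pi>. norm (((w + a) \<bullet> (B *\<^sub>v (w + a)))\<^sup>2) \<le> norm (?Q w)"
      using Q by (intro AE_I2) (smt (verit) real_norm_def zero_le_power2)
  qed (use m in simp)
  have "(\<integral>w. ((w + a) \<bullet> (B *\<^sub>v (w + a)))\<^sup>2 \<partial>?\<pi>) \<le> (\<integral>w. ?Q w \<partial>?\<pi>)"
    by (intro integral_mono iq iQ Q)
  also have "\<dots> = 8 * (a \<bullet> (B *\<^sub>v a))\<^sup>2 + 8 * (s ^ 4 * tr B * (\<Sum>j<d. ?p j * (\<integral>w. \<bar>?T j w\<bar> ^ 4 \<partial>?\<pi>)))"
  proof -
    have "(\<integral>w. (\<Sum>j<d. ?p j * \<bar>?T j w\<bar> ^ 4) \<partial>?\<pi>) = (\<Sum>j<d. ?p j * (\<integral>w. \<bar>?T j w\<bar> ^ 4 \<partial>?\<pi>))"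
      unfolding integral_mult_right_zero[symmetric]
      by (intro Bochner_Integration.integral_sum integrable_mult_right subgauss_power_integrable sub) simp
    moreover have "(\<integral>w. ?Q w \<partial>?\<pi>) = (\<integral>w. 8 * (a \<bullet> (B *\<^sub>v a))\<^sup>2 \<partial>?\<pi>) + (\<integral>w. 8 * (s ^ 4 * tr B * (\<Sum>j<d. ?p j * \<bar>?T j w\<bar> ^ 4)) \<partial>?\<pi>)"
      by (intro Bochner_Integration.integral_add integrable_mult_right iS) simp
    ultimately show ?thesis using P.prob_space by simp
  qed
  also have "\<dots> \<le> 8 * (a \<bullet> (B *\<^sub>v a))\<^sup>2 + 8 * (s ^ 4 * tr B * (\<Sum>j<d. ?p j * 96))"
  proof (intro add_left_mono mult_left_mono sum_mono)
    fix j assume "j \<in> {..<d}"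
    hence "(\<integral>w. \<bar>?T j w\<bar> ^ 4 \<partial>?\<pi>) \<le> fact 4 * (2 * exp (1 / 2))"
      by (intro subgauss_power_integral_le sub) simp
    \<comment> \<open>24 * 2 * 2, since exp (1/2) is at most 2.\<close>
    also have "\<dots> \<le> 96"
    proof -
      have "exp (1/2) \<le> (2::real)"
        using exp_half_le2 by simp
      thus ?thesis by (simp add: fact_numeral)
    qed
    finally show "(\<integral>w. \<bar>?T j w\<bar> ^ 4 \<partial>?\<pi>) \<le> 96" .
  qed (use tr_psd_nonneg[OF B] in auto)
  also have "\<dots> = 8 * (a \<bullet> (B *\<^sub>v a))\<^sup>2 + 768 * (s\<^sup>2 * tr B)\<^sup>2"
    unfolding sum_distrib_right[symmetric] psd_tr_sum[OF B, symmetric] by (simp add: power_mult_distrib power2_eq_square power4_eq_xxxx)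
  finally show "(\<integral>w. ((w + a) \<bullet> (B *\<^sub>v (w + a)))\<^sup>2 \<partial>?\<pi>) \<le> 8 * (a \<bullet> (B *\<^sub>v a))\<^sup>2 + 768 * (s\<^sup>2 * tr B)\<^sup>2" .
qed

text \<open>The Gaussian case of the PAC-Bayes variational inequality: the posterior \<open>N(a, s\<^sup>2)\<close> has relative
  entropy \<open>\<bar>a\<bar>\<^sup>2 / (2 s\<^sup>2)\<close> with respect to the prior \<open>N(0, s\<^sup>2)\<close>.\<close>

lemma pac_bayes:
  assumes s: "s > 0" and B: "sym_psd d B" and L: "L \<in> carrier_vec d" and a: "a \<in> carrier_vec d"
    and c2: "0 \<le> c2" and K: "0 < K"
    and le: "(\<integral>\<^sup>+w. ennreal (exp (L \<bullet> w - c1 * (w \<bullet> (B *\<^sub>v w)) - c2 * (w \<bullet> (B *\<^sub>v w))\<^sup>2)) \<partial>gauss d (iso_cov d s)) \<le> ennreal K"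
  shows "L \<bullet> a \<le> ln K + (a \<bullet> a) / (2 * s\<^sup>2) + c1 * (a \<bullet> (B *\<^sub>v a) + s\<^sup>2 * tr B)
      + c2 * (8 * (a \<bullet> (B *\<^sub>v a))\<^sup>2 + 768 * (s\<^sup>2 * tr B)\<^sup>2)"
proof -
  let ?\<pi> = "gauss d (iso_cov d s)"
  interpret P: prob_space ?\<pi> by (rule prob_space_gauss[OF s])
  have Bc: "B \<in> carrier_mat d d" by (rule sym_psd_carrier[OF B])
  let ?h = "\<lambda>w. L \<bullet> w - c1 * (w \<bullet> (B *\<^sub>v w)) - c2 * (w \<bullet> (B *\<^sub>v w))\<^sup>2"
  \<comment> \<open>\<open>?k\<close> is the exponent at the posterior point w + a minus the
    logarithm of the posterior density relative to the prior. Jensen's inequality for w under the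
    prior is thus Jensen's inequality for w + a under the posterior.\<close>
  let ?k = "\<lambda>w. ?h (w + a) - (a \<bullet> w) / s\<^sup>2 - (a \<bullet> a) / (2 * s\<^sup>2)"
  note Ma = gauss_scalar_moments[OF s a] and Lm = gauss_scalar_moments[OF s L] and F = gauss_form_moments[OF s B a]
  have id: "(\<lambda>w. w) \<in> vborel d \<rightarrow>\<^sub>M vborel d" by simp
  have mh: "?h \<in> borel_measurable (vborel d)"
    using measurable_scalar_prod[OF measurable_vec_const[OF L] id] psd_form_measurable[OF Bc id] by measurable
  have ma: "(\<lambda>w. a \<bullet> w) \<in> borel_measurable (vborel d)" by (rule measurable_scalar_prod[OF measurable_vec_const[OF a] id])
  have La: "L \<bullet> (w + a) = L \<bullet> w + L \<bullet> a" if "w \<in> space ?\<pi>" for w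
    using scalar_prod_add_distrib[OF L _ a] that by simp
  have k: "?k w = (L \<bullet> w + L \<bullet> a) - c1 * ((w + a) \<bullet> (B *\<^sub>v (w + a))) - c2 * ((w + a) \<bullet> (B *\<^sub>v (w + a)))\<^sup>2 - (a \<bullet> w) / s\<^sup>2 - (a \<bullet> a) / (2 * s\<^sup>2)"
    if "w \<in> space ?\<pi>" for w unfolding La[OF that] ..
  have ik': "integrable ?\<pi> (\<lambda>w. (L \<bullet> w + L \<bullet> a) - c1 * ((w + a) \<bullet> (B *\<^sub>v (w + a))) - c2 * ((w + a) \<bullet> (B *\<^sub>v (w + a)))\<^sup>2 - (a \<bullet> w) / s\<^sup>2 - (a \<bullet> a) / (2 * s\<^sup>2))"
    by (intro Bochner_Integration.integrable_diff Bochner_Integration.integrable_add integrable_mult_right integrable_divide F Ma Lm) auto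
  have ik: "integrable ?\<pi> ?k" using ik' by (subst Bochner_Integration.integrable_cong[OF refl k])
  have "(\<integral>w. ?k w \<partial>?\<pi>) = (\<integral>w. (L \<bullet> w + L \<bullet> a) - c1 * ((w + a) \<bullet> (B *\<^sub>v (w + a))) - c2 * ((w + a) \<bullet> (B *\<^sub>v (w + a)))\<^sup>2 - (a \<bullet> w) / s\<^sup>2 - (a \<bullet> a) / (2 * s\<^sup>2) \<partial>?\<pi>)"
    by (rule Bochner_Integration.integral_cong[OF refl k])
  also have "\<dots> = L \<bullet> a - c1 * (a \<bullet> (B *\<^sub>v a) + s\<^sup>2 * tr B) - c2 * (\<integral>w. ((w + a) \<bullet> (B *\<^sub>v (w + a)))\<^sup>2 \<partial>?\<pi>) - (a \<bullet> a) / (2 * s\<^sup>2)"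
    using P.prob_space F(1,3) Ma(1) Lm(1) by (simp add: F(2) Ma(2) Lm(2))
  finally have int: "(\<integral>w. ?k w \<partial>?\<pi>) = L \<bullet> a - c1 * (a \<bullet> (B *\<^sub>v a) + s\<^sup>2 * tr B) - c2 * (\<integral>w. ((w + a) \<bullet> (B *\<^sub>v (w + a)))\<^sup>2 \<partial>?\<pi>) - (a \<bullet> a) / (2 * s\<^sup>2)" .
  have "ennreal (exp (\<integral>w. ?k w \<partial>?\<pi>)) \<le> (\<integral>\<^sup>+w. ennreal (exp (?k w)) \<partial>?\<pi>)"
    by (rule exp_integral_le[OF prob_space_gauss[OF s] ik])
  also have "\<dots> = (\<integral>\<^sup>+w. ennreal (exp (?h (w + a) - (a \<bullet> (w + a)) / s\<^sup>2 + (a \<bullet> a) / (2 * s\<^sup>2))) \<partial>?\<pi>)"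
  proof (rule nn_integral_cong)
    fix w assume w: "w \<in> space ?\<pi>"
    have "x - p / c - q / (2 * c) = x - (p + q) / c + q / (2 * c)" if "c > 0" for x p q c :: real
      using that by (simp add: field_simps)
    from this[of "s\<^sup>2" "?h (w + a)" "a \<bullet> w" "a \<bullet> a"] s
    have "?k w = ?h (w + a) - (a \<bullet> (w + a)) / s\<^sup>2 + (a \<bullet> a) / (2 * s\<^sup>2)"
      using scalar_prod_add_distrib[OF a _ a, of w] w by simp
    thus "ennreal (exp (?k w)) = ennreal (exp (?h (w + a) - (a \<bullet> (w + a)) / s\<^sup>2 + (a \<bullet> a) / (2 * s\<^sup>2)))" by simp
  qed
  also have "\<dots> = (\<integral>\<^sup>+w. ennreal (exp (a \<bullet> w / s\<^sup>2 - (a \<bullet> a) / (2 * s\<^sup>2))) * ennreal (exp (?h w - (a \<bullet> w) / s\<^sup>2 + (a \<bullet> a) / (2 * s\<^sup>2))) \<partial>?\<pi>)"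
    by (rule gauss_translation[OF s _ a, of "\<lambda>w. ennreal (exp (?h w - (a \<bullet> w) / s\<^sup>2 + (a \<bullet> a) / (2 * s\<^sup>2)))"])
       (use mh ma in measurable)
  also have "\<dots> = (\<integral>\<^sup>+w. ennreal (exp (?h w)) \<partial>?\<pi>)"
    by (intro nn_integral_cong) (simp add: ennreal_mult'[symmetric] exp_add[symmetric])
  also note le
  finally have "exp (\<integral>w. ?k w \<partial>?\<pi>) \<le> K" using K by (simp add: ennreal_le_iff)
  hence "(\<integral>w. ?k w \<partial>?\<pi>) \<le> ln K" using K by (simp add: ln_ge_iff)
  hence "L \<bullet> a \<le> ln K + (a \<bullet> a) / (2 * s\<^sup>2) + c1 * (a \<bullet> (B *\<^sub>v a) + s\<^sup>2 * tr B) + c2 * (\<integral>w. ((w + a) \<bullet> (B *\<^sub>v (w + a)))\<^sup>2 \<partial>?\<pi>)"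
    unfolding int by linarith
  also have "c2 * (\<integral>w. ((w + a) \<bullet> (B *\<^sub>v (w + a)))\<^sup>2 \<partial>?\<pi>) \<le> c2 * (8 * (a \<bullet> (B *\<^sub>v a))\<^sup>2 + 768 * (s\<^sup>2 * tr B)\<^sup>2)"
    by (rule mult_left_mono[OF F(4) c2])
  finally show ?thesis by simp
qed

text \<open>Markov's inequality for the mixture over \<open>\<theta>\<close> is applied to the left-hand side; the two blocks of
  indices are those of the samples and of the perturbations.\<close>

lemma product_mixture_le:
  fixes g :: "'p \<Rightarrow> 'a \<Rightarrow> 'b \<Rightarrow> ennreal" and c :: ennreal and k m :: nat
  assumes T: "prob_space T" and G: "prob_space G" and P: "prob_space P"
    and g: "(\<lambda>(\<theta>, x, w). g \<theta> x w) \<in> borel_measurable (P \<Otimes>\<^sub>M (T \<Otimes>\<^sub>M G))"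
    and le: "\<And>\<theta>. \<theta> \<in> space P \<Longrightarrow> (\<integral>\<^sup>+x. \<integral>\<^sup>+w. g \<theta> x w \<partial>G \<partial>T) \<le> 1"
  shows "(\<integral>\<^sup>+x. \<integral>\<^sup>+w. c * (\<integral>\<^sup>+\<theta>. (\<Prod>i<m. g \<theta> (x (k + i)) (w i)) \<partial>P) \<partial>(\<Pi>\<^sub>M i\<in>{..<m}. G) \<partial>(\<Pi>\<^sub>M i\<in>{k..<k + m}. T)) \<le> c"
proof -
  interpret T: prob_space T by fact
  interpret G: prob_space G by fact
  interpret P: prob_space P by fact
  interpret PT: product_sigma_finite "\<lambda>i::nat. T" by standard
  interpret PG: product_sigma_finite "\<lambda>i::nat. G" by standard
  interpret PPT: product_prob_space "\<lambda>i::nat. T" by standard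
  interpret PPG: product_prob_space "\<lambda>i::nat. G" by standard
  let ?X = "\<Pi>\<^sub>M i\<in>{k..<k + m}. T" and ?W = "\<Pi>\<^sub>M i\<in>{..<m}. G"
  interpret X: prob_space ?X by (rule prob_space_PiM) (rule T)
  interpret W: prob_space ?W by (rule prob_space_PiM) (rule G)
  interpret WP: pair_sigma_finite ?W P by standard
  interpret XP: pair_sigma_finite ?X P by standard
  let ?g1 = "\<lambda>\<theta> x. \<integral>\<^sup>+w. g \<theta> x w \<partial>G"
  have g': "(\<lambda>((\<theta>, x), w). g \<theta> x w) \<in> borel_measurable ((P \<Otimes>\<^sub>M T) \<Otimes>\<^sub>M G)"
  proof -
    have "(\<lambda>z. (fst (fst z), snd (fst z), snd z)) \<in> (P \<Otimes>\<^sub>M T) \<Otimes>\<^sub>M G \<rightarrow>\<^sub>M P \<Otimes>\<^sub>M (T \<Otimes>\<^sub>M G)" by measurable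
    from measurable_compose[OF this g] show ?thesis by (simp add: case_prod_beta')
  qed
  have g1: "(\<lambda>(\<theta>, x). ?g1 \<theta> x) \<in> borel_measurable (P \<Otimes>\<^sub>M T)"
    using G.borel_measurable_nn_integral_fst[OF g'] by (simp add: case_prod_beta')
  have mW: "(\<lambda>z. \<Prod>i<m. g (snd z) (x (k + i)) (fst z i)) \<in> borel_measurable (?W \<Otimes>\<^sub>M P)" if x: "x \<in> space ?X" for x
  proof (rule borel_measurable_prod_ennreal)
    fix i assume i: "i \<in> {..<m}"
    have xi: "x (k + i) \<in> space T" using x i by (auto simp: space_PiM PiE_iff)
    have "(\<lambda>z. fst z i) \<in> ?W \<Otimes>\<^sub>M P \<rightarrow>\<^sub>M G"
      by (rule measurable_compose[OF measurable_fst measurable_component_singleton[OF i]])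
    hence "(\<lambda>z. (snd z, x (k + i), fst z i)) \<in> ?W \<Otimes>\<^sub>M P \<rightarrow>\<^sub>M P \<Otimes>\<^sub>M (T \<Otimes>\<^sub>M G)"
      using xi by (intro measurable_Pair measurable_snd measurable_const)
    from measurable_compose[OF this g] show "(\<lambda>z. g (snd z) (x (k + i)) (fst z i)) \<in> borel_measurable (?W \<Otimes>\<^sub>M P)" by simp
  qed
  have mX: "(\<lambda>z. \<Prod>i<m. ?g1 (snd z) (fst z (k + i))) \<in> borel_measurable (?X \<Otimes>\<^sub>M P)"
  proof (rule borel_measurable_prod_ennreal)
    fix i assume i: "i \<in> {..<m}"
    have "(\<lambda>z. fst z (k + i)) \<in> ?X \<Otimes>\<^sub>M P \<rightarrow>\<^sub>M T"
      using i by (intro measurable_compose[OF measurable_fst measurable_component_singleton]) auto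
    hence "(\<lambda>z. (snd z, fst z (k + i))) \<in> ?X \<Otimes>\<^sub>M P \<rightarrow>\<^sub>M P \<Otimes>\<^sub>M T"
      by (intro measurable_Pair measurable_snd)
    from measurable_compose[OF this g1] show "(\<lambda>z. ?g1 (snd z) (fst z (k + i))) \<in> borel_measurable (?X \<Otimes>\<^sub>M P)" by simp
  qed
  have gw: "g \<theta> x \<in> borel_measurable G" if "\<theta> \<in> space P" "x \<in> space T" for \<theta> x
    using measurable_Pair2[OF g', of "(\<theta>, x)"] that by (simp add: space_pair_measure)
  have g1x: "?g1 \<theta> \<in> borel_measurable T" if "\<theta> \<in> space P" for \<theta>
    using measurable_Pair2[OF g1 that] by simp
  have "(\<integral>\<^sup>+x. \<integral>\<^sup>+w. c * (\<integral>\<^sup>+\<theta>. (\<Prod>i<m. g \<theta> (x (k + i)) (w i)) \<partial>P) \<partial>?W \<partial>?X)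
      = (\<integral>\<^sup>+x. c * (\<integral>\<^sup>+\<theta>. (\<Prod>i<m. ?g1 \<theta> (x (k + i))) \<partial>P) \<partial>?X)"
  proof (rule nn_integral_cong)
    fix x assume x: "x \<in> space ?X"
    have "(\<integral>\<^sup>+w. c * (\<integral>\<^sup>+\<theta>. (\<Prod>i<m. g \<theta> (x (k + i)) (w i)) \<partial>P) \<partial>?W)
        = c * (\<integral>\<^sup>+w. \<integral>\<^sup>+\<theta>. (\<Prod>i<m. g \<theta> (x (k + i)) (w i)) \<partial>P \<partial>?W)"
      using P.borel_measurable_nn_integral_fst[OF mW[OF x]] by (intro nn_integral_cmult) simp
    also have "(\<integral>\<^sup>+w. \<integral>\<^sup>+\<theta>. (\<Prod>i<m. g \<theta> (x (k + i)) (w i)) \<partial>P \<partial>?W) = (\<integral>\<^sup>+\<theta>. \<integral>\<^sup>+w. (\<Prod>i<m. g \<theta> (x (k + i)) (w i)) \<partial>?W \<partial>P)"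
      using WP.Fubini'[of "\<lambda>w \<theta>. \<Prod>i<m. g \<theta> (x (k + i)) (w i)"] mW[OF x] by (simp add: case_prod_beta')
    also have "\<dots> = (\<integral>\<^sup>+\<theta>. (\<Prod>i<m. ?g1 \<theta> (x (k + i))) \<partial>P)"
    proof (rule nn_integral_cong)
      fix \<theta> assume th: "\<theta> \<in> space P"
      have "g \<theta> (x (k + i)) \<in> borel_measurable G" if "i \<in> {..<m}" for i
        using x that by (intro gw[OF th]) (auto simp: space_PiM PiE_iff)
      thus "(\<integral>\<^sup>+w. (\<Prod>i<m. g \<theta> (x (k + i)) (w i)) \<partial>?W) = (\<Prod>i<m. ?g1 \<theta> (x (k + i)))"
        by (intro PG.product_nn_integral_prod) auto
    qed
    finally show "(\<integral>\<^sup>+w. c * (\<integral>\<^sup>+\<theta>. (\<Prod>i<m. g \<theta> (x (k + i)) (w i)) \<partial>P) \<partial>?W) = c * (\<integral>\<^sup>+\<theta>. (\<Prod>i<m. ?g1 \<theta> (x (k + i))) \<partial>P)" .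
  qed
  also have "\<dots> = c * (\<integral>\<^sup>+x. \<integral>\<^sup>+\<theta>. (\<Prod>i<m. ?g1 \<theta> (x (k + i))) \<partial>P \<partial>?X)"
    using P.borel_measurable_nn_integral_fst[OF mX] by (intro nn_integral_cmult) simp
  also have "(\<integral>\<^sup>+x. \<integral>\<^sup>+\<theta>. (\<Prod>i<m. ?g1 \<theta> (x (k + i))) \<partial>P \<partial>?X) = (\<integral>\<^sup>+\<theta>. \<integral>\<^sup>+x. (\<Prod>i<m. ?g1 \<theta> (x (k + i))) \<partial>?X \<partial>P)"
    using XP.Fubini'[of "\<lambda>x \<theta>. \<Prod>i<m. ?g1 \<theta> (x (k + i))"] mX by (simp add: case_prod_beta')
  also have "c * (\<integral>\<^sup>+\<theta>. \<integral>\<^sup>+x. (\<Prod>i<m. ?g1 \<theta> (x (k + i))) \<partial>?X \<partial>P) \<le> c * (\<integral>\<^sup>+\<theta>. 1 \<partial>P)"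
  proof (rule mult_left_mono[OF nn_integral_mono])
    fix \<theta> assume th: "\<theta> \<in> space P"
    have re: "(\<Prod>i<m. ?g1 \<theta> (x (k + i))) = (\<Prod>j\<in>{k..<k + m}. ?g1 \<theta> (x j))" for x
      by (rule prod.reindex_bij_witness[of _ "\<lambda>j. j - k" "\<lambda>i. k + i"]) auto
    have "(\<integral>\<^sup>+x. (\<Prod>i<m. ?g1 \<theta> (x (k + i))) \<partial>?X) = (\<Prod>j\<in>{k..<k + m}. \<integral>\<^sup>+x. ?g1 \<theta> x \<partial>T)"
      unfolding re by (intro PT.product_nn_integral_prod g1x th) auto
    also have "\<dots> \<le> 1" using le[OF th] by (intro prod_le_1) auto
    finally show "(\<integral>\<^sup>+x. (\<Prod>i<m. ?g1 \<theta> (x (k + i))) \<partial>?X) \<le> 1" .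
  qed simp
  also have "\<dots> = c" by (simp add: P.emeasure_space_1)
  finally show ?thesis .
qed

section \<open>The error of the local step in the weighted norm\<close>

locale weighted_smoothing = smoothing +
  fixes M :: "real mat"
  assumes fs: "finite_second_moments d f" and r_le: "r\<^sup>2 \<le> opnorm (cov_mat d f)"
    and M: "sym_psd d M" and M_nonzero: "M \<noteq> 0\<^sub>m d d"

abbreviation (in weighted_smoothing) rt :: "real mat" where "rt \<equiv> mat_sqrt M"
abbreviation (in weighted_smoothing) inv_fi :: "real mat" where "inv_fi \<equiv> mat_inv fi"
abbreviation (in weighted_smoothing) Bm :: "real mat" where "Bm \<equiv> rt * inv_fi * rt"
text \<open>By symmetry <theta, M^(1/2) I_R^(-1) s> = <\<open>dir\<close> theta, s>: testing the
  weighted estimation error against theta is testing the score against \<open>dir\<close>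
  theta.\<close>

abbreviation (in weighted_smoothing) dir :: "real vec \<Rightarrow> real vec" where
  "dir \<theta> \<equiv> inv_fi *\<^sub>v (rt *\<^sub>v \<theta>)"
abbreviation (in weighted_smoothing) kap :: real where
  "kap \<equiv> opnorm (cov_mat d f) / r\<^sup>2"

lemma (in weighted_smoothing) opnorm_cov_pos: "0 < opnorm (cov_mat d f)"
  using r r_le zero_less_power[OF r, of 2] by linarith

lemma (in weighted_smoothing) kap_ge_1: "1 \<le> kap"
  using r r_le by simp

lemma (in weighted_smoothing) fisher_pos:
  assumes v: "v \<in> carrier_vec d" "v \<noteq> 0\<^sub>v d"
  shows "0 < v \<bullet> (fi *\<^sub>v v)"
proof -
  have "v \<bullet> v \<noteq> 0" using v scalar_prod_self_eq_0 by blast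
  hence "0 < v \<bullet> v" using scalar_prod_self_nonneg[of v] by simp
  also note fisher_lower_bound[OF fs r_le v(1)]
  finally have "0 < 2 * opnorm (cov_mat d f) * (v \<bullet> (fi *\<^sub>v v))" .
  thus ?thesis using opnorm_cov_pos by (simp add: zero_less_mult_iff)
qed

lemma (in weighted_smoothing) inv_fi:
  "inv_fi \<in> carrier_mat d d" "fi * inv_fi = 1\<^sub>m d" "inv_fi * fi = 1\<^sub>m d" "transpose_mat inv_fi = inv_fi"
proof -
  note i = mat_inv_pos_def[OF fisher_carrier fisher_pos]
  show "inv_fi \<in> carrier_mat d d" by (rule i(1))
  show "fi * inv_fi = 1\<^sub>m d" by (rule i(2))
  show "inv_fi * fi = 1\<^sub>m d" by (rule i(3))
  show "transpose_mat inv_fi = inv_fi" by (rule transpose_mat_inv[OF fisher_carrier fisher_symmetric i])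
qed

lemma (in weighted_smoothing) rt:
  "rt \<in> carrier_mat d d" "transpose_mat rt = rt" "rt * rt = M"
  using mat_sqrt_psd[OF M] by (auto simp: sym_psd_def)

lemma (in weighted_smoothing) dir_carrier:
  "\<theta> \<in> carrier_vec d \<Longrightarrow> dir \<theta> \<in> carrier_vec d"
  by (intro mult_mat_vec_carrier[OF inv_fi(1)] mult_mat_vec_carrier[OF rt(1)])

lemma (in weighted_smoothing) fisher_dir:
  assumes "\<theta> \<in> carrier_vec d"
  shows "fi *\<^sub>v dir \<theta> = rt *\<^sub>v \<theta>"
proof -
  have c: "rt *\<^sub>v \<theta> \<in> carrier_vec d" by (rule mult_mat_vec_carrier[OF rt(1) assms])
  have "fi *\<^sub>v dir \<theta> = (fi * inv_fi) *\<^sub>v (rt *\<^sub>v \<theta>)"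
    by (rule assoc_mult_mat_vec[OF fisher_carrier inv_fi(1) c, symmetric])
  thus ?thesis using inv_fi(2) c by simp
qed

lemma (in weighted_smoothing) dir_scalar:
  assumes t: "\<theta> \<in> carrier_vec d" and x: "x \<in> carrier_vec d"
  shows "dir \<theta> \<bullet> x = (rt *\<^sub>v \<theta>) \<bullet> (inv_fi *\<^sub>v x)" "dir \<theta> \<bullet> x = \<theta> \<bullet> (rt *\<^sub>v (inv_fi *\<^sub>v x))"
    and "dir \<theta> \<bullet> (fi *\<^sub>v x) = (rt *\<^sub>v \<theta>) \<bullet> x"
proof -
  have c: "rt *\<^sub>v \<theta> \<in> carrier_vec d" by (rule mult_mat_vec_carrier[OF rt(1) t])
  have ix: "inv_fi *\<^sub>v x \<in> carrier_vec d" by (rule mult_mat_vec_carrier[OF inv_fi(1) x])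
  show 1: "dir \<theta> \<bullet> x = (rt *\<^sub>v \<theta>) \<bullet> (inv_fi *\<^sub>v x)"
    by (rule sym_scalar_prod_mult[OF inv_fi(1,4) c x, symmetric])
  show "dir \<theta> \<bullet> x = \<theta> \<bullet> (rt *\<^sub>v (inv_fi *\<^sub>v x))"
    unfolding 1 by (rule sym_scalar_prod_mult[OF rt(1,2) t ix, symmetric])
  show "dir \<theta> \<bullet> (fi *\<^sub>v x) = (rt *\<^sub>v \<theta>) \<bullet> x"
    using sym_scalar_prod_mult[OF fisher_carrier fisher_symmetric dir_carrier[OF t] x] fisher_dir[OF t] by simp
qed

lemma (in weighted_smoothing) Bm_mult:
  assumes t: "\<theta> \<in> carrier_vec d"
  shows "Bm *\<^sub>v \<theta> = rt *\<^sub>v dir \<theta>"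
proof -
  have c: "rt *\<^sub>v \<theta> \<in> carrier_vec d" by (rule mult_mat_vec_carrier[OF rt(1) t])
  have "Bm *\<^sub>v \<theta> = (rt * inv_fi) *\<^sub>v (rt *\<^sub>v \<theta>)"
    by (rule assoc_mult_mat_vec[OF mult_carrier_mat[OF rt(1) inv_fi(1)] rt(1) t])
  also have "\<dots> = rt *\<^sub>v dir \<theta>" by (rule assoc_mult_mat_vec[OF rt(1) inv_fi(1) c])
  finally show ?thesis .
qed

text \<open>\<open>fi\<close> maps \<open>dir\<close> theta back to M^(1/2) theta, so one of the two
  inverses cancels. The variance of the score tested against \<open>dir\<close> theta is thereby the
  form of the matrix whose trace and norm appear in the result.\<close>

lemma (in weighted_smoothing) Bm_form:
  assumes t: "\<theta> \<in> carrier_vec d"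
  shows "\<theta> \<bullet> (Bm *\<^sub>v \<theta>) = dir \<theta> \<bullet> (fi *\<^sub>v dir \<theta>)"
  unfolding Bm_mult[OF t] dir_scalar(3)[OF t dir_carrier[OF t]]
  by (rule sym_scalar_prod_mult[OF rt(1,2) t dir_carrier[OF t]])

lemma (in weighted_smoothing) Bm_carrier: "Bm \<in> carrier_mat d d"
  by (intro mult_carrier_mat[OF _ rt(1)] mult_carrier_mat[OF rt(1) inv_fi(1)])

lemma (in weighted_smoothing) Bm_psd: "sym_psd d Bm"
proof -
  have ri: "rt * inv_fi \<in> carrier_mat d d" by (rule mult_carrier_mat[OF rt(1) inv_fi(1)])
  have "transpose_mat Bm = rt * (inv_fi * rt)"
    unfolding transpose_mult[OF ri rt(1)] transpose_mult[OF rt(1) inv_fi(1)] rt(2) inv_fi(4) ..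
  also have "\<dots> = Bm" by (rule assoc_mult_mat[OF rt(1) inv_fi(1) rt(1), symmetric])
  finally have "transpose_mat Bm = Bm" .
  moreover have "0 \<le> \<theta> \<bullet> (Bm *\<^sub>v \<theta>)" if t: "\<theta> \<in> carrier_vec d" for \<theta>
    unfolding Bm_form[OF t] fisher_form_square[OF dir_carrier[OF t]] by simp
  ultimately show ?thesis using Bm_carrier by (auto simp: sym_psd_def)
qed

text \<open>A nonzero M has a square root with a nonzero column. Since \<open>fi\<close> maps
  \<open>dir\<close> theta back to M^(1/2) theta, the corresponding direction is nonzero and has
  positive Fisher form. Both d_R and the scale \<open>t\<close> of the deviation bound divide by
  this norm.\<close>

lemma (in weighted_smoothing) opnorm_Bm_pos: "0 < opnorm Bm"
proof -
  have "\<exists>j<d. rt *\<^sub>v unit_vec d j \<noteq> 0\<^sub>v d"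
  proof (rule ccontr)
    assume "\<not> ?thesis"
    hence z: "rt *\<^sub>v unit_vec d j = 0\<^sub>v d" if "j < d" for j using that by blast
    have "rt $$ (i, j) = 0" if "i < d" "j < d" for i j
      using arg_cong[OF z[OF that(2)], of "\<lambda>v. v $ i"] rt(1) that by simp
    hence "rt = 0\<^sub>m d d" using rt(1) by (intro eq_matI) auto
    hence "M = 0\<^sub>m d d" using rt(3) by simp
    with M_nonzero show False by simp
  qed
  then obtain j where j: "j < d" "rt *\<^sub>v unit_vec d j \<noteq> 0\<^sub>v d" by blast
  let ?t = "unit_vec d j"
  have t: "?t \<in> carrier_vec d" by simp
  have "dir ?t \<noteq> 0\<^sub>v d"
  proof
    assume "dir ?t = 0\<^sub>v d"
    with fisher_dir[OF t] have "rt *\<^sub>v ?t = fi *\<^sub>v 0\<^sub>v d" by simp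
    moreover have "A *\<^sub>v 0\<^sub>v d = 0\<^sub>v d" if "A \<in> carrier_mat d d" for A :: "real mat" using that by auto
    ultimately show False using j fisher_carrier by metis
  qed
  hence "0 < ?t \<bullet> (Bm *\<^sub>v ?t)" unfolding Bm_form[OF t] by (intro fisher_pos dir_carrier t)
  also have "\<dots> \<le> opnorm Bm * (vnorm ?t)\<^sup>2" by (rule quadratic_form_le_opnorm[OF Bm_carrier t])
  finally show ?thesis using opnorm_nonneg[OF Bm_carrier] by (cases "opnorm Bm = 0") auto
qed

lemma (in weighted_smoothing) d_eff_Bm_ge_1: "1 \<le> d_eff Bm"
  using opnorm_le_tr[OF Bm_psd] opnorm_Bm_pos by (simp add: d_eff_def)

text \<open>The mixture over \<open>\<theta>\<close> of this likelihood-ratio-like process is what the PAC-Bayes bound controls.\<close>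

definition (in weighted_smoothing) weight :: "real \<Rightarrow> real \<Rightarrow> real vec \<Rightarrow> real vec \<Rightarrow> real vec \<Rightarrow> real" where
  "weight h t e \<theta> u = exp (t * (dir \<theta> \<bullet> shifted_mean e) - t * (dir \<theta> \<bullet> sc u)
     - (1 + 5 * h) / 2 * t\<^sup>2 * (\<theta> \<bullet> (Bm *\<^sub>v \<theta>)) - 80 * exp 18 * kap\<^sup>2 / h * t ^ 4 * (\<theta> \<bullet> (Bm *\<^sub>v \<theta>))\<^sup>2)"

lemma (in weighted_smoothing) shifted_mean_carrier: "shifted_mean e \<in> carrier_vec d"
  by (simp add: shifted_mean_def)

text \<open>The exponent of \<open>weight\<close> subtracts exactly the logarithm of the bound in
  \<open>shifted_mgf\<close> at v = t times \<open>dir\<close> theta, where the Fisher form is t^2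
  times the form of \<open>Bm\<close>.\<close>

lemma (in weighted_smoothing) weight_integral_le:
  assumes e: "e \<in> carrier_vec d" and er: "vnorm e \<le> r" and h: "0 < h" "h \<le> 1"
    and ek: "(vnorm e / r)\<^sup>2 * (200 * exp 40 * kap) \<le> h\<^sup>2" and \<theta>: "\<theta> \<in> carrier_vec d"
  shows "(\<integral>\<^sup>+z. ennreal (weight h t e \<theta> (fst z + snd z - e)) \<partial>joint) \<le> 1"
proof -
  let ?v = "t \<cdot>\<^sub>v dir \<theta>" and ?b = "\<theta> \<bullet> (Bm *\<^sub>v \<theta>)"
  have dc: "dir \<theta> \<in> carrier_vec d" by (rule dir_carrier[OF \<theta>])
  have v: "?v \<in> carrier_vec d" using dc by simp
  have fd: "fi *\<^sub>v dir \<theta> \<in> carrier_vec d" by (rule mult_mat_vec_carrier[OF fisher_carrier dc])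
  have J: "?v \<bullet> (fi *\<^sub>v ?v) = t\<^sup>2 * ?b"
    unfolding Bm_form[OF \<theta>] mult_mat_vec[OF fisher_carrier dc] using dc fd by (simp add: power2_eq_square)
  have vs: "?v \<bullet> x = t * (dir \<theta> \<bullet> x)" if "x \<in> carrier_vec d" for x using dc that by simp
  have lower: "?v \<bullet> ?v / r\<^sup>2 \<le> 2 * kap * (?v \<bullet> (fi *\<^sub>v ?v))"
    using divide_right_mono[OF fisher_lower_bound[OF fs r_le v], of "r\<^sup>2"] by simp
  let ?c = "(1 + 5 * h) / 2 * (t\<^sup>2 * ?b) + 80 * exp 18 * kap\<^sup>2 / h * (t\<^sup>2 * ?b)\<^sup>2"
  let ?C = "t * (dir \<theta> \<bullet> shifted_mean e) - ?c"
  have m: "(\<lambda>z. exp (- (?v \<bullet> sc (fst z + snd z - e)))) \<in> borel_measurable joint"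
  proof -
    have "(\<lambda>z. fst z + snd z - e) \<in> joint \<rightarrow>\<^sub>M vborel d"
      by (intro measurable_vec_diff sum_measurable measurable_vec_const e)
    from measurable_compose[OF this scalar_score_measurable(1)[OF v]] show ?thesis by simp
  qed
  have "(\<integral>\<^sup>+z. ennreal (weight h t e \<theta> (fst z + snd z - e)) \<partial>joint)
      = (\<integral>\<^sup>+z. ennreal (exp ?C) * ennreal (exp (- (?v \<bullet> sc (fst z + snd z - e)))) \<partial>joint)"
  proof (rule nn_integral_cong)
    fix z :: "real vec \<times> real vec"
    have "t * (dir \<theta> \<bullet> shifted_mean e) - t * (dir \<theta> \<bullet> sc (fst z + snd z - e))
     - (1 + 5 * h) / 2 * t\<^sup>2 * ?b - 80 * exp 18 * kap\<^sup>2 / h * t ^ 4 * ?b\<^sup>2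
      = ?C + - (?v \<bullet> sc (fst z + snd z - e))"
      unfolding vs[OF score_carrier] power_mult_distrib power_mult[symmetric] by simp
    hence w: "weight h t e \<theta> (fst z + snd z - e) = exp (?C + - (?v \<bullet> sc (fst z + snd z - e)))"
      unfolding weight_def by (rule arg_cong)
    show "ennreal (weight h t e \<theta> (fst z + snd z - e)) = ennreal (exp ?C) * ennreal (exp (- (?v \<bullet> sc (fst z + snd z - e))))"
      unfolding w exp_add[of ?C] by (rule ennreal_mult[OF exp_ge_zero exp_ge_zero])
  qed
  also have "\<dots> = ennreal (exp ?C) * (\<integral>\<^sup>+z. ennreal (exp (- (?v \<bullet> sc (fst z + snd z - e)))) \<partial>joint)"
    using m by (intro nn_integral_cmult) simp
  also have "\<dots> \<le> ennreal (exp ?C) * ennreal (exp (- (?v \<bullet> shifted_mean e) + (1 + 5 * h) / 2 * (?v \<bullet> (fi *\<^sub>v ?v)) + 80 * exp 18 * kap\<^sup>2 / h * (?v \<bullet> (fi *\<^sub>v ?v))\<^sup>2))"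
    using kap_ge_1 by (intro mult_left_mono shifted_mgf v e er h lower ek) auto
  also have "\<dots> = ennreal (exp (?C + (- (?v \<bullet> shifted_mean e) + (1 + 5 * h) / 2 * (?v \<bullet> (fi *\<^sub>v ?v)) + 80 * exp 18 * kap\<^sup>2 / h * (?v \<bullet> (fi *\<^sub>v ?v))\<^sup>2)))"
    unfolding exp_add[of ?C] by (rule ennreal_mult[OF exp_ge_zero exp_ge_zero, symmetric])
  also have "?C + (- (?v \<bullet> shifted_mean e) + (1 + 5 * h) / 2 * (?v \<bullet> (fi *\<^sub>v ?v)) + 80 * exp 18 * kap\<^sup>2 / h * (?v \<bullet> (fi *\<^sub>v ?v))\<^sup>2) = 0"
    unfolding J vs[OF shifted_mean_carrier] by simp
  finally show ?thesis by simp
qed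

lemma (in weighted_smoothing) dir_measurable: "g \<in> N \<rightarrow>\<^sub>M vborel d \<Longrightarrow> (\<lambda>x. dir (g x)) \<in> N \<rightarrow>\<^sub>M vborel d"
  by (intro measurable_mult_mat_vec[OF inv_fi(1)] measurable_mult_mat_vec[OF rt(1)])

lemma (in weighted_smoothing) weight_measurable:
  assumes g: "g \<in> N \<rightarrow>\<^sub>M vborel d" and u: "u \<in> N \<rightarrow>\<^sub>M vborel d"
  shows "(\<lambda>x. weight h t e (g x) (u x)) \<in> borel_measurable N"
proof -
  have 1: "(\<lambda>x. dir (g x) \<bullet> shifted_mean e) \<in> borel_measurable N"
    by (rule measurable_scalar_prod[OF dir_measurable[OF g] measurable_vec_const[OF shifted_mean_carrier]])
  have 2: "(\<lambda>x. dir (g x) \<bullet> sc (u x)) \<in> borel_measurable N"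
    by (rule measurable_scalar_prod[OF dir_measurable[OF g] measurable_compose[OF u score_measurable]])
  have 3: "(\<lambda>x. g x \<bullet> (Bm *\<^sub>v g x)) \<in> borel_measurable N"
    by (rule psd_form_measurable[OF Bm_carrier g])
  show ?thesis unfolding weight_def using 1 2 3 by measurable
qed

text \<open>The product of the weights is the exponential of a linear functional of theta minus
  multiples of the form of \<open>Bm\<close> and of its square, which is the shape that
  \<open>pac_bayes\<close> accepts. A single bound on the mixture thus serves every direction
  \<open>a\<close> of length at most 1 simultaneously.\<close>

lemma (in weighted_smoothing) weight_mixture_bound:
  assumes K: "0 < K" and s: "0 < s" and h: "0 < h" and a: "a \<in> carrier_vec d" "vnorm a \<le> 1"
    and le: "(\<integral>\<^sup>+\<theta>. (\<Prod>i<m. ennreal (weight h t e \<theta> (u i))) \<partial>gauss d (iso_cov d s)) \<le> ennreal K"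
  shows "t * (\<Sum>i<m. dir a \<bullet> shifted_mean e - dir a \<bullet> sc (u i)) \<le> ln K + 1 / (2 * s\<^sup>2)
     + real m * ((1 + 5 * h) / 2 * t\<^sup>2) * (opnorm Bm + s\<^sup>2 * tr Bm)
     + real m * (80 * exp 18 * kap\<^sup>2 / h * t ^ 4) * (8 * (opnorm Bm)\<^sup>2 + 768 * (s\<^sup>2 * tr Bm)\<^sup>2)"
proof -
  let ?c1 = "real m * ((1 + 5 * h) / 2 * t\<^sup>2)" and ?c2 = "real m * (80 * exp 18 * kap\<^sup>2 / h * t ^ 4)"
  \<comment> \<open>\<open>D\<close> is t times the sum of the centred scores; \<open>?L\<close>
    represents it as a functional of theta instead of \<open>dir\<close> theta.\<close>
  define D where "D = vec d (\<lambda>j. t * (\<Sum>i<m. shifted_mean e $ j - sc (u i) $ j))"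
  let ?L = "rt *\<^sub>v (inv_fi *\<^sub>v D)"
  have D: "D \<in> carrier_vec d" by (simp add: D_def)
  have Lc: "?L \<in> carrier_vec d"
    by (intro mult_mat_vec_carrier[OF rt(1)] mult_mat_vec_carrier[OF inv_fi(1)] D)
  have L: "?L \<bullet> \<theta> = t * (\<Sum>i<m. dir \<theta> \<bullet> shifted_mean e - dir \<theta> \<bullet> sc (u i))" if \<theta>: "\<theta> \<in> carrier_vec d" for \<theta>
  proof -
    have "?L \<bullet> \<theta> = dir \<theta> \<bullet> D"
      using comm_scalar_prod[OF Lc \<theta>] dir_scalar(2)[OF \<theta> D] by simp
    also have "\<dots> = (\<Sum>j<d. dir \<theta> $ j * (t * (\<Sum>i<m. shifted_mean e $ j - sc (u i) $ j)))"
      unfolding scalar_prod_lt[OF D] by (intro sum.cong refl) (simp add: D_def)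
    also have "\<dots> = t * (\<Sum>j<d. \<Sum>i<m. dir \<theta> $ j * (shifted_mean e $ j - sc (u i) $ j))"
      by (simp only: sum_distrib_left mult.left_commute)
    also have "(\<Sum>j<d. \<Sum>i<m. dir \<theta> $ j * (shifted_mean e $ j - sc (u i) $ j))
        = (\<Sum>i<m. \<Sum>j<d. dir \<theta> $ j * (shifted_mean e $ j - sc (u i) $ j))" by (rule sum.swap)
    also have "\<dots> = (\<Sum>i<m. dir \<theta> \<bullet> shifted_mean e - dir \<theta> \<bullet> sc (u i))"
      unfolding scalar_prod_lt[OF shifted_mean_carrier] scalar_prod_lt[OF score_carrier]
      by (simp only: right_diff_distrib sum_subtractf)
    finally show ?thesis .
  qed
  have "(\<integral>\<^sup>+\<theta>. ennreal (exp (?L \<bullet> \<theta> - ?c1 * (\<theta> \<bullet> (Bm *\<^sub>v \<theta>)) - ?c2 * (\<theta> \<bullet> (Bm *\<^sub>v \<theta>))\<^sup>2)) \<partial>gauss d (iso_cov d s))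
      = (\<integral>\<^sup>+\<theta>. (\<Prod>i<m. ennreal (weight h t e \<theta> (u i))) \<partial>gauss d (iso_cov d s))"
  proof (rule nn_integral_cong)
    fix \<theta> assume "\<theta> \<in> space (gauss d (iso_cov d s))"
    hence \<theta>: "\<theta> \<in> carrier_vec d" by simp
    let ?b = "\<theta> \<bullet> (Bm *\<^sub>v \<theta>)"
    let ?q = "(1 + 5 * h) / 2 * t\<^sup>2 * ?b" and ?q' = "80 * exp 18 * kap\<^sup>2 / h * t ^ 4 * ?b\<^sup>2"
    have "(\<Prod>i<m. ennreal (weight h t e \<theta> (u i))) = ennreal (\<Prod>i<m. weight h t e \<theta> (u i))"
      by (rule prod_ennreal) (simp add: weight_def)
    also have "(\<Prod>i<m. weight h t e \<theta> (u i)) = exp (\<Sum>i<m. t * (dir \<theta> \<bullet> shifted_mean e) - t * (dir \<theta> \<bullet> sc (u i)) - ?q - ?q')"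
      unfolding weight_def by (rule exp_sum[symmetric]) simp
    also have "(\<Sum>i<m. t * (dir \<theta> \<bullet> shifted_mean e) - t * (dir \<theta> \<bullet> sc (u i)) - ?q - ?q')
        = t * (\<Sum>i<m. dir \<theta> \<bullet> shifted_mean e - dir \<theta> \<bullet> sc (u i)) - real m * ?q - real m * ?q'"
      by (simp add: sum_subtractf sum_distrib_left[symmetric] right_diff_distrib del: index_mult_mat_vec)
    also have "\<dots> = ?L \<bullet> \<theta> - ?c1 * ?b - ?c2 * ?b\<^sup>2" unfolding L[OF \<theta>] by (simp only: mult.assoc)
    finally show "ennreal (exp (?L \<bullet> \<theta> - ?c1 * ?b - ?c2 * ?b\<^sup>2)) = (\<Prod>i<m. ennreal (weight h t e \<theta> (u i)))" by simp
  qed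
  with le have le': "(\<integral>\<^sup>+\<theta>. ennreal (exp (?L \<bullet> \<theta> - ?c1 * (\<theta> \<bullet> (Bm *\<^sub>v \<theta>)) - ?c2 * (\<theta> \<bullet> (Bm *\<^sub>v \<theta>))\<^sup>2)) \<partial>gauss d (iso_cov d s)) \<le> ennreal K" by simp
  have c0: "0 \<le> ?c1" "0 \<le> ?c2" using h by auto
  have aa: "a \<bullet> a \<le> 1" using a power_mono[OF a(2) vnorm_nonneg, of 2] by (simp add: vnorm_square)
  have b: "0 \<le> a \<bullet> (Bm *\<^sub>v a)" "a \<bullet> (Bm *\<^sub>v a) \<le> opnorm Bm"
  proof -
    show "0 \<le> a \<bullet> (Bm *\<^sub>v a)" using Bm_psd a by (simp add: sym_psd_def)
    have "a \<bullet> (Bm *\<^sub>v a) \<le> opnorm Bm * (vnorm a)\<^sup>2" by (rule quadratic_form_le_opnorm[OF Bm_carrier a(1)])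
    also have "\<dots> \<le> opnorm Bm * 1" using aa opnorm_Bm_pos by (intro mult_left_mono) (auto simp: vnorm_square)
    finally show "a \<bullet> (Bm *\<^sub>v a) \<le> opnorm Bm" by simp
  qed
  have "?L \<bullet> a \<le> ln K + (a \<bullet> a) / (2 * s\<^sup>2) + ?c1 * (a \<bullet> (Bm *\<^sub>v a) + s\<^sup>2 * tr Bm)
      + ?c2 * (8 * (a \<bullet> (Bm *\<^sub>v a))\<^sup>2 + 768 * (s\<^sup>2 * tr Bm)\<^sup>2)"
    by (rule pac_bayes[OF s Bm_psd Lc a(1) c0(2) K le'])
  also have "\<dots> \<le> ln K + 1 / (2 * s\<^sup>2) + ?c1 * (opnorm Bm + s\<^sup>2 * tr Bm) + ?c2 * (8 * (opnorm Bm)\<^sup>2 + 768 * (s\<^sup>2 * tr Bm)\<^sup>2)"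
    using aa b c0 s by (intro add_mono mult_left_mono divide_right_mono power_mono order_refl) auto
  finally show ?thesis unfolding L[OF a(1)] .
qed

text \<open>The choice of \<open>t\<close> and of the prior variance \<open>\<sigma>\<close> that balances the PAC-Bayes bound.\<close>

lemma balance_pac_bayes:
  fixes \<tau> \<beta> L m h c t \<sigma> :: real
  assumes pos: "0 < \<beta>" "\<beta> \<le> \<tau>" "0 < L" "0 < m" "0 < h" "0 \<le> c"
    and t: "t = sqrt (L / (m * \<beta>))" and \<sigma>: "\<sigma> = 1 / (t * sqrt (m * \<tau>))"
    and c: "768 * c * (L + \<tau> / \<beta>) \<le> h * m" and K: "K \<le> L"
  shows "(K + 1 / (2 * \<sigma>) + m * ((1 + 5 * h) / 2 * t\<^sup>2) * (\<beta> + \<sigma> * \<tau>) + m * (c * t ^ 4) * (8 * \<beta>\<^sup>2 + 768 * (\<sigma> * \<tau>)\<^sup>2)) / (m * t)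
    \<le> (1 + 4 * h) * (sqrt (\<tau> / m) + 2 * sqrt (\<beta> * L / m))"
proof -
  \<comment> \<open>The choice of t makes \<open>L / (m * t)\<close> and \<open>t * \<beta>\<close>
    both equal to \<open>?X\<close>; that of the prior variance makes
    \<open>1 / (2 * \<sigma>) / (m * t)\<close> equal to \<open>?Y / 2\<close> and
    \<open>t * (\<sigma> * \<tau>)\<close> equal to \<open>?Y\<close>. To leading order the sum is
    therefore ?Y / 2 + ?Y / 2 plus ?X + ?X / 2, so the trace term has coefficient 1.\<close>
  let ?X = "sqrt (\<beta> * L / m)" and ?Y = "sqrt (\<tau> / m)"
  have \<tau>: "0 < \<tau>" using pos by linarith
  have t0: "0 < t" unfolding t using pos by simp
  have X0: "0 < ?X" and Y0: "0 < ?Y" using pos \<tau> by auto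
  have t2: "t\<^sup>2 = L / (m * \<beta>)" unfolding t using pos by simp
  have tb: "t * \<beta> = ?X"
  proof -
    have "(t * \<beta>)\<^sup>2 = \<beta> * L / m" unfolding power_mult_distrib t2 using pos by (simp add: power2_eq_square)
    thus ?thesis using t0 pos by (metis real_sqrt_unique mult_nonneg_nonneg less_imp_le)
  qed
  have Lt: "L / (m * t) = ?X"
  proof -
    have "L = t\<^sup>2 * (m * \<beta>)" unfolding t2 using pos by simp
    hence "L / (m * t) = t * \<beta>" using t0 pos by (simp add: power2_eq_square field_simps)
    thus ?thesis unfolding tb .
  qed
  have sm: "sqrt (m * \<tau>) = m * ?Y"
  proof -
    have "m * ?Y = sqrt (m\<^sup>2 * (\<tau> / m))" by (subst real_sqrt_mult) (use pos in simp)
    also have "m\<^sup>2 * (\<tau> / m) = m * \<tau>" using pos by (simp add: power2_eq_square)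
    finally show ?thesis ..
  qed
  have YY: "?Y * ?Y = \<tau> / m" using \<tau> pos by simp
  have \<sigma>0: "0 < \<sigma>" unfolding \<sigma> using t0 pos \<tau> by simp
  have \<sigma>': "\<sigma> = 1 / (t * (m * ?Y))" unfolding \<sigma> sm ..
  have st: "\<sigma> * \<tau> = ?Y / t"
  proof -
    have "\<tau> = m * (?Y * ?Y)" using YY pos by simp
    hence A: "\<sigma> * \<tau> = (m * (?Y * ?Y)) / (t * (m * ?Y))" unfolding \<sigma>' by simp
    have B: "(m * (y * y)) / (t * (m * y)) = y / t" if "0 < y" for y
      using that pos t0 by (simp add: field_simps)
    show ?thesis by (rule trans[OF A B[OF Y0]])
  qed
  have half: "1 / (2 * \<sigma>) / (m * t) = ?Y / 2" unfolding \<sigma>' using pos t0 Y0 by (simp add: field_simps)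
  have lin: "m * ((1 + 5 * h) / 2 * t\<^sup>2) * (\<beta> + \<sigma> * \<tau>) / (m * t) = (1 + 5 * h) / 2 * (?X + ?Y)"
  proof -
    have "m * ((1 + 5 * h) / 2 * t\<^sup>2) * (\<beta> + \<sigma> * \<tau>) / (m * t) = (1 + 5 * h) / 2 * (t * \<beta> + t * (\<sigma> * \<tau>))"
      using pos t0 by (simp add: power2_eq_square field_simps)
    thus ?thesis unfolding tb st using t0 by simp
  qed
  have tX: "t * ?X = L / m"
    unfolding tb[symmetric] using t2 pos by (simp add: power2_eq_square field_simps)
  have tY: "t * ?Y \<le> (L + \<tau> / \<beta>) / m"
  proof -
    have "t * ?Y = sqrt (L * (\<tau> / \<beta>)) / m"
    proof -
      have "t * ?Y = sqrt (L / (m * \<beta>) * (\<tau> / m))" unfolding t real_sqrt_mult ..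
      also have "L / (m * \<beta>) * (\<tau> / m) = L * (\<tau> / \<beta>) / m\<^sup>2" by (simp add: power2_eq_square)
      also have "sqrt \<dots> = sqrt (L * (\<tau> / \<beta>)) / m" by (subst real_sqrt_divide) (use pos in simp)
      finally show ?thesis .
    qed
    also have "sqrt (L * (\<tau> / \<beta>)) \<le> L + \<tau> / \<beta>"
    proof (rule real_le_lsqrt)
      have "0 \<le> \<tau> / \<beta>" using pos \<tau> by simp
      thus "0 \<le> L + \<tau> / \<beta>" using pos by simp
      have "x * y \<le> (x + y)\<^sup>2" if "0 \<le> x" "0 \<le> y" for x y :: real
        using mult_nonneg_nonneg[OF that] zero_le_power2[of x] zero_le_power2[of y]
        unfolding power2_sum by linarith
      from this[OF less_imp_le[OF pos(3)] \<open>0 \<le> \<tau> / \<beta>\<close>] show "L * (\<tau> / \<beta>) \<le> (L + \<tau> / \<beta>)\<^sup>2" .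
    qed
    finally show ?thesis using pos by (simp add: divide_right_mono)
  qed
  have quart: "m * (c * t ^ 4) * (8 * \<beta>\<^sup>2 + 768 * (\<sigma> * \<tau>)\<^sup>2) / (m * t) = 8 * c * (t * ?X) * ?X + 768 * c * (t * ?Y) * ?Y"
  proof -
    have "m * (c * t ^ 4) * (8 * \<beta>\<^sup>2 + 768 * (\<sigma> * \<tau>)\<^sup>2) / (m * t) = 8 * c * (t * (t * \<beta>)) * (t * \<beta>) + 768 * c * (t * (t * (\<sigma> * \<tau>))) * (t * (\<sigma> * \<tau>))"
      using pos t0 by (simp add: power2_eq_square power4_eq_xxxx field_simps)
    thus ?thesis unfolding tb st using t0 by simp
  qed
  have q1: "8 * c * (t * ?X) * ?X \<le> h * ?X"
  proof -
    have "0 \<le> \<tau> / \<beta>" using pos \<tau> by simp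
    hence "8 * c * L \<le> 768 * c * (L + \<tau> / \<beta>)" using pos by (intro mult_mono) auto
    hence "8 * c * L \<le> h * m" using c by linarith
    hence "8 * c * (t * ?X) \<le> h" unfolding tX using pos by (simp add: field_simps)
    thus ?thesis using X0 by (intro mult_right_mono) auto
  qed
  have q2: "768 * c * (t * ?Y) * ?Y \<le> h * ?Y"
  proof -
    have "768 * c * (t * ?Y) \<le> 768 * c * ((L + \<tau> / \<beta>) / m)" using tY pos by (intro mult_left_mono) auto
    also have "\<dots> = 768 * c * (L + \<tau> / \<beta>) / m" by simp
    also have "\<dots> \<le> h" using c pos by (simp add: divide_le_eq)
    finally show ?thesis using Y0 by (intro mult_right_mono) auto
  qed
  have Kt: "K / (m * t) \<le> ?X" unfolding Lt[symmetric] using K pos t0 by (intro divide_right_mono) auto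
  have split: "(p + q + u + v) / x = p / x + q / x + u / x + v / x" for p q u v x :: real
    by (simp add: add_divide_distrib)
  have collect: "x + y / 2 + (1 + 5 * h) / 2 * (x + y) + (h * x + h * y) = (1 + 7 / 2 * h) * y + (3 / 2 + 7 / 2 * h) * x" for x y
    by (simp add: field_simps)
  have "(K + 1 / (2 * \<sigma>) + m * ((1 + 5 * h) / 2 * t\<^sup>2) * (\<beta> + \<sigma> * \<tau>) + m * (c * t ^ 4) * (8 * \<beta>\<^sup>2 + 768 * (\<sigma> * \<tau>)\<^sup>2)) / (m * t)
      = K / (m * t) + ?Y / 2 + (1 + 5 * h) / 2 * (?X + ?Y) + (8 * c * (t * ?X) * ?X + 768 * c * (t * ?Y) * ?Y)"
    unfolding split half lin quart ..
  also have "\<dots> \<le> ?X + ?Y / 2 + (1 + 5 * h) / 2 * (?X + ?Y) + (h * ?X + h * ?Y)"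
    using Kt q1 q2 by (intro add_mono order_refl)
  also have "\<dots> = (1 + 7 / 2 * h) * ?Y + (3 / 2 + 7 / 2 * h) * ?X" by (rule collect)
  \<comment> \<open>The coefficient 3/2 is rounded up to 2, within the 4 that the final bound
    allows.\<close>
  also have "\<dots> \<le> (1 + 4 * h) * ?Y + (2 + 8 * h) * ?X"
    using pos X0 Y0 by (intro add_mono mult_right_mono) auto
  also have "\<dots> = (1 + 4 * h) * (?Y + 2 * ?X)" by (simp add: algebra_simps)
  finally show ?thesis .
qed

lemma (in weighted_smoothing) local_mle_nth:
  assumes l1: "l1 \<in> carrier_vec d"
  shows "local_mle d f (iso_cov d r) m x w l1 \<in> carrier_vec d"
    and "j < d \<Longrightarrow> local_mle d f (iso_cov d r) m x w l1 $ j
      = l1 $ j - (1 / real m) * (\<Sum>i<m. (inv_fi *\<^sub>v sc (x i + w i - l1)) $ j)"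
proof -
  have c: "inv_fi *\<^sub>v sc u \<in> carrier_vec d" for u by (rule mult_mat_vec_carrier[OF inv_fi(1) score_carrier])
  have fc: "finsum_vec TYPE(real) d (\<lambda>i. inv_fi *\<^sub>v sc (x i + w i - l1)) {..<m} \<in> carrier_vec d"
    by (intro finsum_vec_closed) (use c in auto)
  show "local_mle d f (iso_cov d r) m x w l1 \<in> carrier_vec d"
    unfolding local_mle_def using l1 fc by simp
  assume j: "j < d"
  show "local_mle d f (iso_cov d r) m x w l1 $ j
      = l1 $ j - (1 / real m) * (\<Sum>i<m. (inv_fi *\<^sub>v sc (x i + w i - l1)) $ j)"
    unfolding local_mle_def using l1 fc j c
    by (simp add: index_finsum_vec[OF _ j, of "{..<m}"] del: index_mult_mat_vec)
qed

text \<open>The weighted norm of the error is its scalar product, after multiplication by M^(1/2),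
  with the unit vector along it. This vector depends on the data, hence a bound for all
  \<open>a\<close>. What remains is the bias, which is the difference of the Fisher form and the
  shifted mean, plus the centred fluctuation.\<close>

lemma (in weighted_smoothing) local_mle_error:
  assumes l: "l \<in> carrier_vec d" and l1: "l1 \<in> carrier_vec d" and m: "0 < m" and t: "0 < t"
    and er: "vnorm (l1 - l) \<le> r"
    and bound: "\<And>a. a \<in> carrier_vec d \<Longrightarrow> vnorm a \<le> 1 \<Longrightarrow>
      t * (\<Sum>i<m. dir a \<bullet> shifted_mean (l1 - l) - dir a \<bullet> sc (x i + w i - l1)) \<le> b"
    and b: "0 \<le> b"
  shows "mnorm M (local_mle d f (iso_cov d r) m x w l1 - l)
    \<le> 18 * exp 12 * (vnorm (l1 - l) / r)\<^sup>2 * sqrt (opnorm Bm) + b / (real m * t)"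
proof -
  let ?e = "l1 - l" and ?u = "\<lambda>i. x i + w i - l1"
  let ?est = "local_mle d f (iso_cov d r) m x w l1"
  have e: "?e \<in> carrier_vec d" using l l1 by simp
  have lm: "?est - l \<in> carrier_vec d" using local_mle_nth(1)[OF l1] l by simp
  let ?y = "rt *\<^sub>v (?est - l)"
  have y: "?y \<in> carrier_vec d" by (rule mult_mat_vec_carrier[OF rt(1) lm])
  \<comment> \<open>For a vanishing error this is the zero vector, and \<open>ay\<close> still
    holds.\<close>
  define a where "a = normalize_vec ?y"
  have a: "a \<in> carrier_vec d" unfolding a_def by (rule normalize_vec(1)[OF y])
  have a1: "vnorm a \<le> 1"
    using normalize_vec(2)[OF y] by (simp add: a_def vnorm_def)
  have ay: "a \<bullet> ?y = vnorm ?y"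
  proof (cases "vnorm ?y = 0")
    case True
    hence y0: "?y = 0\<^sub>v d" by (rule vnorm_eq_0[OF y])
    show ?thesis unfolding y0 using a by simp
  next
    case False
    have "vnorm ?y * (a \<bullet> ?y) = vnorm ?y * vnorm ?y"
      using normalize_vec(3)[OF y y] vnorm_square[of ?y] by (simp only: a_def power2_eq_square)
    thus ?thesis using False by simp
  qed
  have ra: "rt *\<^sub>v a \<in> carrier_vec d" by (rule mult_mat_vec_carrier[OF rt(1) a])
  have "a \<bullet> ?y = (rt *\<^sub>v a) \<bullet> (?est - l)" by (rule sym_scalar_prod_mult[OF rt(1,2) a lm])
  also have "\<dots> = (\<Sum>j<d. (rt *\<^sub>v a) $ j * (?e $ j - (1 / real m) * (\<Sum>i<m. (inv_fi *\<^sub>v sc (?u i)) $ j)))"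
    unfolding scalar_prod_lt[OF lm]
    using local_mle_nth(2)[OF l1] l l1 by (intro sum.cong refl) (auto simp del: index_mult_mat_vec)
  also have "\<dots> = (\<Sum>j<d. (rt *\<^sub>v a) $ j * ?e $ j) - (1 / real m) * (\<Sum>j<d. \<Sum>i<m. (rt *\<^sub>v a) $ j * (inv_fi *\<^sub>v sc (?u i)) $ j)"
    by (simp only: right_diff_distrib sum_subtractf sum_distrib_left mult.left_commute)
  also have "(\<Sum>j<d. \<Sum>i<m. (rt *\<^sub>v a) $ j * (inv_fi *\<^sub>v sc (?u i)) $ j) = (\<Sum>i<m. \<Sum>j<d. (rt *\<^sub>v a) $ j * (inv_fi *\<^sub>v sc (?u i)) $ j)"
    by (rule sum.swap)
  also have "\<dots> = (\<Sum>i<m. dir a \<bullet> sc (?u i))"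
    using dir_scalar(1)[OF a score_carrier] scalar_prod_lt[OF mult_mat_vec_carrier[OF inv_fi(1) score_carrier]]
    by (simp only:)
  also have "(\<Sum>j<d. (rt *\<^sub>v a) $ j * ?e $ j) = dir a \<bullet> (fi *\<^sub>v ?e)"
    unfolding dir_scalar(3)[OF a e] scalar_prod_lt[OF e] ..
  finally have 1: "vnorm ?y = dir a \<bullet> (fi *\<^sub>v ?e) - (1 / real m) * (\<Sum>i<m. dir a \<bullet> sc (?u i))" unfolding ay .
  have 2: "(\<Sum>i<m. dir a \<bullet> shifted_mean ?e - dir a \<bullet> sc (?u i)) = real m * (dir a \<bullet> shifted_mean ?e) - (\<Sum>i<m. dir a \<bullet> sc (?u i))"
    by (simp add: sum_subtractf del: index_mult_mat_vec)
  have 3: "(\<Sum>i<m. dir a \<bullet> shifted_mean ?e - dir a \<bullet> sc (?u i)) / real m \<le> b / (real m * t)"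
    using bound[OF a a1] t m by (simp add: field_simps del: index_mult_mat_vec)
  have "vnorm ?y = (dir a \<bullet> (fi *\<^sub>v ?e) - dir a \<bullet> shifted_mean ?e) + (\<Sum>i<m. dir a \<bullet> shifted_mean ?e - dir a \<bullet> sc (?u i)) / real m"
    unfolding 1 2 using m by (simp add: diff_divide_distrib del: index_mult_mat_vec)
  also have "\<dots> \<le> 18 * exp 12 * (vnorm ?e / r)\<^sup>2 * sqrt (dir a \<bullet> (fi *\<^sub>v dir a)) + b / (real m * t)"
    using shifted_bias[OF dir_carrier[OF a] e er] 3 by linarith
  also have "\<dots> \<le> 18 * exp 12 * (vnorm ?e / r)\<^sup>2 * sqrt (opnorm Bm) + b / (real m * t)"
  proof -
    have "a \<bullet> (Bm *\<^sub>v a) \<le> opnorm Bm * (vnorm a)\<^sup>2" by (rule quadratic_form_le_opnorm[OF Bm_carrier a])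
    also have "\<dots> \<le> opnorm Bm * 1" using a1 opnorm_Bm_pos by (intro mult_left_mono) (auto simp: power_le_one)
    finally have "dir a \<bullet> (fi *\<^sub>v dir a) \<le> opnorm Bm" unfolding Bm_form[OF a] by simp
    thus ?thesis by (intro add_right_mono mult_left_mono) (auto simp del: index_mult_mat_vec)
  qed
  finally show ?thesis unfolding mnorm_eq_vnorm_sqrt[OF M lm] .
qed

subsection \<open>Translated distributions\<close>

lemma sets_translate [simp, measurable_cong]: "sets (translate d l f) = sets (vborel d)"
  by (simp add: translate_def)

lemma translate_measurable:
  assumes f: "sets f = sets (vborel d)" and l: "l \<in> carrier_vec d"
  shows "(\<lambda>x. x + l) \<in> f \<rightarrow>\<^sub>M vborel d"
  by (intro measurable_vec_add measurable_vec_const l measurable_ident_sets f)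

lemma vec_distribution_translate:
  assumes f: "vec_distribution d f" and l: "l \<in> carrier_vec d"
  shows "vec_distribution d (translate d l f)"
proof -
  interpret prob_space f using f by (simp add: vec_distribution_def)
  have "prob_space (translate d l f)" unfolding translate_def
    using f by (intro prob_space_distr translate_measurable l) (simp add: vec_distribution_def)
  thus ?thesis by (simp add: vec_distribution_def)
qed

lemma translate_moments:
  assumes f: "vec_distribution d f" and fs: "finite_second_moments d f" and l: "l \<in> carrier_vec d"
  shows "finite_second_moments d (translate d l f)"
    and "mean_vec d (translate d l f) = mean_vec d f + l"
    and "cov_mat d (translate d l f) = cov_mat d f"
proof -
  interpret prob_space f using f by (simp add: vec_distribution_def)
  have sf: "sets f = sets (vborel d)" using f by (simp add: vec_distribution_def)
  have sp: "space f = carrier_vec d" using sets_eq_imp_space_eq[OF sf] by simp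
  note T = translate_measurable[OF sf l] and i = square_integrable_scalar_prod[OF f fs]
  have add: "(x + l) $ i = x $ i + l $ i" if "i < d" for x :: "real vec" and i using l that by simp
  show "finite_second_moments d (translate d l f)"
    unfolding finite_second_moments_def
  proof (intro allI impI)
    fix j assume j: "j < d"
    have m: "(\<lambda>x. (x $ j)\<^sup>2) \<in> borel_measurable (vborel d)" using measurable_vec_nth[OF j] by simp
    have "integrable f (\<lambda>x. (x $ j - - (l $ j)) * (x $ j - - (l $ j)))" by (rule i(3)[OF j j])
    hence "integrable f (\<lambda>x. ((x + l) $ j)\<^sup>2)" by (simp add: add[OF j] power2_eq_square)
    thus "integrable (translate d l f) (\<lambda>x. (x $ j)\<^sup>2)"
      unfolding translate_def integrable_distr_eq[OF T m] .
  qed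
  have mean: "mean_vec d (translate d l f) $ j = mean_vec d f $ j + l $ j" if j: "j < d" for j
  proof -
    have "mean_vec d (translate d l f) $ j = (\<integral>x. x $ j \<partial>translate d l f)" using j by (simp add: mean_vec_def)
    also have "\<dots> = (\<integral>x. (x + l) $ j \<partial>f)"
      unfolding translate_def by (rule integral_distr[OF T measurable_vec_nth[OF j]])
    also have "\<dots> = (\<integral>x. x $ j \<partial>f) + l $ j" using i(1)[OF j] prob_space by (simp add: add[OF j])
    finally show ?thesis using j by (simp add: mean_vec_def)
  qed
  show "mean_vec d (translate d l f) = mean_vec d f + l"
    using mean l by (intro eq_vecI) (auto simp: mean_vec_def)
  show "cov_mat d (translate d l f) = cov_mat d f"
  proof (rule eq_matI)
    fix a b assume "a < dim_row (cov_mat d f)" "b < dim_col (cov_mat d f)"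
    hence ab: "a < d" "b < d" by (auto simp: cov_mat_def)
    let ?m = "mean_vec d (translate d l f)"
    have m: "(\<lambda>x. (x $ a - ?m $ a) * (x $ b - ?m $ b)) \<in> borel_measurable (vborel d)"
      using measurable_vec_nth[OF ab(1)] measurable_vec_nth[OF ab(2)] by simp
    have "cov_mat d (translate d l f) $$ (a, b) = (\<integral>x. (x $ a - ?m $ a) * (x $ b - ?m $ b) \<partial>translate d l f)"
      using ab by (simp add: cov_mat_def)
    also have "\<dots> = (\<integral>x. ((x + l) $ a - ?m $ a) * ((x + l) $ b - ?m $ b) \<partial>f)"
      unfolding translate_def by (rule integral_distr[OF T m[unfolded translate_def]])
    also have "\<dots> = cov_mat d f $$ (a, b)"
      using ab by (simp add: cov_mat_def add mean)
    finally show "cov_mat d (translate d l f) $$ (a, b) = cov_mat d f $$ (a, b)" .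
  qed (simp_all add: cov_mat_def)
qed

text \<open>Seen from the true location, the error l1 - l is the only parameter left; this removes
  the unknown \<open>l\<close> from the analysis.\<close>

lemma (in smoothing) translate_joint:
  assumes l: "l \<in> carrier_vec d" and l1: "l1 \<in> carrier_vec d"
    and g: "g \<in> borel_measurable (vborel d)"
  shows "(\<integral>\<^sup>+x. \<integral>\<^sup>+w. g (x + w - l1) \<partial>noise \<partial>translate d l f) = (\<integral>\<^sup>+z. g (fst z + snd z - (l1 - l)) \<partial>joint)"
proof -
  interpret N: prob_space noise by (rule prob_noise)
  note T = translate_measurable[OF sets_f l]
  have e: "l1 - l \<in> carrier_vec d" using l l1 by simp
  have mp: "fst \<in> vborel d \<Otimes>\<^sub>M noise \<rightarrow>\<^sub>M vborel d" "snd \<in> vborel d \<Otimes>\<^sub>M noise \<rightarrow>\<^sub>M vborel d"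
    using measurable_fst[of "vborel d" noise] measurable_snd[of "vborel d" noise] by (simp_all cong: measurable_cong_sets)
  have "(\<lambda>z. fst z + snd z - l1) \<in> vborel d \<Otimes>\<^sub>M noise \<rightarrow>\<^sub>M vborel d"
    by (intro measurable_vec_diff measurable_vec_add measurable_vec_const mp l1)
  from measurable_compose[OF this g]
  have m: "(\<lambda>x. \<integral>\<^sup>+w. g (x + w - l1) \<partial>noise) \<in> borel_measurable (vborel d)"
    using N.borel_measurable_nn_integral_fst[of "\<lambda>z. g (fst z + snd z - l1)" "vborel d"] by simp
  have "(\<lambda>z. fst z + snd z - (l1 - l)) \<in> joint \<rightarrow>\<^sub>M vborel d"
    by (intro measurable_vec_diff sum_measurable measurable_vec_const e)
  from measurable_compose[OF this g]
  have m2: "(\<lambda>z. g (fst z + snd z - (l1 - l))) \<in> borel_measurable joint" .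
  have "(\<integral>\<^sup>+x. \<integral>\<^sup>+w. g (x + w - l1) \<partial>noise \<partial>translate d l f) = (\<integral>\<^sup>+y. \<integral>\<^sup>+w. g (y + l + w - l1) \<partial>noise \<partial>f)"
    unfolding translate_def by (rule nn_integral_distr[OF T]) (use m in simp)
  also have "\<dots> = (\<integral>\<^sup>+y. \<integral>\<^sup>+w. g (y + w - (l1 - l)) \<partial>noise \<partial>f)"
  proof (intro nn_integral_cong)
    fix y w assume "y \<in> space f" "w \<in> space noise"
    hence "y + l + w - l1 = y + w - (l1 - l)" using l l1 by (intro eq_vecI) auto
    thus "g (y + l + w - l1) = g (y + w - (l1 - l))" by simp
  qed
  also have "\<dots> = (\<integral>\<^sup>+z. g (fst z + snd z - (l1 - l)) \<partial>joint)"
    using N.nn_integral_fst[OF m2] by simp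
  finally show ?thesis .
qed

text \<open>The initial estimate is a constant here, as after conditioning on the first part of the
  sample; the samples carry the indices from \<open>k\<close> on because they are the rest of one
  sequence. Failure forces the mixture of weights above 2 / delta, while its mean is at most 1. The
  iterated integral of an indicator is the form in which the two stages are joined.\<close>

lemma (in weighted_smoothing) local_mle_tail:
  fixes k m :: nat
  assumes l: "l \<in> carrier_vec d" and l1: "l1 \<in> carrier_vec d" and er: "vnorm (l1 - l) \<le> r"
    and h: "0 < h" "h \<le> 1" and ek: "(vnorm (l1 - l) / r)\<^sup>2 * (200 * exp 40 * kap) \<le> h\<^sup>2"
    and m: "0 < m" and \<delta>: "0 < \<delta>" and L: "0 < L" "ln (2 / \<delta>) \<le> L"
    and size: "768 * (80 * exp 18 * kap\<^sup>2 / h) * (L + d_eff Bm) \<le> h * real m"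
    and bnd: "18 * exp 12 * (vnorm (l1 - l) / r)\<^sup>2 * sqrt (opnorm Bm)
       + (1 + 4 * h) * (sqrt (tr Bm / m) + 2 * sqrt (opnorm Bm * L / m)) \<le> bnd"
  shows "(\<integral>\<^sup>+x. \<integral>\<^sup>+w. indicator {v. \<not> mnorm M (v - l) \<le> bnd} (local_mle d f (iso_cov d r) m (\<lambda>i. x (k + i)) w l1)
      \<partial>(\<Pi>\<^sub>M i\<in>{..<m}. noise) \<partial>(\<Pi>\<^sub>M i\<in>{k..<k + m}. translate d l f)) \<le> ennreal (\<delta> / 2)"
proof -
  let ?e = "l1 - l" and ?\<beta> = "opnorm Bm" and ?\<tau> = "tr Bm"
  have e: "?e \<in> carrier_vec d" using l l1 by simp
  have \<beta>: "0 < ?\<beta>" by (rule opnorm_Bm_pos)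
  have \<tau>: "?\<beta> \<le> ?\<tau>" by (rule opnorm_le_tr[OF Bm_psd])
  define t where "t = sqrt (L / (real m * ?\<beta>))"
  define \<sigma> where "\<sigma> = 1 / (t * sqrt (real m * ?\<tau>))"
  have t0: "0 < t" unfolding t_def using L m \<beta> by simp
  have \<sigma>0: "0 < \<sigma>" unfolding \<sigma>_def using t0 m \<beta> \<tau> by simp
  let ?s = "sqrt \<sigma>" and ?\<pi> = "gauss d (iso_cov d (sqrt \<sigma>))"
  have s0: "0 < ?s" and s2: "?s\<^sup>2 = \<sigma>" using \<sigma>0 by simp_all
  let ?c = "80 * exp 18 * kap\<^sup>2 / h"
  let ?b = "ln (2 / \<delta>) + 1 / (2 * \<sigma>) + real m * ((1 + 5 * h) / 2 * t\<^sup>2) * (?\<beta> + \<sigma> * ?\<tau>)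
     + real m * (?c * t ^ 4) * (8 * ?\<beta>\<^sup>2 + 768 * (\<sigma> * ?\<tau>)\<^sup>2)"
  let ?F = "\<lambda>x w. \<integral>\<^sup>+\<theta>. (\<Prod>i<m. ennreal (weight h t ?e \<theta> (x (k + i) + w i - l1))) \<partial>?\<pi>"
  let ?est = "\<lambda>x w. local_mle d f (iso_cov d r) m (\<lambda>i. x (k + i)) w l1"
  have bal: "?b / (real m * t) \<le> (1 + 4 * h) * (sqrt (?\<tau> / m) + 2 * sqrt (?\<beta> * L / m))"
    using L h m \<beta> \<tau> size unfolding d_eff_def
    by (intro balance_pac_bayes t_def \<sigma>_def) auto
  \<comment> \<open>Markov's inequality in pointwise form: where the mixture is at most 2 / delta
    the estimate succeeds, and elsewhere the right-hand side is at least 1.\<close>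
  have point: "indicator {v. \<not> mnorm M (v - l) \<le> bnd} (?est x w) \<le> ennreal (\<delta> / 2) * ?F x w" for x w
  proof (cases "?F x w \<le> ennreal (2 / \<delta>)")
    case True
    have bound: "t * (\<Sum>i<m. dir a \<bullet> shifted_mean ?e - dir a \<bullet> sc (x (k + i) + w i - l1)) \<le> ?b"
      if "a \<in> carrier_vec d" "vnorm a \<le> 1" for a
      using weight_mixture_bound[OF _ s0 h(1) that True] \<delta> unfolding s2 by simp
    \<comment> \<open>In the direction 0 the bound reads 0 <= \<open>?b\<close>.\<close>
    have b0: "0 \<le> ?b"
      using bound[of "0\<^sub>v d"] t0
    proof -
      have "dir (0\<^sub>v d) = 0\<^sub>v d"
      proof -
        have z: "A *\<^sub>v 0\<^sub>v d = 0\<^sub>v d" if "A \<in> carrier_mat d d" for A :: "real mat" using that by auto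
        show ?thesis unfolding z[OF rt(1)] z[OF inv_fi(1)] ..
      qed
      thus ?thesis using bound[of "0\<^sub>v d"] shifted_mean_carrier score_carrier by simp
    qed
    have "mnorm M (?est x w - l) \<le> 18 * exp 12 * (vnorm ?e / r)\<^sup>2 * sqrt ?\<beta> + ?b / (real m * t)"
      by (rule local_mle_error[OF l l1 m t0 er bound b0])
    hence "mnorm M (?est x w - l) \<le> bnd" using bal bnd by linarith
    thus ?thesis by simp
  next
    case False
    hence "ennreal (\<delta> / 2) * ennreal (2 / \<delta>) \<le> ennreal (\<delta> / 2) * ?F x w" by (intro mult_left_mono) auto
    moreover have "ennreal (\<delta> / 2) * ennreal (2 / \<delta>) = 1" using \<delta> by (simp add: ennreal_mult'[symmetric])
    ultimately have "1 \<le> ennreal (\<delta> / 2) * ?F x w" by simp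
    thus ?thesis by (simp add: indicator_def)
  qed
  have "(\<integral>\<^sup>+x. \<integral>\<^sup>+w. indicator {v. \<not> mnorm M (v - l) \<le> bnd} (?est x w) \<partial>(\<Pi>\<^sub>M i\<in>{..<m}. noise) \<partial>(\<Pi>\<^sub>M i\<in>{k..<k + m}. translate d l f))
      \<le> (\<integral>\<^sup>+x. \<integral>\<^sup>+w. ennreal (\<delta> / 2) * ?F x w \<partial>(\<Pi>\<^sub>M i\<in>{..<m}. noise) \<partial>(\<Pi>\<^sub>M i\<in>{k..<k + m}. translate d l f))"
    by (intro nn_integral_mono point)
  also have "\<dots> \<le> ennreal (\<delta> / 2)"
  proof (rule product_mixture_le[of "translate d l f" noise ?\<pi> "\<lambda>\<theta> x w. ennreal (weight h t ?e \<theta> (x + w - l1))"])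
    show "prob_space (translate d l f)"
      using vec_distribution_translate[OF f l] by (simp add: vec_distribution_def)
    show "prob_space noise" by (rule prob_noise)
    show "prob_space ?\<pi>" by (rule prob_space_gauss[OF s0])
    let ?N = "?\<pi> \<Otimes>\<^sub>M (translate d l f \<Otimes>\<^sub>M noise)"
    have mT: "fst \<in> ?N \<rightarrow>\<^sub>M vborel d" "(\<lambda>z. fst (snd z)) \<in> ?N \<rightarrow>\<^sub>M vborel d" "(\<lambda>z. snd (snd z)) \<in> ?N \<rightarrow>\<^sub>M vborel d"
    proof -
      have "fst \<in> ?N \<rightarrow>\<^sub>M ?\<pi>" "(\<lambda>z. fst (snd z)) \<in> ?N \<rightarrow>\<^sub>M translate d l f" "(\<lambda>z. snd (snd z)) \<in> ?N \<rightarrow>\<^sub>M noise"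
        by measurable
      thus "fst \<in> ?N \<rightarrow>\<^sub>M vborel d" "(\<lambda>z. fst (snd z)) \<in> ?N \<rightarrow>\<^sub>M vborel d" "(\<lambda>z. snd (snd z)) \<in> ?N \<rightarrow>\<^sub>M vborel d"
        by (simp_all cong: measurable_cong_sets)
    qed
    have "(\<lambda>z. weight h t ?e (fst z) (fst (snd z) + snd (snd z) - l1)) \<in> borel_measurable ?N"
      by (intro weight_measurable mT measurable_vec_diff measurable_vec_add measurable_vec_const l1)
    thus "(\<lambda>(\<theta>, x, w). ennreal (weight h t ?e \<theta> (x + w - l1))) \<in> borel_measurable ?N"
      by (simp add: case_prod_beta')
    fix \<theta> assume "\<theta> \<in> space ?\<pi>"
    hence \<theta>: "\<theta> \<in> carrier_vec d" by simp
    have mw: "(\<lambda>u. ennreal (weight h t ?e \<theta> u)) \<in> borel_measurable (vborel d)"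
      by (intro measurable_compose[OF weight_measurable measurable_ennreal] measurable_vec_const \<theta> measurable_ident_sets refl)
    show "(\<integral>\<^sup>+x. \<integral>\<^sup>+w. ennreal (weight h t ?e \<theta> (x + w - l1)) \<partial>noise \<partial>translate d l f) \<le> 1"
      unfolding translate_joint[OF l l1 mw] by (rule weight_integral_le[OF e er h ek \<theta>])
  qed
  finally show ?thesis .
qed

section \<open>Conditioning on the first part of the sample, and the arithmetic of the sample
  size\<close>

lemma two_stage_probability:
  fixes k m :: nat and T :: "'a measure" and G :: "'b measure"
  assumes T: "prob_space T" and G: "prob_space G"
    and A: "A \<in> sets ((\<Pi>\<^sub>M i\<in>{..<k + m}. T) \<Otimes>\<^sub>M (\<Pi>\<^sub>M i\<in>{..<m}. G))"
    and E: "E \<in> sets (\<Pi>\<^sub>M i\<in>{..<k}. T)" and a: "1 - a \<le> measure (\<Pi>\<^sub>M i\<in>{..<k}. T) E" and b: "0 \<le> b"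
    and inner: "\<And>x. x \<in> E \<Longrightarrow> (\<integral>\<^sup>+y. \<integral>\<^sup>+w. indicator (- A) (merge {..<k} {k..<k + m} (x, y), w)
        \<partial>(\<Pi>\<^sub>M i\<in>{..<m}. G) \<partial>(\<Pi>\<^sub>M i\<in>{k..<k + m}. T)) \<le> ennreal b"
  shows "1 - (a + b) \<le> measure ((\<Pi>\<^sub>M i\<in>{..<k + m}. T) \<Otimes>\<^sub>M (\<Pi>\<^sub>M i\<in>{..<m}. G)) A"
proof -
  interpret T: prob_space T by fact
  interpret G: prob_space G by fact
  interpret PT: product_sigma_finite "\<lambda>i::nat. T" by standard
  let ?X = "\<Pi>\<^sub>M i\<in>{..<k + m}. T" and ?X1 = "\<Pi>\<^sub>M i\<in>{..<k}. T" and ?X2 = "\<Pi>\<^sub>M i\<in>{k..<k + m}. T" and ?W = "\<Pi>\<^sub>M i\<in>{..<m}. G"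
  interpret X: prob_space ?X by (rule prob_space_PiM) (rule T)
  interpret X1: prob_space ?X1 by (rule prob_space_PiM) (rule T)
  interpret X2: prob_space ?X2 by (rule prob_space_PiM) (rule T)
  interpret W: prob_space ?W by (rule prob_space_PiM) (rule G)
  interpret XW: pair_prob_space ?X ?W by standard
  let ?P = "?X \<Otimes>\<^sub>M ?W"
  have un: "{..<k} \<union> {k..<k + m} = {..<k + m}" and disj: "{..<k} \<inter> {k..<k + m} = {}" by auto
  have mi: "(\<lambda>z. indicator (space ?P - A) z :: ennreal) \<in> borel_measurable ?P" using A by simp
  have mf: "(\<lambda>x. \<integral>\<^sup>+w. indicator (space ?P - A) (x, w) \<partial>?W) \<in> borel_measurable (\<Pi>\<^sub>M i\<in>{..<k} \<union> {k..<k + m}. T)"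
    unfolding un by (rule W.borel_measurable_nn_integral_fst[OF mi])
  have "emeasure ?P (space ?P - A) = (\<integral>\<^sup>+z. indicator (space ?P - A) z \<partial>?P)" using A by simp
  also have "\<dots> = (\<integral>\<^sup>+x. \<integral>\<^sup>+w. indicator (space ?P - A) (x, w) \<partial>?W \<partial>?X)"
    by (rule W.nn_integral_fst[OF mi, symmetric])
  also have "\<dots> = (\<integral>\<^sup>+x. \<integral>\<^sup>+y. \<integral>\<^sup>+w. indicator (space ?P - A) (merge {..<k} {k..<k + m} (x, y), w) \<partial>?W \<partial>?X2 \<partial>?X1)"
    using PT.product_nn_integral_fold[OF disj finite_lessThan finite_atLeastLessThan mf] unfolding un .
  \<comment> \<open>The union bound: on \<open>E\<close> the conditional failure probability is at
    most \<open>b\<close>, and off \<open>E\<close> it is at most 1, which contributes the mass of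
    the complement.\<close>
  also have "\<dots> \<le> (\<integral>\<^sup>+x. indicator (space ?X1 - E) x + ennreal b \<partial>?X1)"
  proof (rule nn_integral_mono)
    fix x assume x: "x \<in> space ?X1"
    show "(\<integral>\<^sup>+y. \<integral>\<^sup>+w. indicator (space ?P - A) (merge {..<k} {k..<k + m} (x, y), w) \<partial>?W \<partial>?X2) \<le> indicator (space ?X1 - E) x + ennreal b"
    proof (cases "x \<in> E")
      case True
      have "(\<integral>\<^sup>+y. \<integral>\<^sup>+w. indicator (space ?P - A) (merge {..<k} {k..<k + m} (x, y), w) \<partial>?W \<partial>?X2)
          \<le> (\<integral>\<^sup>+y. \<integral>\<^sup>+w. indicator (- A) (merge {..<k} {k..<k + m} (x, y), w) \<partial>?W \<partial>?X2)"
        by (intro nn_integral_mono) (auto simp: indicator_def)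
      also have "\<dots> \<le> ennreal b" by (rule inner[OF True])
      finally show ?thesis using True by simp
    next
      case False
      have "(\<integral>\<^sup>+y. \<integral>\<^sup>+w. indicator (space ?P - A) (merge {..<k} {k..<k + m} (x, y), w) \<partial>?W \<partial>?X2) \<le> (\<integral>\<^sup>+y. \<integral>\<^sup>+w. 1 \<partial>?W \<partial>?X2)"
        by (intro nn_integral_mono) (auto simp: indicator_def)
      also have "\<dots> = 1" by (simp add: X2.emeasure_space_1 W.emeasure_space_1)
      also have "\<dots> \<le> indicator (space ?X1 - E) x + ennreal b" using x False by simp
      finally show ?thesis .
    qed
  qed
  also have "\<dots> = emeasure ?X1 (space ?X1 - E) + ennreal b"
    using E by (subst nn_integral_add) (auto simp: X1.emeasure_space_1)
  also have "emeasure ?X1 (space ?X1 - E) \<le> ennreal a"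
    unfolding X1.emeasure_eq_measure X1.prob_compl[OF E] using a by (intro ennreal_leI) simp
  finally have le: "emeasure ?P (space ?P - A) \<le> ennreal a + ennreal b" by (simp add: add_right_mono)
  have a0: "0 \<le> a" using a X1.prob_le_1[of E] by linarith
  have "measure ?P (space ?P - A) \<le> a + b"
    using le a0 b unfolding XW.P.emeasure_eq_measure by (simp add: ennreal_plus[symmetric] del: ennreal_plus)
  thus ?thesis using XW.P.prob_compl[OF A] by simp
qed

text \<open>\<open>N\<close>, \<open>k\<close> and \<open>m\<close> are the sizes of the sample and
  of its two parts, \<open>\<kappa>\<close> is ||Sigma|| / r^2, \<open>L\<close> is log(4/delta),
  \<open>dR\<close> and \<open>dS\<close> are the effective dimensions of B and Sigma, and
  \<open>e2\<close> is (|e|/r)^2. Apart from the sizes, the claims make the quartic PAC-Bayes term,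
  the tilt and the bias small at scale 1/gamma. The summand \<open>C2\<close> of \<open>C\<close>
  makes the first part long enough for the mean estimator; the square of \<open>D\<close> pays for
  the rest, and it is a square because the bias is compared with 1 / sqrt N.\<close>

lemma sample_size_consequences:
  fixes C1 C2 \<gamma> \<kappa> L dR dS N k m e2 D C :: real
  assumes C1: "0 < C1" and C2: "0 < C2" and \<gamma>: "2 \<le> \<gamma>" and \<kappa>: "1 \<le> \<kappa>" and L: "1 \<le> L" and dR: "1 \<le> dR" and dS: "0 \<le> dS"
    and D: "D = 1000 * exp 40 * (1 + C1\<^sup>2)" and C: "C = D\<^sup>2 + C2"
    and N: "C * \<gamma> ^ 4 * \<kappa>\<^sup>2 * (L + dR + dS\<^sup>2 / dR) \<le> N"
    and k: "N / \<gamma> - 1 < k" "k \<le> N / \<gamma>" and m: "m = N - k"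
  shows "0 < k" "4 * C2 * L \<le> k" "N * (1 - 1 / \<gamma>) \<le> m" "0 < m" "m \<le> N" "0 < N"
    and "768 * (80 * exp 18 * \<kappa>\<^sup>2 / (1 / \<gamma>)) * (L + dR) \<le> (1 / \<gamma>) * m"
    and "e2 \<le> 2 * C1\<^sup>2 * \<kappa> * (dS + L) / k \<Longrightarrow> e2 * (200 * exp 40 * \<kappa>) \<le> (1 / \<gamma>)\<^sup>2"
    and "e2 \<le> 2 * C1\<^sup>2 * \<kappa> * (dS + L) / k \<Longrightarrow> 18 * exp 12 * e2 \<le> (1 / \<gamma>) * ((sqrt dR + sqrt L) / sqrt m)"
proof -
  define Q where "Q = L + dR + dS\<^sup>2 / dR"
  have q0: "0 \<le> dS\<^sup>2 / dR" using dR by simp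
  have QL: "L + dR \<le> Q" unfolding Q_def using q0 by linarith
  have Q1: "1 \<le> Q" "L \<le> Q" using QL dR L by linarith+
  \<comment> \<open>This is the purpose of the summand \<open>dS\<^sup>2 / dR\<close>: it gives dS
    <= sqrt Q sqrt dR, which compares the dimension of the initial error with that of the
    target.\<close>
  have QR: "dS\<^sup>2 \<le> Q * dR"
  proof -
    have "dS\<^sup>2 / dR * dR \<le> Q * dR" unfolding Q_def using L dR q0 by (intro mult_right_mono) auto
    thus ?thesis using dR by simp
  qed
  have QS: "dS \<le> Q"
  proof -
    have "dR \<le> Q" using QL L by linarith
    hence "Q * dR \<le> Q * Q" using Q1 by (intro mult_left_mono) auto
    hence "dS\<^sup>2 \<le> Q\<^sup>2" using QR by (simp add: power2_eq_square)
    thus ?thesis by (rule power2_le_imp_le) (use Q1 in simp)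
  qed
  have e1: "1 \<le> exp (x::real)" if "0 \<le> x" for x using that by simp
  have C1s: "0 < C1\<^sup>2" using C1 by simp
  have ex40: "1 \<le> exp (40::real)" by simp
  have D1: "1000 * exp 40 \<le> D" "1000 * exp 40 * C1\<^sup>2 \<le> D" unfolding D using C1s by (simp_all add: algebra_simps)
  have D0: "1000 \<le> D" using D1(1) ex40 by linarith
  have DD: "1000 * D \<le> D\<^sup>2" using mult_right_mono[OF D0, of D] D0 by (simp add: power2_eq_square)
  have CD: "D\<^sup>2 \<le> C" "C2 \<le> C" unfolding C using C2 by auto
  have C0: "1000000 \<le> C" using CD(1) DD D0 by linarith
  have \<gamma>p: "1 \<le> \<gamma> ^ j" for j using \<gamma> by (intro one_le_power) simp
  have \<kappa>2: "1 \<le> \<kappa>\<^sup>2" using \<kappa> by simp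
  have N': "C * \<gamma> ^ 4 * \<kappa>\<^sup>2 * Q \<le> N" using N unfolding Q_def .
  have CQ: "C * \<gamma> ^ 3 * \<kappa>\<^sup>2 * Q \<le> N / \<gamma>"
  proof -
    have "C * \<gamma> ^ 3 * \<kappa>\<^sup>2 * Q * \<gamma> \<le> N" using N' by (simp add: power4_eq_xxxx power3_eq_cube mult_ac)
    thus ?thesis using \<gamma> by (simp add: le_divide_eq)
  qed
  have g3: "8 \<le> \<gamma> ^ 3" using power_mono[OF \<gamma>, of 3] by simp
  have gk: "8 \<le> \<gamma> ^ 3 * \<kappa>\<^sup>2" using mult_mono[OF g3 \<kappa>2] \<gamma> by simp
  have big: "8 * (C * Q) \<le> N / \<gamma>"
  proof -
    have "8 * (C * Q) \<le> (\<gamma> ^ 3 * \<kappa>\<^sup>2) * (C * Q)" using C0 Q1 by (intro mult_right_mono gk) auto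
    also have "\<dots> = C * \<gamma> ^ 3 * \<kappa>\<^sup>2 * Q" by (simp only: mult_ac)
    finally show ?thesis using CQ by linarith
  qed
  have CQ1: "1000000 \<le> C * Q" using mult_mono[OF C0 Q1(1)] C0 by simp
  \<comment> \<open>Rounding the first part down loses less than 1, and \<open>N / \<gamma>\<close>
    is so large that half of it remains.\<close>
  have half: "(1 / 2) * (N / \<gamma>) \<le> k" and Ng: "0 < N / \<gamma>" and Ck: "4 * (C * Q) \<le> k"
  proof -
    have "(1 / 2) * x \<le> k \<and> 0 < x \<and> 4 * y \<le> k" if "x - 1 < k" "8 * y \<le> x" "1000000 \<le> y" for x y :: real
      using that by linarith
    from this[OF k(1) big CQ1] show "(1 / 2) * (N / \<gamma>) \<le> k" "0 < N / \<gamma>" "4 * (C * Q) \<le> k" by blast+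
  qed
  show N0: "0 < N" using Ng \<gamma> by (simp add: zero_less_divide_iff)
  show k0: "0 < k" using Ck CQ1 by linarith
  show "4 * C2 * L \<le> k"
  proof -
    have "C2 * L \<le> C * Q" using CD(2) Q1(2) C2 L by (intro mult_mono) auto
    thus ?thesis using Ck by linarith
  qed
  show mN: "N * (1 - 1 / \<gamma>) \<le> m" unfolding m using k(2) by (simp add: algebra_simps)
  have m2: "N / 2 \<le> m"
  proof -
    have "1 / \<gamma> \<le> 1 / 2" using \<gamma> by (intro divide_left_mono) auto
    hence "N * (1 / 2) \<le> N * (1 - 1 / \<gamma>)" using N0 by (intro mult_left_mono) auto
    from order_trans[OF this mN] show ?thesis by simp
  qed
  show m0: "0 < m" using m2 N0 by linarith
  show mle: "m \<le> N" unfolding m using k0 by simp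
  have inv: "1 / k \<le> 2 * \<gamma> / N"
  proof -
    have "1 / k \<le> 1 / ((1 / 2) * (N / \<gamma>))" using half Ng by (intro divide_left_mono mult_pos_pos k0) auto
    thus ?thesis using N0 \<gamma> by simp
  qed
  show "768 * (80 * exp 18 * \<kappa>\<^sup>2 / (1 / \<gamma>)) * (L + dR) \<le> (1 / \<gamma>) * m"
  proof -
    have ex: "exp (18::real) \<le> exp 40" by simp
    \<comment> \<open>61440 is 768 * 80, the product of the constants of the second moment and of
      the quartic term.\<close>
    have "61440 * exp 18 \<le> C / 2" using ex C0 CD(1) DD D1(1) by linarith
    moreover have "1 \<le> \<gamma>\<^sup>2" using \<gamma> by simp
    ultimately have "61440 * exp 18 * 1 \<le> C / 2 * \<gamma>\<^sup>2" using C0 by (intro mult_mono) auto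
    hence "(61440 * exp 18) * (\<gamma>\<^sup>2 * \<kappa>\<^sup>2 * (L + dR)) \<le> (C / 2 * \<gamma>\<^sup>2) * (\<gamma>\<^sup>2 * \<kappa>\<^sup>2 * (L + dR))"
      using L dR by (intro mult_right_mono) auto
    also have "\<dots> = (C * \<gamma> ^ 4 * \<kappa>\<^sup>2 * (L + dR)) / 2" by (simp add: power2_eq_square power4_eq_xxxx)
    also have "\<dots> \<le> (C * \<gamma> ^ 4 * \<kappa>\<^sup>2 * Q) / 2" using QL C0 \<gamma>p[of 4] \<kappa>2 by (intro divide_right_mono mult_left_mono) auto
    also have "\<dots> \<le> m" using N' m2 by linarith
    finally have "(61440 * exp 18) * (\<gamma>\<^sup>2 * \<kappa>\<^sup>2 * (L + dR)) \<le> m" .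
    hence "(1 / \<gamma>) * ((61440 * exp 18) * (\<gamma>\<^sup>2 * \<kappa>\<^sup>2 * (L + dR))) \<le> (1 / \<gamma>) * m" using \<gamma> by (intro mult_left_mono) auto
    moreover have "768 * (80 * exp 18 * \<kappa>\<^sup>2 / (1 / \<gamma>)) * (L + dR) = (1 / \<gamma>) * ((61440 * exp 18) * (\<gamma>\<^sup>2 * \<kappa>\<^sup>2 * (L + dR)))"
      using \<gamma> by (simp add: power2_eq_square)
    ultimately show ?thesis by (simp only:)
  qed
  assume e2: "e2 \<le> 2 * C1\<^sup>2 * \<kappa> * (dS + L) / k"
  have e2': "e2 \<le> 4 * C1\<^sup>2 * \<gamma> * \<kappa> * (dS + L) / N"
  proof -
    have "2 * C1\<^sup>2 * \<kappa> * (dS + L) * (1 / k) \<le> 2 * C1\<^sup>2 * \<kappa> * (dS + L) * (2 * \<gamma> / N)"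
      using inv \<kappa> dS L by (intro mult_left_mono) auto
    thus ?thesis using e2 by (simp add: mult_ac)
  qed
  show "e2 * (200 * exp 40 * \<kappa>) \<le> (1 / \<gamma>)\<^sup>2"
  proof -
    have c: "1600 * exp 40 * C1\<^sup>2 \<le> C"
    proof -
      have "1600 * x * y \<le> c" if "1000 * x * y \<le> D" "0 \<le> x * y" "1000 * D \<le> c" for x y c :: real
        using that by (simp add: mult.assoc)
      from this[OF D1(2) _ order_trans[OF DD CD(1)]] show ?thesis by simp
    qed
    have "e2 * (200 * exp 40 * \<kappa>) \<le> 4 * C1\<^sup>2 * \<gamma> * \<kappa> * (dS + L) / N * (200 * exp 40 * \<kappa>)"
      using e2' \<kappa> by (intro mult_right_mono) auto
    also have "\<dots> = (800 * exp 40 * C1\<^sup>2) * (\<gamma> * \<kappa>\<^sup>2) * (dS + L) / N" by (simp add: power2_eq_square)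
    also have "\<dots> \<le> (800 * exp 40 * C1\<^sup>2) * (\<gamma> * \<kappa>\<^sup>2) * (2 * Q) / N"
      using QS Q1 \<gamma> N0 by (intro divide_right_mono mult_left_mono) auto
    also have "\<dots> = (1600 * exp 40 * C1\<^sup>2) * (\<gamma> * \<kappa>\<^sup>2 * Q) / N" by simp
    also have "\<dots> \<le> C * (\<gamma> * \<kappa>\<^sup>2 * Q) / N"
      using c \<gamma> Q1 N0 by (intro divide_right_mono mult_right_mono) auto
    also have "\<dots> \<le> (1 / \<gamma>)\<^sup>2"
    proof -
      have "N / \<gamma> \<le> N" using mult_left_mono[of 1 \<gamma> N] \<gamma> N0 by (simp add: divide_le_eq)
      with CQ have "C * \<gamma> ^ 3 * \<kappa>\<^sup>2 * Q \<le> N" by (rule order_trans)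
      hence "C * (\<gamma> * \<kappa>\<^sup>2 * Q) * \<gamma>\<^sup>2 \<le> N" by (simp add: power2_eq_square power3_eq_cube mult_ac)
      hence "C * (\<gamma> * \<kappa>\<^sup>2 * Q) \<le> N / \<gamma>\<^sup>2" using \<gamma> by (simp add: pos_le_divide_eq)
      hence "C * (\<gamma> * \<kappa>\<^sup>2 * Q) / N \<le> (N / \<gamma>\<^sup>2) / N" using N0 by (intro divide_right_mono) auto
      thus ?thesis using N0 by (simp add: power_divide)
    qed
    finally show ?thesis .
  qed
  show "18 * exp 12 * e2 \<le> (1 / \<gamma>) * ((sqrt dR + sqrt L) / sqrt m)"
  proof -
    have ex: "exp (12::real) \<le> exp 40" by simp
    have c: "72 * exp 12 * C1\<^sup>2 \<le> D"
    proof -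
      have "72 * exp 12 * C1\<^sup>2 \<le> 1000 * exp 40 * C1\<^sup>2" using ex by (intro mult_right_mono mult_mono) auto
      thus ?thesis using D1(2) by linarith
    qed
    \<comment> \<open>The whole factor gamma^4 kappa^2 is spent here: the bound on \<open>e2\<close>
      brings gamma kappa, the target brings another 1/gamma, and the comparison is between 1/N and 1
      / sqrt N.\<close>
    have sN: "D * \<gamma>\<^sup>2 * \<kappa> * sqrt Q \<le> sqrt N"
    proof (rule real_le_rsqrt)
      have "(D * \<gamma>\<^sup>2 * \<kappa> * sqrt Q)\<^sup>2 = D\<^sup>2 * \<gamma> ^ 4 * \<kappa>\<^sup>2 * Q"
        using Q1 by (simp add: power_mult_distrib)
      also have "\<dots> \<le> C * \<gamma> ^ 4 * \<kappa>\<^sup>2 * Q" using CD(1) Q1 \<gamma> by (intro mult_right_mono) auto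
      finally show "(D * \<gamma>\<^sup>2 * \<kappa> * sqrt Q)\<^sup>2 \<le> N" using N' by linarith
    qed
    have s1: "dS \<le> sqrt Q * sqrt dR"
      unfolding real_sqrt_mult[symmetric] using QR by (rule real_le_rsqrt)
    have s2: "L \<le> sqrt Q * sqrt L"
    proof -
      have "L\<^sup>2 \<le> Q * L" using Q1 L by (simp add: power2_eq_square mult_right_mono)
      thus ?thesis unfolding real_sqrt_mult[symmetric] by (rule real_le_rsqrt)
    qed
    have "18 * exp 12 * e2 \<le> 18 * exp 12 * (4 * C1\<^sup>2 * \<gamma> * \<kappa> * (dS + L) / N)" using e2' by (intro mult_left_mono) auto
    also have "\<dots> = (72 * exp 12 * C1\<^sup>2) * (\<gamma> * \<kappa> * (dS + L)) / N" by simp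
    also have "\<dots> \<le> D * (\<gamma> * \<kappa> * (dS + L)) / N" using c \<gamma> \<kappa> dS L N0 by (intro divide_right_mono mult_right_mono) auto
    also have "\<dots> \<le> D * (\<gamma> * \<kappa> * (sqrt Q * (sqrt dR + sqrt L))) / N"
      using s1 s2 \<gamma> \<kappa> D0 N0 by (intro divide_right_mono mult_left_mono) (auto simp: distrib_left)
    also have "\<dots> = (1 / \<gamma>) * ((D * \<gamma>\<^sup>2 * \<kappa> * sqrt Q) * (sqrt dR + sqrt L) / N)"
      using \<gamma> by (simp add: power2_eq_square)
    also have "\<dots> \<le> (1 / \<gamma>) * (sqrt N * (sqrt dR + sqrt L) / N)"
      using sN \<gamma> dR L N0 by (intro mult_left_mono divide_right_mono mult_right_mono) auto
    also have "\<dots> = (1 / \<gamma>) * ((sqrt dR + sqrt L) / sqrt N)"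
    proof -
      have "s * x / (s * s) = x / s" if "0 < s" for s x :: real using that by simp
      from this[of "sqrt N" "sqrt dR + sqrt L"] N0 show ?thesis by simp
    qed
    also have "\<dots> \<le> (1 / \<gamma>) * ((sqrt dR + sqrt L) / sqrt m)"
      using mle m0 \<gamma> dR L by (intro mult_left_mono divide_left_mono) auto
    finally show ?thesis .
  qed
qed

subsection \<open>The two-stage estimator\<close>

text \<open>Squaring costs (a + b)^2 <= 2 (a^2 + b^2). Dividing by r^2 and writing the trace as
  ||Sigma|| times the effective dimension produces the factor ||Sigma|| / r^2.\<close>

lemma initial_error_square:
  fixes v r C1 s T l L k :: real
  assumes v: "0 \<le> v" "v \<le> C1 * (sqrt (T / k) + sqrt (s * l / k))"
    and r: "0 < r" and s: "0 < s" and T: "0 \<le> T" and l: "0 \<le> l" "l \<le> L" and k: "0 < k"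
  shows "(v / r)\<^sup>2 \<le> 2 * C1\<^sup>2 * (s / r\<^sup>2) * (T / s + L) / k"
proof -
  have sq: "(a + b)\<^sup>2 \<le> 2 * (a\<^sup>2 + b\<^sup>2)" for a b :: real
    using zero_le_power2[of "a - b"] by (simp add: power2_diff power2_sum)
  have "v\<^sup>2 \<le> (C1 * (sqrt (T / k) + sqrt (s * l / k)))\<^sup>2" by (rule power_mono[OF v(2,1)])
  also have "\<dots> \<le> C1\<^sup>2 * (2 * ((sqrt (T / k))\<^sup>2 + (sqrt (s * l / k))\<^sup>2))"
    unfolding power_mult_distrib by (rule mult_left_mono[OF sq]) simp
  also have "\<dots> = C1\<^sup>2 * (2 * (T / k + s * l / k))" using T k s l by simp
  also have "\<dots> \<le> C1\<^sup>2 * (2 * (T / k + s * L / k))"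
    using l s k by (intro mult_left_mono add_left_mono divide_right_mono) auto
  finally have "v\<^sup>2 / r\<^sup>2 \<le> C1\<^sup>2 * (2 * (T / k + s * L / k)) / r\<^sup>2" by (rule divide_right_mono) simp
  also have "\<dots> = 2 * C1\<^sup>2 * (s / r\<^sup>2) * (T / s + L) / k" using s k r by (simp add: field_simps)
  finally show ?thesis by (simp add: power_divide)
qed

text \<open>Here h is 1/gamma. Over sqrt m, bias and fluctuation together have the coefficient h +
  (1 + 4 h) = 1 + 5 h at sqrt T and h + 2 (1 + 4 h) <= 4 (1 + 5 h) at the norm term. Passing from m
  to N costs 1 + 2 h, and (1 + 5 h) (1 + 2 h) <= 1 + 12 h for h <= 1/2; this is the constant 12 of
  the theorem.\<close>

lemma final_bound:
  fixes N m h T \<beta> L b :: real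
  assumes N: "0 < N" and m: "0 < m" "N * (1 - h) \<le> m" and h: "0 < h" "h \<le> 1 / 2"
    and T: "0 \<le> T" and \<beta>: "0 < \<beta>" and L: "0 \<le> L"
    and b: "b \<le> h * ((sqrt (T / \<beta>) + sqrt L) / sqrt m)"
  shows "b * sqrt \<beta> + (1 + 4 * h) * (sqrt (T / m) + 2 * sqrt (\<beta> * L / m))
    \<le> (1 + 12 * h) * (sqrt (T / N) + 4 * sqrt (\<beta> * L / N))"
proof -
  let ?X = "sqrt T" and ?Y = "sqrt (\<beta> * L)"
  have XY: "0 \<le> ?X" "0 \<le> ?Y" using T \<beta> L by simp_all
  have "b * sqrt \<beta> \<le> h * ((sqrt (T / \<beta>) + sqrt L) / sqrt m) * sqrt \<beta>"
    using \<beta> by (intro mult_right_mono b) simp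
  also have "\<dots> = h * ((?X + ?Y) / sqrt m)"
    using \<beta> m by (simp add: real_sqrt_divide real_sqrt_mult field_simps)
  finally have 1: "b * sqrt \<beta> \<le> h * ((?X + ?Y) / sqrt m)" .
  have sN: "sqrt N \<le> (1 + 2 * h) * sqrt m"
  proof -
    have "4 * h\<^sup>2 \<le> 1"
      using mult_mono[OF h(2) h(2)] h by (simp add: power2_eq_square)
    \<comment> \<open>This product equals (1 + 2 h)^2 (1 - h) - 1.\<close>
    hence "0 \<le> h * (3 - 4 * h\<^sup>2)" using h by (intro mult_nonneg_nonneg) auto
    hence "1 \<le> (1 + 2 * h)\<^sup>2 * (1 - h)" by (simp add: power2_eq_square algebra_simps)
    hence "N * 1 \<le> N * ((1 + 2 * h)\<^sup>2 * (1 - h))" using N by (intro mult_left_mono) auto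
    also have "\<dots> = (1 + 2 * h)\<^sup>2 * (N * (1 - h))" by simp
    also have "\<dots> \<le> (1 + 2 * h)\<^sup>2 * m" by (rule mult_left_mono[OF m(2)]) simp
    finally have "sqrt N \<le> sqrt ((1 + 2 * h)\<^sup>2 * m)" by simp
    thus ?thesis using h by (simp add: real_sqrt_mult)
  qed
  have inv: "1 / sqrt m \<le> (1 + 2 * h) / sqrt N"
    using sN N m by (simp add: field_simps)
  have "b * sqrt \<beta> + (1 + 4 * h) * (sqrt (T / m) + 2 * sqrt (\<beta> * L / m))
      \<le> h * ((?X + ?Y) / sqrt m) + (1 + 4 * h) * ((?X + 2 * ?Y) / sqrt m)"
    using 1 by (simp add: real_sqrt_divide add_divide_distrib)
  also have "\<dots> = (h * (?X + ?Y) + (1 + 4 * h) * (?X + 2 * ?Y)) * (1 / sqrt m)"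
  proof -
    have "h * (x / s) + c * (y / s) = (h * x + c * y) * (1 / s)" for c x y s :: real
      by (simp add: add_divide_distrib)
    thus ?thesis .
  qed
  also have "\<dots> \<le> ((1 + 5 * h) * (?X + 4 * ?Y)) * (1 / sqrt m)"
  proof (rule mult_right_mono)
    have "0 \<le> h * ?Y" using h XY by simp
    thus "h * (?X + ?Y) + (1 + 4 * h) * (?X + 2 * ?Y) \<le> (1 + 5 * h) * (?X + 4 * ?Y)"
      using XY by (simp add: algebra_simps)
  qed (use m in simp)
  also have "\<dots> \<le> ((1 + 5 * h) * (?X + 4 * ?Y)) * ((1 + 2 * h) / sqrt N)"
    using XY h by (intro mult_left_mono inv) auto
  also have "\<dots> = ((1 + 5 * h) * (1 + 2 * h)) * ((?X + 4 * ?Y) / sqrt N)" by simp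
  also have "\<dots> \<le> (1 + 12 * h) * ((?X + 4 * ?Y) / sqrt N)"
  proof (rule mult_right_mono)
    have "h * h \<le> h * (1 / 2)" using h by (intro mult_left_mono) auto
    thus "(1 + 5 * h) * (1 + 2 * h) \<le> 1 + 12 * h" by (simp add: algebra_simps)
  qed (use XY N in simp)
  also have "\<dots> = (1 + 12 * h) * (sqrt (T / N) + 4 * sqrt (\<beta> * L / N))"
    by (simp add: real_sqrt_divide add_divide_distrib)
  finally show ?thesis .
qed

lemma cov_mat_psd:
  assumes P: "vec_distribution d P" and fs: "finite_second_moments d P"
  shows "sym_psd d (cov_mat d P)"
proof -
  have "transpose_mat (cov_mat d P) = cov_mat d P"
    by (rule eq_matI) (auto simp: cov_mat_def mult.commute)
  moreover have "0 \<le> v \<bullet> (cov_mat d P *\<^sub>v v)" if "v \<in> carrier_vec d" for v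
    unfolding cov_mat_form(2)[OF P fs that] by simp
  ultimately show ?thesis by (simp add: sym_psd_def cov_mat_def)
qed

lemma (in weighted_smoothing) local_mle_measurable:
  assumes X: "\<And>i. i < m \<Longrightarrow> X i \<in> N \<rightarrow>\<^sub>M vborel d" and W: "\<And>i. i < m \<Longrightarrow> W i \<in> N \<rightarrow>\<^sub>M vborel d"
    and l1: "l1 \<in> N \<rightarrow>\<^sub>M vborel d"
  shows "(\<lambda>z. local_mle d f (iso_cov d r) m (\<lambda>i. X i z) (\<lambda>i. W i z) (l1 z)) \<in> N \<rightarrow>\<^sub>M vborel d"
proof (rule measurable_into_vborel)
  fix z assume "z \<in> space N"
  thus "local_mle d f (iso_cov d r) m (\<lambda>i. X i z) (\<lambda>i. W i z) (l1 z) \<in> carrier_vec d"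
    by (intro local_mle_nth(1) measurable_vborel_carrier[OF l1])
next
  fix j assume j: "j < d"
  have t: "(\<lambda>z. (inv_fi *\<^sub>v sc (X i z + W i z - l1 z)) $ j) \<in> borel_measurable N" if "i < m" for i
    by (intro measurable_vborel_nth[OF _ j] measurable_mult_mat_vec[OF inv_fi(1)] measurable_compose[OF _ score_measurable]
        measurable_vec_diff measurable_vec_add X W l1 that)
  have "(\<lambda>z. l1 z $ j - (1 / real m) * (\<Sum>i<m. (inv_fi *\<^sub>v sc (X i z + W i z - l1 z)) $ j)) \<in> borel_measurable N"
    by (intro borel_measurable_diff borel_measurable_times borel_measurable_sum t measurable_vborel_nth[OF l1 j]) auto
  moreover have "local_mle d f (iso_cov d r) m (\<lambda>i. X i z) (\<lambda>i. W i z) (l1 z) $ j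
      = l1 z $ j - (1 / real m) * (\<Sum>i<m. (inv_fi *\<^sub>v sc (X i z + W i z - l1 z)) $ j)" if "z \<in> space N" for z
    by (rule local_mle_nth(2)[OF measurable_vborel_carrier[OF l1 that] j])
  ultimately show "(\<lambda>z. local_mle d f (iso_cov d r) m (\<lambda>i. X i z) (\<lambda>i. W i z) (l1 z) $ j) \<in> borel_measurable N"
    by (subst measurable_cong) auto
qed

lemma (in weighted_smoothing) error_measurable:
  assumes g: "g \<in> N \<rightarrow>\<^sub>M vborel d" and l: "l \<in> carrier_vec d"
  shows "(\<lambda>z. mnorm M (g z - l)) \<in> borel_measurable N"
proof -
  have "(\<lambda>z. g z - l) \<in> N \<rightarrow>\<^sub>M vborel d" by (intro measurable_vec_diff measurable_vec_const g l)
  from measurable_scalar_prod[OF this measurable_mult_mat_vec[OF sym_psd_carrier[OF M] this]]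
  show ?thesis unfolding mnorm_def by measurable
qed

lemma first_part_bounds:
  assumes "2 \<le> \<gamma>"
  shows "real n / \<gamma> - 1 < real (first_part n \<gamma>)" "real (first_part n \<gamma>) \<le> real n / \<gamma>" "first_part n \<gamma> \<le> n"
proof -
  have p: "0 \<le> real n / \<gamma>" using assms by simp
  hence e: "real (first_part n \<gamma>) = of_int \<lfloor>real n / \<gamma>\<rfloor>" by (simp add: first_part_def)
  show "real n / \<gamma> - 1 < real (first_part n \<gamma>)" "real (first_part n \<gamma>) \<le> real n / \<gamma>"
    unfolding e by linarith+
  note this(2)
  also have "real n / \<gamma> \<le> real n / 1" using assms by (intro divide_left_mono) auto
  finally show "first_part n \<gamma> \<le> n" by simp
qed

lemma ln_2_ge_half: "1 / 2 \<le> ln (2::real)"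
  using ln_le_minus_one[of "1 / 2 :: real"] by (simp add: ln_div)

lemma estimator_applies:
  fixes C2 \<delta> L :: real
  assumes C2: "0 < C2" and \<delta>: "0 < \<delta>" and L: "1 \<le> L" "ln (2 / \<delta>) \<le> L" and k: "4 * C2 * L \<le> real k"
  shows "2 powr (- real k / C2) < \<delta> / 2"
proof -
  have "4 * L \<le> real k / C2" using k C2 by (simp add: le_divide_eq mult_ac)
  \<comment> \<open>Bounding ln 2 below by 1/2 loses half of the factor 4; the remaining 2 L
    strictly exceeds ln (2 / delta), as the estimator demands.\<close>
  hence "(4 * L) * (1 / 2) \<le> (real k / C2) * ln 2" using ln_2_ge_half L by (intro mult_mono) auto
  hence "ln (2 / \<delta>) < (real k / C2) * ln 2" using L by linarith
  hence "- (real k / C2) * ln 2 < ln (\<delta> / 2)" using \<delta> by (simp add: ln_div)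
  hence "exp (- (real k / C2) * ln 2) < exp (ln (\<delta> / 2))" by simp
  thus ?thesis using \<delta> by (simp add: powr_def)
qed

text \<open>The failure probability is split evenly between the initial estimate and the local step.
  Both involve log(2/delta), which is at most L = log(4/delta), so one L serves both.\<close>

lemma (in weighted_smoothing) global_mle_deviation:
  fixes C1 C2 D C \<gamma> \<delta> :: real and n :: nat
  assumes C1: "0 < C1" and C2: "0 < C2" and D: "D = 1000 * exp 40 * (1 + C1\<^sup>2)" and C: "C = D\<^sup>2 + C2"
    and est: "heavy_tailed_mean_estimator d C1 C2 est" and l: "l \<in> carrier_vec d"
    and \<delta>: "0 < \<delta>" "\<delta> < 1" and \<gamma>: "2 \<le> \<gamma>"
    and n: "C * \<gamma> ^ 4 * kap\<^sup>2 * (ln (4 / \<delta>) + d_eff Bm + (d_eff (cov_mat d f))\<^sup>2 / d_eff Bm) \<le> real n"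
  shows "1 - \<delta> \<le> measure (mle_space d f l n (iso_cov d r) \<gamma>)
    {(x, w) \<in> space (mle_space d f l n (iso_cov d r) \<gamma>).
      mnorm M (global_mle d est \<delta> f n x (iso_cov d r) \<gamma> w - l)
        \<le> (1 + 12 / \<gamma>) * (sqrt (tr Bm / n) + 4 * sqrt (opnorm Bm * ln (4 / \<delta>) / n))}"
proof -
  define L where "L = ln (4 / \<delta>)"
  define k where "k = first_part n \<gamma>"
  define m where "m = n - k"
  define bnd where "bnd = (1 + 12 / \<gamma>) * (sqrt (tr Bm / n) + 4 * sqrt (opnorm Bm * L / n))"
  let ?\<Sigma> = "cov_mat d f" and ?T = "translate d l f"
  have \<Sigma>: "sym_psd d ?\<Sigma>" by (rule cov_mat_psd[OF f fs])
  have s0: "0 < opnorm ?\<Sigma>" by (rule opnorm_cov_pos)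
  have tr0: "0 \<le> tr ?\<Sigma>" by (rule tr_psd_nonneg[OF \<Sigma>])
  \<comment> \<open>As delta is below 1, L is at least ln 4 = 2 ln 2.\<close>
  have L1: "1 \<le> L"
  proof -
    have "ln (4::real) = 2 * ln 2" using ln_realpow[of "2::real" 2] by simp
    moreover have "ln 4 \<le> L" unfolding L_def using \<delta> by (subst ln_le_cancel_iff) (auto simp: le_divide_eq)
    ultimately show ?thesis using ln_2_ge_half by linarith
  qed
  have lL: "ln (2 / \<delta>) \<le> L" unfolding L_def using \<delta> by (subst ln_le_cancel_iff) (auto intro!: divide_right_mono)
  have l0: "0 \<le> ln (2 / \<delta>)" using \<delta> by simp
  have k: "real n / \<gamma> - 1 < real k" "real k \<le> real n / \<gamma>" "k \<le> n"
    unfolding k_def by (rule first_part_bounds[OF \<gamma>])+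
  have nk: "n = k + m" and mr: "real m = real n - real k" using k(3) by (simp_all add: m_def)
  have dS: "0 \<le> d_eff ?\<Sigma>" using tr0 s0 by (simp add: d_eff_def)
  note S = sample_size_consequences[OF C1 C2 \<gamma> kap_ge_1 L1 d_eff_Bm_ge_1 dS D C n[folded L_def] k(1,2) mr]
  have k0: "0 < k" and m0: "0 < m" using S(1,4) by simp_all
  note E = est[unfolded heavy_tailed_mean_estimator_def, rule_format,
      OF estimator_applies[OF C2 \<delta>(1) L1 lL S(2)]]
  have em: "est k (\<delta> / 2) \<in> (\<Pi>\<^sub>M i\<in>{..<k}. vborel d) \<rightarrow>\<^sub>M vborel d" using E by blast
  have vT: "vec_distribution d ?T" by (rule vec_distribution_translate[OF f l])
  have pT: "prob_space ?T" using vT by (simp add: vec_distribution_def)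
  note tm = translate_moments[OF f fs l]
  have spT: "space ?T = carrier_vec d" by (simp add: translate_def)
  define E1 where "E1 = {x \<in> space (\<Pi>\<^sub>M i\<in>{..<k}. ?T).
      vnorm (est k (\<delta> / 2) x - mean_vec d ?T)
        \<le> C1 * (sqrt (tr (cov_mat d ?T) / k) + sqrt (opnorm (cov_mat d ?T) * ln (1 / (\<delta> / 2)) / k))}"
  have E1: "1 - \<delta> / 2 \<le> measure (\<Pi>\<^sub>M i\<in>{..<k}. ?T) E1"
    unfolding E1_def using E vT tm(1) by blast
  have emT: "est k (\<delta> / 2) \<in> (\<Pi>\<^sub>M i\<in>{..<k}. ?T) \<rightarrow>\<^sub>M vborel d"
  proof -
    have "sets (\<Pi>\<^sub>M i\<in>{..<k}. ?T) = sets (\<Pi>\<^sub>M i\<in>{..<k}. vborel d)" by (intro sets_PiM_cong) auto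
    from measurable_cong_sets[OF this refl] em show ?thesis by blast
  qed
  have E1s: "E1 \<in> sets (\<Pi>\<^sub>M i\<in>{..<k}. ?T)"
  proof -
    have "mean_vec d ?T \<in> carrier_vec d" by (simp add: mean_vec_def)
    from measurable_vnorm[OF measurable_vec_diff[OF emT measurable_vec_const[OF this]]]
    show ?thesis unfolding E1_def by measurable
  qed
  have mc: "mean_vec d f \<in> carrier_vec d" by (simp add: mean_vec_def)
  let ?l1 = "\<lambda>x. est k (\<delta> / 2) x - mean_vec d f"
  let ?X = "\<Pi>\<^sub>M i\<in>{..<k + m}. ?T" and ?W = "\<Pi>\<^sub>M i\<in>{..<m}. noise"
  let ?P = "?X \<Otimes>\<^sub>M ?W"
  let ?g = "\<lambda>x w. local_mle d f (iso_cov d r) m (\<lambda>i. x (k + i)) w (?l1 (restrict x {..<k}))"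
  define A where "A = {z \<in> space ?P. mnorm M (?g (fst z) (snd z) - l) \<le> bnd}"
  have As: "A \<in> sets ?P"
  proof -
    have comp: "(\<lambda>z. fst z i) \<in> ?P \<rightarrow>\<^sub>M vborel d" if "i < k + m" for i
    proof -
      have "(\<lambda>z. fst z i) \<in> ?P \<rightarrow>\<^sub>M ?T"
        by (rule measurable_compose[OF measurable_fst measurable_component_singleton]) (use that in simp)
      thus ?thesis by (simp cong: measurable_cong_sets)
    qed
    have cw: "(\<lambda>z. snd z i) \<in> ?P \<rightarrow>\<^sub>M vborel d" if "i < m" for i
    proof -
      have "(\<lambda>z. snd z i) \<in> ?P \<rightarrow>\<^sub>M noise"
        by (rule measurable_compose[OF measurable_snd measurable_component_singleton]) (use that in simp)
      thus ?thesis by (simp cong: measurable_cong_sets)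
    qed
    have "(\<lambda>z. restrict (fst z) {..<k}) \<in> ?P \<rightarrow>\<^sub>M (\<Pi>\<^sub>M i\<in>{..<k}. vborel d)"
      by (rule measurable_restrict) (use comp in simp)
    from measurable_compose[OF this em]
    have "(\<lambda>z. ?l1 (restrict (fst z) {..<k})) \<in> ?P \<rightarrow>\<^sub>M vborel d"
      by (intro measurable_vec_diff measurable_vec_const mc)
    hence "(\<lambda>z. ?g (fst z) (snd z)) \<in> ?P \<rightarrow>\<^sub>M vborel d"
      using local_mle_measurable[of m "\<lambda>i z. fst z (k + i)" ?P "\<lambda>i z. snd z i"] comp cw by simp
    from error_measurable[OF this l] show ?thesis unfolding A_def by measurable
  qed
  have inner: "(\<integral>\<^sup>+y. \<integral>\<^sup>+w. indicator (- A) (merge {..<k} {k..<k + m} (x, y), w)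
      \<partial>?W \<partial>(\<Pi>\<^sub>M i\<in>{k..<k + m}. ?T)) \<le> ennreal (\<delta> / 2)" if x: "x \<in> E1" for x
  proof -
    have xs: "x \<in> space (\<Pi>\<^sub>M i\<in>{..<k}. ?T)" using x by (simp add: E1_def)
    have ec: "est k (\<delta> / 2) x \<in> carrier_vec d" by (rule measurable_vborel_carrier[OF emT xs])
    have l1: "?l1 x \<in> carrier_vec d" using ec mc by simp
    \<comment> \<open>The translated distribution has mean \<open>mean_vec d f + l\<close>, so after
      subtracting the known mean the location error is exactly the error of the mean
      estimator.\<close>
    have e: "?l1 x - l = est k (\<delta> / 2) x - mean_vec d ?T"
      unfolding tm(2) using ec mc l by (intro eq_vecI) auto
    let ?e2 = "(vnorm (?l1 x - l) / r)\<^sup>2"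
    have "vnorm (?l1 x - l) \<le> C1 * (sqrt (tr ?\<Sigma> / k) + sqrt (opnorm ?\<Sigma> * ln (2 / \<delta>) / k))"
      using x unfolding E1_def e tm(3) by simp
    hence e2: "?e2 \<le> 2 * C1\<^sup>2 * kap * (d_eff ?\<Sigma> + L) / real k"
      unfolding d_eff_def using k0 by (intro initial_error_square[OF vnorm_nonneg _ r s0 tr0 l0 lL]) auto
    have ek: "?e2 * (200 * exp 40 * kap) \<le> (1 / \<gamma>)\<^sup>2" by (rule S(8)[OF e2])
    have er: "vnorm (?l1 x - l) \<le> r"
    proof -
      have "1 \<le> 200 * exp (40::real)" using exp_ge_add_one_self[of "40::real"] by linarith
      hence "1 * 1 \<le> (200 * exp 40) * kap" by (rule mult_mono[OF _ kap_ge_1]) auto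
      hence "?e2 * 1 \<le> ?e2 * (200 * exp 40 * kap)" by (intro mult_left_mono) auto
      moreover have "(1 / \<gamma>)\<^sup>2 \<le> 1\<^sup>2" using \<gamma> by (intro power_mono) auto
      ultimately have "?e2 \<le> 1\<^sup>2" using ek by linarith
      hence "vnorm (?l1 x - l) / r \<le> 1" by (rule power2_le_imp_le) simp
      thus ?thesis using r by simp
    qed
    have bb: "18 * exp 12 * ?e2 * sqrt (opnorm Bm) + (1 + 4 * (1 / \<gamma>)) * (sqrt (tr Bm / m) + 2 * sqrt (opnorm Bm * L / m)) \<le> bnd"
    proof -
      have "18 * exp 12 * ?e2 * sqrt (opnorm Bm) + (1 + 4 * (1 / \<gamma>)) * (sqrt (tr Bm / m) + 2 * sqrt (opnorm Bm * L / m))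
          \<le> (1 + 12 * (1 / \<gamma>)) * (sqrt (tr Bm / n) + 4 * sqrt (opnorm Bm * L / n))"
        by (rule final_bound[OF S(6,4,3) _ _ tr_psd_nonneg[OF Bm_psd] opnorm_Bm_pos _ S(9)[OF e2, unfolded d_eff_def[of Bm]]])
          (use \<gamma> L1 in auto)
      thus ?thesis by (simp add: bnd_def)
    qed
    have "(\<integral>\<^sup>+y. \<integral>\<^sup>+w. indicator (- A) (merge {..<k} {k..<k + m} (x, y), w) \<partial>?W \<partial>(\<Pi>\<^sub>M i\<in>{k..<k + m}. ?T))
      \<le> (\<integral>\<^sup>+y. \<integral>\<^sup>+w. indicator {v. \<not> mnorm M (v - l) \<le> bnd}
          (local_mle d f (iso_cov d r) m (\<lambda>i. y (k + i)) w (?l1 x)) \<partial>?W \<partial>(\<Pi>\<^sub>M i\<in>{k..<k + m}. ?T))"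
    proof (intro nn_integral_mono)
      fix y w assume y: "y \<in> space (\<Pi>\<^sub>M i\<in>{k..<k + m}. ?T)" and w: "w \<in> space ?W"
      let ?z = "merge {..<k} {k..<k + m} (x, y)"
      have "?z \<in> space ?X"
        using xs y by (auto simp: space_PiM PiE_iff merge_def extensional_def)
      hence z: "(?z, w) \<in> space ?P" using w by (simp add: space_pair_measure)
      have rz: "restrict ?z {..<k} = x"
        using xs by (auto simp: space_PiM PiE_iff merge_def extensional_def restrict_def)
      \<comment> \<open>The local step reads the merged sample only at indices from \<open>k\<close>
        on, where it coincides with \<open>y\<close>.\<close>
      have "local_mle d f (iso_cov d r) m (\<lambda>i. ?z (k + i)) w (?l1 x) = local_mle d f (iso_cov d r) m (\<lambda>i. y (k + i)) w (?l1 x)"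
      proof (rule eq_vecI)
        fix j assume "j < dim_vec (local_mle d f (iso_cov d r) m (\<lambda>i. y (k + i)) w (?l1 x))"
        hence j: "j < d" using local_mle_nth(1)[OF l1] by (metis carrier_vecD)
        show "local_mle d f (iso_cov d r) m (\<lambda>i. ?z (k + i)) w (?l1 x) $ j
            = local_mle d f (iso_cov d r) m (\<lambda>i. y (k + i)) w (?l1 x) $ j"
          unfolding local_mle_nth(2)[OF l1 j] by (simp add: merge_def del: index_mult_mat_vec)
      qed (use local_mle_nth(1)[OF l1] in \<open>metis carrier_vecD\<close>)
      thus "indicator (- A) (?z, w) \<le> (indicator {v. \<not> mnorm M (v - l) \<le> bnd}
          (local_mle d f (iso_cov d r) m (\<lambda>i. y (k + i)) w (?l1 x)) :: ennreal)"
        using z rz by (auto simp: A_def indicator_def)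
    qed
    also have "\<dots> \<le> ennreal (\<delta> / 2)"
      by (rule local_mle_tail[OF l l1 er _ _ ek m0 \<delta>(1) _ lL S(7) bb]) (use \<gamma> L1 in auto)
    finally show ?thesis .
  qed
  have "1 - (\<delta> / 2 + \<delta> / 2) \<le> measure ?P A"
    by (rule two_stage_probability[OF pT prob_noise As E1s E1 _ inner]) (use \<delta> in auto)
  hence pA: "1 - \<delta> \<le> measure ?P A" by simp
  have P: "mle_space d f l n (iso_cov d r) \<gamma> = ?P"
    unfolding mle_space_def k_def[symmetric] m_def[symmetric] by (simp add: nk)
  have "A = {(x, w) \<in> space ?P. mnorm M (global_mle d est \<delta> f n x (iso_cov d r) \<gamma> w - l) \<le> bnd}"
    unfolding A_def global_mle_def Let_def k_def[symmetric] m_def[symmetric] by auto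
  with pA show ?thesis unfolding P L_def[symmetric] bnd_def[symmetric] by (simp only:)
qed

text \<open>\<open>C\<close> and \<open>K\<close> are fixed before the dimension and the
  distribution, so they depend at most on the constants of the mean estimator.\<close>

theorem theoremB16:
  fixes C1 C2 :: real
  assumes "0 < C1" and "0 < C2"
  shows "\<exists>C>0. \<exists>K>0.
    \<forall>(d::nat) (est::mean_estimator) (f::real vec measure) (l::real vec) (n::nat)
       (r::real) (M::real mat) (\<delta>::real) (\<gamma>::real) (\<alpha>::real).
      let \<Sigma> = cov_mat d f;
          R = r\<^sup>2 \<cdot>\<^sub>m 1\<^sub>m d;
          B = mat_sqrt M * mat_inv (fisher d R f) * mat_sqrt M;
          d_R = d_eff B
      in
        heavy_tailed_mean_estimator d C1 C2 est \<longrightarrow>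
        vec_distribution d f \<longrightarrow> finite_second_moments d f \<longrightarrow>
        l \<in> carrier_vec d \<longrightarrow>
        0 < r\<^sup>2 \<longrightarrow> r\<^sup>2 < opnorm \<Sigma> \<longrightarrow>
        sym_psd d M \<longrightarrow> M \<noteq> 0\<^sub>m d d \<longrightarrow>
        0 < \<delta> \<longrightarrow> 0 < \<alpha> \<longrightarrow>
        2 \<le> \<gamma> \<longrightarrow> \<gamma> \<le> (real n / (d_R + ln (1 / \<delta>))) powr (1 / 8 - \<alpha>) \<longrightarrow>
        real n \<ge> C * \<gamma> ^ 4 * (opnorm \<Sigma> / r\<^sup>2)\<^sup>2 * (ln (4 / \<delta>) + d_R + (d_eff \<Sigma>)\<^sup>2 / d_R) \<longrightarrow>
        measure (mle_space d f l n R \<gamma>)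
          {(x, w) \<in> space (mle_space d f l n R \<gamma>).
             mnorm M (global_mle d est \<delta> f n x R \<gamma> w - l) \<le>
               (1 + K / \<gamma>) * (sqrt (tr B / n) + 4 * sqrt (opnorm B * ln (4 / \<delta>) / n))}
          \<ge> 1 - \<delta>"
proof -
  define D where "D = 1000 * exp 40 * (1 + C1\<^sup>2)"
  define C where "C = D\<^sup>2 + C2"
  have C0: "0 < C" unfolding C_def using assms by (intro add_nonneg_pos) auto
  show ?thesis unfolding Let_def
  proof (rule exI[of _ C], rule conjI[OF C0], rule exI[of _ 12], rule conjI, simp, intro allI impI, goal_cases)
    case (1 d est f l n r M \<delta> \<gamma> \<alpha>)
    show ?case
    proof (cases "\<delta> < 1")
      case True
      \<comment> \<open>Only the square of r is assumed positive, so r may be negative; the standard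
        deviation of the noise is its absolute value.\<close>
      interpret weighted_smoothing d f "\<bar>r\<bar>" M
        by unfold_locales (use 1 in auto)
      show ?thesis
        using global_mle_deviation[OF assms D_def C_def 1(1) 1(4) 1(9) True 1(11), unfolded power2_abs, OF 1(13)] .
    next
      case False
      \<comment> \<open>For delta >= 1 the claim is that a measure is nonnegative.\<close>
      hence "1 - \<delta> \<le> 0" by simp
      thus ?thesis using measure_nonneg order_trans by blast
    qed
  qed
qed

end
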